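(* Let $L$ be a relatively complemented modular lattice. If $L$ is either conditionally $\aleph_0$-meet-continuous or conditionally $\aleph_0$-join-continuous, then $\operatorname{Dim}L$ is a generalized cardinal algebra (GCA).
   Context: Lattices are not assumed to be bounded. A lattice is relatively complemented if every closed interval $[a,b]$ of it is complemented. A lattice $K$ is $\aleph_0$-meet-continuous if for every $a\in K$ and every increasing sequence $\langle b_n\mid n\in\omega\rangle$ of elements of $K$, the supremum $\bigvee_nb_n$ exists and $a\wedge\bigvee_nb_n=\bigvee_n(a\wedge b_n)$; $\aleph_0$-join-continuous is the dual notion. A lattice is conditionally $\aleph_0$-meet-continuous (resp., conditionally $\aleph_0$-join-continuous) if each of its closed intervals is $\aleph_0$-meet-continuous (resp., $\aleph_0$-join-continuous). For a lattice $L$, the dimension monoid $\operatorname{Dim}L$ is the commutative monoid defined by generators $\Delta(a,b)$ (for $a\leq b$ in $L$) and the relations: (D0) $\Delta(a,a)=0$; (D1) $\Delta(a,c)=\Delta(a,b)+\Delta(b,c)$ for $a\leq b\leq c$; (D2) $\Delta(a,a\vee b)=\Delta(a\wedge b,b)$ for all $a,b\in L$. A generalized cardinal algebra (GCA) is a quadruple $\langle A,+,0,\sum\rangle$ where $0\in A$, $+$ is a partial binary operation on $A$, and $\sum$ is a partial function from $A^\omega$ to $A$ (written $\sum_na_n$), satisfying the following (an asserted equality includes the assertion that the terms are defined): (GCA1) if $a=\sum_na_n$, then $a=a_0+\sum_na_{n+1}$; (GCA2) if $c=\sum_n(a_n+b_n)$, then $c=\sum_na_n+\sum_nb_n$; (GCA3)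 $a+0=0+a=a$ for all $a\in A$; (GCA4) (refinement postulate) if $a+b=\sum_nc_n$, then there are $a_n,b_n\in A$ ($n\in\omega$) with $a=\sum_na_n$, $b=\sum_nb_n$ and $c_n=a_n+b_n$ for all $n$; (GCA5) (remainder postulate) if $a_n=b_n+a_{n+1}$ for all $n\in\omega$, then all sums $\sum_kb_{n+k}$ ($n\in\omega$) are defined and there is $a\in A$ with $a_n=a+\sum_kb_{n+k}$ for all $n$. A commutative monoid $\langle A,+,0\rangle$ is said to be a GCA if there is a partial function $\sum$ making $\langle A,+,0,\sum\rangle$ a GCA. *)

theory Defs
  imports "HOL-Algebra.Lattice" "HOL-Algebra.Group" "HOL-Library.Multiset"
begin

section \<open>Modular and relatively complemented lattices\<close>

locale modular_lattice = lattice L for L (structure) +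
  assumes modular:
    "\<lbrakk>x \<in> carrier L; y \<in> carrier L; z \<in> carrier L; x \<sqsubseteq> z\<rbrakk>
      \<Longrightarrow> x \<squnion> (y \<sqinter> z) = (x \<squnion> y) \<sqinter> z"

locale complemented_lattice = bounded_lattice L for L (structure) +
  assumes complement_exists:
    "x \<in> carrier L \<Longrightarrow> \<exists>y\<in>carrier L. x \<sqinter> y = \<bottom> \<and> x \<squnion> y = \<top>"

definition interval_lattice :: "('a, 'm) gorder_scheme \<Rightarrow> 'a \<Rightarrow> 'a \<Rightarrow> ('a, 'm) gorder_scheme"
  where "interval_lattice L a b = L\<lparr>carrier := \<lbrace>a..b\<rbrace>\<^bsub>L\<^esub>\<rparr>"

locale relatively_complemented_lattice = lattice L for L (structure) +
  assumes interval_complemented: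
    "\<lbrakk>a \<in> carrier L; b \<in> carrier L; a \<sqsubseteq> b\<rbrakk>
      \<Longrightarrow> complemented_lattice (interval_lattice L a b)"

section \<open>Countable continuity\<close>

text \<open>The library's \<^const>\<open>Lattice.sup\<close> and \<^const>\<open>Lattice.inf\<close> are meaningful only where the
  bound exists.  The assumption \<open>sup_seq_exists\<close> (resp. \<open>inf_seq_exists\<close>) covers
  both sides of the distributive law below, since \<open>\<lambda>n. a \<sqinter> b n\<close> is again increasing
  (resp. \<open>\<lambda>n. a \<squnion> b n\<close> is again decreasing).\<close>

locale aleph0_meet_continuous_lattice = lattice L for L (structure) +
  assumes sup_seq_exists:
    "\<lbrakk>\<And>n::nat. b n \<in> carrier L; \<And>n. b n \<sqsubseteq> b (Suc n)\<rbrakk>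
      \<Longrightarrow> \<exists>s. is_lub L s (range b)"
  and meet_sup_seq:
    "\<lbrakk>a \<in> carrier L; \<And>n::nat. b n \<in> carrier L; \<And>n. b n \<sqsubseteq> b (Suc n)\<rbrakk>
      \<Longrightarrow> a \<sqinter> (\<Squnion>(range b)) = \<Squnion>(range (\<lambda>n. a \<sqinter> b n))"

locale aleph0_join_continuous_lattice = lattice L for L (structure) +
  assumes inf_seq_exists:
    "\<lbrakk>\<And>n::nat. b n \<in> carrier L; \<And>n. b (Suc n) \<sqsubseteq> b n\<rbrakk>
      \<Longrightarrow> \<exists>s. is_glb L s (range b)"
  and join_inf_seq:
    "\<lbrakk>a \<in> carrier L; \<And>n::nat. b n \<in> carrier L; \<And>n. b (Suc n) \<sqsubseteq> b n\<rbrakk>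
      \<Longrightarrow> a \<squnion> (\<Sqinter>(range b)) = \<Sqinter>(range (\<lambda>n. a \<squnion> b n))"

locale conditionally_aleph0_meet_continuous_lattice = lattice L for L (structure) +
  assumes interval_meet_continuous:
    "\<lbrakk>a \<in> carrier L; b \<in> carrier L; a \<sqsubseteq> b\<rbrakk>
      \<Longrightarrow> aleph0_meet_continuous_lattice (interval_lattice L a b)"

locale conditionally_aleph0_join_continuous_lattice = lattice L for L (structure) +
  assumes interval_join_continuous:
    "\<lbrakk>a \<in> carrier L; b \<in> carrier L; a \<sqsubseteq> b\<rbrakk>
      \<Longrightarrow> aleph0_join_continuous_lattice (interval_lattice L a b)"

section \<open>The dimension monoid\<close>

text \<open>The generator \<open>\<Delta>(a,b)\<close> is the pair \<open>(a, b)\<close>.  The free commutative monoid on the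
  generators consists of the finite multisets of such pairs, and the dimension monoid is its
  quotient by the least congruence containing the defining relations.\<close>

definition dim_generators :: "('a, 'm) gorder_scheme \<Rightarrow> ('a \<times> 'a) set"
  where "dim_generators L = {(a, b). a \<in> carrier L \<and> b \<in> carrier L \<and> a \<sqsubseteq>\<^bsub>L\<^esub> b}"

definition dim_words :: "('a, 'm) gorder_scheme \<Rightarrow> ('a \<times> 'a) multiset set"
  where "dim_words L = {X. set_mset X \<subseteq> dim_generators L}"

inductive_set dim_cong ::
    "('a, 'm) gorder_scheme \<Rightarrow> (('a \<times> 'a) multiset \<times> ('a \<times> 'a) multiset) set"
  for L (structure)
where
  D0: "a \<in> carrier L \<Longrightarrow> ({#(a, a)#}, {#}) \<in> dim_cong L"
| D1: "\<lbrakk>a \<in> carrier L; b \<in> carrier L; c \<in> carrier L; a \<sqsubseteq> b; b \<sqsubseteq> c\<rbrakk>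
        \<Longrightarrow> ({#(a, c)#}, {#(a, b), (b, c)#}) \<in> dim_cong L"
| D2: "\<lbrakk>a \<in> carrier L; b \<in> carrier L\<rbrakk>
        \<Longrightarrow> ({#(a, a \<squnion> b)#}, {#(a \<sqinter> b, b)#}) \<in> dim_cong L"
| refl: "X \<in> dim_words L \<Longrightarrow> (X, X) \<in> dim_cong L"
| sym: "(X, Y) \<in> dim_cong L \<Longrightarrow> (Y, X) \<in> dim_cong L"
| trans: "\<lbrakk>(X, Y) \<in> dim_cong L; (Y, Z) \<in> dim_cong L\<rbrakk> \<Longrightarrow> (X, Z) \<in> dim_cong L"
| add: "\<lbrakk>(X, Y) \<in> dim_cong L; (U, V) \<in> dim_cong L\<rbrakk> \<Longrightarrow> (X + U, Y + V) \<in> dim_cong L"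

text \<open>The addition of the dimension monoid is the operation \<open>\<otimes>\<close> of the record, and its zero
  is \<open>\<one>\<close>.\<close>

definition Dim :: "('a, 'm) gorder_scheme \<Rightarrow> ('a \<times> 'a) multiset set monoid"
  where "Dim L =
    \<lparr>carrier = dim_words L // dim_cong L,
     monoid.mult = (\<lambda>P Q. \<Union>X\<in>P. \<Union>Y\<in>Q. dim_cong L `` {X + Y}),
     one = dim_cong L `` {{#}}\<rparr>"

lemma (in lattice) dim_cong_words:
  assumes "(X, Y) \<in> dim_cong L"
  shows "X \<in> dim_words L \<and> Y \<in> dim_words L"
  using assms
  by (induction rule: dim_cong.induct)
    (auto simp: dim_words_def dim_generators_def join_left meet_right intro: le_trans)

lemma (in lattice) equiv_dim_cong: "equiv (dim_words L) (dim_cong L)"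
proof (rule equivI)
  show "dim_cong L \<subseteq> dim_words L \<times> dim_words L"
    by (auto dest: dim_cong_words)
  show "refl_on (dim_words L) (dim_cong L)"
    by (auto simp: refl_on_def intro: dim_cong.refl)
  show "Relation.sym (dim_cong L)"
    by (blast intro: Relation.symI dim_cong.sym)
  show "Relation.trans (dim_cong L)"
    by (blast intro: Relation.transI dim_cong.trans)
qed

lemma (in lattice) dim_mult_class:
  assumes "X \<in> dim_words L" "Y \<in> dim_words L"
  shows "(dim_cong L `` {X}) \<otimes>\<^bsub>Dim L\<^esub> (dim_cong L `` {Y}) = dim_cong L `` {X + Y}"
proof -
  have "(\<lambda>X Y. dim_cong L `` {X + Y}) respects2 dim_cong L"
    by (intro congruent2I' equiv_class_eq[OF equiv_dim_cong] dim_cong.add)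
  from UN_equiv_class2[OF equiv_dim_cong equiv_dim_cong this assms]
  show ?thesis by (simp add: Dim_def)
qed

lemma (in lattice) comm_monoid_Dim: "comm_monoid (Dim L)"
proof -
  have add: "X + Y \<in> dim_words L" if "X \<in> dim_words L" "Y \<in> dim_words L" for X Y
    using that by (auto simp: dim_words_def)
  have zero: "{#} \<in> dim_words L" by (simp add: dim_words_def)
  have one: "\<one>\<^bsub>Dim L\<^esub> = dim_cong L `` {{#}}" by (simp add: Dim_def)
  have carr: "carrier (Dim L) = dim_words L // dim_cong L" by (simp add: Dim_def)
  show ?thesis
    by (rule comm_monoidI)
      (auto simp: carr one elim!: quotientE
        simp: dim_mult_class add zero ac_simps intro!: quotientI)
qed

section \<open>Generalized cardinal algebras\<close>

text \<open>Partial operations are rendered as functions into an option type, whose domain and range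
  are confined to \<open>A\<close> by the closure assumptions.\<close>

locale generalized_cardinal_algebra =
  fixes A :: "'a set"
    and plus :: "'a \<Rightarrow> 'a \<Rightarrow> 'a option"
    and zero :: 'a
    and isum :: "(nat \<Rightarrow> 'a) \<Rightarrow> 'a option"
  assumes zero_closed: "zero \<in> A"
    and plus_closed: "plus a b = Some c \<Longrightarrow> a \<in> A \<and> b \<in> A \<and> c \<in> A"
    and isum_closed: "isum f = Some c \<Longrightarrow> range f \<subseteq> A \<and> c \<in> A"
    and GCA1: "isum f = Some a
      \<Longrightarrow> \<exists>t. isum (\<lambda>n. f (Suc n)) = Some t \<and> plus (f 0) t = Some a"
    and GCA2: "\<lbrakk>\<And>n. plus (f n) (g n) = Some (h n); isum h = Some c\<rbrakk>
      \<Longrightarrow> \<exists>s t. isum f = Some s \<and> isum g = Some t \<and> plus s t = Some c"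
    and GCA3: "a \<in> A \<Longrightarrow> plus a zero = Some a \<and> plus zero a = Some a"
    and GCA4: "\<lbrakk>plus a b = Some c; isum h = Some c\<rbrakk>
      \<Longrightarrow> \<exists>f g. isum f = Some a \<and> isum g = Some b \<and> (\<forall>n. plus (f n) (g n) = Some (h n))"
    and GCA5: "(\<And>n. plus (g n) (f (Suc n)) = Some (f n))
      \<Longrightarrow> \<exists>a\<in>A. \<forall>n. \<exists>s. isum (\<lambda>k. g (n + k)) = Some s \<and> plus a s = Some (f n)"

definition is_GCA :: "('a, 'm) monoid_scheme \<Rightarrow> bool"
  where "is_GCA M \<longleftrightarrow> comm_monoid M \<and>
    (\<exists>isum. generalized_cardinal_algebra (carrier M)
      (\<lambda>x y. if x \<in> carrier M \<and> y \<in> carrier M then Some (x \<otimes>\<^bsub>M\<^esub> y) else None)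
      \<one>\<^bsub>M\<^esub> isum)"

end

theory Submission
  imports Defs
begin

text \<open>The main step is countable additivity of \<open>\<Delta>\<close> (in the meet-continuous case): if two bounded
  increasing sequences have the same classes \<open>\<Delta>(y\<^sub>n, y\<^sub>n\<^sub>+\<^sub>1)\<close>, then the intervals from their first
  terms to their joins have the same class.  To see this, call two intervals related if every
  element that is perspective to a relative complement representing one of them, and disjoint from
  one representing the other, is perspective to the latter (over every common lower bound, in both
  directions).  Continuity makes the largest relation of this kind that is compatible with
  splitting intervals countably additive.  It is transitive because perspectivity is transitive
  for disjoint elements, which in turn follows from Tarski's cancellation theorem, applied to the
  same construction inside a block.  Intervals of equal dimension are related, since \<open>\<Delta>\<close> is the
  finest additive, splitting invariant of intervals under transposition.  Conversely, related
  intervals have equal dimension, by cancellation and absorption.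

  Infinite sums of classes of intervals are then read off increasing sequences with a join.
  Since \<open>Dim L\<close> is a refinement monoid generated by these classes, closing the infinite sums
  under finite pointwise addition turns it into a GCA.  In the join-continuous case the same
  argument applies to the dual lattice and \<open>(a, b) \<mapsto> \<Delta>(b, a)\<close>.\<close>

section \<open>Relatively complemented modular lattices\<close>

text \<open>Axes of perspectivities can be joined when they lie in independent parts of the lattice,
  which makes perspectivity countably additive between disjoint elements. Intervals of equal
  dimension may overlap, hence the detour through a third element disjoint from the target. The
  relation so obtained is not visibly compatible with splitting, which cancellation needs. Passing
  to the largest compatible subrelation gives splitting for free, and membership is proved as for a
  bisimulation. What remains is a circle: cancellation needs transitivity of the mediated relation,
  which rests on transitivity of disjoint perspectivity, which needs cancellation. Blocks break it.
  If mediators are required to be disjoint from a fixed \<open>B\<close> and only intervals below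
  \<open>B\<close> are compared, the middle representative is disjoint from every mediator, and
  transitivity is immediate. Since \<open>L\<close> need not have a least element, representatives
  are taken over an arbitrary common lower bound, which has to be lowered when three intervals are
  involved.\<close>

notation Lattices.inf (infixl "\<^bold>\<sqinter>" 70)

text \<open>A relation, because joins exist only for bounded sequences and are compared between a
  carrier, its up-sets and its down-sets.\<close>

definition seq_lub :: "'b::order set \<Rightarrow> (nat \<Rightarrow> 'b) \<Rightarrow> 'b \<Rightarrow> bool"
  where "seq_lub C Y s \<longleftrightarrow> s \<in> C \<and> (\<forall>n. Y n \<le> s) \<and> (\<forall>u\<in>C. (\<forall>n. Y n \<le> u) \<longrightarrow> s \<le> u)"

definition chain_in :: "'b::order set \<Rightarrow> (nat \<Rightarrow> 'b) \<Rightarrow> bool"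
  where "chain_in C Y \<longleftrightarrow> (\<forall>n. Y n \<in> C) \<and> mono Y"

definition above :: "'b::order set \<Rightarrow> 'b \<Rightarrow> 'b set" where "above C b = {x \<in> C. b \<le> x}"

definition below :: "'b::order set \<Rightarrow> 'b \<Rightarrow> 'b set" where "below C b = {x \<in> C. x \<le> b}"

lemma above_iff: "x \<in> above C b \<longleftrightarrow> x \<in> C \<and> b \<le> x"
  by (simp add: above_def)

lemma below_iff: "x \<in> below C b \<longleftrightarrow> x \<in> C \<and> x \<le> b"
  by (simp add: below_def)

text \<open>Order and meet come from the type class and are total; the join is a parameter. Those
  laws of \<open>jn\<close> that have no membership premises hold on arbitrary sets in the intended
  instance, principal ideals. \<open>continuous\<close> speaks of sequences bounded in
  \<open>C\<close>, which is what conditional continuity provides.\<close>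

locale relcomp_modular =
  fixes C :: "'b::semilattice_inf set"
    and jn :: "'b \<Rightarrow> 'b \<Rightarrow> 'b" (infixl "\<^bold>\<squnion>" 65)
  assumes inf_closed [simp, intro]: "x \<in> C \<Longrightarrow> y \<in> C \<Longrightarrow> x \<^bold>\<sqinter> y \<in> C"
    and jn_closed [simp, intro]: "x \<in> C \<Longrightarrow> y \<in> C \<Longrightarrow> x \<^bold>\<squnion> y \<in> C"
    and jn_commute: "x \<^bold>\<squnion> y = y \<^bold>\<squnion> x"
    and jn_assoc: "(x \<^bold>\<squnion> y) \<^bold>\<squnion> w = x \<^bold>\<squnion> (y \<^bold>\<squnion> w)"
    and jn_ge1 [simp]: "x \<le> x \<^bold>\<squnion> y"
    and jn_least: "w \<in> C \<Longrightarrow> x \<le> w \<Longrightarrow> y \<le> w \<Longrightarrow> x \<^bold>\<squnion> y \<le> w"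
    and jn_mono: "x \<le> x' \<Longrightarrow> y \<le> y' \<Longrightarrow> x \<^bold>\<squnion> y \<le> x' \<^bold>\<squnion> y'"
    and modular_le: "x \<in> C \<Longrightarrow> y \<in> C \<Longrightarrow> w \<in> C \<Longrightarrow> x \<le> w \<Longrightarrow> (x \<^bold>\<squnion> y) \<^bold>\<sqinter> w \<le> x \<^bold>\<squnion> (y \<^bold>\<sqinter> w)"
    and relcomp: "a \<in> C \<Longrightarrow> b \<in> C \<Longrightarrow> x \<in> C \<Longrightarrow> a \<le> x \<Longrightarrow> x \<le> b \<Longrightarrow>
      \<exists>y\<in>C. x \<^bold>\<sqinter> y = a \<and> x \<^bold>\<squnion> y = b"
    and continuous: "chain_in C Y \<Longrightarrow> u \<in> C \<Longrightarrow> (\<And>n. Y n \<le> u) \<Longrightarrow>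
      \<exists>s. seq_lub C Y s \<and> (\<forall>a\<in>C. seq_lub C (\<lambda>n. a \<^bold>\<sqinter> Y n) (a \<^bold>\<sqinter> s))"
begin

lemma jn_left_commute: "x \<^bold>\<squnion> (y \<^bold>\<squnion> w) = y \<^bold>\<squnion> (x \<^bold>\<squnion> w)"
  by (metis jn_assoc jn_commute)

lemmas jn_ac = jn_commute jn_assoc jn_left_commute
lemmas mt_ac = inf.commute inf.assoc inf.left_commute

lemma jn_ge2 [simp]: "y \<le> x \<^bold>\<squnion> y"
  by (metis jn_commute jn_ge1)

lemma jn_le_iff: "w \<in> C \<Longrightarrow> x \<^bold>\<squnion> y \<le> w \<longleftrightarrow> x \<le> w \<and> y \<le> w"
  by (meson jn_ge1 jn_ge2 jn_least order_trans)

lemma jn_absorb2: "y \<in> C \<Longrightarrow> x \<le> y \<Longrightarrow> x \<^bold>\<squnion> y = y"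
  by (simp add: jn_least order_antisym)

lemma jn_absorb1: "x \<in> C \<Longrightarrow> y \<le> x \<Longrightarrow> x \<^bold>\<squnion> y = x"
  by (simp add: jn_least order_antisym)

lemma jn_idem [simp]: "x \<in> C \<Longrightarrow> x \<^bold>\<squnion> x = x"
  by (simp add: jn_absorb1)

lemma le_jnI1: "x \<le> y \<Longrightarrow> x \<le> y \<^bold>\<squnion> w"
  by (meson jn_ge1 order_trans)

lemma le_jnI2: "x \<le> w \<Longrightarrow> x \<le> y \<^bold>\<squnion> w"
  by (meson jn_ge2 order_trans)

lemma modular: "x \<in> C \<Longrightarrow> y \<in> C \<Longrightarrow> w \<in> C \<Longrightarrow> x \<le> w \<Longrightarrow> (x \<^bold>\<squnion> y) \<^bold>\<sqinter> w = x \<^bold>\<squnion> (y \<^bold>\<sqinter> w)"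
  by (intro order_antisym modular_le jn_least) (auto intro: le_jnI1 le_jnI2 le_infI1 le_infI2)

lemma modular2: "x \<in> C \<Longrightarrow> y \<in> C \<Longrightarrow> w \<in> C \<Longrightarrow> x \<le> w \<Longrightarrow> w \<^bold>\<sqinter> (y \<^bold>\<squnion> x) = (w \<^bold>\<sqinter> y) \<^bold>\<squnion> x"
  by (metis modular inf.commute jn_commute)

text \<open>The modular law evaluates \<open>(x \<squnion> g) \<sqinter> y\<close> as
  \<open>x\<close>: comparable elements with a common relative complement coincide.\<close>

lemma modular_cancel:
  assumes "x \<in> C" "y \<in> C" "g \<in> C" "x \<le> y" "y \<le> x \<^bold>\<squnion> g" "y \<^bold>\<sqinter> g \<le> x"
  shows "x = y"
proof -
  have "y = (x \<^bold>\<squnion> g) \<^bold>\<sqinter> y" using assms by (simp add: inf_absorb2)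
  also have "\<dots> = x \<^bold>\<squnion> (g \<^bold>\<sqinter> y)" using assms by (intro modular)
  also have "\<dots> = x" using assms by (intro jn_absorb1) (simp_all add: inf.commute)
  finally show ?thesis ..
qed

lemma seq_lub_unique: "seq_lub C Y s \<Longrightarrow> seq_lub C Y t \<Longrightarrow> s = t"
  unfolding seq_lub_def by (simp add: order_antisym)

lemma seq_lubD: "seq_lub C Y s \<Longrightarrow> s \<in> C" "seq_lub C Y s \<Longrightarrow> Y n \<le> s"
  unfolding seq_lub_def by auto

lemma seq_lub_least: "seq_lub C Y s \<Longrightarrow> u \<in> C \<Longrightarrow> (\<And>n. Y n \<le> u) \<Longrightarrow> s \<le> u"
  unfolding seq_lub_def by auto

lemma seq_lubI: "s \<in> C \<Longrightarrow> (\<And>n. Y n \<le> s) \<Longrightarrow> (\<And>u. u \<in> C \<Longrightarrow> (\<And>n. Y n \<le> u) \<Longrightarrow> s \<le> u) \<Longrightarrow> seq_lub C Y s"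
  unfolding seq_lub_def by auto

lemma chain_inD: "chain_in C Y \<Longrightarrow> Y n \<in> C" "chain_in C Y \<Longrightarrow> m \<le> n \<Longrightarrow> Y m \<le> Y n"
  unfolding chain_in_def by (auto dest: monoD)

lemma chain_inI: "(\<And>n. Y n \<in> C) \<Longrightarrow> (\<And>n. Y n \<le> Y (Suc n)) \<Longrightarrow> chain_in C Y"
  unfolding chain_in_def by (simp add: mono_iff_le_Suc)

lemma chain_in_step: "chain_in C Y \<Longrightarrow> Y n \<le> Y (Suc n)"
  by (simp add: chain_inD(2))

lemma seq_lub_ex: "chain_in C Y \<Longrightarrow> u \<in> C \<Longrightarrow> (\<And>n. Y n \<le> u) \<Longrightarrow> \<exists>s. seq_lub C Y s"
  using continuous by blast

lemma seq_lub_inf: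
  assumes "chain_in C Y" "seq_lub C Y s" "a \<in> C"
  shows "seq_lub C (\<lambda>n. a \<^bold>\<sqinter> Y n) (a \<^bold>\<sqinter> s)"
proof -
  obtain t where "seq_lub C Y t" "\<forall>a\<in>C. seq_lub C (\<lambda>n. a \<^bold>\<sqinter> Y n) (a \<^bold>\<sqinter> t)"
    using continuous[OF assms(1), of s] assms(2) by (auto simp: seq_lub_def)
  moreover from this(1) have "t = s" using assms(2) by (rule seq_lub_unique)
  ultimately show ?thesis using assms(3) by simp
qed

lemma seq_lub_jn:
  assumes "seq_lub C X x" "seq_lub C Y y"
  shows "seq_lub C (\<lambda>n. X n \<^bold>\<squnion> Y n) (x \<^bold>\<squnion> y)"
proof (rule seq_lubI)
  show "x \<^bold>\<squnion> y \<in> C" using assms seq_lubD(1) by blast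
  show "X n \<^bold>\<squnion> Y n \<le> x \<^bold>\<squnion> y" for n using assms seq_lubD(2) by (blast intro: jn_mono)
  fix u assume u: "u \<in> C" "\<And>n. X n \<^bold>\<squnion> Y n \<le> u"
  then have "X n \<le> u" "Y n \<le> u" for n by (auto simp: jn_le_iff)
  then show "x \<^bold>\<squnion> y \<le> u" using assms u(1) by (intro jn_least) (auto intro: seq_lub_least)
qed

lemma seq_lub_const: "a \<in> C \<Longrightarrow> seq_lub C (\<lambda>n. a) a"
  by (simp add: seq_lub_def)

lemma seq_lub_shift:
  assumes "chain_in C Y" "seq_lub C Y s"
  shows "seq_lub C (\<lambda>n. Y (k + n)) s"
proof (rule seq_lubI)
  fix u assume "u \<in> C" "\<And>n. Y (k + n) \<le> u"
  then have "Y n \<le> u" for n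
    using chain_inD(2)[OF assms(1), of n "k + n"] order_trans by auto
  with \<open>u \<in> C\<close> show "s \<le> u" by (rule seq_lub_least[OF assms(2)])
qed (use assms in \<open>auto dest: seq_lubD\<close>)

lemma chain_in_shift: "chain_in C Y \<Longrightarrow> chain_in C (\<lambda>n. Y (k + n))"
  by (auto simp: chain_in_def mono_def)

lemma chain_in_inf: "chain_in C Y \<Longrightarrow> a \<in> C \<Longrightarrow> chain_in C (\<lambda>n. a \<^bold>\<sqinter> Y n)"
  by (intro chain_inI inf_closed inf_mono order_refl) (auto dest: chain_inD chain_in_step)

lemma chain_in_jn: "chain_in C Y \<Longrightarrow> a \<in> C \<Longrightarrow> chain_in C (\<lambda>n. a \<^bold>\<squnion> Y n)"
  by (intro chain_inI jn_closed jn_mono order_refl) (auto dest: chain_inD chain_in_step)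

text \<open>Continuity is applied in one variable at a time; the mixed term
  \<open>Q n \<sqinter> P m\<close> lies below the diagonal term with index
  \<open>max n m\<close>.\<close>

lemma seq_lub_inf_le:
  assumes "chain_in C P" "seq_lub C P p" "chain_in C Q" "seq_lub C Q q" "u \<in> C"
    and "\<And>n. P n \<^bold>\<sqinter> Q n \<le> u"
  shows "p \<^bold>\<sqinter> q \<le> u"
proof (rule seq_lub_least[OF seq_lub_inf[OF assms(3,4)]])
  show "p \<in> C" using assms seq_lubD by blast
  show "p \<^bold>\<sqinter> Q n \<le> u" for n
    unfolding inf.commute[of p]
  proof (rule seq_lub_least[OF seq_lub_inf[OF assms(1,2)]])
    show "Q n \<in> C" using assms chain_inD by blast
    show "Q n \<^bold>\<sqinter> P m \<le> u" for m
    proof -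
      have "Q n \<^bold>\<sqinter> P m \<le> P (max n m) \<^bold>\<sqinter> Q (max n m)"
        using chain_inD(2)[OF assms(1), of m "max n m"] chain_inD(2)[OF assms(3), of n "max n m"]
        by (simp add: le_infI1 le_infI2)
      then show ?thesis using assms(6) order_trans by blast
    qed
  qed fact
qed fact

text \<open>A relative complement lies between the ends of its interval, and the join of a bounded
  sequence between a term and the bound, so convexity keeps both in \<open>S\<close>.\<close>

lemma sub_relcomp_modular:
  assumes "S \<subseteq> C" "\<And>x y. x \<in> S \<Longrightarrow> y \<in> S \<Longrightarrow> x \<^bold>\<sqinter> y \<in> S \<and> x \<^bold>\<squnion> y \<in> S"
    and convex: "\<And>x y w. x \<in> S \<Longrightarrow> y \<in> S \<Longrightarrow> w \<in> C \<Longrightarrow> x \<le> w \<Longrightarrow> w \<le> y \<Longrightarrow> w \<in> S"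
  shows "relcomp_modular S jn"
proof unfold_locales
  fix a b x assume A: "a \<in> S" "b \<in> S" "x \<in> S" "a \<le> x" "x \<le> b"
  then obtain y where "y \<in> C" "x \<^bold>\<sqinter> y = a" "x \<^bold>\<squnion> y = b"
    using relcomp[of a b x] assms(1) by blast
  with A show "\<exists>y\<in>S. x \<^bold>\<sqinter> y = a \<and> x \<^bold>\<squnion> y = b"
    using convex[of a b y] by (metis inf_le2 jn_ge2)
next
  fix Y u assume A: "chain_in S Y" "u \<in> S" "\<And>n. Y n \<le> u"
  then have c: "chain_in C Y" using assms(1) by (auto simp: chain_in_def)
  obtain s where s: "seq_lub C Y s" "\<forall>a\<in>C. seq_lub C (\<lambda>n. a \<^bold>\<sqinter> Y n) (a \<^bold>\<sqinter> s)"
    using continuous[OF c _ A(3)] A assms(1) by blast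
  have sS: "s \<in> S"
    using convex[of "Y 0" u s] A s seq_lub_least[OF s(1), of u] seq_lubD[OF s(1)] assms(1)
    by (auto simp: chain_in_def)
  have "seq_lub S Y s" using s(1) sS assms(1) by (auto simp: seq_lub_def)
  moreover have "seq_lub S (\<lambda>n. a \<^bold>\<sqinter> Y n) (a \<^bold>\<sqinter> s)" if "a \<in> S" for a
    using s(2) sS that assms(1) assms(2)[of a s] by (auto simp: seq_lub_def)
  ultimately show "\<exists>s. seq_lub S Y s \<and> (\<forall>a\<in>S. seq_lub S (\<lambda>n. a \<^bold>\<sqinter> Y n) (a \<^bold>\<sqinter> s))"
    by blast
next
  fix x y w assume "x \<in> S" "y \<in> S" "w \<in> S" "x \<le> w"
  with assms(1) show "(x \<^bold>\<squnion> y) \<^bold>\<sqinter> w \<le> x \<^bold>\<squnion> y \<^bold>\<sqinter> w" by (intro modular_le) auto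
next
  fix x y w assume "w \<in> S" "x \<le> w" "y \<le> w"
  with assms(1) show "x \<^bold>\<squnion> y \<le> w" by (intro jn_least) auto
qed (use assms(2) in \<open>simp_all add: jn_assoc jn_mono\<close>, rule jn_commute)

lemma below_relcomp_modular:
  assumes "b \<in> C" shows "relcomp_modular (below C b) jn"
  by (rule sub_relcomp_modular) (use assms in \<open>auto simp: jn_le_iff below_iff intro: le_infI1\<close>)

lemma above_relcomp_modular:
  assumes "b \<in> C" shows "relcomp_modular (above C b) jn"
  by (rule sub_relcomp_modular) (use assms in \<open>auto simp: above_iff intro: le_jnI1\<close>)

end

section \<open>Perspectivity\<close>

text \<open>The bottom is a parameter because the locale is entered at \<open>above C t\<close> with
  bottom \<open>t\<close> for many different \<open>t\<close>.\<close>

locale relcomp_modular_0 = relcomp_modular C jn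
  for C :: "'b::semilattice_inf set" and jn (infixl "\<^bold>\<squnion>" 65) +
  fixes z :: 'b
  assumes z_closed [simp, intro]: "z \<in> C" and z_le [simp, intro]: "x \<in> C \<Longrightarrow> z \<le> x"
begin

definition disj :: "'b \<Rightarrow> 'b \<Rightarrow> bool" (infix "\<^bold>\<bottom>" 50)
  where "x \<^bold>\<bottom> y \<longleftrightarrow> x \<^bold>\<sqinter> y = z"

lemma jn_z [simp]: "x \<in> C \<Longrightarrow> x \<^bold>\<squnion> z = x" "x \<in> C \<Longrightarrow> z \<^bold>\<squnion> x = x"
  by (simp_all add: jn_absorb1 jn_absorb2)

lemma inf_z [simp]: "x \<in> C \<Longrightarrow> x \<^bold>\<sqinter> z = z" "x \<in> C \<Longrightarrow> z \<^bold>\<sqinter> x = z"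
  by (simp_all add: inf_absorb1 inf_absorb2)

lemma disj_z [simp]: "x \<in> C \<Longrightarrow> x \<^bold>\<bottom> z" "x \<in> C \<Longrightarrow> z \<^bold>\<bottom> x"
  by (simp_all add: disj_def)

lemma eq_zI: "x \<in> C \<Longrightarrow> x \<le> z \<Longrightarrow> x = z"
  by (simp add: order_antisym)

lemma disj_commute: "x \<^bold>\<bottom> y \<longleftrightarrow> y \<^bold>\<bottom> x"
  by (simp add: disj_def inf.commute)

lemma disj_mono:
  assumes "x \<^bold>\<bottom> y" "x' \<le> x" "y' \<le> y" "x' \<in> C" "y' \<in> C"
  shows "x' \<^bold>\<bottom> y'"
proof -
  have "x' \<^bold>\<sqinter> y' \<le> x \<^bold>\<sqinter> y" using assms by (intro inf_mono)
  also have "x \<^bold>\<sqinter> y = z" using assms(1) by (simp only: disj_def)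
  finally have "x' \<^bold>\<sqinter> y' \<le> z" .
  then show ?thesis using assms eq_zI by (simp add: disj_def)
qed

text \<open>Independence of three elements can be tested successively:
  \<open>(y \<squnion> w) \<sqinter> (x \<squnion> y)\<close> is \<open>y\<close> by the modular
  law, and \<open>x\<close> meets \<open>y\<close> only in \<open>z\<close>.\<close>

lemma disj_jn:
  assumes "x \<in> C" "y \<in> C" "w \<in> C" "x \<^bold>\<bottom> y" "x \<^bold>\<squnion> y \<^bold>\<bottom> w"
  shows "x \<^bold>\<bottom> y \<^bold>\<squnion> w"
  unfolding disj_def
proof (rule eq_zI)
  have "x \<^bold>\<sqinter> (y \<^bold>\<squnion> w) \<le> (y \<^bold>\<squnion> w) \<^bold>\<sqinter> (x \<^bold>\<squnion> y)"
    by (auto intro: le_infI1 le_infI2)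
  also have "\<dots> = y \<^bold>\<squnion> (w \<^bold>\<sqinter> (x \<^bold>\<squnion> y))" using assms by (intro modular) auto
  also have "\<dots> = y" using assms by (simp add: inf.commute disj_def)
  finally have "x \<^bold>\<sqinter> (y \<^bold>\<squnion> w) \<le> x \<^bold>\<sqinter> y" by simp
  with assms show "x \<^bold>\<sqinter> (y \<^bold>\<squnion> w) \<le> z" by (simp add: disj_def)
qed (use assms in auto)

text \<open>Dedekind's transposition: joining with \<open>B\<close> embeds the elements below
  \<open>A\<close>, and meeting with \<open>A\<close> recovers them.\<close>

lemma disj_jn_absorb:
  assumes "A \<in> C" "B \<in> C" "x \<in> C" "y \<in> C" "A \<^bold>\<bottom> B" "x \<le> A" "y \<le> A"
  shows "(x \<^bold>\<squnion> B) \<^bold>\<sqinter> (y \<^bold>\<squnion> B) = (x \<^bold>\<sqinter> y) \<^bold>\<squnion> B"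
proof -
  have "(B \<^bold>\<squnion> x) \<^bold>\<sqinter> (y \<^bold>\<squnion> B) = B \<^bold>\<squnion> (x \<^bold>\<sqinter> (y \<^bold>\<squnion> B))"
    using assms by (intro modular) auto
  also have "x \<^bold>\<sqinter> (y \<^bold>\<squnion> B) = x \<^bold>\<sqinter> ((y \<^bold>\<squnion> B) \<^bold>\<sqinter> A)"
    using assms(6) by (metis inf.absorb1 inf.assoc inf.commute)
  also have "(y \<^bold>\<squnion> B) \<^bold>\<sqinter> A = y"
    using assms modular[of y B A] by (simp add: disj_def inf.commute[of B A])
  finally show ?thesis by (simp add: jn_commute)
qed

text \<open>For disjoint \<open>A\<close> and \<open>B\<close>, the joins of an element below
  \<open>A\<close> with an element below \<open>B\<close> behave like a direct product, so meets are
  computed componentwise.\<close>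

lemma disj_jn_inf:
  assumes "A \<in> C" "B \<in> C" "x \<in> C" "y \<in> C" "p \<in> C" "g \<in> C" "A \<^bold>\<bottom> B"
    and "x \<le> A" "y \<le> A" "p \<le> B" "g \<le> B"
  shows "(x \<^bold>\<squnion> p) \<^bold>\<sqinter> (y \<^bold>\<squnion> g) = (x \<^bold>\<sqinter> y) \<^bold>\<squnion> (p \<^bold>\<sqinter> g)"
proof (rule order_antisym)
  let ?u = "x \<^bold>\<sqinter> y" and ?v = "p \<^bold>\<sqinter> g"
  have "(x \<^bold>\<squnion> p) \<^bold>\<sqinter> (y \<^bold>\<squnion> g) \<le> (x \<^bold>\<squnion> B) \<^bold>\<sqinter> (y \<^bold>\<squnion> B)"
    using assms by (intro inf_mono jn_mono order_refl)
  also have "\<dots> = ?u \<^bold>\<squnion> B" using assms by (intro disj_jn_absorb)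
  finally have 1: "(x \<^bold>\<squnion> p) \<^bold>\<sqinter> (y \<^bold>\<squnion> g) \<le> ?u \<^bold>\<squnion> B" .
  have "(x \<^bold>\<squnion> p) \<^bold>\<sqinter> (y \<^bold>\<squnion> g) \<le> (p \<^bold>\<squnion> A) \<^bold>\<sqinter> (g \<^bold>\<squnion> A)"
    using assms unfolding jn_commute[of x] jn_commute[of y] by (intro inf_mono jn_mono order_refl)
  also have "\<dots> = ?v \<^bold>\<squnion> A"
    using assms disj_commute[of A] by (intro disj_jn_absorb[of B]) simp_all
  finally have 2: "(x \<^bold>\<squnion> p) \<^bold>\<sqinter> (y \<^bold>\<squnion> g) \<le> ?v \<^bold>\<squnion> A" .
  have uA: "?u \<le> A" and vB: "?v \<le> B" using assms by (auto intro: le_infI1)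
  have "(?u \<^bold>\<squnion> B) \<^bold>\<sqinter> (?v \<^bold>\<squnion> A) = ?u \<^bold>\<squnion> (B \<^bold>\<sqinter> (?v \<^bold>\<squnion> A))"
    using assms uA by (intro modular) (auto intro: le_jnI2)
  also have "B \<^bold>\<sqinter> (?v \<^bold>\<squnion> A) = ?v \<^bold>\<squnion> (A \<^bold>\<sqinter> B)"
    using assms modular[of ?v A B] vB by (simp add: inf.commute)
  finally have "(?u \<^bold>\<squnion> B) \<^bold>\<sqinter> (?v \<^bold>\<squnion> A) = ?u \<^bold>\<squnion> ?v" using assms by (simp add: disj_def)
  with 1 2 show "(x \<^bold>\<squnion> p) \<^bold>\<sqinter> (y \<^bold>\<squnion> g) \<le> ?u \<^bold>\<squnion> ?v" by (metis le_infI)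
  show "?u \<^bold>\<squnion> ?v \<le> (x \<^bold>\<squnion> p) \<^bold>\<sqinter> (y \<^bold>\<squnion> g)"
    by (intro le_infI jn_mono inf_le1 inf_le2)
qed

lemma complement_below:
  assumes "x \<in> C" "y \<in> C" "x \<le> y"
  obtains w where "w \<in> C" "x \<^bold>\<bottom> w" "x \<^bold>\<squnion> w = y" "w \<le> y"
  using relcomp[of z y x] assms by (metis jn_ge2 z_closed z_le disj_def)

definition axis :: "'b \<Rightarrow> 'b \<Rightarrow> 'b \<Rightarrow> bool"
  where "axis g x y \<longleftrightarrow> g \<in> C \<and> x \<^bold>\<bottom> g \<and> y \<^bold>\<bottom> g \<and> x \<^bold>\<squnion> g = y \<^bold>\<squnion> g"

definition persp :: "'b \<Rightarrow> 'b \<Rightarrow> bool" (infix "\<sim>" 50)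
  where "x \<sim> y \<longleftrightarrow> x \<in> C \<and> y \<in> C \<and> (\<exists>g. axis g x y)"

lemma persp_closed: "x \<sim> y \<Longrightarrow> x \<in> C" "x \<sim> y \<Longrightarrow> y \<in> C"
  by (auto simp: persp_def)

lemma persp_refl [simp]: "x \<in> C \<Longrightarrow> x \<sim> x"
  by (auto simp: persp_def axis_def intro!: exI[of _ z])

lemma axis_sym: "axis g x y \<Longrightarrow> axis g y x"
  by (simp add: axis_def)

lemma persp_sym: "x \<sim> y \<Longrightarrow> y \<sim> x"
  unfolding persp_def using axis_sym by blast

lemma perspI: "x \<in> C \<Longrightarrow> y \<in> C \<Longrightarrow> g \<in> C \<Longrightarrow> x \<^bold>\<bottom> g \<Longrightarrow> y \<^bold>\<bottom> g \<Longrightarrow>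
    x \<^bold>\<squnion> g = y \<^bold>\<squnion> g \<Longrightarrow> x \<sim> y"
  unfolding persp_def axis_def by blast

text \<open>Cutting an axis down to \<open>x \<squnion> y\<close> leaves an axis, by modularity.
  This locality is what allows axes over disjoint parts to be combined.\<close>

lemma persp_axis_below:
  assumes "x \<sim> y"
  obtains g where "axis g x y" "x \<^bold>\<squnion> g = x \<^bold>\<squnion> y" "y \<^bold>\<squnion> g = x \<^bold>\<squnion> y" "g \<le> x \<^bold>\<squnion> y" "g \<in> C"
proof -
  obtain h where h: "axis h x y" and c: "x \<in> C" "y \<in> C" using assms by (auto simp: persp_def)
  then have hC: "h \<in> C" and xh: "x \<^bold>\<squnion> h = y \<^bold>\<squnion> h" by (auto simp: axis_def)
  let ?g = "h \<^bold>\<sqinter> (x \<^bold>\<squnion> y)"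
  have le: "x \<^bold>\<squnion> y \<le> y \<^bold>\<squnion> h" using c hC xh by (metis jn_closed jn_ge1 jn_least)
  have 1: "x \<^bold>\<squnion> ?g = x \<^bold>\<squnion> y"
    using hC c modular[of x h "x \<^bold>\<squnion> y"] le xh by (simp add: inf_absorb2)
  have 2: "y \<^bold>\<squnion> ?g = x \<^bold>\<squnion> y"
    using hC c modular[of y h "x \<^bold>\<squnion> y"] le by (simp add: inf_absorb2)
  have "x \<^bold>\<bottom> ?g" "y \<^bold>\<bottom> ?g"
    using h c hC by (auto simp: axis_def elim: disj_mono)
  then have "axis ?g x y" using hC c 1 2 by (simp add: axis_def)
  with 1 2 show thesis using that hC c by simp
qed

text \<open>The local axes \<open>g\<close> and \<open>h\<close> lie below disjoint elements, so
  \<open>disj_jn_inf\<close> makes \<open>g \<squnion> h\<close> an axis.\<close>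

lemma persp_jn:
  assumes "x \<sim> y" "p \<sim> q" "x \<^bold>\<squnion> y \<^bold>\<bottom> p \<^bold>\<squnion> q"
  shows "x \<^bold>\<squnion> p \<sim> y \<^bold>\<squnion> q"
proof -
  obtain g where g: "axis g x y" "g \<le> x \<^bold>\<squnion> y" using persp_axis_below[OF assms(1)] by metis
  obtain h where h: "axis h p q" "h \<le> p \<^bold>\<squnion> q" using persp_axis_below[OF assms(2)] by metis
  have c: "x \<in> C" "y \<in> C" "p \<in> C" "q \<in> C" "g \<in> C" "h \<in> C"
    using assms g h by (auto simp: axis_def dest: persp_closed)
  have "(x \<^bold>\<squnion> p) \<^bold>\<sqinter> (g \<^bold>\<squnion> h) = (x \<^bold>\<sqinter> g) \<^bold>\<squnion> (p \<^bold>\<sqinter> h)"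
    "(y \<^bold>\<squnion> q) \<^bold>\<sqinter> (g \<^bold>\<squnion> h) = (y \<^bold>\<sqinter> g) \<^bold>\<squnion> (q \<^bold>\<sqinter> h)"
    by (rule disj_jn_inf[of "x \<^bold>\<squnion> y" "p \<^bold>\<squnion> q"]; use assms(3) g h c in simp)+
  moreover have "(x \<^bold>\<squnion> p) \<^bold>\<squnion> (g \<^bold>\<squnion> h) = (x \<^bold>\<squnion> g) \<^bold>\<squnion> (p \<^bold>\<squnion> h)"
    "(y \<^bold>\<squnion> q) \<^bold>\<squnion> (g \<^bold>\<squnion> h) = (y \<^bold>\<squnion> g) \<^bold>\<squnion> (q \<^bold>\<squnion> h)" by (simp_all only: jn_ac)
  ultimately show ?thesis using c g(1) h(1)
    by (intro perspI[of _ _ "g \<^bold>\<squnion> h"]) (simp_all add: axis_def disj_def)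
qed

definition dsum :: "'b \<Rightarrow> 'b \<Rightarrow> 'b \<Rightarrow> bool"
  where "dsum x x1 x2 \<longleftrightarrow> x1 \<in> C \<and> x2 \<in> C \<and> x1 \<^bold>\<bottom> x2 \<and> x = x1 \<^bold>\<squnion> x2"

lemma dsumD: "dsum x x1 x2 \<Longrightarrow> x \<in> C \<and> x1 \<in> C \<and> x2 \<in> C \<and> x1 \<le> x \<and> x2 \<le> x"
  by (auto simp: dsum_def)

lemma dsum_ex:
  assumes "x \<in> C" "x1 \<in> C" "x1 \<le> x" obtains x2 where "dsum x x1 x2"
  using complement_below[of x1 x] assms by (metis dsum_def)

text \<open>All four parts are independent, so they can be regrouped:
  \<open>v1 \<squnion> w1\<close> and \<open>v2 \<squnion> w2\<close> are disjoint, as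
  \<open>persp_jn\<close> requires.\<close>

lemma persp_dsum_jn:
  assumes "dsum v v1 v2" "dsum w w1 w2" "v1 \<sim> w1" "v2 \<sim> w2" "v \<^bold>\<bottom> w"
  shows "v \<sim> w"
proof -
  have "(v1 \<^bold>\<squnion> w1) \<^bold>\<sqinter> (v2 \<^bold>\<squnion> w2) = (v1 \<^bold>\<sqinter> v2) \<^bold>\<squnion> (w1 \<^bold>\<sqinter> w2)"
    by (rule disj_jn_inf[of v w]) (use assms in \<open>auto simp: dsum_def\<close>)
  then have "v1 \<^bold>\<squnion> w1 \<^bold>\<bottom> v2 \<^bold>\<squnion> w2" using assms by (simp add: dsum_def disj_def)
  then show ?thesis
    using persp_jn[OF assms(3,4)] assms by (auto simp: dsum_def)
qed

text \<open>The isomorphism, induced by the axis \<open>g\<close>, from the elements below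
  \<open>x\<close> onto those below \<open>y\<close>.\<close>

definition img :: "'b \<Rightarrow> 'b \<Rightarrow> 'b \<Rightarrow> 'b" where "img g y x = (x \<^bold>\<squnion> g) \<^bold>\<sqinter> y"

lemma img_props:
  assumes "axis g x y" "x1 \<in> C" "x1 \<le> x" "y \<in> C" "x \<in> C"
  shows "img g y x1 \<in> C" "img g y x1 \<^bold>\<squnion> g = x1 \<^bold>\<squnion> g" "axis g x1 (img g y x1)" "x1 \<sim> img g y x1"
    "img g y x1 \<le> y"
proof -
  let ?i = "img g y x1"
  have g: "g \<in> C" "x \<^bold>\<bottom> g" "y \<^bold>\<bottom> g" and gx: "g \<^bold>\<squnion> y = x \<^bold>\<squnion> g"
    using assms by (auto simp: axis_def jn_commute)
  show iC: "?i \<in> C" using g assms by (simp add: img_def)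
  have "g \<^bold>\<squnion> (y \<^bold>\<sqinter> (x1 \<^bold>\<squnion> g)) = (g \<^bold>\<squnion> y) \<^bold>\<sqinter> (x1 \<^bold>\<squnion> g)"
    using g assms by (intro modular[symmetric]) auto
  also have "\<dots> = x1 \<^bold>\<squnion> g" unfolding gx using assms by (intro inf_absorb2 jn_mono) auto
  finally show 1: "?i \<^bold>\<squnion> g = x1 \<^bold>\<squnion> g" by (simp add: img_def inf.commute jn_commute)
  show le: "?i \<le> y" by (simp add: img_def)
  have "x1 \<^bold>\<bottom> g" using g(2) assms g(1) by (auto elim: disj_mono)
  moreover have "?i \<^bold>\<bottom> g" using disj_mono[OF g(3) le order_refl iC g(1)] .
  ultimately show "axis g x1 ?i" unfolding axis_def using 1 g(1) by simp
  then show "x1 \<sim> ?i" using assms iC by (auto simp: persp_def)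
qed

lemma img_full: "axis g x y \<Longrightarrow> x \<in> C \<Longrightarrow> y \<in> C \<Longrightarrow> img g y x = y"
  by (simp add: img_def axis_def inf_absorb2)

text \<open>Disjointness is preserved by \<open>disj_jn_absorb\<close>. For joins, both sides have
  the same join with \<open>g\<close>, and \<open>img g y w\<close> is disjoint from
  \<open>g\<close>, so \<open>modular_cancel\<close> applies.\<close>

lemma img_dsum:
  assumes "axis g x y" "x \<in> C" "y \<in> C" "dsum w w1 w2" "w \<le> x"
  shows "dsum (img g y w) (img g y w1) (img g y w2)"
proof -
  have w: "w \<in> C" "w1 \<in> C" "w2 \<in> C" "w1 \<le> w" "w2 \<le> w" "w1 \<le> x" "w2 \<le> x"
    using dsumD[OF assms(4)] assms(5) order_trans by blast+
  have g: "g \<in> C" "y \<^bold>\<bottom> g" "x \<^bold>\<bottom> g" using assms by (auto simp: axis_def)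
  note p = img_props[OF assms(1) w(1) assms(5,3,2)]
  note p1 = img_props[OF assms(1) w(2) w(6) assms(3,2)]
  note p2 = img_props[OF assms(1) w(3) w(7) assms(3,2)]
  have "img g y w1 \<^bold>\<sqinter> img g y w2 \<le> (w1 \<^bold>\<squnion> g) \<^bold>\<sqinter> (w2 \<^bold>\<squnion> g)"
    by (auto simp: img_def intro: le_infI1 le_infI2)
  also have "\<dots> = (w1 \<^bold>\<sqinter> w2) \<^bold>\<squnion> g" using w g assms by (intro disj_jn_absorb[of x]) auto
  also have "\<dots> = g" using assms(4) g by (simp add: dsum_def disj_def)
  finally have "img g y w1 \<^bold>\<sqinter> img g y w2 \<le> y \<^bold>\<sqinter> g" using p1(5) by (auto intro: le_infI1)
  also have "y \<^bold>\<sqinter> g = z" using g(2) by (simp only: disj_def)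
  finally have d: "img g y w1 \<^bold>\<bottom> img g y w2" unfolding disj_def
    using p1(1) p2(1) g by (intro eq_zI) simp_all
  have "img g y w1 \<le> img g y w" "img g y w2 \<le> img g y w"
    unfolding img_def using w by (intro inf_mono jn_mono order_refl; simp)+
  then have le: "img g y w1 \<^bold>\<squnion> img g y w2 \<le> img g y w"
    using p by (intro jn_least)
  have "(img g y w1 \<^bold>\<squnion> img g y w2) \<^bold>\<squnion> g = (img g y w1 \<^bold>\<squnion> g) \<^bold>\<squnion> (img g y w2 \<^bold>\<squnion> g)"
    using jn_idem[OF g(1)] by (metis jn_assoc jn_commute)
  also have "\<dots> = w \<^bold>\<squnion> g" using p1(2) p2(2) assms(4) jn_idem[OF g(1)]
    by (metis dsum_def jn_assoc jn_commute)
  finally have "img g y w \<le> (img g y w1 \<^bold>\<squnion> img g y w2) \<^bold>\<squnion> g" by (simp add: img_def)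
  moreover have "img g y w \<^bold>\<sqinter> g = z" using p(3) by (simp add: axis_def disj_def)
  ultimately have "img g y w1 \<^bold>\<squnion> img g y w2 = img g y w"
    using p1(1) p2(1) p(1) g le by (intro modular_cancel[of _ _ g]) auto
  with d show ?thesis using p1(1) p2(1) by (simp add: dsum_def)
qed

lemma persp_dsum:
  assumes "x \<sim> y" "dsum x x1 x2"
  obtains y1 y2 where "dsum y y1 y2" "x1 \<sim> y1" "x2 \<sim> y2"
proof -
  obtain g where g: "axis g x y" "x \<in> C" "y \<in> C" using assms by (auto simp: persp_def)
  show thesis
  proof
    show "dsum y (img g y x1) (img g y x2)"
      using img_dsum[OF g assms(2)] img_full[OF g] by simp
  qed (use dsumD[OF assms(2)] img_props(4)[OF g(1) _ _ g(3,2)] in auto)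
qed

text \<open>The axis is the join of the axis of the first perspectivity with an axis of the second one
  that lies below \<open>q \<^bold>\<squnion> q'\<close>.\<close>

lemma persp_absorb:
  assumes "p \<sim> q" "q \<sim> q'" "p \<^bold>\<bottom> q \<^bold>\<squnion> q'"
  shows "p \<sim> q'"
proof -
  obtain g where g: "axis g p q" "p \<^bold>\<squnion> g = p \<^bold>\<squnion> q" "q \<^bold>\<squnion> g = p \<^bold>\<squnion> q" "g \<le> p \<^bold>\<squnion> q" "g \<in> C"
    using persp_axis_below[OF assms(1)] by metis
  obtain t where t: "axis t q q'" "q \<^bold>\<squnion> t = q \<^bold>\<squnion> q'" "q' \<^bold>\<squnion> t = q \<^bold>\<squnion> q'" "t \<le> q \<^bold>\<squnion> q'" "t \<in> C"
    using persp_axis_below[OF assms(2)] by metis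
  have c: "p \<in> C" "q \<in> C" "q' \<in> C" using persp_closed[OF assms(1)] persp_closed[OF assms(2)] by auto
  have pgq: "p \<^bold>\<bottom> g" "q \<^bold>\<bottom> g" "q \<^bold>\<bottom> t" "q' \<^bold>\<bottom> t"
    using g t by (auto simp: axis_def)
  have "(q \<^bold>\<squnion> p) \<^bold>\<sqinter> (q \<^bold>\<squnion> q') = q \<^bold>\<squnion> (p \<^bold>\<sqinter> (q \<^bold>\<squnion> q'))"
    using c by (intro modular) auto
  then have pq: "(p \<^bold>\<squnion> q) \<^bold>\<sqinter> (q \<^bold>\<squnion> q') = q" using assms(3) c by (simp add: jn_commute disj_def)
  have "g \<^bold>\<sqinter> (q \<^bold>\<squnion> q') = z"
  proof (rule eq_zI)
    have "g \<^bold>\<sqinter> (q \<^bold>\<squnion> q') = g \<^bold>\<sqinter> ((p \<^bold>\<squnion> q) \<^bold>\<sqinter> (q \<^bold>\<squnion> q'))"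
      using g(4) by (metis inf.absorb1 inf.assoc)
    then show "g \<^bold>\<sqinter> (q \<^bold>\<squnion> q') \<le> z" using pq pgq by (simp add: inf.commute disj_def)
  qed (use c g in auto)
  then have "q' \<^bold>\<squnion> t \<^bold>\<bottom> g" using t(3) by (simp add: inf.commute disj_def)
  then have q': "q' \<^bold>\<bottom> t \<^bold>\<squnion> g"
    using c g t pgq by (intro disj_jn) auto
  have "t \<^bold>\<squnion> q \<^bold>\<bottom> p" using assms(3) t(2) by (simp add: jn_commute inf.commute disj_def)
  then have "t \<^bold>\<bottom> q \<^bold>\<squnion> p" using c t pgq disj_commute by (intro disj_jn) auto
  then have "p \<^bold>\<squnion> g \<^bold>\<bottom> t" using g(2) by (simp add: inf.commute jn_commute disj_def)
  then have p: "p \<^bold>\<bottom> g \<^bold>\<squnion> t" using c g t pgq by (intro disj_jn) auto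
  have "p \<^bold>\<squnion> (g \<^bold>\<squnion> t) = (p \<^bold>\<squnion> g) \<^bold>\<squnion> t" by (simp add: jn_assoc)
  also have "\<dots> = g \<^bold>\<squnion> (q \<^bold>\<squnion> t)" unfolding g(2) g(3)[symmetric] by (simp only: jn_ac)
  also have "\<dots> = q' \<^bold>\<squnion> (g \<^bold>\<squnion> t)" unfolding t(2) t(3)[symmetric] by (simp only: jn_ac)
  finally show ?thesis using p q' c g(5) t(5)
    by (intro perspI[of _ _ "g \<^bold>\<squnion> t"]) (simp_all add: jn_commute)
qed

end

section \<open>Representing intervals over the bottom, and absorption\<close>

context relcomp_modular_0 begin

text \<open>The interval \<open>[z, w]\<close> transposes up to \<open>[a, b]\<close>, so
  \<open>w\<close> stands for that interval over the bottom.\<close>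

definition rep :: "'b \<Rightarrow> 'b \<Rightarrow> 'b \<Rightarrow> bool"
  where "rep w a b \<longleftrightarrow> w \<in> C \<and> w \<^bold>\<bottom> a \<and> w \<^bold>\<squnion> a = b"

lemma repD: "rep w a b \<Longrightarrow> w \<in> C \<and> w \<^bold>\<bottom> a \<and> w \<^bold>\<squnion> a = b \<and> a \<le> b \<and> w \<le> b"
  unfolding rep_def using jn_ge1 jn_ge2 by blast

lemma rep_ex: "a \<in> C \<Longrightarrow> b \<in> C \<Longrightarrow> a \<le> b \<Longrightarrow> \<exists>w. rep w a b"
  unfolding rep_def by (metis complement_below jn_commute disj_commute)

lemma rep_z: "w \<in> C \<Longrightarrow> rep w z w"
  by (simp add: rep_def)

lemma rep_iff_dsum: "a \<in> C \<Longrightarrow> rep p a b \<longleftrightarrow> dsum b a p"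
  unfolding rep_def dsum_def using jn_commute disj_commute by metis

text \<open>A representative survives the upward transposition, since below \<open>b\<close> meeting
  with \<open>a\<close> and meeting with \<open>a \<sqinter> b\<close> agree.\<close>

lemma rep_transp:
  assumes "rep w (a \<^bold>\<sqinter> b) b" "a \<in> C" "b \<in> C" shows "rep w a (a \<^bold>\<squnion> b)"
proof -
  note w = repD[OF assms(1)]
  have "w \<^bold>\<sqinter> a = w \<^bold>\<sqinter> (a \<^bold>\<sqinter> b)" using w by (metis inf.absorb1 inf.assoc inf.commute)
  moreover have "w \<^bold>\<squnion> a = w \<^bold>\<squnion> ((a \<^bold>\<sqinter> b) \<^bold>\<squnion> a)" using assms by (simp add: jn_absorb2)
  then have "w \<^bold>\<squnion> a = (w \<^bold>\<squnion> (a \<^bold>\<sqinter> b)) \<^bold>\<squnion> a" by (simp add: jn_assoc)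
  ultimately show ?thesis using w by (simp add: rep_def disj_def jn_commute)
qed

lemma rep_persp: "rep w a b \<Longrightarrow> rep w' a b \<Longrightarrow> a \<in> C \<Longrightarrow> w \<sim> w'"
  unfolding rep_def by (auto intro: perspI[of _ _ a])

text \<open>Meeting with \<open>w\<close> is an isomorphism from \<open>[a, b]\<close> onto
  \<open>[z, w]\<close>, with inverse joining with \<open>a\<close>. Subintervals can therefore be
  represented inside \<open>w\<close>.\<close>

lemma rep_inf:
  assumes "rep w a b" "a \<in> C" "c \<in> C" "d \<in> C" "a \<le> c" "c \<le> d" "d \<le> b"
    and "rep u (w \<^bold>\<sqinter> c) (w \<^bold>\<sqinter> d)"
  shows "rep u c d"
proof -
  note w = repD[OF assms(1)] note u = repD[OF assms(8)]
  have eq: "(w \<^bold>\<sqinter> e) \<^bold>\<squnion> a = e" if "e \<in> C" "a \<le> e" "e \<le> b" for e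
  proof -
    have "e \<^bold>\<sqinter> (w \<^bold>\<squnion> a) = (e \<^bold>\<sqinter> w) \<^bold>\<squnion> a" using that assms w by (intro modular2) auto
    then show ?thesis using w that by (simp add: inf_absorb1 inf.commute[of w e])
  qed
  have "u \<le> w" using u by simp
  then have "u \<^bold>\<sqinter> c = u \<^bold>\<sqinter> (w \<^bold>\<sqinter> c)" by (metis inf.absorb1 inf.assoc)
  then have 1: "u \<^bold>\<bottom> c" using u by (simp add: disj_def)
  have "u \<^bold>\<squnion> c = u \<^bold>\<squnion> ((w \<^bold>\<sqinter> c) \<^bold>\<squnion> a)" using eq[of c] assms by auto
  also have "\<dots> = (w \<^bold>\<sqinter> d) \<^bold>\<squnion> a" using u by (simp flip: jn_assoc)
  also have "\<dots> = d" using eq[of d] assms by auto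
  finally show ?thesis using 1 u by (simp add: rep_def)
qed

lemma rep_inf_bottom:
  assumes "rep w a b" "a \<in> C" "c \<in> C" "a \<le> c" "c \<le> b"
  shows "rep (w \<^bold>\<sqinter> c) a c"
proof (rule rep_inf[OF assms(1,2,2,3) order_refl assms(4,5)])
  have "w \<^bold>\<sqinter> a = z" "w \<^bold>\<sqinter> c \<in> C" using repD[OF assms(1)] assms by (simp_all add: disj_def)
  then show "rep (w \<^bold>\<sqinter> c) (w \<^bold>\<sqinter> a) (w \<^bold>\<sqinter> c)" by (simp only: rep_z)
qed

lemma rep_dsum:
  assumes "rep w a b" "a \<in> C" "c \<in> C" "a \<le> c" "c \<le> b" "dsum w (w \<^bold>\<sqinter> c) w2"
  shows "rep w2 c b"
proof (rule rep_inf[OF assms(1)])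
  note w = repD[OF assms(1)]
  show "b \<in> C" using w assms(2) jn_closed by metis
  have "w \<^bold>\<sqinter> b = w" using w by (simp add: inf_absorb1)
  then show "rep w2 (w \<^bold>\<sqinter> c) (w \<^bold>\<sqinter> b)"
    using assms(3,6) w by (simp add: rep_iff_dsum)
qed (use assms in auto)

text \<open>The step axes, cut down to \<open>p n \<squnion> q n\<close>, lie in independent blocks
  because \<open>x\<close> and \<open>y\<close> are disjoint. Their finite joins are axes, and
  continuity keeps the limit disjoint from both sides.\<close>

lemma persp_seq_lub:
  assumes X: "chain_in C X" "X 0 = z" "seq_lub C X x" and Y: "chain_in C Y" "Y 0 = z" "seq_lub C Y y"
    and xy: "x \<^bold>\<bottom> y"
    and step: "\<And>n. \<exists>p q. rep p (X n) (X (Suc n)) \<and> rep q (Y n) (Y (Suc n)) \<and> p \<sim> q"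
  shows "x \<sim> y"
proof -
  obtain p q where pq: "\<And>n. rep (p n) (X n) (X (Suc n))" "\<And>n. rep (q n) (Y n) (Y (Suc n))" "\<And>n. p n \<sim> q n"
    using step by metis
  have "\<exists>g. axis g (p n) (q n) \<and> p n \<^bold>\<squnion> g = p n \<^bold>\<squnion> q n \<and> g \<le> p n \<^bold>\<squnion> q n \<and> g \<in> C" for n
    using persp_axis_below[OF pq(3)[of n]] by metis
  then obtain g where g: "\<And>n. axis (g n) (p n) (q n)" "\<And>n. p n \<^bold>\<squnion> g n = p n \<^bold>\<squnion> q n"
    "\<And>n. g n \<le> p n \<^bold>\<squnion> q n" "\<And>n. g n \<in> C" by metis
  \<comment> \<open>The accumulated axis: \<open>G n\<close> serves for \<open>X n\<close> and
    \<open>Y n\<close>.\<close>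
  define G where "G = rec_nat z (\<lambda>n h. h \<^bold>\<squnion> g n)"
  have G: "G 0 = z" "\<And>n. G (Suc n) = G n \<^bold>\<squnion> g n" by (simp_all add: G_def)
  have c: "x \<in> C" "y \<in> C" "X n \<in> C" "Y n \<in> C" "X n \<le> x" "Y n \<le> y" for n
    using chain_inD(1)[OF X(1)] chain_inD(1)[OF Y(1)] seq_lubD[OF X(3)] seq_lubD[OF Y(3)] by auto
  have pqc: "p n \<in> C" "q n \<in> C" "p n \<le> x" "q n \<le> y" for n
    using repD[OF pq(1)[of n]] repD[OF pq(2)[of n]] c(5)[of "Suc n"] c(6)[of "Suc n"] by auto
  \<comment> \<open>The bound \<open>G n \<le> X n \<squnion> Y n\<close> is carried along because
    it separates \<open>G n\<close> from the block of the next step.\<close>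
  have inv: "axis (G n) (X n) (Y n) \<and> X n \<^bold>\<squnion> G n = X n \<^bold>\<squnion> Y n \<and> G n \<le> X n \<^bold>\<squnion> Y n" for n
  proof (induction n)
    case 0 then show ?case using X Y G by (simp add: axis_def)
  next
    case (Suc n)
    let ?A = "X n \<^bold>\<squnion> Y n" and ?B = "p n \<^bold>\<squnion> q n"
    have GC: "G n \<in> C" using Suc by (simp add: axis_def)
    have XS: "X (Suc n) = X n \<^bold>\<squnion> p n" "Y (Suc n) = Y n \<^bold>\<squnion> q n"
      using repD[OF pq(1)[of n]] repD[OF pq(2)[of n]] by (simp_all add: jn_commute)
    have "?A \<^bold>\<sqinter> ?B = (X n \<^bold>\<sqinter> p n) \<^bold>\<squnion> (Y n \<^bold>\<sqinter> q n)"
      by (rule disj_jn_inf[of x y]) (use c pqc xy in auto)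
    then have AB: "?A \<^bold>\<bottom> ?B"
      using repD[OF pq(1)[of n]] repD[OF pq(2)[of n]] by (simp add: disj_def inf.commute)
    have "(X n \<^bold>\<squnion> p n) \<^bold>\<sqinter> (G n \<^bold>\<squnion> g n) = (X n \<^bold>\<sqinter> G n) \<^bold>\<squnion> (p n \<^bold>\<sqinter> g n)"
      "(Y n \<^bold>\<squnion> q n) \<^bold>\<sqinter> (G n \<^bold>\<squnion> g n) = (Y n \<^bold>\<sqinter> G n) \<^bold>\<squnion> (q n \<^bold>\<sqinter> g n)"
      by (rule disj_jn_inf[of ?A ?B]; use AB c pqc GC g Suc in simp)+
    then have 1: "X (Suc n) \<^bold>\<bottom> G (Suc n)" "Y (Suc n) \<^bold>\<bottom> G (Suc n)"
      using Suc g(1)[of n] by (simp_all add: XS G axis_def disj_def)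
    have eqs: "X n \<^bold>\<squnion> G n = ?A" "Y n \<^bold>\<squnion> G n = ?A" "p n \<^bold>\<squnion> g n = ?B" "q n \<^bold>\<squnion> g n = ?B"
      using Suc g(1,2)[of n] unfolding axis_def by metis+
    have "X (Suc n) \<^bold>\<squnion> G (Suc n) = (X n \<^bold>\<squnion> G n) \<^bold>\<squnion> (p n \<^bold>\<squnion> g n)"
      "Y (Suc n) \<^bold>\<squnion> G (Suc n) = (Y n \<^bold>\<squnion> G n) \<^bold>\<squnion> (q n \<^bold>\<squnion> g n)"
      "X (Suc n) \<^bold>\<squnion> Y (Suc n) = ?A \<^bold>\<squnion> ?B"
      unfolding XS G by (simp_all only: jn_ac)
    moreover have "G (Suc n) \<le> ?A \<^bold>\<squnion> ?B" "G (Suc n) \<in> C"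
      unfolding G using Suc g(3,4) GC by (auto intro!: jn_mono)
    ultimately show ?case using 1 unfolding eqs axis_def by metis
  qed
  then have Gc: "G n \<in> C" for n by (simp add: axis_def)
  then have Gch: "chain_in C G" by (intro chain_inI) (auto simp: G)
  have "G n \<le> x \<^bold>\<squnion> y" for n
    using inv[of n] jn_mono[OF c(5)[of n] c(6)[of n]] by (meson order_trans)
  then obtain h where h: "seq_lub C G h" using seq_lub_ex[OF Gch, of "x \<^bold>\<squnion> y"] c by auto
  have hC: "h \<in> C" using h seq_lubD by blast
  have "x \<^bold>\<sqinter> h \<le> z" "y \<^bold>\<sqinter> h \<le> z"
    by (rule seq_lub_inf_le[OF X(1,3) Gch h], use inv in \<open>simp_all add: axis_def disj_def\<close>)
      (rule seq_lub_inf_le[OF Y(1,3) Gch h], use inv in \<open>simp_all add: axis_def disj_def\<close>)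
  then have 1: "x \<^bold>\<bottom> h" "y \<^bold>\<bottom> h" using c hC unfolding disj_def by (auto intro: eq_zI)
  have "X n \<^bold>\<squnion> G n = Y n \<^bold>\<squnion> G n" for n using inv by (simp add: axis_def)
  then have "x \<^bold>\<squnion> h = y \<^bold>\<squnion> h"
    using seq_lub_jn[OF X(3) h] seq_lub_jn[OF Y(3) h] seq_lub_unique by simp
  with 1 c hC show ?thesis by (intro perspI)
qed

definition absorbs :: "'b set \<Rightarrow> 'b \<Rightarrow> 'b \<Rightarrow> 'b \<Rightarrow> 'b \<Rightarrow> bool"
  where "absorbs V a b c d \<longleftrightarrow>
    (\<forall>v w w'. v \<in> V \<longrightarrow> rep w a b \<longrightarrow> rep w' c d \<longrightarrow> v \<sim> w \<longrightarrow> v \<^bold>\<bottom> w' \<longrightarrow> v \<sim> w')"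

lemma absorbsD: "absorbs V a b c d \<Longrightarrow> v \<in> V \<Longrightarrow> rep w a b \<Longrightarrow> rep w' c d \<Longrightarrow> v \<sim> w \<Longrightarrow> v \<^bold>\<bottom> w' \<Longrightarrow> v \<sim> w'"
  unfolding absorbs_def by blast

text \<open>The perspectivity from \<open>w\<close> to \<open>v\<close> carries the chain in
  \<open>w\<close> to a chain in \<open>v\<close>. Each step of the latter is again a test element,
  hence the closure assumption on \<open>V\<close>, and is perspective to the matching step in
  \<open>w'\<close>; these perspectivities are joined by \<open>persp_seq_lub\<close>.\<close>

lemma absorbs_seq_lub:
  assumes down: "\<And>v v'. v \<in> V \<Longrightarrow> v' \<in> C \<Longrightarrow> v' \<le> v \<Longrightarrow> v' \<in> V"
    and Y: "chain_in C Y" "seq_lub C Y y" and Z: "chain_in C Z" "seq_lub C Z y'"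
    and step: "\<And>n. absorbs V (Y n) (Y (Suc n)) (Z n) (Z (Suc n))"
  shows "absorbs V (Y 0) y (Z 0) y'"
  unfolding absorbs_def
proof (intro allI impI)
  fix v w w' assume v: "v \<in> V" and w: "rep w (Y 0) y" and w': "rep w' (Z 0) y'"
    and vw: "v \<sim> w" and vw': "v \<^bold>\<bottom> w'"
  obtain g where g: "axis g w v" using persp_sym[OF vw] by (auto simp: persp_def)
  have c: "v \<in> C" "w \<in> C" "w' \<in> C" "g \<in> C" "v \<^bold>\<bottom> g" "w \<^bold>\<squnion> g = v \<^bold>\<squnion> g" "y \<in> C" "y' \<in> C"
    "w \<le> y" "w' \<le> y'" "\<And>n. Y n \<in> C" "\<And>n. Z n \<in> C"
    using persp_closed[OF vw] g repD[OF w] repD[OF w'] seq_lubD(1)[OF Y(2)] seq_lubD(1)[OF Z(2)]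
      chain_inD(1)[OF Y(1)] chain_inD(1)[OF Z(1)] by (simp_all add: axis_def)
  define W where "W = (\<lambda>n. w \<^bold>\<sqinter> Y n)"
  define W' where "W' = (\<lambda>n. w' \<^bold>\<sqinter> Z n)"
  \<comment> \<open>The image of \<open>W n\<close> in \<open>v\<close>, written as a meet so that
    continuity computes the join of the sequence.\<close>
  define U where "U = (\<lambda>n. v \<^bold>\<sqinter> (g \<^bold>\<squnion> W n))"
  have U_img: "U n = img g v (W n)" for n by (simp add: U_def img_def jn_commute inf.commute)
  have W: "chain_in C W" "W 0 = z" "seq_lub C W w"
    using chain_in_inf[OF Y(1) c(2)] seq_lub_inf[OF Y c(2)] w c(9)
    by (simp_all add: W_def rep_def disj_def inf_absorb1)
  have W': "chain_in C W'" "W' 0 = z" "seq_lub C W' w'"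
    using chain_in_inf[OF Z(1) c(3)] seq_lub_inf[OF Z c(3)] w' c(10)
    by (simp_all add: W'_def rep_def disj_def inf_absorb1)
  have gW: "chain_in C (\<lambda>n. g \<^bold>\<squnion> W n)" using chain_in_jn[OF W(1) c(4)] .
  have Uch: "chain_in C U" unfolding U_def using chain_in_inf[OF gW c(1)] .
  have U0: "U 0 = z" using W(2) c by (simp add: U_def disj_def)
  have Ul: "seq_lub C U v"
    using seq_lub_inf[OF gW seq_lub_jn[OF seq_lub_const[OF c(4)] W(3)] c(1)] c
    by (simp add: U_def jn_commute[of g] inf_absorb1)
  have Wle: "W n \<le> w" for n by (simp add: W_def)
  show "v \<sim> w'"
  proof (rule persp_seq_lub[OF Uch U0 Ul W' vw'])
    fix n
    have Wc: "W m \<in> C" "W' m \<in> C" for m using chain_inD(1)[OF W(1)] chain_inD(1)[OF W'(1)] by auto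
    obtain u where u: "rep u (W n) (W (Suc n))" using rep_ex[OF Wc(1) Wc(1) chain_in_step[OF W(1)]] by metis
    obtain u' where u': "rep u' (W' n) (W' (Suc n))" using rep_ex[OF Wc(2) Wc(2) chain_in_step[OF W'(1)]] by metis
    have uw: "u \<in> C" "u \<le> w" and uw': "u' \<in> C" "u' \<le> w'"
      using repD[OF u] repD[OF u'] by (simp_all add: W_def W'_def)
    have uY: "rep u (Y n) (Y (Suc n))"
      by (rule rep_inf[OF w c(11) c(11) c(11)])
        (use u chain_inD(2)[OF Y(1)] seq_lubD(2)[OF Y(2)] in \<open>simp_all add: W_def\<close>)
    have uZ: "rep u' (Z n) (Z (Suc n))"
      by (rule rep_inf[OF w' c(12) c(12) c(12)])
        (use u' chain_inD(2)[OF Z(1)] seq_lubD(2)[OF Z(2)] in \<open>simp_all add: W'_def\<close>)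
    let ?p = "img g v u"
    have p: "?p \<in> C" "u \<sim> ?p" "?p \<le> v" using img_props[OF g uw c(1,2)] by auto
    have "dsum (U (Suc n)) (U n) ?p"
      unfolding U_img using img_dsum[OF g c(2,1) _ Wle] u Wc by (simp add: rep_iff_dsum)
    then have "rep ?p (U n) (U (Suc n))" using chain_inD(1)[OF Uch] by (simp add: rep_iff_dsum)
    moreover have "?p \<sim> u'"
      using disj_mono[OF vw' p(3) uw'(2) p(1) uw'(1)] down[OF v p(1,3)] persp_sym[OF p(2)]
      by (intro absorbsD[OF step[of n] _ uY uZ])
    ultimately show "\<exists>p q. rep p (U n) (U (Suc n)) \<and> rep q (W' n) (W' (Suc n)) \<and> p \<sim> q"
      using u' by blast
  qed
qed

end

section \<open>Separating a chain into two independent chains\<close>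

context relcomp_modular_0 begin

text \<open>The two parts of each step are represented by \<open>p n\<close> and \<open>q n\<close>,
  and the \<open>p n\<close> and the \<open>q n\<close> are collected separately. All these pieces
  are independent, so \<open>P n\<close> and \<open>Q n\<close> stay disjoint with join
  \<open>Y n\<close>, and continuity gives the same for the limits.\<close>

lemma split_chain_0:
  assumes Y: "chain_in C Y" "Y 0 = z" "seq_lub C Y y"
    and c: "\<And>n. c n \<in> C" "\<And>n. Y n \<le> c n" "\<And>n. c n \<le> Y (Suc n)"
  shows "\<exists>P Q p q. chain_in C P \<and> P 0 = z \<and> seq_lub C P p \<and> chain_in C Q \<and> Q 0 = z \<and> seq_lub C Q q \<and>
    p \<^bold>\<bottom> q \<and> p \<^bold>\<squnion> q = y \<and>
    (\<forall>n. (\<exists>r. rep r (P n) (P (Suc n)) \<and> rep r (Y n) (c n)) \<and> (\<exists>r. rep r (Q n) (Q (Suc n)) \<and> rep r (c n) (Y (Suc n))))"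
proof -
  have Yc: "Y n \<in> C" "Y n \<le> y" "y \<in> C" for n using chain_inD(1)[OF Y(1)] seq_lubD[OF Y(3)] by auto
  obtain p q where p: "\<And>n. rep (p n) (Y n) (c n)" and q: "\<And>n. rep (q n) (c n) (Y (Suc n))"
    using rep_ex[OF Yc(1) c(1,2)] rep_ex[OF c(1) Yc(1) c(3)] by metis
  have pq: "p n \<in> C" "p n \<^bold>\<bottom> Y n" "p n \<^bold>\<squnion> Y n = c n" "q n \<in> C" "q n \<^bold>\<bottom> c n" "q n \<^bold>\<squnion> c n = Y (Suc n)"
    for n using p[of n] q[of n] by (simp_all add: rep_def)
  define P where "P = rec_nat z (\<lambda>n h. h \<^bold>\<squnion> p n)"
  define Q where "Q = rec_nat z (\<lambda>n h. h \<^bold>\<squnion> q n)"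
  have PQ: "P 0 = z" "\<And>n. P (Suc n) = P n \<^bold>\<squnion> p n" "Q 0 = z" "\<And>n. Q (Suc n) = Q n \<^bold>\<squnion> q n"
    by (simp_all add: P_def Q_def)
  have PC: "P n \<in> C" "Q n \<in> C" for n by (induction n) (simp_all add: PQ pq)
  have inv: "P n \<^bold>\<bottom> Q n \<and> P n \<^bold>\<squnion> Q n = Y n" for n
  proof (induction n)
    case 0 then show ?case using Y(2) by (simp add: PQ)
  next
    case (Suc n)
    have "Y n \<^bold>\<bottom> p n \<^bold>\<squnion> q n"
      using pq[of n] Yc disj_commute by (intro disj_jn) (auto simp: jn_commute)
    moreover have "P n \<le> Y n" "Q n \<le> Y n" using Suc jn_ge1 jn_ge2 by metis+
    ultimately have "(P n \<^bold>\<squnion> p n) \<^bold>\<sqinter> (Q n \<^bold>\<squnion> q n) = (P n \<^bold>\<sqinter> Q n) \<^bold>\<squnion> (p n \<^bold>\<sqinter> q n)"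
      using pq PC Yc by (intro disj_jn_inf[of "Y n" "p n \<^bold>\<squnion> q n"]) simp_all
    moreover have "q n \<^bold>\<bottom> p n" using disj_mono[OF pq(5) order_refl _ pq(4,1)] pq(3) jn_ge1 by metis
    ultimately have "P (Suc n) \<^bold>\<bottom> Q (Suc n)" using Suc by (simp add: disj_def PQ inf.commute)
    moreover have "P (Suc n) \<^bold>\<squnion> Q (Suc n) = q n \<^bold>\<squnion> (p n \<^bold>\<squnion> (P n \<^bold>\<squnion> Q n))" by (simp only: PQ jn_ac)
    ultimately show ?case using Suc pq by simp
  qed
  have PY: "P n \<le> Y n" "Q n \<le> Y n" for n using inv jn_ge1 jn_ge2 by metis+
  then have Py: "P n \<le> y" "Q n \<le> y" for n using Yc order_trans by blast+
  have Pch: "chain_in C P" "chain_in C Q" using PC by (auto intro: chain_inI simp: PQ)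
  obtain l m where l: "seq_lub C P l" and m: "seq_lub C Q m"
    using seq_lub_ex[OF Pch(1) Yc(3) Py(1)] seq_lub_ex[OF Pch(2) Yc(3) Py(2)] by blast
  have "l \<^bold>\<sqinter> m \<le> z"
    by (rule seq_lub_inf_le[OF Pch(1) l Pch(2) m]) (use inv in \<open>simp_all add: disj_def\<close>)
  then have "l \<^bold>\<bottom> m" unfolding disj_def using seq_lubD(1)[OF l] seq_lubD(1)[OF m] by (intro eq_zI) auto
  moreover have "l \<^bold>\<squnion> m = y"
    using seq_lub_unique[OF seq_lub_jn[OF l m]] Y(3) inv by simp
  moreover have "rep (p n) (P n) (P (Suc n))" for n
    using disj_mono[OF pq(2)[of n] order_refl PY(1) pq(1) PC(1)] pq(1) by (simp add: rep_def PQ jn_commute)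
  moreover have "rep (q n) (Q n) (Q (Suc n))" for n
    using disj_mono[OF pq(5)[of n] order_refl order_trans[OF PY(2) c(2)] pq(4) PC(2)] pq(4)
    by (simp add: rep_def PQ jn_commute)
  ultimately show ?thesis using Pch PQ(1,3) l m p q by blast
qed

end

context relcomp_modular begin

lemma seq_lub_above:
  assumes "o' \<le> Y 0" shows "seq_lub (above C o') Y s \<longleftrightarrow> seq_lub C Y s"
proof -
  have "o' \<le> u" if "\<forall>n. Y n \<le> u" for u using that assms order_trans by metis
  then show ?thesis by (auto simp: seq_lub_def above_iff)
qed

lemma chain_in_above:
  assumes "o' \<le> Y 0" shows "chain_in (above C o') Y \<longleftrightarrow> chain_in C Y"
proof -
  have "o' \<le> Y n" if "mono Y" for n using monoD[OF that, of 0 n] assms by simp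
  then show ?thesis unfolding chain_in_def above_iff by blast
qed

lemma above_relcomp_modular_0: "b \<in> C \<Longrightarrow> relcomp_modular_0 (above C b) jn b"
  by (intro relcomp_modular_0.intro above_relcomp_modular relcomp_modular_0_axioms.intro)
    (simp_all add: above_iff)

text \<open>This is \<open>split_chain_0\<close> over the bottom \<open>Y 0\<close>. The element
  \<open>r\<close> shows that a step of the new chain and the part of the old step it came from are
  both transposes of \<open>[Y 0, r]\<close>.\<close>

lemma split_chain:
  assumes Y: "chain_in C Y" "seq_lub C Y y"
    and c: "\<And>n. c n \<in> C" "\<And>n. Y n \<le> c n" "\<And>n. c n \<le> Y (Suc n)"
  obtains P Q p q where "chain_in C P" "P 0 = Y 0" "seq_lub C P p" "chain_in C Q" "Q 0 = Y 0" "seq_lub C Q q"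
    "p \<^bold>\<sqinter> q = Y 0" "p \<^bold>\<squnion> q = y"
    "\<And>n. \<exists>r\<in>C. r \<^bold>\<sqinter> P n = Y 0 \<and> r \<^bold>\<squnion> P n = P (Suc n) \<and> r \<^bold>\<sqinter> Y n = Y 0 \<and> r \<^bold>\<squnion> Y n = c n"
    "\<And>n. \<exists>r\<in>C. r \<^bold>\<sqinter> Q n = Y 0 \<and> r \<^bold>\<squnion> Q n = Q (Suc n) \<and> r \<^bold>\<sqinter> c n = Y 0 \<and> r \<^bold>\<squnion> c n = Y (Suc n)"
proof -
  let ?U = "above C (Y 0)"
  have Y0: "Y 0 \<in> C" using chain_inD(1)[OF Y(1)] .
  interpret up: relcomp_modular_0 ?U jn "Y 0" by (rule above_relcomp_modular_0[OF Y0])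
  have "Y 0 \<le> c n" for n using chain_inD(2)[OF Y(1), of 0 n] c(2)[of n] by simp
  then have cU: "c n \<in> ?U" for n using c(1) by (simp add: above_iff)
  have Yu: "chain_in ?U Y" "seq_lub ?U Y y" using Y by (simp_all add: chain_in_above seq_lub_above)
  obtain P Q p q where *: "chain_in ?U P \<and> P 0 = Y 0 \<and> seq_lub ?U P p \<and> chain_in ?U Q \<and> Q 0 = Y 0 \<and> seq_lub ?U Q q \<and>
    up.disj p q \<and> p \<^bold>\<squnion> q = y \<and> (\<forall>n. (\<exists>r. up.rep r (P n) (P (Suc n)) \<and> up.rep r (Y n) (c n)) \<and>
    (\<exists>r. up.rep r (Q n) (Q (Suc n)) \<and> up.rep r (c n) (Y (Suc n))))"
    using up.split_chain_0[OF Yu(1) HOL.refl Yu(2) cU c(2,3)] by (elim exE) (rule that)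
  show thesis
  proof (rule that[of P p Q q])
    show "chain_in C P" "chain_in C Q" "seq_lub C P p" "seq_lub C Q q" "P 0 = Y 0" "Q 0 = Y 0" "p \<^bold>\<squnion> q = y"
      using * chain_in_above[of "Y 0" P] chain_in_above[of "Y 0" Q] seq_lub_above[of "Y 0" P] seq_lub_above[of "Y 0" Q]
      by simp_all
    show "p \<^bold>\<sqinter> q = Y 0" using * by (simp add: up.disj_def)
    fix n
    obtain r where "up.rep r (P n) (P (Suc n))" "up.rep r (Y n) (c n)" using * by auto
    then show "\<exists>r\<in>C. r \<^bold>\<sqinter> P n = Y 0 \<and> r \<^bold>\<squnion> P n = P (Suc n) \<and> r \<^bold>\<sqinter> Y n = Y 0 \<and> r \<^bold>\<squnion> Y n = c n"
      by (auto simp: up.rep_def up.disj_def above_iff)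
    obtain r where "up.rep r (Q n) (Q (Suc n))" "up.rep r (c n) (Y (Suc n))" using * by auto
    then show "\<exists>r\<in>C. r \<^bold>\<sqinter> Q n = Y 0 \<and> r \<^bold>\<squnion> Q n = Q (Suc n) \<and> r \<^bold>\<sqinter> c n = Y 0 \<and> r \<^bold>\<squnion> c n = Y (Suc n)"
      by (auto simp: up.rep_def up.disj_def above_iff)
  qed
qed

end

section \<open>Invariants of intervals\<close>

text \<open>The values of \<open>D\<close> carry no algebraic structure; additivity and refinement
  are stated below as compatibility of equality of values with gluing and cutting intervals. One
  development thus serves block classes, kernel classes and dimension classes.\<close>

locale transp_dim = relcomp_modular C jn
  for C :: "'b::semilattice_inf set" and jn (infixl "\<^bold>\<squnion>" 65) +
  fixes D :: "'b \<Rightarrow> 'b \<Rightarrow> 'm"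
  assumes D_transp: "a \<in> C \<Longrightarrow> b \<in> C \<Longrightarrow> D a (a \<^bold>\<squnion> b) = D (a \<^bold>\<sqinter> b) b"
begin

lemma D_refl: "a \<in> C \<Longrightarrow> b \<in> C \<Longrightarrow> D a a = D b b"
  using D_transp[of a "a \<^bold>\<sqinter> b"] D_transp[of b "a \<^bold>\<sqinter> b"]
  by (simp add: jn_absorb1 inf_absorb2)

lemma D_complement: "r \<in> C \<Longrightarrow> a \<in> C \<Longrightarrow> r \<^bold>\<sqinter> a = x \<Longrightarrow> r \<^bold>\<squnion> a = b \<Longrightarrow> D a b = D x r"
  using D_transp[of a r] by (auto simp: jn_commute inf.commute)

lemma D_same_complement: "\<exists>r\<in>C. r \<^bold>\<sqinter> a = x \<and> r \<^bold>\<squnion> a = b \<and> r \<^bold>\<sqinter> c = x \<and> r \<^bold>\<squnion> c = d \<Longrightarrow>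
    a \<in> C \<Longrightarrow> c \<in> C \<Longrightarrow> D a b = D c d"
  using D_complement by metis

text \<open>Commutativity: a relative complement of the cut point exchanges the two parts.\<close>

lemma D_swap:
  assumes "a \<in> C" "b \<in> C" "c \<in> C" "a \<le> c" "c \<le> b"
  obtains c' where "c' \<in> C" "a \<le> c'" "c' \<le> b" "D a c' = D c b" "D c' b = D a c"
proof -
  obtain c' where c': "c' \<in> C" "c \<^bold>\<sqinter> c' = a" "c \<^bold>\<squnion> c' = b" using relcomp[of a b c] assms by blast
  have "D c b = D a c'" "D c' b = D a c"
    using D_complement[of c' c a b] D_complement[of c c' a b] c' assms by (simp_all add: inf.commute jn_commute)
  with c' that show thesis by (metis inf_le2 jn_ge2)
qed

text \<open>An element \<open>p\<close> cuts \<open>[x, y]\<close> at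
  \<open>x \<squnion> (p \<sqinter> y)\<close>; the two parts are transposes of the traces of the
  interval below and above \<open>p\<close>.\<close>

lemma D_modular:
  assumes "x \<in> C" "y \<in> C" "p \<in> C" "x \<le> y"
  shows "D x (x \<^bold>\<squnion> (p \<^bold>\<sqinter> y)) = D (p \<^bold>\<sqinter> x) (p \<^bold>\<sqinter> y)"
    and "D (x \<^bold>\<squnion> (p \<^bold>\<sqinter> y)) y = D (p \<^bold>\<squnion> x) (p \<^bold>\<squnion> y)"
proof -
  have "x \<^bold>\<sqinter> (p \<^bold>\<sqinter> y) = p \<^bold>\<sqinter> x" using assms(4) by (metis inf.absorb1 inf.left_commute inf.commute)
  then show "D x (x \<^bold>\<squnion> (p \<^bold>\<sqinter> y)) = D (p \<^bold>\<sqinter> x) (p \<^bold>\<sqinter> y)"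
    using D_transp[of x "p \<^bold>\<sqinter> y"] assms by simp
  have "(p \<^bold>\<squnion> x) \<^bold>\<squnion> y = p \<^bold>\<squnion> y" using assms by (simp add: jn_assoc jn_absorb2)
  moreover have "(p \<^bold>\<squnion> x) \<^bold>\<sqinter> y = x \<^bold>\<squnion> (p \<^bold>\<sqinter> y)" using modular[of x p y] assms by (simp add: jn_commute)
  ultimately show "D (x \<^bold>\<squnion> (p \<^bold>\<sqinter> y)) y = D (p \<^bold>\<squnion> x) (p \<^bold>\<squnion> y)"
    using D_transp[of "p \<^bold>\<squnion> x" y] assms by simp
qed

end

locale split_dim = transp_dim +
  assumes D_split: "a \<in> C \<Longrightarrow> b \<in> C \<Longrightarrow> c \<in> C \<Longrightarrow> a' \<in> C \<Longrightarrow> b' \<in> C \<Longrightarrow> a \<le> c \<Longrightarrow> c \<le> b \<Longrightarrow> a' \<le> b' \<Longrightarrow>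
    D a b = D a' b' \<Longrightarrow> \<exists>c'\<in>C. a' \<le> c' \<and> c' \<le> b' \<and> D a c = D a' c' \<and> D c b = D c' b'"
begin

text \<open>The element \<open>e\<close> cuts every step of \<open>Y\<close>, and
  \<open>D_split\<close> copies these cuts to points \<open>c n\<close> in the steps of
  \<open>Z\<close>. Then \<open>split_chain\<close> sorts the pieces: those matching the steps of
  \<open>e \<sqinter> Y n\<close> build up to \<open>f\<close>, the others lead from
  \<open>f\<close> to \<open>y'\<close>.\<close>

lemma D_split_chain:
  assumes Y: "chain_in C Y" "seq_lub C Y y" and Z: "chain_in C Z" "seq_lub C Z y'"
    and step: "\<And>n. D (Y n) (Y (Suc n)) = D (Z n) (Z (Suc n))"
    and e: "e \<in> C" "Y 0 \<le> e" "e \<le> y"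
  shows "\<exists>f A B P R. f \<in> C \<and> Z 0 \<le> f \<and> f \<le> y' \<and>
    chain_in C A \<and> A 0 = Y 0 \<and> seq_lub C A e \<and> chain_in C P \<and> P 0 = Z 0 \<and> seq_lub C P f \<and>
    chain_in C B \<and> B 0 = e \<and> seq_lub C B y \<and> chain_in C R \<and> R 0 = f \<and> seq_lub C R y' \<and>
    (\<forall>n. D (A n) (A (Suc n)) = D (P n) (P (Suc n)) \<and> D (B n) (B (Suc n)) = D (R n) (R (Suc n)))"
proof -
  have Yc: "Y n \<in> C" "Z n \<in> C" "Y n \<le> Y (Suc n)" "Z n \<le> Z (Suc n)" "y \<in> C" "y' \<in> C" for n
    using chain_inD(1)[OF Y(1)] chain_inD(1)[OF Z(1)] chain_in_step[OF Y(1)] chain_in_step[OF Z(1)]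
      seq_lubD(1)[OF Y(2)] seq_lubD(1)[OF Z(2)] by auto
  have "\<exists>c\<in>C. Z n \<le> c \<and> c \<le> Z (Suc n) \<and> D (Y n) (Y n \<^bold>\<squnion> (e \<^bold>\<sqinter> Y (Suc n))) = D (Z n) c \<and>
      D (Y n \<^bold>\<squnion> (e \<^bold>\<sqinter> Y (Suc n))) (Y (Suc n)) = D c (Z (Suc n))" for n
    using Yc e by (intro D_split step jn_least inf_le2) auto
  then have "\<exists>c. \<forall>n. c n \<in> C \<and> Z n \<le> c n \<and> c n \<le> Z (Suc n) \<and>
      D (e \<^bold>\<sqinter> Y n) (e \<^bold>\<sqinter> Y (Suc n)) = D (Z n) (c n) \<and> D (e \<^bold>\<squnion> Y n) (e \<^bold>\<squnion> Y (Suc n)) = D (c n) (Z (Suc n))"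
    unfolding D_modular[OF Yc(1) Yc(1) e(1) Yc(3)] Bex_def by (intro choice) simp
  then obtain c where c: "\<And>n. c n \<in> C" "\<And>n. Z n \<le> c n" "\<And>n. c n \<le> Z (Suc n)"
    and cD: "\<And>n. D (e \<^bold>\<sqinter> Y n) (e \<^bold>\<sqinter> Y (Suc n)) = D (Z n) (c n)"
      "\<And>n. D (e \<^bold>\<squnion> Y n) (e \<^bold>\<squnion> Y (Suc n)) = D (c n) (Z (Suc n))" by auto
  obtain P Q p q where P: "chain_in C P" "P 0 = Z 0" "seq_lub C P p"
    and Q: "chain_in C Q" "Q 0 = Z 0" "seq_lub C Q q"
    and pq: "p \<^bold>\<sqinter> q = Z 0" "p \<^bold>\<squnion> q = y'"
    and PD: "\<And>n. \<exists>r\<in>C. r \<^bold>\<sqinter> P n = Z 0 \<and> r \<^bold>\<squnion> P n = P (Suc n) \<and> r \<^bold>\<sqinter> Z n = Z 0 \<and> r \<^bold>\<squnion> Z n = c n"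
    and QD: "\<And>n. \<exists>r\<in>C. r \<^bold>\<sqinter> Q n = Z 0 \<and> r \<^bold>\<squnion> Q n = Q (Suc n) \<and> r \<^bold>\<sqinter> c n = Z 0 \<and> r \<^bold>\<squnion> c n = Z (Suc n)"
    by (rule split_chain[OF Z c]) (rule that)
  have PQc: "P n \<in> C" "Q n \<in> C" "Q n \<le> Q (Suc n)" "Q n \<le> q" "Z 0 \<le> Q n" for n
    using chain_inD(1)[OF P(1)] chain_inD(1)[OF Q(1)] chain_in_step[OF Q(1)] seq_lubD(2)[OF Q(3)]
      chain_inD(2)[OF Q(1), of 0 n] Q(2) by auto
  have pqc: "p \<in> C" "q \<in> C" using seq_lubD(1)[OF P(3)] seq_lubD(1)[OF Q(3)] by auto
  have 1: "D (e \<^bold>\<sqinter> Y n) (e \<^bold>\<sqinter> Y (Suc n)) = D (P n) (P (Suc n))" for n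
    using cD(1) D_same_complement[OF PD[of n] PQc(1) Yc(2)] by simp
  \<comment> \<open>Over \<open>Z 0\<close> the elements \<open>p\<close> and \<open>Q n\<close> are
    disjoint, so each step of \<open>Q\<close> is a transpose of a step of the sequence
    \<open>p \<squnion> Q n\<close>, which starts at \<open>p\<close>.\<close>
  have 2: "D (e \<^bold>\<squnion> Y n) (e \<^bold>\<squnion> Y (Suc n)) = D (p \<^bold>\<squnion> Q n) (p \<^bold>\<squnion> Q (Suc n))" for n
  proof -
    have "p \<^bold>\<sqinter> Q (Suc n) \<le> p \<^bold>\<sqinter> q" using PQc(4) by (intro inf_mono order_refl)
    moreover have "Z 0 \<le> p \<^bold>\<sqinter> Q (Suc n)" using PQc(5) inf_le1[of p q] pq(1) by simp
    ultimately have "p \<^bold>\<sqinter> Q (Suc n) = Z 0" using pq(1) by simp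
    then have "Q n \<^bold>\<squnion> (p \<^bold>\<sqinter> Q (Suc n)) = Q n" using PQc by (simp add: jn_absorb1)
    then show ?thesis
      using cD(2) D_same_complement[OF QD[of n] PQc(2) c(1)] D_modular(2)[OF PQc(2)[of n] PQc(2)[of "Suc n"] pqc(1) PQc(3)[of n]] by simp
  qed
  have "Z 0 \<le> p" "p \<le> y'" using inf_le1[of p q] jn_ge1[of p q] pq by simp_all
  moreover have "e \<^bold>\<sqinter> Y 0 = Y 0" "e \<^bold>\<squnion> Y 0 = e" "p \<^bold>\<squnion> Q 0 = p" "e \<^bold>\<sqinter> y = e" "e \<^bold>\<squnion> y = y"
    using e Q(2) pqc \<open>Z 0 \<le> p\<close> Yc by (simp_all add: inf_absorb2 inf_absorb1 jn_absorb1 jn_absorb2)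
  moreover have "seq_lub C (\<lambda>n. p \<^bold>\<squnion> Q n) y'" "seq_lub C (\<lambda>n. e \<^bold>\<squnion> Y n) (e \<^bold>\<squnion> y)"
    using seq_lub_jn[OF seq_lub_const[OF pqc(1)] Q(3)] pq(2) seq_lub_jn[OF seq_lub_const[OF e(1)] Y(2)] by simp_all
  ultimately show ?thesis using pqc P 1 2 chain_in_inf[OF Y(1) e(1)] chain_in_jn[OF Y(1) e(1)]
    chain_in_jn[OF Q(1) pqc(1)] seq_lub_inf[OF Y e(1)]
    by (intro exI[of _ p] exI[of _ "\<lambda>n. e \<^bold>\<sqinter> Y n"] exI[of _ "\<lambda>n. e \<^bold>\<squnion> Y n"] exI[of _ P]
      exI[of _ "\<lambda>n. p \<^bold>\<squnion> Q n"]) simp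
qed

end

locale add_dim = transp_dim +
  assumes D_add: "a \<in> C \<Longrightarrow> b \<in> C \<Longrightarrow> c \<in> C \<Longrightarrow> a' \<in> C \<Longrightarrow> b' \<in> C \<Longrightarrow> c' \<in> C \<Longrightarrow>
    a \<le> b \<Longrightarrow> b \<le> c \<Longrightarrow> a' \<le> b' \<Longrightarrow> b' \<le> c' \<Longrightarrow> D a b = D a' b' \<Longrightarrow> D b c = D b' c' \<Longrightarrow> D a c = D a' c'"
begin

lemma D_add_disj:
  assumes "x \<in> C" "y \<in> C" "x' \<in> C" "y' \<in> C" "x \<^bold>\<sqinter> y = a" "x' \<^bold>\<sqinter> y' = a'" "D a x = D a' x'" "D a y = D a' y'"
  shows "D a (x \<^bold>\<squnion> y) = D a' (x' \<^bold>\<squnion> y')"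
proof (rule D_add[of a x _ a' x'])
  show "D x (x \<^bold>\<squnion> y) = D x' (x' \<^bold>\<squnion> y')"
    using D_complement[of y x a] D_complement[of y' x' a'] assms by (simp add: inf.commute jn_commute)
qed (use assms inf_le1[of x y] inf_le1[of x' y'] in auto)

end

locale cont_dim = transp_dim +
  assumes D_seq_lub: "chain_in C Y \<Longrightarrow> seq_lub C Y y \<Longrightarrow> chain_in C Z \<Longrightarrow> seq_lub C Z y' \<Longrightarrow>
    (\<And>n. D (Y n) (Y (Suc n)) = D (Z n) (Z (Suc n))) \<Longrightarrow> D (Y 0) y = D (Z 0) y'"

text \<open>A chain of two steps is continued by its last term; the degenerate steps so added have
  equal values by \<open>D_refl\<close>.\<close>

sublocale cont_dim \<subseteq> add_dim
proof
  fix a b c a' b' c' assume A: "a \<in> C" "b \<in> C" "c \<in> C" "a' \<in> C" "b' \<in> C" "c' \<in> C"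
    "a \<le> b" "b \<le> c" "a' \<le> b'" "b' \<le> c'" "D a b = D a' b'" "D b c = D b' c'"
  define Y where "Y a b c n = (if n = 0 then a else if n = 1 then b else c)" for a b c :: 'a and n :: nat
  have Y: "chain_in C (Y a b c)" "seq_lub C (Y a b c) c" if "a \<in> C" "b \<in> C" "c \<in> C" "a \<le> b" "b \<le> c" for a b c
    using that by (auto intro!: chain_inI seq_lubI simp: Y_def dest: spec[of _ 2] intro: order_trans)
  show "D a c = D a' c'"
    using D_seq_lub[OF Y[OF A(1-3,7,8)] Y[OF A(4-6,9,10)]] A(11,12) D_refl[OF A(3,6)]
    by (simp add: Y_def)
qed

locale countable_dim = split_dim C jn D + cont_dim C jn D
  for C :: "'b::semilattice_inf set" and jn (infixl "\<^bold>\<squnion>" 65) and D :: "'b \<Rightarrow> 'b \<Rightarrow> 'm"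

section \<open>Countable sums and cancellation\<close>

text \<open>\<open>P x y v\<close> stands for \<open>x + y = v\<close> and \<open>S f v\<close> for \<open>\<Sum>\<^sub>n f n = v\<close>, both including definedness.\<close>

locale countable_sums =
  fixes P :: "'m \<Rightarrow> 'm \<Rightarrow> 'm \<Rightarrow> bool" and S :: "(nat \<Rightarrow> 'm) \<Rightarrow> 'm \<Rightarrow> bool"
  assumes P_unique: "P x y v \<Longrightarrow> P x y v' \<Longrightarrow> v = v'"
    and P_commute: "P x y v \<Longrightarrow> P y x v"
    and P_assoc: "P x y u \<Longrightarrow> P u w v \<Longrightarrow> \<exists>t. P y w t \<and> P x t v"
    and P_refine: "P a b e \<Longrightarrow> P c d e \<Longrightarrow> \<exists>p q r s. P p q a \<and> P r s b \<and> P p r c \<and> P q s d"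
    and S_unique: "S f v \<Longrightarrow> S f v' \<Longrightarrow> v = v'"
    and S_Suc: "S f v \<Longrightarrow> \<exists>t. S (\<lambda>n. f (Suc n)) t \<and> P (f 0) t v"
    and S_P: "(\<And>n. P (f n) (g n) (h n)) \<Longrightarrow> S h v \<Longrightarrow> \<exists>s t. S f s \<and> S g t \<and> P s t v"
    and S_refine: "P a b v \<Longrightarrow> S h v \<Longrightarrow> \<exists>f g. S f a \<and> S g b \<and> (\<forall>n. P (f n) (g n) (h n))"
    and S_remainder: "(\<And>n. P (g n) (f (Suc n)) (f n)) \<Longrightarrow> \<exists>a. \<forall>n. \<exists>s. S (\<lambda>k. g (n + k)) s \<and> P a s (f n)"
begin

text \<open>Tarski's cancellation theorem: the refinement matrices of \<open>c n + t n = c n + s n\<close> are iterated, and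
  the remainders of the resulting sequences yield the summands that \<open>c\<close> absorbs.\<close>

theorem cancellation:
  assumes "P c a e" "P c b e"
  obtains r s t \<sigma> x \<tau> y where "P r s a" "P r t b" "S (\<lambda>_. s) \<sigma>" "P \<sigma> x c" "S (\<lambda>_. t) \<tau>" "P \<tau> y c"
proof -
  \<comment> \<open>In a state \<open>(c, s, t, r)\<close> the sums of \<open>c\<close> with
    \<open>s\<close> and with \<open>t\<close> agree; \<open>r\<close> is the part split off both
    summands by the step that led there.\<close>
  define ok where "ok = (\<lambda>(c, s, t, r :: 'm). \<exists>e. P c t e \<and> P c s e)"
  define step where "step = (\<lambda>(c, s, t, r :: 'm) (c', s', t', r').
    P s' c' c \<and> P t' c' c \<and> P r' s' s \<and> P r' t' t)"
  have ex: "\<exists>w'. ok w' \<and> step w w'" if "ok w" for w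
  proof -
    obtain c s t r where w: "w = (c, s, t, r)" by (cases w)
    then obtain e where "P c t e" "P c s e" using \<open>ok w\<close> by (auto simp: ok_def)
    \<comment> \<open>The refinement matrix of the two sums: \<open>p\<close> becomes the new common
      part, \<open>q\<close> and \<open>r'\<close> are the new summands, each completing
      \<open>p\<close> to \<open>c\<close>, and \<open>s'\<close> is split off.\<close>
    then obtain p q r' s' where *: "P p q c" "P r' s' t" "P p r' c" "P q s' s" using P_refine by metis
    then have "step w (p, q, r', s')" unfolding step_def w by (simp add: P_commute)
    moreover have "ok (p, q, r', s')" using * unfolding ok_def by auto
    ultimately show ?thesis by blast
  qed
  \<comment> \<open>The last component of the initial state is a placeholder; \<open>rr\<close>
    reads that component one index later.\<close>
  obtain F where F: "F 0 = (c, a, b, a)" "\<And>n. ok (F n) \<and> step (F n) (F (Suc n))"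
  proof -
    have "ok (c, a, b, a)" using assms by (auto simp: ok_def)
    then show thesis
      using dependent_nat_choice[of "\<lambda>n w. ok w \<and> (n = 0 \<longrightarrow> w = (c, a, b, a))" "\<lambda>n. step"] ex that
      by (metis nat.distinct(1))
  qed
  define cc where "cc n = fst (F n)" for n
  define ss where "ss n = fst (snd (F n))" for n
  define tt where "tt n = fst (snd (snd (F n)))" for n
  define rr where "rr n = snd (snd (snd (F (Suc n))))" for n
  have st: "P (ss (Suc n)) (cc (Suc n)) (cc n)" "P (tt (Suc n)) (cc (Suc n)) (cc n)"
    "P (rr n) (ss (Suc n)) (ss n)" "P (rr n) (tt (Suc n)) (tt n)" for n
    using F(2)[of n] unfolding step_def cc_def ss_def tt_def rr_def by (auto split: prod.splits)
  have 0: "cc 0 = c" "ss 0 = a" "tt 0 = b" using F(1) by (simp_all add: cc_def ss_def tt_def)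
  \<comment> \<open>Both sequences lose the same terms \<open>rr n\<close>, so their remainders
    \<open>s\<close> and \<open>t\<close> are taken against one and the same tail sum.\<close>
  obtain s where s: "\<And>n. \<exists>u. S (\<lambda>k. rr (n + k)) u \<and> P s u (ss n)" using S_remainder[of rr ss, OF st(3)] by blast
  obtain t where t: "\<And>n. \<exists>u. S (\<lambda>k. rr (n + k)) u \<and> P t u (tt n)" using S_remainder[of rr tt, OF st(4)] by blast
  obtain \<rho> where \<rho>: "\<And>n. S (\<lambda>k. rr (n + k)) (\<rho> n)" "\<And>n. P s (\<rho> n) (ss n)" using s by metis
  have \<rho>t: "P t (\<rho> n) (tt n)" for n using t \<rho>(1) S_unique by metis
  \<comment> \<open>The remainder postulate for \<open>cc\<close> exhibits the sum of all
    \<open>ss (Suc k)\<close> inside \<open>c\<close>, and each of these terms contains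
    \<open>s\<close>.\<close>
  have absorb: "\<exists>\<sigma> x. S (\<lambda>_. s) \<sigma> \<and> P \<sigma> x c"
    if rem: "\<And>n. P (ss (Suc n)) (cc (Suc n)) (cc n)" and ss: "\<And>n. P s (\<rho> n) (ss n)" for ss s
  proof -
    obtain x \<Sigma> where "S (\<lambda>k. ss (Suc (0 + k))) \<Sigma>" "P x \<Sigma> (cc 0)"
      using S_remainder[of "\<lambda>n. ss (Suc n)" cc, OF rem] by metis
    moreover from this(1) obtain \<sigma> u where "S (\<lambda>_. s) \<sigma>" "P \<sigma> u \<Sigma>"

      using S_P[of "\<lambda>_. s" "\<lambda>k. \<rho> (Suc k)" "\<lambda>k. ss (Suc k)" \<Sigma>, OF ss] by auto
    ultimately show ?thesis unfolding 0 using P_assoc P_commute by meson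
  qed
  show thesis
    using that[OF P_commute[OF \<rho>(2)[of 0, unfolded 0]] P_commute[OF \<rho>t[of 0, unfolded 0]]]
      absorb[OF st(1) \<rho>(2)] absorb[OF st(2) \<rho>t] by metis
qed

end

section \<open>Partial sums of interval values\<close>

context countable_dim begin

text \<open>A relation, because two values need not be realized by adjacent intervals.\<close>

definition plus_rel :: "'m \<Rightarrow> 'm \<Rightarrow> 'm \<Rightarrow> bool"
  where "plus_rel \<alpha> \<beta> \<gamma> \<longleftrightarrow>
    (\<exists>a\<in>C. \<exists>b\<in>C. \<exists>c\<in>C. a \<le> b \<and> b \<le> c \<and> \<alpha> = D a b \<and> \<beta> = D b c \<and> \<gamma> = D a c)"

definition sum_rel :: "(nat \<Rightarrow> 'm) \<Rightarrow> 'm \<Rightarrow> bool"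
  where "sum_rel f \<gamma> \<longleftrightarrow>
    (\<exists>Y y. chain_in C Y \<and> seq_lub C Y y \<and> (\<forall>n. f n = D (Y n) (Y (Suc n))) \<and> \<gamma> = D (Y 0) y)"

lemma plus_relI: "a \<in> C \<Longrightarrow> b \<in> C \<Longrightarrow> c \<in> C \<Longrightarrow> a \<le> b \<Longrightarrow> b \<le> c \<Longrightarrow> plus_rel (D a b) (D b c) (D a c)"
  unfolding plus_rel_def by blast

lemma sum_relI: "chain_in C Y \<Longrightarrow> seq_lub C Y y \<Longrightarrow> sum_rel (\<lambda>n. D (Y n) (Y (Suc n))) (D (Y 0) y)"
  unfolding sum_rel_def by blast

lemma plus_relE:
  assumes "plus_rel \<alpha> \<beta> \<gamma>"
  obtains a b c where "a \<in> C" "b \<in> C" "c \<in> C" "a \<le> b" "b \<le> c" "\<alpha> = D a b" "\<beta> = D b c" "\<gamma> = D a c"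
  using assms unfolding plus_rel_def by (elim bexE conjE) (rule that)

lemma sum_relE:
  assumes "sum_rel f \<gamma>"
  obtains Y y where "chain_in C Y" "seq_lub C Y y" "\<And>n. f n = D (Y n) (Y (Suc n))" "\<gamma> = D (Y 0) y"
  using assms unfolding sum_rel_def by auto

text \<open>Any interval realizing the total will do, since \<open>D_split\<close> copies the cut
  into it.\<close>

lemma plus_rel_realize:
  assumes "plus_rel \<alpha> \<beta> (D a b)" "a \<in> C" "b \<in> C" "a \<le> b"
  obtains c where "c \<in> C" "a \<le> c" "c \<le> b" "\<alpha> = D a c" "\<beta> = D c b"
proof -
  obtain a' c' b' where *: "a' \<in> C" "c' \<in> C" "b' \<in> C" "a' \<le> c'" "c' \<le> b'"
    "\<alpha> = D a' c'" "\<beta> = D c' b'" "D a b = D a' b'"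
    by (rule plus_relE[OF assms(1)]) (rule that)
  then show thesis using D_split[OF *(1,3,2) assms(2,3) *(4,5) assms(4) *(8)[symmetric]] that by auto
qed

text \<open>Repeated realization inside \<open>[Y n, b]\<close>. Keeping the upper end fixed makes
  the chain bounded, which later provides its join.\<close>

lemma plus_rel_realize_chain:
  assumes step: "\<And>n. plus_rel (g n) (f (Suc n)) (f n)" and "a \<in> C" "b \<in> C" "a \<le> b" "f 0 = D a b"
  obtains Y where "chain_in C Y" "Y 0 = a" "\<And>n. Y n \<le> b" "\<And>n. D (Y n) (Y (Suc n)) = g n"
    "\<And>n. D (Y n) b = f n"
proof -
  have "\<exists>Y. \<forall>n. (Y n \<in> C \<and> Y n \<le> b \<and> D (Y n) b = f n \<and> (n = 0 \<longrightarrow> Y n = a)) \<and>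
      Y n \<le> Y (Suc n) \<and> D (Y n) (Y (Suc n)) = g n"
  proof (rule dependent_nat_choice)
    show "\<exists>x. x \<in> C \<and> x \<le> b \<and> D x b = f 0 \<and> (0 = 0 \<longrightarrow> x = a)" using assms by auto
    fix x n assume x: "x \<in> C \<and> x \<le> b \<and> D x b = f n \<and> (n = 0 \<longrightarrow> x = a)"
    then have "plus_rel (g n) (f (Suc n)) (D x b)" using step[of n] by simp
    then obtain c where "c \<in> C" "x \<le> c" "c \<le> b" "g n = D x c" "f (Suc n) = D c b"
      by (rule plus_rel_realize) (use x assms(3) that in auto)
    then show "\<exists>y. (y \<in> C \<and> y \<le> b \<and> D y b = f (Suc n) \<and> (Suc n = 0 \<longrightarrow> y = a)) \<and> x \<le> y \<and> D x y = g n"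
      by auto
  qed
  then obtain Y where Y: "\<And>n. Y n \<in> C" "\<And>n. Y n \<le> b" "\<And>n. D (Y n) b = f n" "Y 0 = a"
    "\<And>n. Y n \<le> Y (Suc n)" "\<And>n. D (Y n) (Y (Suc n)) = g n" by auto
  show thesis by (rule that[of Y]) (use Y in \<open>auto intro: chain_inI\<close>)
qed

lemma plus_rel_unique:
  assumes "plus_rel \<alpha> \<beta> \<gamma>" "plus_rel \<alpha> \<beta> \<gamma>'" shows "\<gamma> = \<gamma>'"
proof -
  obtain a b c where 1: "a \<in> C" "b \<in> C" "c \<in> C" "a \<le> b" "b \<le> c" "\<alpha> = D a b" "\<beta> = D b c" "\<gamma> = D a c"
    by (rule plus_relE[OF assms(1)]) (rule that)
  obtain a' b' c' where 2: "a' \<in> C" "b' \<in> C" "c' \<in> C" "a' \<le> b'" "b' \<le> c'" "\<alpha> = D a' b'" "\<beta> = D b' c'" "\<gamma>' = D a' c'"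
    by (rule plus_relE[OF assms(2)]) (rule that)
  show ?thesis using D_add[OF 1(1-3) 2(1-3) 1(4,5) 2(4,5)] 1 2 by simp
qed

lemma sum_rel_unique:
  assumes "sum_rel f \<gamma>" "sum_rel f \<gamma>'" shows "\<gamma> = \<gamma>'"
proof -
  obtain Y y where Y: "chain_in C Y" "seq_lub C Y y" "\<And>n. f n = D (Y n) (Y (Suc n))" "\<gamma> = D (Y 0) y"
    by (rule sum_relE[OF assms(1)]) (rule that)
  obtain Z y' where Z: "chain_in C Z" "seq_lub C Z y'" "\<And>n. f n = D (Z n) (Z (Suc n))" "\<gamma>' = D (Z 0) y'"
    by (rule sum_relE[OF assms(2)]) (rule that)
  show ?thesis using D_seq_lub[OF Y(1,2) Z(1,2)] Y(3,4) Z(3,4) by simp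
qed

lemma plus_rel_commute:
  assumes "plus_rel \<alpha> \<beta> \<gamma>" shows "plus_rel \<beta> \<alpha> \<gamma>"
proof -
  obtain a b c where *: "a \<in> C" "b \<in> C" "c \<in> C" "a \<le> b" "b \<le> c" "\<alpha> = D a b" "\<beta> = D b c" "\<gamma> = D a c"
    by (rule plus_relE[OF assms]) (rule that)
  obtain b' where "b' \<in> C" "a \<le> b'" "b' \<le> c" "D a b' = D b c" "D b' c = D a b"
    by (rule D_swap[OF *(1,3,2,4,5)]) (rule that)
  then show ?thesis using plus_relI[of a b' c] * by simp
qed

lemma plus_rel_assoc:
  assumes "plus_rel \<alpha> \<beta> \<mu>" "plus_rel \<mu> \<delta> \<gamma>" shows "\<exists>\<tau>. plus_rel \<beta> \<delta> \<tau> \<and> plus_rel \<alpha> \<tau> \<gamma>"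
proof -
  obtain a c d where 1: "a \<in> C" "c \<in> C" "d \<in> C" "a \<le> c" "c \<le> d" "\<mu> = D a c" "\<delta> = D c d" "\<gamma> = D a d"
    by (rule plus_relE[OF assms(2)]) (rule that)
  obtain b where 2: "b \<in> C" "a \<le> b" "b \<le> c" "\<alpha> = D a b" "\<beta> = D b c"
    by (rule plus_rel_realize[OF assms(1)[unfolded 1(6)] 1(1,2,4)]) (rule that)
  have "b \<le> d" using 2(3) 1(5) by (rule order_trans)
  then have "plus_rel \<beta> \<delta> (D b d)" "plus_rel \<alpha> (D b d) \<gamma>" using plus_relI[of b c d] plus_relI[of a b d] 1 2 by simp_all
  then show ?thesis by blast
qed

text \<open>Both decompositions are realized by cut points \<open>j\<close> and \<open>l\<close> of
  one interval. The diagonal entries are the parts below \<open>j \<sqinter> l\<close> and above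
  \<open>j \<squnion> l\<close>; each of the other two occurs twice, as a pair of
  transposes.\<close>

lemma plus_rel_refine:
  assumes "plus_rel \<alpha> \<beta> \<epsilon>" "plus_rel \<gamma> \<delta> \<epsilon>"
  shows "\<exists>p q r s. plus_rel p q \<alpha> \<and> plus_rel r s \<beta> \<and> plus_rel p r \<gamma> \<and> plus_rel q s \<delta>"
proof -
  obtain i j k where 1: "i \<in> C" "j \<in> C" "k \<in> C" "i \<le> j" "j \<le> k" "\<alpha> = D i j" "\<beta> = D j k" "\<epsilon> = D i k"
    by (rule plus_relE[OF assms(1)]) (rule that)
  have "i \<le> k" using 1(4,5) by (rule order_trans)
  then obtain l where 2: "l \<in> C" "i \<le> l" "l \<le> k" "\<gamma> = D i l" "\<delta> = D l k"
    by (rule plus_rel_realize[OF assms(2)[unfolded 1(8)] 1(1,3)]) (rule that)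
  let ?m = "j \<^bold>\<sqinter> l" and ?n = "j \<^bold>\<squnion> l"
  have mn: "?m \<in> C" "?n \<in> C" "i \<le> ?m" "?n \<le> k" using 1 2 by (simp_all add: jn_least)
  have "D ?m l = D j ?n" "D ?m j = D l ?n"
    using D_transp[of j l] D_transp[of l j] 1 2 by (simp_all add: jn_commute inf.commute)
  moreover have "plus_rel (D i ?m) (D ?m j) \<alpha>" "plus_rel (D j ?n) (D ?n k) \<beta>"
    "plus_rel (D i ?m) (D ?m l) \<gamma>" "plus_rel (D l ?n) (D ?n k) \<delta>"
    unfolding 1(6,7) 2(4,5) using 1(1-5) 2(1-3) mn by (intro plus_relI; simp)+
  ultimately show ?thesis by auto
qed

lemma sum_rel_Suc:
  assumes "sum_rel f \<gamma>" shows "\<exists>\<tau>. sum_rel (\<lambda>n. f (Suc n)) \<tau> \<and> plus_rel (f 0) \<tau> \<gamma>"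
proof -
  obtain Y y where Y: "chain_in C Y" "seq_lub C Y y" "\<And>n. f n = D (Y n) (Y (Suc n))" "\<gamma> = D (Y 0) y"
    by (rule sum_relE[OF assms]) (rule that)
  have "sum_rel (\<lambda>n. f (Suc n)) (D (Y (1 + 0)) y)"
    using sum_relI[OF chain_in_shift[OF Y(1), of 1] seq_lub_shift[OF Y(1,2), of 1]] Y(3) by simp
  moreover have "plus_rel (f 0) (D (Y 1) y) \<gamma>"
    using plus_relI[of "Y 0" "Y 1" y] Y chain_inD(1)[OF Y(1)] chain_in_step[OF Y(1), of 0] seq_lubD[OF Y(2)]
    by simp
  ultimately show ?thesis by auto
qed

text \<open>Each decomposition is realized inside the corresponding step of the chain for
  \<open>h\<close>, and \<open>split_chain\<close> collects the two families of pieces into chains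
  of their own.\<close>

lemma sum_rel_plus_rel:
  assumes "\<And>n. plus_rel (f n) (g n) (h n)" "sum_rel h \<gamma>"
  shows "\<exists>\<sigma> \<tau>. sum_rel f \<sigma> \<and> sum_rel g \<tau> \<and> plus_rel \<sigma> \<tau> \<gamma>"
proof -
  obtain Y y where Y: "chain_in C Y" "seq_lub C Y y" "\<And>n. h n = D (Y n) (Y (Suc n))" "\<gamma> = D (Y 0) y"
    by (rule sum_relE[OF assms(2)]) (rule that)
  have "\<exists>c. c \<in> C \<and> Y n \<le> c \<and> c \<le> Y (Suc n) \<and> f n = D (Y n) c \<and> g n = D c (Y (Suc n))" for n
    by (rule plus_rel_realize[OF assms(1)[of n, unfolded Y(3)] chain_inD(1)[OF Y(1)] chain_inD(1)[OF Y(1)]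
      chain_in_step[OF Y(1)]]) blast
  then have "\<exists>c. \<forall>n. c n \<in> C \<and> Y n \<le> c n \<and> c n \<le> Y (Suc n) \<and> f n = D (Y n) (c n) \<and> g n = D (c n) (Y (Suc n))"
    by (intro choice) simp
  then obtain c where c: "\<And>n. c n \<in> C" "\<And>n. Y n \<le> c n" "\<And>n. c n \<le> Y (Suc n)"
    and cD: "\<And>n. f n = D (Y n) (c n)" "\<And>n. g n = D (c n) (Y (Suc n))" by auto
  obtain P Q p q where P: "chain_in C P" "P 0 = Y 0" "seq_lub C P p"
    and Q: "chain_in C Q" "Q 0 = Y 0" "seq_lub C Q q"
    and pq: "p \<^bold>\<sqinter> q = Y 0" "p \<^bold>\<squnion> q = y"
    and PD: "\<And>n. \<exists>r\<in>C. r \<^bold>\<sqinter> P n = Y 0 \<and> r \<^bold>\<squnion> P n = P (Suc n) \<and> r \<^bold>\<sqinter> Y n = Y 0 \<and> r \<^bold>\<squnion> Y n = c n"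
    and QD: "\<And>n. \<exists>r\<in>C. r \<^bold>\<sqinter> Q n = Y 0 \<and> r \<^bold>\<squnion> Q n = Q (Suc n) \<and> r \<^bold>\<sqinter> c n = Y 0 \<and> r \<^bold>\<squnion> c n = Y (Suc n)"
    by (rule split_chain[OF Y(1,2) c]) (rule that)
  have "f n = D (P n) (P (Suc n))" "g n = D (Q n) (Q (Suc n))" for n
    using D_same_complement[OF PD[of n] chain_inD(1)[OF P(1)] chain_inD(1)[OF Y(1)]]
      D_same_complement[OF QD[of n] chain_inD(1)[OF Q(1)] c(1)] cD by simp_all
  then have "f = (\<lambda>n. D (P n) (P (Suc n)))" "g = (\<lambda>n. D (Q n) (Q (Suc n)))" by auto
  then have "sum_rel f (D (Y 0) p)" "sum_rel g (D (Y 0) q)"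
    using sum_relI[OF P(1,3)] sum_relI[OF Q(1,3)] P(2) Q(2) by simp_all
  moreover have "plus_rel (D (Y 0) p) (D (Y 0) q) \<gamma>"
  proof -
    have c: "p \<in> C" "q \<in> C" "Y 0 \<in> C" "Y 0 \<le> p" "p \<le> y"
      using seq_lubD(1)[OF P(3)] seq_lubD(1)[OF Q(3)] chain_inD(1)[OF Y(1)] inf_le1[of p q] jn_ge1[of p q] pq
      by simp_all
    moreover have "D p y = D (Y 0) q"
      using D_complement[of q p "Y 0" y] c pq by (simp add: inf.commute jn_commute)
    ultimately show ?thesis using plus_relI[of "Y 0" p y] Y seq_lubD(1)[OF Y(2)] by simp
  qed
  ultimately show ?thesis by blast
qed

text \<open>A cut point \<open>p\<close> of the total splits every step by \<open>D_modular\<close>,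
  and continuity makes the traces \<open>p \<sqinter> Y n\<close> have join
  \<open>p\<close>.\<close>

lemma sum_rel_refine:
  assumes "plus_rel \<alpha> \<beta> \<gamma>" "sum_rel h \<gamma>"
  shows "\<exists>f g. sum_rel f \<alpha> \<and> sum_rel g \<beta> \<and> (\<forall>n. plus_rel (f n) (g n) (h n))"
proof -
  obtain Y y where Y: "chain_in C Y" "seq_lub C Y y" "\<And>n. h n = D (Y n) (Y (Suc n))" "\<gamma> = D (Y 0) y"
    by (rule sum_relE[OF assms(2)]) (rule that)
  have Yc: "Y n \<in> C" "y \<in> C" "Y n \<le> Y (Suc n)" "Y n \<le> y" for n
    using chain_inD(1)[OF Y(1)] seq_lubD[OF Y(2)] chain_in_step[OF Y(1)] by auto
  obtain p where p: "p \<in> C" "Y 0 \<le> p" "p \<le> y" "\<alpha> = D (Y 0) p" "\<beta> = D p y"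
    by (rule plus_rel_realize[OF assms(1)[unfolded Y(4)] Yc(1,2,4)]) (rule that)
  have "sum_rel (\<lambda>n. D (p \<^bold>\<sqinter> Y n) (p \<^bold>\<sqinter> Y (Suc n))) \<alpha>"
    using sum_relI[OF chain_in_inf[OF Y(1) p(1)] seq_lub_inf[OF Y(1,2) p(1)]] p
    by (simp add: inf_absorb1 inf_absorb2)
  moreover have "sum_rel (\<lambda>n. D (p \<^bold>\<squnion> Y n) (p \<^bold>\<squnion> Y (Suc n))) \<beta>"
    using sum_relI[OF chain_in_jn[OF Y(1) p(1)] seq_lub_jn[OF seq_lub_const[OF p(1)] Y(2)]] p Yc
    by (simp add: jn_absorb1 jn_absorb2)
  moreover have "plus_rel (D (p \<^bold>\<sqinter> Y n) (p \<^bold>\<sqinter> Y (Suc n))) (D (p \<^bold>\<squnion> Y n) (p \<^bold>\<squnion> Y (Suc n))) (h n)" for n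
    unfolding Y(3)[of n] D_modular[OF Yc(1) Yc(1) p(1) Yc(3), symmetric]
    using Yc p by (intro plus_relI jn_least) auto
  ultimately show ?thesis by blast
qed

text \<open>The realized chain is bounded by \<open>b\<close>, so it has a join \<open>y\<close>,
  and \<open>[y, b]\<close> is the remainder common to all tails.\<close>

lemma sum_rel_remainder:
  assumes "\<And>n. plus_rel (g n) (f (Suc n)) (f n)"
  shows "\<exists>\<alpha>. \<forall>n. \<exists>\<sigma>. sum_rel (\<lambda>k. g (n + k)) \<sigma> \<and> plus_rel \<alpha> \<sigma> (f n)"
proof -
  obtain a b where ab: "a \<in> C" "b \<in> C" "a \<le> b" "f 0 = D a b"
    by (rule plus_relE[OF assms[of 0]]) (rule that, auto)
  obtain Y where Y: "chain_in C Y" "\<And>n. Y n \<le> b" "\<And>n. D (Y n) (Y (Suc n)) = g n" "\<And>n. D (Y n) b = f n"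
    by (rule plus_rel_realize_chain[of g f, OF assms ab]) (rule that)
  obtain y where y: "seq_lub C Y y" using seq_lub_ex[OF Y(1) ab(2) Y(2)] by blast
  have yb: "y \<le> b" "y \<in> C" using seq_lub_least[OF y ab(2) Y(2)] seq_lubD(1)[OF y] .
  have "sum_rel (\<lambda>k. g (n + k)) (D (Y n) y) \<and> plus_rel (D y b) (D (Y n) y) (f n)" for n
  proof
    show "sum_rel (\<lambda>k. g (n + k)) (D (Y n) y)"
      using sum_relI[OF chain_in_shift[OF Y(1), of n] seq_lub_shift[OF Y(1) y, of n]] Y(3) by simp
    show "plus_rel (D y b) (D (Y n) y) (f n)"
      using plus_relI[of "Y n" y b] chain_inD(1)[OF Y(1)] yb ab(2) seq_lubD(2)[OF y] Y(4)
      by (simp add: plus_rel_commute)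
  qed
  then show ?thesis by blast
qed

sublocale countable_sums plus_rel sum_rel
proof
  show "\<exists>a. \<forall>n. \<exists>s. sum_rel (\<lambda>k. g (n + k)) s \<and> plus_rel a s (f n)"
    if "\<And>n. plus_rel (g n) (f (Suc n)) (f n)" for f g using that by (rule sum_rel_remainder)
  show "\<exists>s t. sum_rel f s \<and> sum_rel g t \<and> plus_rel s t v"
    if "\<And>n. plus_rel (f n) (g n) (h n)" "sum_rel h v" for f g h v using that by (rule sum_rel_plus_rel)
qed (fact plus_rel_unique plus_rel_commute plus_rel_assoc plus_rel_refine
    sum_rel_unique sum_rel_Suc sum_rel_refine)+

lemma plus_rel_disj:
  assumes "x \<in> C" "y \<in> C" "x \<^bold>\<sqinter> y = a" shows "plus_rel (D a x) (D a y) (D a (x \<^bold>\<squnion> y))"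
proof -
  have "D x (x \<^bold>\<squnion> y) = D a y" using D_complement[of y x a] assms by (simp add: inf.commute jn_commute)
  then show ?thesis using plus_relI[of a x "x \<^bold>\<squnion> y"] assms by auto
qed

lemma plus_rel_realize_disj:
  assumes "plus_rel \<alpha> \<beta> (D a b)" "a \<in> C" "b \<in> C" "a \<le> b"
  obtains x y where "x \<in> C" "y \<in> C" "x \<^bold>\<sqinter> y = a" "x \<^bold>\<squnion> y = b" "D a x = \<alpha>" "D a y = \<beta>"
proof -
  obtain c where c: "c \<in> C" "a \<le> c" "c \<le> b" "\<alpha> = D a c" "\<beta> = D c b"
    by (rule plus_rel_realize[OF assms]) (rule that)
  obtain y where y: "y \<in> C" "c \<^bold>\<sqinter> y = a" "c \<^bold>\<squnion> y = b" using relcomp[of a b c] assms c by blast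
  then have "D c b = D a y" using D_complement[of y c a b] c by (simp add: inf.commute jn_commute)
  with c y show thesis by (intro that[of c y]) simp_all
qed

lemma sum_rel_const_realize:
  assumes "sum_rel (\<lambda>_. s) \<sigma>" "plus_rel \<sigma> x (D a b)" "a \<in> C" "b \<in> C" "a \<le> b"
  obtains Y y where "chain_in C Y" "Y 0 = a" "seq_lub C Y y" "y \<le> b" "\<And>n. D (Y n) (Y (Suc n)) = s"
proof -
  \<comment> \<open>A constant series coincides with its tail, so its sum absorbs one more
    term.\<close>
  have "plus_rel s \<sigma> \<sigma>" using sum_rel_Suc[OF assms(1)] sum_rel_unique[OF assms(1)] by metis
  obtain c where c: "c \<in> C" "a \<le> c" "c \<le> b" "\<sigma> = D a c"
    by (rule plus_rel_realize[OF assms(2-)]) (rule that)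
  obtain Y where Y: "chain_in C Y" "Y 0 = a" "\<And>n. Y n \<le> c" "\<And>n. D (Y n) (Y (Suc n)) = s"
    by (rule plus_rel_realize_chain[of "\<lambda>_. s" "\<lambda>_. \<sigma>", OF \<open>plus_rel s \<sigma> \<sigma>\<close> assms(3) c(1,2,4)]) (rule that)
  obtain y where y: "seq_lub C Y y" using seq_lub_ex[OF Y(1) c(1) Y(3)] by blast
  then have "y \<le> c" using seq_lub_least[OF y c(1) Y(3)] by simp
  then have "y \<le> b" using c(3) by (rule order_trans)
  with Y y show thesis by (intro that[of Y y])
qed

end

section \<open>Splitting kernels\<close>

text \<open>\<open>kernel C A\<close> is the largest symmetric relation inside \<open>A\<close> that is compatible with splitting
  the two intervals.\<close>

definition good_rel :: "'b::order set \<Rightarrow> ('b \<Rightarrow> 'b \<Rightarrow> 'b \<Rightarrow> 'b \<Rightarrow> bool) \<Rightarrow> ('b \<Rightarrow> 'b \<Rightarrow> 'b \<Rightarrow> 'b \<Rightarrow> bool) \<Rightarrow> bool"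
  where "good_rel C A X \<longleftrightarrow> (\<forall>a b c d. X a b c d \<longrightarrow>
    a \<in> C \<and> b \<in> C \<and> c \<in> C \<and> d \<in> C \<and> a \<le> b \<and> c \<le> d \<and> A a b c d \<and> X c d a b \<and>
    (\<forall>e\<in>C. a \<le> e \<longrightarrow> e \<le> b \<longrightarrow> (\<exists>f\<in>C. c \<le> f \<and> f \<le> d \<and> X a e c f \<and> X e b f d)))"

definition kernel :: "'b::order set \<Rightarrow> ('b \<Rightarrow> 'b \<Rightarrow> 'b \<Rightarrow> 'b \<Rightarrow> bool) \<Rightarrow> 'b \<Rightarrow> 'b \<Rightarrow> 'b \<Rightarrow> 'b \<Rightarrow> bool"
  where "kernel C A a b c d \<longleftrightarrow> (\<exists>X. good_rel C A X \<and> X a b c d)"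

lemma good_relD:
  assumes "good_rel C A X" "X a b c d"
  shows "a \<in> C" "b \<in> C" "c \<in> C" "d \<in> C" "a \<le> b" "c \<le> d" "A a b c d" "X c d a b"
    and "e \<in> C \<Longrightarrow> a \<le> e \<Longrightarrow> e \<le> b \<Longrightarrow> \<exists>f\<in>C. c \<le> f \<and> f \<le> d \<and> X a e c f \<and> X e b f d"
proof -
  note * = assms(1)[unfolded good_rel_def, THEN spec, THEN spec, THEN spec, THEN spec, THEN mp, OF assms(2)]
  show "a \<in> C" "b \<in> C" "c \<in> C" "d \<in> C" "a \<le> b" "c \<le> d" "A a b c d" "X c d a b"
    using * by - (elim conjE, assumption)+
  from * have "\<forall>e\<in>C. a \<le> e \<longrightarrow> e \<le> b \<longrightarrow> (\<exists>f\<in>C. c \<le> f \<and> f \<le> d \<and> X a e c f \<and> X e b f d)"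
    by (elim conjE)
  then show "e \<in> C \<Longrightarrow> a \<le> e \<Longrightarrow> e \<le> b \<Longrightarrow> \<exists>f\<in>C. c \<le> f \<and> f \<le> d \<and> X a e c f \<and> X e b f d"
    by (drule_tac bspec) iprover+
qed

text \<open>Goodness passes to unions, as each requirement on related intervals is either
  independent of the relation or asks for further related intervals.\<close>

lemma good_rel_kernel: "good_rel C A (kernel C A)"
  unfolding good_rel_def
proof (intro allI impI)
  fix a b c d assume "kernel C A a b c d"
  then obtain X where X: "good_rel C A X" "X a b c d" unfolding kernel_def by blast
  have *: "X a b c d \<Longrightarrow> kernel C A a b c d" for a b c d using X(1) unfolding kernel_def by blast
  show "a \<in> C \<and> b \<in> C \<and> c \<in> C \<and> d \<in> C \<and> a \<le> b \<and> c \<le> d \<and> A a b c d \<and> kernel C A c d a b \<and>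
    (\<forall>e\<in>C. a \<le> e \<longrightarrow> e \<le> b \<longrightarrow> (\<exists>f\<in>C. c \<le> f \<and> f \<le> d \<and> kernel C A a e c f \<and> kernel C A e b f d))"
  proof (intro conjI ballI impI)
    show "a \<in> C" "b \<in> C" "c \<in> C" "d \<in> C" "a \<le> b" "c \<le> d" "A a b c d" by (fact good_relD[OF X])+
    show "kernel C A c d a b" by (rule *[OF good_relD(8)[OF X]])
    fix e assume "e \<in> C" "a \<le> e" "e \<le> b"
    from good_relD(9)[OF X this] show "\<exists>f\<in>C. c \<le> f \<and> f \<le> d \<and> kernel C A a e c f \<and> kernel C A e b f d"
      using * by metis
  qed
qed

lemma kernelI: "good_rel C A X \<Longrightarrow> X a b c d \<Longrightarrow> kernel C A a b c d"
  unfolding kernel_def by blast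

text \<open>\<open>A_trans\<close> and \<open>A_seq_lub\<close> are required for intervals linked by
  a good relation, so their proofs may cut the intervals involved.\<close>

locale kernel_dim = relcomp_modular C jn
  for C :: "'b::semilattice_inf set" and jn (infixl "\<^bold>\<squnion>" 65) +
  fixes A :: "'b \<Rightarrow> 'b \<Rightarrow> 'b \<Rightarrow> 'b \<Rightarrow> bool"
  assumes A_transp: "a \<in> C \<Longrightarrow> b \<in> C \<Longrightarrow> A a (a \<^bold>\<squnion> b) (a \<^bold>\<sqinter> b) b"
    and A_sym: "A a b c d \<Longrightarrow> A c d a b"
    and A_trans: "good_rel C A X \<Longrightarrow> X a b c d \<Longrightarrow> X c d e f \<Longrightarrow> A a b e f"
    and A_seq_lub: "good_rel C A X \<Longrightarrow> chain_in C Y \<Longrightarrow> seq_lub C Y y \<Longrightarrow> chain_in C Z \<Longrightarrow> seq_lub C Z y' \<Longrightarrow>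
      (\<And>n. X (Y n) (Y (Suc n)) (Z n) (Z (Suc n))) \<Longrightarrow> A (Y 0) y (Z 0) y'"
begin

abbreviation K where "K \<equiv> kernel C A"

lemmas KD = good_relD[OF good_rel_kernel[of C A]]

text \<open>Transposed pairs together with their inverses form a good relation: a cut
  \<open>e\<close> of the upper interval corresponds to \<open>e \<sqinter> d\<close> in the lower
  one, and a cut of the lower interval to its join with the bottom of the upper one. Modularity
  makes the parts transposes again.\<close>

lemma K_transp:
  assumes "a \<in> C" "b \<in> C" shows "K a (a \<^bold>\<squnion> b) (a \<^bold>\<sqinter> b) b"
proof (rule kernelI)
  let ?T = "\<lambda>a b c d. a \<in> C \<and> d \<in> C \<and> b = a \<^bold>\<squnion> d \<and> c = a \<^bold>\<sqinter> d"
  show "good_rel C A (\<lambda>a b c d. ?T a b c d \<or> ?T c d a b)"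
    unfolding good_rel_def
  proof (intro allI impI)
    fix a b c d assume T: "?T a b c d \<or> ?T c d a b"
    then show "a \<in> C \<and> b \<in> C \<and> c \<in> C \<and> d \<in> C \<and> a \<le> b \<and> c \<le> d \<and> A a b c d \<and> (?T c d a b \<or> ?T a b c d) \<and>
      (\<forall>e\<in>C. a \<le> e \<longrightarrow> e \<le> b \<longrightarrow> (\<exists>f\<in>C. c \<le> f \<and> f \<le> d \<and> (?T a e c f \<or> ?T c f a e) \<and> (?T e b f d \<or> ?T f d e b)))"
    proof
      assume T: "?T a b c d"
      have "?T a e c (e \<^bold>\<sqinter> d) \<and> ?T e b (e \<^bold>\<sqinter> d) d \<and> c \<le> e \<^bold>\<sqinter> d \<and> e \<^bold>\<sqinter> d \<in> C \<and> e \<^bold>\<sqinter> d \<le> d"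
        if e: "e \<in> C" "a \<le> e" "e \<le> b" for e
      proof -
        have b: "b \<in> C" "d \<le> b" "b = a \<^bold>\<squnion> d" using T by auto
        have "e = (a \<^bold>\<squnion> d) \<^bold>\<sqinter> e" using T e by (simp add: inf_absorb2)
        also have "\<dots> = a \<^bold>\<squnion> (e \<^bold>\<sqinter> d)" using modular[of a d e] T e by (simp add: inf.commute)
        finally have "a \<^bold>\<squnion> (e \<^bold>\<sqinter> d) = e" ..
        moreover have "a \<^bold>\<sqinter> (e \<^bold>\<sqinter> d) = c" using T e by (simp add: inf_absorb1 flip: inf.assoc)
        moreover have "e \<^bold>\<squnion> d = b"
          using jn_least[OF b(1) e(3) b(2)] jn_mono[OF e(2) order_refl[of d]] b(3) by simp
        moreover have "c \<le> e \<^bold>\<sqinter> d" using T e(2) by (simp add: le_infI1)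
        ultimately show ?thesis using T e by simp
      qed
      then have "\<forall>e\<in>C. a \<le> e \<longrightarrow> e \<le> b \<longrightarrow> (\<exists>f\<in>C. c \<le> f \<and> f \<le> d \<and> (?T a e c f \<or> ?T c f a e) \<and> (?T e b f d \<or> ?T f d e b))"
        by metis
      moreover have "A a b c d" "b \<in> C" "c \<in> C" "a \<le> b" "c \<le> d" using T A_transp[of a d] by simp_all
      ultimately show ?thesis using T by (intro conjI) blast+
    next
      assume T: "?T c d a b"
      have "?T c (c \<^bold>\<squnion> e) a e \<and> ?T (c \<^bold>\<squnion> e) d e b \<and> c \<^bold>\<squnion> e \<le> d \<and> c \<^bold>\<squnion> e \<in> C \<and> c \<le> c \<^bold>\<squnion> e"
        if e: "e \<in> C" "a \<le> e" "e \<le> b" for e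
      proof -
        have "c \<^bold>\<sqinter> e \<le> c \<^bold>\<sqinter> b" using e by (intro inf_mono) auto
        then have "c \<^bold>\<sqinter> e = a" using T e by (intro order_antisym) auto
        moreover have "(c \<^bold>\<squnion> e) \<^bold>\<sqinter> b = e" using modular[of e c b] T e
          by (simp add: jn_absorb1 jn_commute)
        moreover have "(c \<^bold>\<squnion> e) \<^bold>\<squnion> b = d" using T e by (simp add: jn_assoc jn_absorb2)
        moreover have "c \<^bold>\<squnion> e \<le> d" using T jn_mono[OF order_refl[of c] e(3)] by simp
        ultimately show ?thesis using T e by simp
      qed
      then have "\<forall>e\<in>C. a \<le> e \<longrightarrow> e \<le> b \<longrightarrow> (\<exists>f\<in>C. c \<le> f \<and> f \<le> d \<and> (?T a e c f \<or> ?T c f a e) \<and> (?T e b f d \<or> ?T f d e b))"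
        by metis
      moreover have "A a b c d" "a \<in> C" "d \<in> C" "a \<le> b" "c \<le> d" using T A_sym[OF A_transp[of c b]] by simp_all
      ultimately show ?thesis using T by (intro conjI) blast+
    qed
  qed
qed (use assms in simp)

lemma K_refl: "a \<in> C \<Longrightarrow> b \<in> C \<Longrightarrow> a \<le> b \<Longrightarrow> K a b a b"
  using K_transp[of a b] by (simp add: jn_absorb2 inf_absorb1)

text \<open>The composite of the kernel with itself is good: a cut is carried over in two
  moves.\<close>

lemma K_trans:
  assumes "K a b c d" "K c d e f" shows "K a b e f"
proof (rule kernelI)
  show "good_rel C A (\<lambda>a b e f. \<exists>c d. K a b c d \<and> K c d e f)"
    unfolding good_rel_def
  proof (intro allI impI, elim exE conjE)
    fix a b e f c d assume K: "K a b c d" "K c d e f"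
    have "\<exists>g\<in>C. e \<le> g \<and> g \<le> f \<and> (\<exists>c d. K a x c d \<and> K c d e g) \<and> (\<exists>c d. K x b c d \<and> K c d g f)"
      if "x \<in> C" "a \<le> x" "x \<le> b" for x
      using KD(9)[OF K(1) that] KD(9)[OF K(2)] by metis
    moreover have "A a b e f" by (rule A_trans[OF good_rel_kernel K])
    moreover have "\<exists>c d. K e f c d \<and> K c d a b" using KD(8)[OF K(1)] KD(8)[OF K(2)] by blast
    ultimately show "a \<in> C \<and> b \<in> C \<and> e \<in> C \<and> f \<in> C \<and> a \<le> b \<and> e \<le> f \<and> A a b e f \<and> (\<exists>c d. K e f c d \<and> K c d a b) \<and>
      (\<forall>x\<in>C. a \<le> x \<longrightarrow> x \<le> b \<longrightarrow> (\<exists>g\<in>C. e \<le> g \<and> g \<le> f \<and>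
        (\<exists>c d. K a x c d \<and> K c d e g) \<and> (\<exists>c d. K x b c d \<and> K c d g f)))"
      using KD(1-6)[OF K(1)] KD(1-6)[OF K(2)] by blast
  qed
qed (use assms in blast)

definition cls :: "'b \<Rightarrow> 'b \<Rightarrow> ('b \<times> 'b) set" where "cls a b = {(c, d). K a b c d}"

lemma cls_eq_iff:
  assumes "a \<in> C" "b \<in> C" "a \<le> b" shows "cls a b = cls c d \<longleftrightarrow> K a b c d"
proof
  assume "cls a b = cls c d"
  then have "K c d a b" using K_refl[OF assms] unfolding cls_def by blast
  then show "K a b c d" by (rule KD(8))
next
  assume "K a b c d"
  then have "K a b x y = K c d x y" for x y using K_trans KD(8) by metis
  then show "cls a b = cls c d" unfolding cls_def by auto
qed

sublocale split_dim C jn cls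
proof
  show "cls a (a \<^bold>\<squnion> b) = cls (a \<^bold>\<sqinter> b) b" if "a \<in> C" "b \<in> C" for a b
    using cls_eq_iff[OF that(1) jn_closed[OF that] jn_ge1] K_transp[OF that] by simp
next
  fix a b c a' b' assume *: "a \<in> C" "b \<in> C" "c \<in> C" "a' \<in> C" "b' \<in> C" "a \<le> c" "c \<le> b" "a' \<le> b'" "cls a b = cls a' b'"
  have "a \<le> b" using *(6,7) by (rule order_trans)
  from cls_eq_iff[OF *(1,2) this, THEN iffD1, OF *(9)] have "K a b a' b'" .
  from KD(9)[OF this *(3,6,7)] show "\<exists>c'\<in>C. a' \<le> c' \<and> c' \<le> b' \<and> cls a c = cls a' c' \<and> cls c b = cls c' b'"
    unfolding cls_eq_iff[OF *(1,3,6)] cls_eq_iff[OF *(3,2,7)] .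
qed

text \<open>Coinduction with the relation between intervals exhausted by two chains with equal step
  classes. \<open>A_seq_lub\<close> puts it inside \<open>A\<close>, and
  \<open>D_split_chain\<close> provides the matching cuts.\<close>

sublocale countable_dim C jn cls
proof
  fix Y y Z y' assume Y: "chain_in C Y" "seq_lub C Y y" and Z: "chain_in C Z" "seq_lub C Z y'"
    and step: "\<And>n. cls (Y n) (Y (Suc n)) = cls (Z n) (Z (Suc n))"
  let ?X = "\<lambda>a b c d. \<exists>Y Z. chain_in C Y \<and> Y 0 = a \<and> seq_lub C Y b \<and> chain_in C Z \<and> Z 0 = c \<and> seq_lub C Z d \<and>
    (\<forall>n. cls (Y n) (Y (Suc n)) = cls (Z n) (Z (Suc n)))"
  have "good_rel C A ?X"
    unfolding good_rel_def
  proof (intro allI impI, elim exE conjE)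
    fix a b c d Y Z
    assume Y: "chain_in C Y" "Y 0 = a" "seq_lub C Y b" and Z: "chain_in C Z" "Z 0 = c" "seq_lub C Z d"
      and step: "\<forall>n. cls (Y n) (Y (Suc n)) = cls (Z n) (Z (Suc n))"
    have "K (Y n) (Y (Suc n)) (Z n) (Z (Suc n))" for n
      using step cls_eq_iff[OF chain_inD(1)[OF Y(1)] chain_inD(1)[OF Y(1)] chain_in_step[OF Y(1)]] by metis
    then have A: "A a b c d" using A_seq_lub[OF good_rel_kernel Y(1,3) Z(1,3)] Y(2) Z(2) by simp
    have 1: "?X c d a b" using Y Z step by (intro exI[of _ Z] exI[of _ Y]) simp
    have 2: "\<exists>f\<in>C. c \<le> f \<and> f \<le> d \<and> ?X a e c f \<and> ?X e b f d" if e: "e \<in> C" "a \<le> e" "e \<le> b" for e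
    proof -
      have "Y 0 \<le> e" using e(2) Y(2) by simp
      obtain f A B P R where f: "f \<in> C" "Z 0 \<le> f" "f \<le> d"
        and 1: "chain_in C A" "A 0 = Y 0" "seq_lub C A e" "chain_in C P" "P 0 = Z 0" "seq_lub C P f"
        and 2: "chain_in C B" "B 0 = e" "seq_lub C B b" "chain_in C R" "R 0 = f" "seq_lub C R d"
        and 3: "\<forall>n. cls (A n) (A (Suc n)) = cls (P n) (P (Suc n)) \<and> cls (B n) (B (Suc n)) = cls (R n) (R (Suc n))"
        using D_split_chain[OF Y(1,3) Z(1,3) step[rule_format] e(1) \<open>Y 0 \<le> e\<close> e(3)]
        by (elim exE conjE) (rule that)
      have "?X a e c f" using 1 3 Y(2) Z(2) by (intro exI[of _ A] exI[of _ P]) simp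
      moreover have "?X e b f d" using 2 3 by (intro exI[of _ B] exI[of _ R]) simp
      ultimately show ?thesis using f Z(2) by (intro bexI[of _ f] conjI) simp_all
    qed
    have 3: "a \<in> C \<and> b \<in> C \<and> c \<in> C \<and> d \<in> C \<and> a \<le> b \<and> c \<le> d"
      using chain_inD(1)[OF Y(1), of 0] chain_inD(1)[OF Z(1), of 0] Y(2) Z(2) seq_lubD(1)[OF Y(3)]
        seq_lubD(2)[OF Y(3), of 0] seq_lubD(1)[OF Z(3)] seq_lubD(2)[OF Z(3), of 0] by simp
    show "a \<in> C \<and> b \<in> C \<and> c \<in> C \<and> d \<in> C \<and> a \<le> b \<and> c \<le> d \<and> A a b c d \<and> ?X c d a b \<and>
      (\<forall>e\<in>C. a \<le> e \<longrightarrow> e \<le> b \<longrightarrow> (\<exists>f\<in>C. c \<le> f \<and> f \<le> d \<and> ?X a e c f \<and> ?X e b f d))"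
    proof (intro conjI)
      show "a \<in> C" "b \<in> C" "c \<in> C" "d \<in> C" "a \<le> b" "c \<le> d" using 3 by simp_all
      show "A a b c d" by (rule A)
      show "?X c d a b" by (rule 1)
      show "\<forall>e\<in>C. a \<le> e \<longrightarrow> e \<le> b \<longrightarrow> (\<exists>f\<in>C. c \<le> f \<and> f \<le> d \<and> ?X a e c f \<and> ?X e b f d)"
        using 2 by (intro ballI impI)
    qed
  qed
  moreover have "?X (Y 0) y (Z 0) y'" using Y Z step by (intro exI[of _ Y] exI[of _ Z]) simp
  ultimately have "K (Y 0) y (Z 0) y'" by (rule kernelI)
  then show "cls (Y 0) y = cls (Z 0) y'"
    using cls_eq_iff[OF chain_inD(1)[OF Y(1)] seq_lubD[OF Y(2)]] by simp
qed

end

context relcomp_modular begin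

text \<open>The chain is shifted by one step and \<open>s\<close> is put into the gap: after
  \<open>a\<close> the sequence continues with \<open>s \<squnion> S 0\<close>, which is
  \<open>s\<close>.\<close>

lemma chain_in_case_nat:
  assumes S: "chain_in C S" "S 0 = a" "seq_lub C S y" and s: "s \<in> C" "a \<le> s"
  shows "chain_in C (case_nat a (\<lambda>n. s \<^bold>\<squnion> S n))"
proof (rule chain_inI)
  fix n
  have c: "S m \<in> C" "S m \<le> S (Suc m)" "a \<in> C" for m
    using chain_inD(1)[OF S(1)] chain_inD(1)[OF S(1), of 0] chain_in_step[OF S(1)] S(2) by simp_all
  show "case_nat a (\<lambda>n. s \<^bold>\<squnion> S n) n \<in> C" using c s by (cases n) simp_all
  show "case_nat a (\<lambda>n. s \<^bold>\<squnion> S n) n \<le> case_nat a (\<lambda>n. s \<^bold>\<squnion> S n) (Suc n)"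
    using c s by (cases n) (simp_all add: jn_mono le_jnI1)
qed

lemma seq_lub_case_nat:
  assumes S: "chain_in C S" "S 0 = a" "seq_lub C S y" and s: "s \<in> C" "a \<le> s"
  shows "seq_lub C (case_nat a (\<lambda>n. s \<^bold>\<squnion> S n)) (s \<^bold>\<squnion> y)"
proof (rule seq_lubI)
  have L: "seq_lub C (\<lambda>n. s \<^bold>\<squnion> S n) (s \<^bold>\<squnion> y)" using seq_lub_jn[OF seq_lub_const[OF s(1)] S(3)] .
  show "s \<^bold>\<squnion> y \<in> C" by (rule seq_lubD(1)[OF L])
  show "case_nat a (\<lambda>n. s \<^bold>\<squnion> S n) n \<le> s \<^bold>\<squnion> y" for n
    using seq_lubD(2)[OF L] s(2) by (cases n) (simp_all add: le_jnI1)
  show "s \<^bold>\<squnion> y \<le> u" if u: "u \<in> C" "\<And>n. case_nat a (\<lambda>n. s \<^bold>\<squnion> S n) n \<le> u" for u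
    using u(2)[of "Suc _"] by (intro seq_lub_least[OF L u(1)]) simp
qed

end

context add_dim begin

text \<open>A relative complement \<open>w\<close> of \<open>y\<close> in \<open>[a, x]\<close> is
  disjoint from \<open>s \<squnion> y\<close> as well, so it can be added on both sides.\<close>

lemma D_absorb_extend:
  assumes a: "a \<in> C" and x: "x \<in> C" and s: "s \<in> C" "x \<^bold>\<sqinter> s = a"
    and y: "y \<in> C" "a \<le> y" "y \<le> x" "D a y = D a (s \<^bold>\<squnion> y)"
  shows "D a x = D a (x \<^bold>\<squnion> s)"
proof -
  have as: "a \<le> s" "a \<le> x" using inf_le1[of x s] inf_le2[of x s] s(2) by simp_all
  obtain w where w: "w \<in> C" "y \<^bold>\<sqinter> w = a" "y \<^bold>\<squnion> w = x" using relcomp[of a x y] a x y by blast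
  interpret up: relcomp_modular_0 "above C a" jn a by (rule above_relcomp_modular_0[OF a])
  note [simp del, rule del] = up.z_le
  have "a \<le> w" using inf_le2[of y w] w(2) by simp
  then have "up.disj w (y \<^bold>\<squnion> s)"
    using w s y as by (intro up.disj_jn) (simp_all add: above_iff up.disj_def inf.commute jn_commute)
  then have "(s \<^bold>\<squnion> y) \<^bold>\<sqinter> w = a" by (simp add: up.disj_def inf.commute jn_commute)
  then have "D a (y \<^bold>\<squnion> w) = D a ((s \<^bold>\<squnion> y) \<^bold>\<squnion> w)"
    using w y s by (intro D_add_disj) auto
  moreover have "(s \<^bold>\<squnion> y) \<^bold>\<squnion> w = x \<^bold>\<squnion> s" unfolding w(3)[symmetric] by (simp only: jn_ac)
  ultimately show ?thesis using w(3) by simp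
qed

end

context cont_dim begin

text \<open>A shifting argument: the chain that starts with \<open>s\<close> and continues with the
  steps of \<open>S\<close> has the same step values as \<open>S\<close>, all equal to
  \<open>D a s\<close>. Hence its join \<open>s \<squnion> y\<close> has the value of
  \<open>y\<close>.\<close>

lemma D_absorb:
  assumes S: "chain_in C S" "S 0 = a" "seq_lub C S y" and x: "x \<in> C" "y \<le> x"
    and s: "s \<in> C" "x \<^bold>\<sqinter> s = a" and step: "\<And>n. D (S n) (S (Suc n)) = D a s"
  shows "D a x = D a (x \<^bold>\<squnion> s)"
proof -
  have c: "S n \<in> C" "S n \<le> S (Suc n)" "S n \<le> y" "y \<in> C" "a \<in> C" "a \<le> S n" for n
    using chain_inD(1)[OF S(1)] chain_inD(1)[OF S(1), of 0] chain_in_step[OF S(1)] seq_lubD[OF S(3)] S(2)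
      chain_inD(2)[OF S(1), of 0 n] by simp_all
  have as: "a \<le> s" "a \<le> x" using inf_le1[of x s] inf_le2[of x s] s(2) by simp_all
  define X where "X = case_nat a (\<lambda>n. s \<^bold>\<squnion> S n)"
  have X: "X 0 = a" "\<And>n. X (Suc n) = s \<^bold>\<squnion> S n" by (simp_all add: X_def)
  have Xch: "chain_in C X" and Xl: "seq_lub C X (s \<^bold>\<squnion> y)"
    using chain_in_case_nat[OF S s(1) as(1)] seq_lub_case_nat[OF S s(1) as(1)] by (simp_all add: X_def)
  have "D (S n) (S (Suc n)) = D (X n) (X (Suc n))" for n
  proof (cases n)
    case 0 then show ?thesis using step[of 0] S(2) as s by (simp add: X jn_absorb1)
  next
    case (Suc k)
    have "s \<^bold>\<sqinter> S (Suc k) \<le> x \<^bold>\<sqinter> s" using order_trans[OF c(3)[of "Suc k"] x(2)] by (simp add: le_infI2)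
    then have "s \<^bold>\<sqinter> S (Suc k) \<le> S k" using s(2) c(6)[of k] by simp
    then have "S k \<^bold>\<squnion> (s \<^bold>\<sqinter> S (Suc k)) = S k" using c by (simp add: jn_absorb1)
    then have "D (S k) (S (Suc k)) = D (s \<^bold>\<squnion> S k) (s \<^bold>\<squnion> S (Suc k))"
      using D_modular(2)[OF c(1)[of k] c(1)[of "Suc k"] s(1) c(2)] by simp
    then show ?thesis using step[of k] step[of n] Suc by (simp add: X)
  qed
  then have y: "D a y = D a (s \<^bold>\<squnion> y)" using D_seq_lub[OF S(1,3) Xch Xl] S(2) X(1) by simp
  show ?thesis by (rule D_absorb_extend[OF c(5) x(1) s c(4) _ x(2) y]) (use c(3)[of 0] S(2) in simp)
qed

end

section \<open>Blocks and test elements off a block\<close>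

context relcomp_modular_0 begin

text \<open>An axis chosen below \<open>x \<squnion> y\<close> stays inside \<open>B\<close>, so two
  transpositions inside the block suffice.\<close>

lemma persp_D_eq:
  assumes "transp_dim (below C B) jn D" "x \<sim> y" "x \<le> B" "y \<le> B" "B \<in> C"
  shows "D z x = D z y"
proof -
  obtain g where g: "axis g x y" "g \<le> x \<^bold>\<squnion> y" "g \<in> C" using persp_axis_below[OF assms(2)] by metis
  have "g \<le> B" using g(2) jn_least[OF assms(5,3,4)] by (rule order_trans)
  then have "D g (g \<^bold>\<squnion> x) = D (g \<^bold>\<sqinter> x) x" "D g (g \<^bold>\<squnion> y) = D (g \<^bold>\<sqinter> y) y"
    using assms g(3) persp_closed[OF assms(2)] by (intro transp_dim.D_transp[OF assms(1)]; simp add: below_iff)+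
  then show ?thesis using g(1) by (simp add: axis_def disj_def inf.commute jn_commute)
qed

definition off :: "'b \<Rightarrow> 'b set" where "off B = {v \<in> C. v \<^bold>\<bottom> B}"

lemma offD: "v \<in> off B \<Longrightarrow> w \<in> C \<Longrightarrow> w \<le> B \<Longrightarrow> v \<^bold>\<bottom> w"
  using disj_mono[of v B v w] by (simp add: off_def)

lemma off_down: "v \<in> off B \<Longrightarrow> B \<in> C \<Longrightarrow> v' \<in> C \<Longrightarrow> v' \<le> v \<Longrightarrow> v' \<in> off B"
  using disj_mono[of v B v' B] by (simp add: off_def)

definition block_rel :: "'b \<Rightarrow> 'b \<Rightarrow> 'b \<Rightarrow> 'b \<Rightarrow> 'b \<Rightarrow> bool"
  where "block_rel B a b c d \<longleftrightarrow> absorbs (off B) a b c d \<and> absorbs (off B) c d a b"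

lemma block_rel_sym: "block_rel B a b c d \<Longrightarrow> block_rel B c d a b"
  by (simp add: block_rel_def)

text \<open>Two representatives of one interval are perspective with axis \<open>a\<close>, and
  their join stays below \<open>B\<close>. A test element is therefore disjoint from that join, and
  \<open>persp_absorb\<close> applies.\<close>

lemma block_rel_transp:
  assumes "a \<in> C" "b \<in> C" "a \<le> B" "b \<le> B" "B \<in> C"
  shows "block_rel B a (a \<^bold>\<squnion> b) (a \<^bold>\<sqinter> b) b"
proof -
  have "v \<sim> w'" if v: "v \<in> off B" "v \<sim> w" and w: "rep w a (a \<^bold>\<squnion> b)" "rep w' a (a \<^bold>\<squnion> b)" for v w w'
  proof (rule persp_absorb[OF v(2) rep_persp[OF w assms(1)]])
    have "w \<le> a \<^bold>\<squnion> b" "w' \<le> a \<^bold>\<squnion> b" and C: "w \<in> C" "w' \<in> C" using repD[OF w(1)] repD[OF w(2)] by simp_all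
    then have "w \<^bold>\<squnion> w' \<le> a \<^bold>\<squnion> b" using assms by (simp add: jn_least)
    also have "\<dots> \<le> B" using jn_least[OF assms(5,3,4)] .
    finally show "v \<^bold>\<bottom> w \<^bold>\<squnion> w'" using C by (intro offD[OF v(1)]) simp_all
  qed
  then show ?thesis unfolding block_rel_def absorbs_def using rep_transp[OF _ assms(1,2)] by blast
qed

text \<open>A representative of the middle interval lies below \<open>B\<close> and is disjoint from
  every test element, so the two absorptions compose without any transitivity of
  perspectivity.\<close>

lemma block_rel_trans:
  assumes "block_rel B a b c d" "block_rel B c d e f" "c \<in> C" "d \<in> C" "c \<le> d" "d \<le> B"
  shows "block_rel B a b e f"
proof -
  obtain y where y: "rep y c d" using rep_ex[OF assms(3-5)] by blast
  have "y \<in> C" "y \<le> B" using repD[OF y] assms(6) by (auto intro: order_trans)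
  then have "v \<^bold>\<bottom> y" if "v \<in> off B" for v by (rule offD[OF that])
  then show ?thesis using assms(1,2) y unfolding block_rel_def absorbs_def by meson
qed

lemma block_rel_seq_lub:
  assumes "B \<in> C" "chain_in C Y" "seq_lub C Y y" "chain_in C Z" "seq_lub C Z y'"
    and "\<And>n. block_rel B (Y n) (Y (Suc n)) (Z n) (Z (Suc n))"
  shows "block_rel B (Y 0) y (Z 0) y'"
proof -
  have down: "\<And>v v'. v \<in> off B \<Longrightarrow> v' \<in> C \<Longrightarrow> v' \<le> v \<Longrightarrow> v' \<in> off B" by (rule off_down[OF _ assms(1)])
  have step: "absorbs (off B) (Y n) (Y (Suc n)) (Z n) (Z (Suc n))"
    "absorbs (off B) (Z n) (Z (Suc n)) (Y n) (Y (Suc n))" for n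
    using assms(6)[of n] by (simp_all add: block_rel_def)
  have "absorbs (off B) (Y 0) y (Z 0) y'" by (rule absorbs_seq_lub[OF down assms(2-5) step(1)])
  moreover have "absorbs (off B) (Z 0) y' (Y 0) y" by (rule absorbs_seq_lub[OF down assms(4,5,2,3) step(2)])
  ultimately show ?thesis by (simp add: block_rel_def)
qed

lemma chain_in_below: "chain_in (below C B) Y \<Longrightarrow> chain_in C Y"
  unfolding chain_in_def below_iff by simp

text \<open>An upper bound \<open>u\<close> outside the block can be replaced by
  \<open>u \<sqinter> s\<close>.\<close>

lemma seq_lub_below:
  assumes "seq_lub (below C B) Y s" shows "seq_lub C Y s"
proof (rule seq_lubI)
  show "s \<in> C" "Y n \<le> s" for n using assms by (auto simp: seq_lub_def below_iff)
  fix u assume u: "u \<in> C" "\<And>n. Y n \<le> u"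
  have "u \<^bold>\<sqinter> s \<in> below C B" using u assms by (auto simp: seq_lub_def below_iff intro: le_infI2)
  then have "s \<le> u \<^bold>\<sqinter> s" using u assms unfolding seq_lub_def by (metis le_infI)
  then show "s \<le> u" by simp
qed

lemma seq_lub_belowI: "seq_lub C Y s \<Longrightarrow> s \<le> B \<Longrightarrow> seq_lub (below C B) Y s"
  by (auto simp: seq_lub_def below_iff)

definition block_cls :: "'b \<Rightarrow> 'b \<Rightarrow> 'b \<Rightarrow> ('b \<times> 'b) set"
  where "block_cls B a b = {(c, d). c \<in> C \<and> d \<in> C \<and> c \<le> d \<and> d \<le> B \<and> block_rel B a b c d}"

lemma block_rel_refl: "a \<in> C \<Longrightarrow> b \<in> C \<Longrightarrow> a \<le> b \<Longrightarrow> b \<le> B \<Longrightarrow> B \<in> C \<Longrightarrow> block_rel B a b a b"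
  using block_rel_transp[of a b B] by (simp add: jn_absorb2 inf_absorb1)

lemma block_cls_eq_iff:
  assumes "a \<in> C" "b \<in> C" "a \<le> b" "b \<le> B" "c \<in> C" "d \<in> C" "c \<le> d" "d \<le> B" "B \<in> C"
  shows "block_cls B a b = block_cls B c d \<longleftrightarrow> block_rel B a b c d"
proof
  assume *: "block_cls B a b = block_cls B c d"
  have "(c, d) \<in> block_cls B c d" using block_rel_refl[of c d B] assms by (simp add: block_cls_def)
  then show "block_rel B a b c d" unfolding *[symmetric] by (simp add: block_cls_def)
next
  assume *: "block_rel B a b c d"
  have "block_rel B a b x y = block_rel B c d x y" for x y
    using block_rel_trans[OF * _ assms(5-8)] block_rel_trans[OF block_rel_sym[OF *] _ assms(1-4)] by blast
  then show "block_cls B a b = block_cls B c d" by (simp add: block_cls_def)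
qed

text \<open>Additivity of \<open>block_rel\<close> itself, used for gluing pieces and for
  absorption; splitting is not claimed here.\<close>

lemma cont_dim_block:
  assumes "B \<in> C" shows "cont_dim (below C B) jn (block_cls B)"
proof (intro cont_dim.intro transp_dim.intro transp_dim_axioms.intro cont_dim_axioms.intro)
  show "relcomp_modular (below C B) jn" by (rule below_relcomp_modular[OF assms])
next
  fix a b assume "a \<in> below C B" "b \<in> below C B"
  then have ab: "a \<in> C" "b \<in> C" "a \<le> B" "b \<le> B" by (simp_all add: below_iff)
  show "block_cls B a (a \<^bold>\<squnion> b) = block_cls B (a \<^bold>\<sqinter> b) b"
    using ab assms block_rel_transp[OF ab assms] by (subst block_cls_eq_iff) (simp_all add: jn_least)
next
  fix Y y Z y' assume *: "chain_in (below C B) Y" "seq_lub (below C B) Y y" "chain_in (below C B) Z" "seq_lub (below C B) Z y'"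
    "\<And>n. block_cls B (Y n) (Y (Suc n)) = block_cls B (Z n) (Z (Suc n))"
  interpret blk: relcomp_modular "below C B" jn by (rule below_relcomp_modular[OF assms])
  have c: "Y n \<in> C" "Z n \<in> C" "Y n \<le> B" "Z n \<le> B" "Y n \<le> Y (Suc n)" "Z n \<le> Z (Suc n)" "Y n \<le> y" "Z n \<le> y'"
    "y \<in> C" "y' \<in> C" "y \<le> B" "y' \<le> B" for n
    using blk.chain_inD(1)[OF *(1), of n] blk.chain_inD(1)[OF *(3), of n] blk.chain_in_step[OF *(1)]
      blk.chain_in_step[OF *(3)] blk.seq_lubD[OF *(2)] blk.seq_lubD[OF *(4)] by (simp_all add: below_iff)
  have "block_rel B (Y n) (Y (Suc n)) (Z n) (Z (Suc n))" for n
    by (rule block_cls_eq_iff[OF c(1,1,5,3) c(2,2,6,4) assms, THEN iffD1, OF *(5)])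
  then have "block_rel B (Y 0) y (Z 0) y'"
    by (intro block_rel_seq_lub[OF assms chain_in_below[OF *(1)] seq_lub_below[OF *(2)] chain_in_below[OF *(3)] seq_lub_below[OF *(4)]])
  then show "block_cls B (Y 0) y = block_cls B (Z 0) y'"
    using block_cls_eq_iff[OF c(1,9,7,11) c(2,10,8,12) assms] by simp
qed

text \<open>For the kernel of \<open>block_rel\<close> splitting is available too, and with it
  cancellation inside the block.\<close>

lemma kernel_dim_block:
  assumes "B \<in> C" shows "kernel_dim (below C B) jn (block_rel B)"
proof (intro kernel_dim.intro kernel_dim_axioms.intro)
  show "relcomp_modular (below C B) jn" by (rule below_relcomp_modular[OF assms])
next
  fix a b assume "a \<in> below C B" "b \<in> below C B"
  then show "block_rel B a (a \<^bold>\<squnion> b) (a \<^bold>\<sqinter> b) b" using assms by (intro block_rel_transp) (simp_all add: below_iff)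
next
  fix a b c d assume "block_rel B a b c d" then show "block_rel B c d a b" by (rule block_rel_sym)
next
  fix X a b c d e f assume g: "good_rel (below C B) (block_rel B) X" and X: "X a b c d" "X c d e f"
  show "block_rel B a b e f"
    by (rule block_rel_trans[OF good_relD(7)[OF g X(1)] good_relD(7)[OF g X(2)]])
      (use good_relD(3,4,6)[OF g X(1)] in \<open>simp_all add: below_iff\<close>)
next
  fix X Y y Z y' assume g: "good_rel (below C B) (block_rel B) X"
    and *: "chain_in (below C B) Y" "seq_lub (below C B) Y y" "chain_in (below C B) Z" "seq_lub (below C B) Z y'"
    "\<And>n. X (Y n) (Y (Suc n)) (Z n) (Z (Suc n))"
  show "block_rel B (Y 0) y (Z 0) y'"
    by (intro block_rel_seq_lub[OF assms chain_in_below[OF *(1)] seq_lub_below[OF *(2)]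
      chain_in_below[OF *(3)] seq_lub_below[OF *(4)]] good_relD(7)[OF g *(5)])
qed

end

section \<open>Two elements perspective to a common third\<close>

context relcomp_modular_0 begin

text \<open>Refining the two decompositions of \<open>q\<close> induced by \<open>p = m \<squnion> p0\<close> and \<open>p' = m \<squnion> k\<close>, where
  \<open>m = p \<sqinter> p'\<close>, the cancellation theorem is applied in the block below \<open>m \<squnion> q\<close>.  That block is
  disjoint from \<open>p0\<close> and from \<open>k\<close>, so every step made in it is absorbed.\<close>

lemma zigzag_block:
  assumes "p \<sim> q" "p' \<sim> q" "q \<^bold>\<bottom> p \<^bold>\<squnion> p'"
  shows "block_rel (p \<^bold>\<squnion> p') z p z p'"
proof -
  define m where "m = p \<^bold>\<sqinter> p'"
  \<comment> \<open>Cancellation takes place below \<open>B\<close>, while the conclusion is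
    assembled from pieces of \<open>p\<close> and \<open>p'\<close> in the block
    \<open>U\<close>.\<close>
  define B where "B = m \<^bold>\<squnion> q"
  define U where "U = p \<^bold>\<squnion> p'"
  have c: "p \<in> C" "q \<in> C" "p' \<in> C" using persp_closed[OF assms(1)] persp_closed[OF assms(2)] by auto
  then have mC: "m \<in> C" "m \<le> p" "m \<le> p'" and BC: "B \<in> C" "m \<le> B" "q \<le> B" and UC: "U \<in> C" "p \<le> U" "p' \<le> U"
    by (simp_all add: m_def B_def U_def)
  have mU: "m \<le> U" using mC(2) UC(2) by (rule order_trans)
  have Uq: "U \<^bold>\<bottom> q" using assms(3) disj_commute by (simp add: U_def)
  obtain p0 where p0: "dsum p m p0" using dsum_ex[OF c(1) mC(1,2)] .
  obtain k where k: "dsum p' m k" using dsum_ex[OF c(3) mC(1,3)] .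
  obtain A B' where A: "dsum q A B'" "m \<sim> A" "p0 \<sim> B'" using persp_dsum[OF assms(1) p0] .
  obtain A' D' where A': "dsum q A' D'" "m \<sim> A'" "k \<sim> D'" using persp_dsum[OF assms(2) k] .
  have p0c: "p0 \<in> C" "p0 \<le> p" "m \<^bold>\<bottom> p0" "p = m \<^bold>\<squnion> p0" and kc: "k \<in> C" "k \<le> p'" "m \<^bold>\<bottom> k" "p' = m \<^bold>\<squnion> k"
    using p0 k dsumD[OF p0] dsumD[OF k] by (simp_all add: dsum_def)
  have p0U: "p0 \<le> U" and kU: "k \<le> U" using p0c(2) UC(2) kc(2) UC(3) by (blast intro: order_trans)+
  \<comment> \<open>Since \<open>v \<squnion> m\<close> lies below \<open>U\<close>, which is
    disjoint from \<open>q\<close>, the elements \<open>v\<close>, \<open>m\<close> and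
    \<open>q\<close> are independent.\<close>
  have offB: "v \<in> off B" if "v \<in> C" "v \<^bold>\<bottom> m" "v \<^bold>\<squnion> m \<le> U" for v
    unfolding off_def B_def using that c mC disj_mono[OF Uq that(3) order_refl _ c(2)]
    by (simp add: disj_jn)
  have p0B: "p0 \<in> off B" and kB: "k \<in> off B"
    using p0c kc mC UC disj_commute by (auto intro!: offB simp: jn_commute)
  have "p0 \<^bold>\<bottom> k"
  proof -
    have "p0 \<^bold>\<sqinter> k \<le> p0 \<^bold>\<sqinter> m" unfolding m_def using p0c(2) kc(2) by (auto intro: le_infI1 le_infI2)
    also have "\<dots> = z" using p0c(3) by (simp add: disj_def inf.commute)
    finally show ?thesis unfolding disj_def using p0c(1) kc(1) by (intro eq_zI) auto
  qed
  then have p0kq: "p0 \<^bold>\<bottom> k \<^bold>\<squnion> q"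
    using disj_mono[OF Uq jn_least[OF UC(1) p0U kU] order_refl _ c(2)] p0c(1) kc(1) c(2)
    by (intro disj_jn) simp_all
  interpret K: kernel_dim "below C B" jn "block_rel B" by (rule kernel_dim_block[OF BC(1)])
  interpret Ub: cont_dim "below C U" jn "block_cls U" by (rule cont_dim_block[OF UC(1)])
  note UD = persp_D_eq[OF Ub.transp_dim_axioms] and KD = persp_D_eq[OF K.transp_dim_axioms]
  have qle: "A \<le> B" "B' \<le> B" "A' \<le> B" "D' \<le> B" "A \<in> C" "B' \<in> C" "A' \<in> C" "D' \<in> C"
    using dsumD[OF A(1)] dsumD[OF A'(1)] BC(3) by (meson order_trans)+
  \<comment> \<open>Both \<open>A\<close> and \<open>A'\<close> are copies of \<open>m\<close>, so
    \<open>q\<close> has two decompositions with a common summand, as cancellation requires.\<close>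
  have eqs: "K.cls z A = K.cls z m" "K.cls z A' = K.cls z m"
    using KD[OF persp_sym[OF A(2)] qle(1) BC(2,1)] KD[OF persp_sym[OF A'(2)] qle(3) BC(2,1)] by simp_all
  have "K.plus_rel (K.cls z A) (K.cls z B') (K.cls z q)" "K.plus_rel (K.cls z A') (K.cls z D') (K.cls z q)"
    using K.plus_rel_disj[of A B' z] K.plus_rel_disj[of A' D' z] A(1) A'(1) qle
    by (simp_all add: dsum_def disj_def below_iff)
  then obtain r s t \<sigma> x \<tau> y where rst: "K.plus_rel r s (K.cls z B')" "K.plus_rel r t (K.cls z D')"
    "K.sum_rel (\<lambda>_. s) \<sigma>" "K.plus_rel \<sigma> x (K.cls z m)" "K.sum_rel (\<lambda>_. t) \<tau>" "K.plus_rel \<tau> y (K.cls z m)"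
    unfolding eqs by (rule K.cancellation) (rule that)
  \<comment> \<open>Below \<open>m\<close> there is an infinite chain whose steps all have the class
    of \<open>s1\<close>. The copy \<open>s0\<close> of \<open>s1\<close> is off \<open>B\<close>,
    so it is a test element and becomes perspective to every step of that chain;
    \<open>D_absorb\<close> in the block \<open>U\<close> then applies.\<close>
  have absorb: "block_cls U z m = block_cls U z (m \<^bold>\<squnion> s0)"
    if s0: "s0 \<in> C" "s0 \<in> off B" "s0 \<le> U" "m \<^bold>\<bottom> s0" and s1: "s0 \<sim> s1" "s1 \<le> B" "K.cls z s1 = \<alpha>"
      and sum: "K.sum_rel (\<lambda>_. \<alpha>) \<mu>" "K.plus_rel \<mu> x (K.cls z m)" for s0 s1 \<alpha> \<mu> x
  proof -
    have s1C: "s1 \<in> C" using persp_closed[OF s1(1)] by simp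
    obtain S y where S: "chain_in (below C B) S" "S 0 = z" "seq_lub (below C B) S y" "y \<le> m"
      "\<And>n. K.cls (S n) (S (Suc n)) = \<alpha>"
      by (rule K.sum_rel_const_realize[OF sum]) (use mC BC that in \<open>auto simp: below_iff\<close>)
    have Sc: "S n \<in> C" "S n \<le> S (Suc n)" "S n \<le> y" "S n \<le> B" "y \<in> C" for n
      using K.chain_inD(1)[OF S(1), of n] K.chain_in_step[OF S(1)] K.seq_lubD[OF S(3)] by (simp_all add: below_iff)
    have Sm: "S n \<le> m" "S n \<le> U" for n using order_trans[OF Sc(3) S(4)] order_trans[OF _ mU] by auto
    show ?thesis
    proof (rule Ub.D_absorb[of S z y])
      have "y \<le> U" using S(4) mU by (rule order_trans)
      then show "seq_lub (below C U) S y" by (rule seq_lub_belowI[OF seq_lub_below[OF S(3)]])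
      show "chain_in (below C U) S" using chain_in_below[OF S(1)] Sm by (simp add: chain_in_def below_iff)
      show "block_cls U (S n) (S (Suc n)) = block_cls U z s0" for n
      proof -
        obtain w where w: "rep w (S n) (S (Suc n))" using rep_ex[OF Sc(1) Sc(1) Sc(2)] by blast
        have wC: "w \<in> C" "w \<le> U" "w \<le> B" using repD[OF w] Sm(2)[of "Suc n"] Sc(4)[of "Suc n"] by auto
        have "K.K z s1 (S n) (S (Suc n))"
          using K.cls_eq_iff[of z s1 "S n" "S (Suc n)"] s1 S(5)[of n] s1C BC by (simp add: below_iff)
        then have "absorbs (off B) z s1 (S n) (S (Suc n))" using K.KD(7) by (simp add: block_rel_def)
        from absorbsD[OF this s0(2) rep_z[OF s1C] w s1(1) offD[OF s0(2) wC(1,3)]] have "s0 \<sim> w" .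
        then have "block_cls U z s0 = block_cls U z w" using UD s0(3) wC(2) UC(1) by simp
        moreover have "block_cls U (S n) (S (Suc n)) = block_cls U z w"
          using Ub.D_complement[of w "S n" z "S (Suc n)"] w wC Sc Sm by (simp add: rep_def disj_def below_iff)
        ultimately show ?thesis by simp
      qed
    qed (use S(2,4) mC mU s0 in \<open>simp_all add: below_iff disj_def\<close>)
  qed
  obtain r1 s1 where r1: "r1 \<in> below C B" "s1 \<in> below C B" "r1 \<^bold>\<sqinter> s1 = z" "r1 \<^bold>\<squnion> s1 = B'" "K.cls z r1 = r" "K.cls z s1 = s"
    by (rule K.plus_rel_realize_disj[OF rst(1)]) (use qle BC that in \<open>auto simp: below_iff\<close>)
  obtain r2 t2 where r2: "r2 \<in> below C B" "t2 \<in> below C B" "r2 \<^bold>\<sqinter> t2 = z" "r2 \<^bold>\<squnion> t2 = D'" "K.cls z r2 = r" "K.cls z t2 = t"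
    by (rule K.plus_rel_realize_disj[OF rst(2)]) (use qle BC that in \<open>auto simp: below_iff\<close>)
  have d1: "dsum B' r1 s1" and d2: "dsum D' r2 t2" using r1 r2 by (simp_all add: dsum_def disj_def below_iff)
  obtain r0 s0 where s0: "dsum p0 r0 s0" "r1 \<sim> r0" "s1 \<sim> s0" using persp_dsum[OF persp_sym[OF A(3)] d1] .
  obtain r' t' where t': "dsum k r' t'" "r2 \<sim> r'" "t2 \<sim> t'" using persp_dsum[OF persp_sym[OF A'(3)] d2] .
  have c0: "r0 \<in> C" "s0 \<in> C" "r0 \<le> p0" "s0 \<le> p0" "r' \<in> C" "t' \<in> C" "r' \<le> k" "t' \<le> k"
    using dsumD[OF s0(1)] dsumD[OF t'(1)] by auto
  have cU: "r0 \<le> U" "s0 \<le> U" "r' \<le> U" "t' \<le> U" using c0 p0U kU by (meson order_trans)+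
  have ms: "m \<^bold>\<bottom> s0" "m \<^bold>\<bottom> t'" "m \<^bold>\<bottom> r'" "m \<^bold>\<bottom> r0"
    using disj_mono[OF p0c(3) order_refl _ mC(1)] disj_mono[OF kc(3) order_refl _ mC(1)] c0 by auto
  have 1: "block_cls U z m = block_cls U z (m \<^bold>\<squnion> s0)"
    using r1 by (intro absorb[OF c0(2) off_down[OF p0B BC(1) c0(2,4)] cU(2) ms(1) persp_sym[OF s0(3)] _ r1(6) rst(3,4)])
      (simp add: below_iff)
  have 2: "block_cls U z m = block_cls U z (m \<^bold>\<squnion> t')"
    using r2 by (intro absorb[OF c0(6) off_down[OF kB BC(1) c0(6,8)] cU(4) ms(2) persp_sym[OF t'(3)] _ r2(6) rst(5,6)])
      (simp add: below_iff)
  \<comment> \<open>\<open>r0\<close> is off the block \<open>B\<close>, so it tests the equality of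
    the classes of \<open>r1\<close> and \<open>r2\<close>.\<close>
  have "r0 \<sim> r2"
  proof -
    have "K.K z r1 z r2" using K.cls_eq_iff[of z r1 z r2] r1 r2 BC by (simp add: below_iff)
    then have "absorbs (off B) z r1 z r2" using K.KD(7) by (simp add: block_rel_def)
    then show ?thesis
      using r1(1) r2(1) off_down[OF p0B BC(1) c0(1,3)] offD[OF off_down[OF p0B BC(1) c0(1,3)]] persp_sym[OF s0(2)]
      by (intro absorbsD[of _ z r1 z r2 r0 r1 r2] rep_z) (simp_all add: below_iff)
  qed
  moreover have "r0 \<^bold>\<bottom> r2 \<^bold>\<squnion> r'"
  proof (rule disj_mono[OF p0kq c0(3) _ c0(1)])
    have "r2 \<le> q" using dsumD[OF d2] dsumD[OF A'(1)] by (meson order_trans)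
    then have "r2 \<^bold>\<squnion> r' \<le> q \<^bold>\<squnion> k" using c0(7) by (rule jn_mono)
    then show "r2 \<^bold>\<squnion> r' \<le> k \<^bold>\<squnion> q" by (simp add: jn_commute)
  qed (use dsumD[OF d2] c0 in simp)
  ultimately have "r0 \<sim> r'" using t'(2) persp_absorb by blast
  then have 3: "block_cls U z r0 = block_cls U z r'" using UD cU UC(1) by simp
  have dr: "m \<^bold>\<squnion> s0 \<^bold>\<bottom> r0"
    using disj_jn[of r0 s0 m] s0(1) c0 mC p0c(3) disj_commute by (simp add: dsum_def jn_commute)
  have dt: "m \<^bold>\<squnion> t' \<^bold>\<bottom> r'"
    using disj_jn[of r' t' m] t'(1) c0 mC kc(3) disj_commute by (simp add: dsum_def jn_commute)
  \<comment> \<open>Here \<open>p\<close> is composed of \<open>m\<close>, \<open>s0\<close>,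
    \<open>r0\<close> and \<open>p'\<close> of \<open>m\<close>, \<open>t'\<close>,
    \<open>r'\<close>. The parts \<open>s0\<close> and \<open>t'\<close> are absorbed by
    \<open>m\<close>, and \<open>r0\<close> is exchanged for \<open>r'\<close>.\<close>
  have "block_cls U z ((m \<^bold>\<squnion> s0) \<^bold>\<squnion> r0) = block_cls U z (m \<^bold>\<squnion> r')"
    by (rule Ub.D_add_disj) (use dr ms 1 3 c0 cU mC mU UC jn_least in \<open>simp_all add: disj_def below_iff\<close>)
  moreover have "block_cls U z ((m \<^bold>\<squnion> t') \<^bold>\<squnion> r') = block_cls U z (m \<^bold>\<squnion> r')"
    by (rule Ub.D_add_disj) (use dt ms 2 c0 cU mC mU UC jn_least in \<open>simp_all add: disj_def below_iff\<close>)
  moreover have "(m \<^bold>\<squnion> s0) \<^bold>\<squnion> r0 = p" "(m \<^bold>\<squnion> t') \<^bold>\<squnion> r' = p'"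
    unfolding p0c(4) kc(4) using s0(1) t'(1) by (simp_all add: dsum_def jn_ac)
  ultimately have "block_cls U z p = block_cls U z p'" by simp
  then show ?thesis using block_cls_eq_iff[of z p U z p'] c UC by (simp add: U_def)
qed

text \<open>Reads \<open>zigzag_block\<close> at the test element \<open>v\<close>; this is the form
  in which blocks enter the later arguments.\<close>

lemma persp_zigzag:
  assumes "p \<sim> q" "p' \<sim> q" "q \<^bold>\<bottom> p \<^bold>\<squnion> p'" "v \<sim> p'" "v \<^bold>\<bottom> p \<^bold>\<squnion> p'"
  shows "v \<sim> p"
proof -
  have c: "v \<in> C" "p \<in> C" "p' \<in> C" using persp_closed[OF assms(1)] persp_closed[OF assms(4)] by auto
  have "absorbs (off (p \<^bold>\<squnion> p')) z p' z p" using zigzag_block[OF assms(1-3)] by (simp add: block_rel_def)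
  moreover have "v \<in> off (p \<^bold>\<squnion> p')" using c assms(5) by (simp add: off_def)
  ultimately show ?thesis using assms(4) offD[of v "p \<^bold>\<squnion> p'" p] rep_z[OF c(2)] rep_z[OF c(3)] c(2)
    by (auto intro: absorbsD)
qed

end

section \<open>Transitivity of perspectivity between disjoint elements\<close>

context relcomp_modular_0 begin

lemma dsum_inf_disj:
  assumes "dsum y (y \<^bold>\<sqinter> a) r" shows "r \<^bold>\<bottom> a"
proof -
  have "r \<le> y" using dsumD[OF assms] by simp
  have "(y \<^bold>\<sqinter> a) \<^bold>\<sqinter> r = (r \<^bold>\<sqinter> y) \<^bold>\<sqinter> a" by (simp only: mt_ac)
  also have "r \<^bold>\<sqinter> y = r" using \<open>r \<le> y\<close> by (rule inf_absorb1)
  finally have "r \<^bold>\<sqinter> a = (y \<^bold>\<sqinter> a) \<^bold>\<sqinter> r" ..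
  also have "\<dots> = z" using assms unfolding dsum_def disj_def by (elim conjE)
  finally show ?thesis by (simp only: disj_def)
qed

lemma disj_mono2: "x \<^bold>\<bottom> y \<Longrightarrow> x' \<in> C \<Longrightarrow> y' \<in> C \<Longrightarrow> x' \<le> x \<Longrightarrow> y' \<le> y \<Longrightarrow> x' \<^bold>\<bottom> y'"
  by (rule disj_mono)

text \<open>The element \<open>y\<close> splits into a part off \<open>x \<squnion> w\<close>, a part below \<open>w\<close>, a part below \<open>x\<close>, and a
  part below \<open>x \<squnion> w\<close> disjoint from both, which is the axis of a perspectivity.\<close>

theorem persp_trans_disj:
  assumes "x \<sim> y" "y \<sim> w" "x \<^bold>\<bottom> w"
  shows "x \<sim> w"
proof -
  have c: "x \<in> C" "y \<in> C" "w \<in> C" "x \<^bold>\<squnion> w \<in> C"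
    using persp_closed[OF assms(1)] persp_closed[OF assms(2)] by simp_all
  \<comment> \<open>Quantifying over all parts of \<open>x\<close> and \<open>w\<close> makes
    \<open>T\<close> additive in \<open>y\<close>, so that \<open>y\<close> can be cut into special
    pieces.\<close>
  define T where "T y \<longleftrightarrow> (\<forall>x' w'. x' \<le> x \<longrightarrow> w' \<le> w \<longrightarrow> x' \<sim> y \<longrightarrow> y \<sim> w' \<longrightarrow> x' \<sim> w')" for y
  have TI: "T y" if "\<And>x' w'. x' \<in> C \<Longrightarrow> w' \<in> C \<Longrightarrow> x' \<le> x \<Longrightarrow> w' \<le> w \<Longrightarrow> x' \<^bold>\<bottom> w' \<Longrightarrow> x' \<sim> y \<Longrightarrow> y \<sim> w' \<Longrightarrow> x' \<sim> w'" for y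
    unfolding T_def
  proof (intro allI impI)
    fix x' w' assume *: "x' \<le> x" "w' \<le> w" "x' \<sim> y" "y \<sim> w'"
    have C: "x' \<in> C" "w' \<in> C" using persp_closed[OF *(3)] persp_closed[OF *(4)] by simp_all
    show "x' \<sim> w'" by (rule that[OF C *(1,2) disj_mono[OF assms(3) *(1,2) C] *(3,4)])
  qed
  have T_dsum: "T y" if y: "dsum y y1 y2" "T y1" "T y2" for y y1 y2
  proof (rule TI)
    fix x' w' assume *: "x' \<le> x" "w' \<le> w" "x' \<^bold>\<bottom> w'" "x' \<sim> y" "y \<sim> w'"
    obtain x1 x2 where x: "dsum x' x1 x2" "y1 \<sim> x1" "y2 \<sim> x2" using persp_dsum[OF persp_sym[OF *(4)] y(1)] .
    obtain w1 w2 where w: "dsum w' w1 w2" "y1 \<sim> w1" "y2 \<sim> w2" using persp_dsum[OF *(5) y(1)] .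
    have "x1 \<le> x" "x2 \<le> x" "w1 \<le> w" "w2 \<le> w"
      using dsumD[OF x(1)] dsumD[OF w(1)] *(1,2) by (meson order_trans)+
    then have "x1 \<sim> w1" "x2 \<sim> w2" using y(2,3) x w persp_sym unfolding T_def by blast+
    then show "x' \<sim> w'" using persp_dsum_jn[OF x(1) w(1)] *(3) by simp
  qed
  have "T y'" if y: "y' \<^bold>\<bottom> x \<^bold>\<squnion> w" "y' \<in> C" for y'
  proof (rule TI)
    fix x' w' assume *: "x' \<in> C" "w' \<in> C" "x' \<le> x" "w' \<le> w" "x' \<^bold>\<bottom> w'" "x' \<sim> y'" "y' \<sim> w'"
    have "x' \<^bold>\<squnion> w' \<^bold>\<bottom> y'" using disj_mono[OF y(1) order_refl jn_mono[OF *(3,4)] y(2)] * disj_commute by simp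
    then have "x' \<^bold>\<bottom> w' \<^bold>\<squnion> y'" using * y by (intro disj_jn)
    then show "x' \<sim> w'" using persp_absorb[OF *(6,7)] by (simp add: jn_commute)
  qed
  moreover have "T c" if cc: "c \<le> w" "c \<in> C" for c
  proof (rule TI)
    fix x' w' assume *: "x' \<in> C" "w' \<in> C" "x' \<le> x" "w' \<le> w" "x' \<sim> c" "c \<sim> w'"
    show "x' \<sim> w'" using disj_mono[OF assms(3) *(3) jn_least[OF c(3) cc(1) *(4)]] * cc persp_absorb by simp
  qed
  moreover have "T d" if d: "d \<le> x" "d \<in> C" for d
  proof (rule TI)
    fix x' w' assume *: "x' \<in> C" "w' \<in> C" "x' \<le> x" "w' \<le> w" "x' \<sim> d" "d \<sim> w'"
    have "w' \<^bold>\<bottom> d \<^bold>\<squnion> x'"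
      using disj_mono[OF assms(3) jn_least[OF c(1) d(1) *(3)] *(4)] * d disj_commute by simp
    then show "x' \<sim> w'" using persp_absorb[OF persp_sym[OF *(6)] persp_sym[OF *(5)]] persp_sym by blast
  qed
  moreover have "T e" if e: "e \<in> C" "e \<le> x \<^bold>\<squnion> w" "e \<^bold>\<bottom> x" "e \<^bold>\<bottom> w" for e
  proof (rule TI)
    fix x' w' assume *: "x' \<in> C" "w' \<in> C" "x' \<le> x" "w' \<le> w" "x' \<sim> e" "e \<sim> w'"
    \<comment> \<open>The projections of \<open>e\<close> into \<open>x\<close> from
      \<open>w\<close> and into \<open>w\<close> from \<open>x\<close>. They are perspective to each
      other with axis \<open>e\<close>, and to \<open>e\<close> itself with axes \<open>w\<close>
      and \<open>x\<close>.\<close>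
    let ?x = "x \<^bold>\<sqinter> (e \<^bold>\<squnion> w)" and ?w = "w \<^bold>\<sqinter> (e \<^bold>\<squnion> x)"
    have xw: "?x \<in> C" "?w \<in> C" "?x \<le> x" "?w \<le> w" using c e by simp_all
    have e': "x \<^bold>\<bottom> e" "w \<^bold>\<bottom> e" "w \<^bold>\<bottom> x"
      using e(3,4) assms(3) by (simp_all only: disj_commute[of x e] disj_commute[of w])
    have d: "?x \<^bold>\<bottom> e" "?w \<^bold>\<bottom> e" "?x \<^bold>\<bottom> w" "?w \<^bold>\<bottom> x"
      by (rule disj_mono2[OF e'(1) xw(1) e(1) xw(3) order_refl], rule disj_mono2[OF e'(2) xw(2) e(1) xw(4) order_refl],
        rule disj_mono2[OF assms(3) xw(1) c(3) xw(3) order_refl], rule disj_mono2[OF e'(3) xw(2) c(1) xw(4) order_refl])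
    have "e \<^bold>\<squnion> ?x = (e \<^bold>\<squnion> x) \<^bold>\<sqinter> (e \<^bold>\<squnion> w)" "e \<^bold>\<squnion> ?w = (e \<^bold>\<squnion> w) \<^bold>\<sqinter> (e \<^bold>\<squnion> x)"
      using modular[of e x "e \<^bold>\<squnion> w"] modular[of e w "e \<^bold>\<squnion> x"] c e by simp_all
    then have 1: "?x \<sim> ?w" using d xw e by (intro perspI[of _ _ e]) (simp_all add: jn_commute inf.commute)
    have "w \<^bold>\<squnion> ?x = (w \<^bold>\<squnion> x) \<^bold>\<sqinter> (e \<^bold>\<squnion> w)" "x \<^bold>\<squnion> ?w = (x \<^bold>\<squnion> w) \<^bold>\<sqinter> (e \<^bold>\<squnion> x)"
      using modular[of w x "e \<^bold>\<squnion> w"] modular[of x w "e \<^bold>\<squnion> x"] c e by simp_all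
    moreover have "e \<^bold>\<squnion> w \<le> w \<^bold>\<squnion> x" "e \<^bold>\<squnion> x \<le> x \<^bold>\<squnion> w" using e c by (simp_all add: jn_least jn_commute[of w x])
    ultimately have "?x \<^bold>\<squnion> w = e \<^bold>\<squnion> w" "?w \<^bold>\<squnion> x = e \<^bold>\<squnion> x" by (simp_all add: jn_commute inf_absorb2)
    then have 2: "?x \<sim> e" "?w \<sim> e" using d e xw c
      by (simp_all add: perspI[of ?x e w] perspI[of ?w e x])
    have le: "x' \<^bold>\<squnion> ?x \<le> x" "w' \<^bold>\<squnion> ?w \<le> w" "x' \<^bold>\<squnion> ?x \<in> C" "w' \<^bold>\<squnion> ?w \<in> C"
      using * xw c by (simp_all add: jn_least)
    \<comment> \<open>This zigzag through \<open>e\<close> exchanges \<open>?x\<close> for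
      \<open>x'\<close>; the next one exchanges \<open>?w\<close> for \<open>w'\<close>.\<close>
    have "?w \<sim> x'"
      by (rule persp_zigzag[OF *(5) 2(1) disj_mono2[OF e(3,1) le(3) order_refl le(1)] persp_sym[OF 1]
        disj_mono2[OF d(4) xw(2) le(3) order_refl le(1)]])
    then show "x' \<sim> w'"
      by (intro persp_zigzag[OF persp_sym[OF *(6)] 2(2) disj_mono2[OF e(4,1) le(4) order_refl le(2)] persp_sym[of ?w x']
        disj_mono2[OF assms(3) *(1) le(4) *(3) le(2)]])
  qed
  moreover obtain y' where y': "dsum y (y \<^bold>\<sqinter> (x \<^bold>\<squnion> w)) y'" using dsum_ex[of y "y \<^bold>\<sqinter> (x \<^bold>\<squnion> w)"] c by auto
  moreover define y1 where "y1 = y \<^bold>\<sqinter> (x \<^bold>\<squnion> w)"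
  moreover have y1: "y1 \<in> C" "y1 \<le> x \<^bold>\<squnion> w" using c by (simp_all add: y1_def)
  moreover obtain y2 where y2: "dsum y1 (y1 \<^bold>\<sqinter> w) y2" using dsum_ex[of y1 "y1 \<^bold>\<sqinter> w"] c y1 by auto
  moreover have y2c: "y2 \<in> C" "y2 \<le> y1" using dsumD[OF y2] by auto
  moreover obtain e where e: "dsum y2 (y2 \<^bold>\<sqinter> x) e" using dsum_ex[of y2 "y2 \<^bold>\<sqinter> x"] c y2c by auto
  moreover have ec: "e \<in> C" "e \<le> y2" using dsumD[OF e] by auto
  moreover have "e \<le> x \<^bold>\<squnion> w" using ec y2c y1 by (meson order_trans)
  moreover have "e \<^bold>\<bottom> w" using disj_mono2[OF dsum_inf_disj[OF y2] ec(1) c(3) ec(2)] by simp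
  ultimately have "T (y2 \<^bold>\<sqinter> x)" "T e" "T (y1 \<^bold>\<sqinter> w)" "T y'"
    using dsum_inf_disj[OF e] dsum_inf_disj[OF y'] dsumD[OF y'] c by simp_all
  then have "T y" using T_dsum[OF e] T_dsum[OF y2] T_dsum[OF y'[folded y1_def]] by blast
  then show ?thesis using assms unfolding T_def by blast
qed

text \<open>The inner elements may meet \<open>x\<close> or \<open>v\<close>, so
  \<open>persp_trans_disj\<close> cannot simply be iterated. It handles the part of \<open>y\<close>
  off \<open>v\<close> and, in what is left, the part of \<open>w\<close> off \<open>x\<close>. In
  the remaining piece \<open>y11\<close> lies below \<open>v\<close> and \<open>w11\<close> below
  \<open>x\<close>, a configuration covered by \<open>persp_zigzag\<close>.\<close>

theorem persp_trans3_disj: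
  assumes "x \<sim> y" "y \<sim> w" "w \<sim> v" "x \<^bold>\<bottom> v"
  shows "x \<sim> v"
proof -
  have c: "x \<in> C" "y \<in> C" "w \<in> C" "v \<in> C" using persp_closed[OF assms(1)] persp_closed[OF assms(3)] by auto
  have xv: "x' \<^bold>\<bottom> v'" "v' \<^bold>\<bottom> x'" if "x' \<le> x" "v' \<le> v" "x' \<in> C" "v' \<in> C" for x' v'
    using disj_mono[OF assms(4) that] disj_commute by auto
  obtain y2 where y: "dsum y (y \<^bold>\<sqinter> v) y2" using dsum_ex[of y "y \<^bold>\<sqinter> v"] c by auto
  define y1 where "y1 = y \<^bold>\<sqinter> v"
  note y = y[folded y1_def]
  have y1: "y1 \<in> C" "y1 \<le> v" "y2 \<in> C" "y2 \<^bold>\<bottom> v"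
    using c dsumD[OF y] dsum_inf_disj[OF y[unfolded y1_def]] by (simp_all add: y1_def)
  obtain x1 x2 where x: "dsum x x1 x2" "y1 \<sim> x1" "y2 \<sim> x2" using persp_dsum[OF persp_sym[OF assms(1)] y] .
  obtain w1 w2 where w: "dsum w w1 w2" "y1 \<sim> w1" "y2 \<sim> w2" using persp_dsum[OF assms(2) y] .
  obtain v1 v2 where v: "dsum v v1 v2" "w1 \<sim> v1" "w2 \<sim> v2" using persp_dsum[OF assms(3) w(1)] .
  have c1: "x1 \<in> C" "x2 \<in> C" "x1 \<le> x" "x2 \<le> x" "w1 \<in> C" "v1 \<in> C" "v2 \<in> C" "v1 \<le> v" "v2 \<le> v"
    using dsumD[OF x(1)] dsumD[OF w(1)] dsumD[OF v(1)] by simp_all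
  have "y2 \<sim> v2" using persp_trans_disj[OF w(3) v(3)] disj_mono2[OF y1(4) y1(3) c1(7) order_refl c1(9)] by simp
  then have 2: "x2 \<sim> v2" using persp_trans_disj[OF persp_sym[OF x(3)]] xv c1 by blast
  obtain w12 where w1: "dsum w1 (w1 \<^bold>\<sqinter> x) w12" using dsum_ex[of w1 "w1 \<^bold>\<sqinter> x"] c c1 by auto
  define w11 where "w11 = w1 \<^bold>\<sqinter> x"
  note w1 = w1[folded w11_def]
  have w11: "w11 \<in> C" "w11 \<le> x" "w12 \<in> C" "w12 \<^bold>\<bottom> x"
    using c c1 dsumD[OF w1] dsum_inf_disj[OF w1[unfolded w11_def]] by (simp_all add: w11_def)
  obtain y11 y12 where y': "dsum y1 y11 y12" "w11 \<sim> y11" "w12 \<sim> y12" using persp_dsum[OF persp_sym[OF w(2)] w1] .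
  obtain x11 x12 where x': "dsum x1 x11 x12" "y11 \<sim> x11" "y12 \<sim> x12" using persp_dsum[OF x(2) y'(1)] .
  obtain v11 v12 where v': "dsum v1 v11 v12" "w11 \<sim> v11" "w12 \<sim> v12" using persp_dsum[OF v(2) w1] .
  have c2: "x11 \<in> C" "x12 \<in> C" "v11 \<in> C" "v12 \<in> C" "y11 \<in> C"
    using dsumD[OF x'(1)] dsumD[OF v'(1)] dsumD[OF y'(1)] by simp_all
  have c3: "x11 \<le> x" "x12 \<le> x" "v11 \<le> v" "v12 \<le> v" "y11 \<le> v"
    using dsumD[OF x'(1)] dsumD[OF v'(1)] dsumD[OF y'(1)] c1 y1 by (meson order_trans)+
  have "x12 \<sim> w12"
    using persp_trans_disj[OF persp_sym[OF x'(3)] persp_sym[OF y'(3)]] disj_mono2[OF w11(4,3) c2(2) order_refl c3(2)]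
      disj_commute by blast
  then have 12: "x12 \<sim> v12" using persp_trans_disj[OF _ v'(3)] xv c2 c3 by blast
  have "x11 \<^bold>\<squnion> w11 \<le> x" "x11 \<^bold>\<squnion> w11 \<in> C" using c3 w11 c c2 by (simp_all add: jn_least)
  then have "v11 \<sim> x11"
    using persp_zigzag[OF persp_sym[OF x'(2)] y'(2) _ persp_sym[OF v'(2)]] xv c2 c3 by blast
  then have "x1 \<sim> v1" using persp_dsum_jn[OF x'(1) v'(1) _ 12] persp_sym xv c1 by blast
  then show ?thesis using persp_dsum_jn[OF x(1) v(1) _ 2 assms(4)] by blast
qed

text \<open>With \<open>persp_trans_disj\<close> a test element only has to be disjoint from the
  target, so all elements are admissible.\<close>

lemma absorbs_transp:
  assumes "a \<in> C" "b \<in> C"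
  shows "absorbs UNIV a (a \<^bold>\<squnion> b) (a \<^bold>\<sqinter> b) b" "absorbs UNIV (a \<^bold>\<sqinter> b) b a (a \<^bold>\<squnion> b)"
proof -
  have "v \<sim> w'" if "v \<sim> w" "rep w a (a \<^bold>\<squnion> b)" "rep w' a (a \<^bold>\<squnion> b)" "v \<^bold>\<bottom> w'" for v w w'
    using persp_trans_disj[OF that(1) rep_persp[OF that(2,3) assms(1)] that(4)] .
  then show "absorbs UNIV a (a \<^bold>\<squnion> b) (a \<^bold>\<sqinter> b) b" "absorbs UNIV (a \<^bold>\<sqinter> b) b a (a \<^bold>\<squnion> b)"
    unfolding absorbs_def using rep_transp[OF _ assms] by blast+
qed

text \<open>A decomposition of the representative \<open>y\<close> is a cut of \<open>[c, d]\<close>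
  at \<open>c \<squnion> y1\<close>. The relation carries the cut to \<open>[a, b]\<close>, where it
  decomposes \<open>w\<close>.\<close>

lemma good_rel_dsum:
  assumes g: "good_rel C A X" "X a b c d" and y: "rep y c d" and w: "rep w a b" and s: "dsum y y1 y2"
  obtains a' w1 w2 where "X a a' c (c \<^bold>\<squnion> y1)" "X a' b (c \<^bold>\<squnion> y1) d" "rep y1 c (c \<^bold>\<squnion> y1)" "rep y2 (c \<^bold>\<squnion> y1) d"
    "dsum w w1 w2" "rep w1 a a'" "rep w2 a' b" "a' \<in> C"
proof -
  note D = good_relD[OF g]
  have c: "y \<in> C" "y1 \<in> C" "y2 \<in> C" "y \<^bold>\<bottom> c" "y \<^bold>\<squnion> c = d" "y1 \<^bold>\<bottom> y2" "y = y1 \<^bold>\<squnion> y2" "y1 \<le> y" "y \<le> d"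
    using repD[OF y] s by (auto simp: dsum_def)
  have 1: "rep y1 c (c \<^bold>\<squnion> y1)" using disj_mono2[OF c(4,2) D(3) c(8)] c(2) by (simp add: rep_def jn_commute)
  have "y2 \<^bold>\<bottom> y1 \<^bold>\<squnion> c" using c D(3) disj_commute by (intro disj_jn) (auto simp: jn_commute)
  then have 2: "rep y2 (c \<^bold>\<squnion> y1) d" using c(3) unfolding c(5)[symmetric] c(7) by (simp add: rep_def jn_ac)
  have "c \<^bold>\<squnion> y1 \<le> d" using repD[OF 2] by simp
  then obtain a' where a': "a' \<in> C" "a \<le> a'" "a' \<le> b" "X c (c \<^bold>\<squnion> y1) a a'" "X (c \<^bold>\<squnion> y1) d a' b"
    using good_relD(9)[OF g(1) D(8), of "c \<^bold>\<squnion> y1"] D(3) c(2) by auto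
  have wC: "w \<in> C" using repD[OF w] by simp
  obtain w2 where w2: "dsum w (w \<^bold>\<sqinter> a') w2" using dsum_ex[of w "w \<^bold>\<sqinter> a'"] wC a'(1) by auto
  show thesis
    by (rule that[OF good_relD(8)[OF g(1) a'(4)] good_relD(8)[OF g(1) a'(5)] 1 2 w2
      rep_inf_bottom[OF w D(1) a'(1-3)] rep_dsum[OF w D(1) a'(1-3) w2] a'(1)])
qed

text \<open>With \<open>y\<close> representing the middle interval, the part of \<open>y\<close> off \<open>v\<close> is handled by two successive
  absorptions.  For the part below \<open>v\<close>, the corresponding part of \<open>w\<close> is split in turn by \<open>u\<close>.\<close>

lemma absorbs_trans:
  assumes g: "good_rel C (absorbs UNIV) X" and X: "X a b c d" "X c d e f"
  shows "absorbs UNIV a b e f"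
  unfolding absorbs_def
proof (intro allI impI)
  fix v w u assume w: "rep w a b" and u: "rep u e f" and vw: "v \<sim> w" and vu: "v \<^bold>\<bottom> u"
  note ab = absorbsD[OF good_relD(7)[OF g] UNIV_I] and sym = good_relD(8)[OF g]
  obtain y where y: "rep y c d" using rep_ex good_relD(3,4,6)[OF g X(1)] by blast
  have C: "v \<in> C" "w \<in> C" "y \<in> C" "u \<in> C" using persp_closed[OF vw] repD[OF y] repD[OF u] by auto
  have vu': "v' \<^bold>\<bottom> u'" "u' \<^bold>\<bottom> v'" if "v' \<le> v" "u' \<le> u" "v' \<in> C" "u' \<in> C" for v' u'
    using disj_mono[OF vu that] disj_commute by auto
  obtain y2 where ys: "dsum y (y \<^bold>\<sqinter> v) y2" using dsum_ex[of y "y \<^bold>\<sqinter> v"] C by auto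
  define y1 where "y1 = y \<^bold>\<sqinter> v"
  note ys = ys[folded y1_def]
  have y12: "y1 \<in> C" "y1 \<le> v" "y2 \<in> C" "y2 \<^bold>\<bottom> v"
    using C dsumD[OF ys] dsum_inf_disj[OF ys[unfolded y1_def]] by (simp_all add: y1_def)
  define c' where "c' = c \<^bold>\<squnion> y1"
  obtain a' w1 w2 where I: "X a a' c c'" "X a' b c' d" and y1: "rep y1 c c'" and y2: "rep y2 c' d"
    and ws: "dsum w w1 w2" and w1: "rep w1 a a'" and w2: "rep w2 a' b"
    by (rule good_rel_dsum[OF g X(1) y w ys, folded c'_def]) (rule that)
  obtain e' u1 u2 where K: "X e e' c c'" "X e' f c' d" and us: "dsum u u1 u2" and u1: "rep u1 e e'" and u2: "rep u2 e' f"
    by (rule good_rel_dsum[OF g sym[OF X(2)] y u ys, folded c'_def]) (rule that)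
  obtain v1 v2 where vs: "dsum v v1 v2" "w1 \<sim> v1" "w2 \<sim> v2" using persp_dsum[OF persp_sym[OF vw] ws] .
  have C1: "v1 \<in> C" "v2 \<in> C" "v1 \<le> v" "v2 \<le> v" "u1 \<in> C" "u2 \<in> C" "u1 \<le> u" "u2 \<le> u" "w1 \<in> C"
    using dsumD[OF vs(1)] dsumD[OF us] dsumD[OF ws] by simp_all
  have "v2 \<sim> y2" using ab[OF I(2) w2 y2 persp_sym[OF vs(3)]] disj_mono2[OF y12(4,3) C1(2) order_refl C1(4)]
    disj_commute by blast
  then have 2: "v2 \<sim> u2" using ab[OF sym[OF K(2)] y2 u2] vu' C1 by blast
  \<comment> \<open>\<open>y1\<close> lies below \<open>v\<close>, hence is disjoint from
    \<open>u1\<close> and can serve as its own test element.\<close>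
  have yu: "y1 \<sim> u1" using ab[OF sym[OF K(1)] y1 u1 persp_refl[OF y12(1)]] vu' C1 y12 by blast
  obtain w12 where w1s: "dsum w1 (w1 \<^bold>\<sqinter> u) w12" using dsum_ex[of w1 "w1 \<^bold>\<sqinter> u"] C C1 by auto
  define w11 where "w11 = w1 \<^bold>\<sqinter> u"
  note w1s = w1s[folded w11_def]
  have w112: "w11 \<in> C" "w11 \<le> u" "w12 \<in> C" "w12 \<^bold>\<bottom> u"
    using C C1 dsumD[OF w1s] dsum_inf_disj[OF w1s[unfolded w11_def]] by (simp_all add: w11_def)
  define a'' where "a'' = a \<^bold>\<squnion> w11"
  obtain c'' y11 y12' where J: "X c c'' a a''" "X c'' c' a'' a'" and w11: "rep w11 a a''" and w12: "rep w12 a'' a'"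
    and y1s: "dsum y1 y11 y12'" and y11: "rep y11 c c''" and y12': "rep y12' c'' c'"
    by (rule good_rel_dsum[OF g sym[OF I(1)] w1 y1 w1s, folded a''_def]) (rule that)
  obtain u11 u12 where u1s: "dsum u1 u11 u12" "y11 \<sim> u11" "y12' \<sim> u12" using persp_dsum[OF yu y1s] .
  obtain v11 v12 where v1s: "dsum v1 v11 v12" "w11 \<sim> v11" "w12 \<sim> v12" using persp_dsum[OF vs(2) w1s] .
  have C2: "u11 \<in> C" "u12 \<in> C" "v11 \<in> C" "v12 \<in> C" "y11 \<in> C"
    using dsumD[OF u1s(1)] dsumD[OF v1s(1)] dsumD[OF y1s] by simp_all
  have C3: "u11 \<le> u" "u12 \<le> u" "v11 \<le> v" "v12 \<le> v" "y11 \<le> v"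
    using dsumD[OF u1s(1)] dsumD[OF v1s(1)] dsumD[OF y1s] C1 y12 by (meson order_trans)+
  \<comment> \<open>Now the test element is \<open>u12\<close>, and the target \<open>w12\<close>
    was chosen off \<open>u\<close>.\<close>
  have "u12 \<sim> w12" using ab[OF J(2) y12' w12 persp_sym[OF u1s(3)]]
    disj_mono2[OF w112(4,3) C2(2) order_refl C3(2)] disj_commute by blast
  then have 12: "v12 \<sim> u12" using persp_trans_disj[OF persp_sym[OF v1s(3)] persp_sym] vu' C2 C3 by blast
  \<comment> \<open>\<open>w11\<close> lies below \<open>u\<close> and \<open>y11\<close> below
    \<open>v\<close>, so \<open>w11\<close> tests itself; the sequence \<open>v11\<close>,
    \<open>w11\<close>, \<open>y11\<close>, \<open>u11\<close> is then closed by
    \<open>persp_trans3_disj\<close>.\<close>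
  have "w11 \<sim> y11" using ab[OF sym[OF J(1)] w11 y11 persp_refl[OF w112(1)]] vu' w112 C2 C3 by blast
  then have "v11 \<sim> u11" using persp_trans3_disj[OF persp_sym[OF v1s(2)] _ u1s(2)] vu' C2 C3 by blast
  then have "v1 \<sim> u1" using persp_dsum_jn[OF v1s(1) u1s(1) _ 12] vu' C1 by blast
  then show "v \<sim> u" using persp_dsum_jn[OF vs(1) us _ 2 vu] by blast
qed

end

context relcomp_modular_0 begin

text \<open>Intersection with a relative complement \<open>F\<close> of \<open>t\<close> transports perspectivities over \<open>t\<close> to
  perspectivities over \<open>z\<close>, and join with \<open>t\<close> transports them back.\<close>

lemma absorbs_above:
  assumes t: "t \<in> C" "t \<le> a" "t \<le> e" and c: "a \<in> C" "e \<in> C" and ab: "absorbs UNIV a b e f"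
  shows "relcomp_modular_0.absorbs (above C t) jn t UNIV a b e f"
proof -
  interpret up: relcomp_modular_0 "above C t" jn t by (rule above_relcomp_modular_0[OF t(1)])
  note [simp del, rule del] = up.z_le
  show ?thesis
    unfolding up.absorbs_def
  proof (intro allI impI)
    fix v w u assume w: "up.rep w a b" and u: "up.rep u e f" and vw: "up.persp v w" and vu: "up.disj v u"
    obtain g where g: "up.axis g v w" "g \<le> v \<^bold>\<squnion> w" using up.persp_axis_below[OF vw] by metis
    have C: "v \<in> C" "w \<in> C" "u \<in> C" "g \<in> C" "t \<le> v" "t \<le> w" "t \<le> u" "t \<le> g"
      using up.persp_closed[OF vw] up.repD[OF u] g(1) by (simp_all add: up.axis_def above_iff)
    define M where "M = (v \<^bold>\<squnion> w) \<^bold>\<squnion> u"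
    have M: "M \<in> C" "v \<le> M" "w \<le> M" "u \<le> M" "t \<le> M" "g \<le> M"
      using C g(2) by (simp_all add: M_def le_jnI1)
    obtain F where F: "F \<in> C" "t \<^bold>\<bottom> F" "t \<^bold>\<squnion> F = M" using complement_below[OF t(1) M(1,5)] by blast
    define pr where "pr x = x \<^bold>\<sqinter> F" for x
    have pr_C: "pr x \<in> C" "pr x \<le> F" "pr x \<le> x" if "x \<in> C" for x using that F by (simp_all add: pr_def)
    have restore: "t \<^bold>\<squnion> pr x = x" if "x \<in> C" "t \<le> x" "x \<le> M" for x
      using modular[OF t(1) F(1) that(1,2)] F(3) that(3) by (simp add: pr_def inf.commute[of F] inf_absorb2)
    have pr_inf: "pr x \<^bold>\<bottom> pr y" if "x \<in> C" "y \<in> C" "x \<^bold>\<sqinter> y = t" for x y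
    proof -
      have "pr x \<^bold>\<sqinter> pr y = (x \<^bold>\<sqinter> y) \<^bold>\<sqinter> F" by (simp add: pr_def mt_ac)
      then show ?thesis using that(3) F(2) by (simp add: disj_def)
    qed
    have pr_jn: "pr x \<^bold>\<squnion> pr y = pr (x \<^bold>\<squnion> y)" if "x \<in> C" "t \<le> x" "x \<le> M" "y \<in> C" "t \<le> y" "y \<le> M" for x y
    proof -
      have "x \<^bold>\<squnion> y = (t \<^bold>\<squnion> pr x) \<^bold>\<squnion> (t \<^bold>\<squnion> pr y)" using restore that by simp
      also have "\<dots> = (t \<^bold>\<squnion> t) \<^bold>\<squnion> (pr x \<^bold>\<squnion> pr y)" by (simp only: jn_ac)
      finally have "pr (x \<^bold>\<squnion> y) = ((pr x \<^bold>\<squnion> pr y) \<^bold>\<squnion> t) \<^bold>\<sqinter> F" using t(1) by (simp add: pr_def jn_commute)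
      also have "\<dots> = (pr x \<^bold>\<squnion> pr y) \<^bold>\<squnion> (t \<^bold>\<sqinter> F)" using t(1) F(1) pr_C that by (intro modular jn_least) simp_all
      also have "t \<^bold>\<sqinter> F = z" using F(2) by (simp add: disj_def)
      finally show ?thesis using pr_C that by simp
    qed
    have pr_rep: "rep (pr x) a' b'" if "up.rep x a' b'" "x \<le> M" "a' \<in> C" "t \<le> a'" for x a' b'
    proof -
      have x: "x \<in> C" "t \<le> x" "x \<^bold>\<sqinter> a' = t" "x \<^bold>\<squnion> a' = b'"
        using that(1) by (simp_all add: up.rep_def up.disj_def above_iff)
      have "pr x \<^bold>\<sqinter> a' = (x \<^bold>\<sqinter> a') \<^bold>\<sqinter> F" by (simp add: pr_def mt_ac)
      then have "pr x \<^bold>\<bottom> a'" using x(3) F(2) by (simp add: disj_def)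
      moreover have "pr x \<^bold>\<squnion> a' = (t \<^bold>\<squnion> pr x) \<^bold>\<squnion> a'"
        using jn_absorb2[OF that(3,4)] by (metis jn_assoc jn_commute)
      then have "pr x \<^bold>\<squnion> a' = b'" using restore[OF x(1,2) that(2)] x(4) by simp
      ultimately show ?thesis using pr_C(1)[OF x(1)] by (simp add: rep_def)
    qed
    have g': "v \<^bold>\<sqinter> g = t" "w \<^bold>\<sqinter> g = t" "v \<^bold>\<squnion> g = w \<^bold>\<squnion> g"
      using g(1) by (simp_all add: up.axis_def up.disj_def)
    have "pr v \<sim> pr w"
      using pr_inf[OF C(1,4) g'(1)] pr_inf[OF C(2,4) g'(2)] pr_jn[OF C(1,5) M(2) C(4,8) M(6)]
        pr_jn[OF C(2,6) M(3) C(4,8) M(6)] g'(3) pr_C(1) C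
      by (intro perspI[of _ _ "pr g"]) simp_all
    moreover have "pr v \<^bold>\<bottom> pr u" using vu C by (intro pr_inf) (simp_all add: up.disj_def)
    ultimately have "pr v \<sim> pr u"
      by (rule absorbsD[OF ab UNIV_I pr_rep[OF w M(3) c(1) t(2)] pr_rep[OF u M(4) c(2) t(3)]])
    then obtain h where h: "axis h (pr v) (pr u)" "h \<le> pr v \<^bold>\<squnion> pr u" "h \<in> C" using persp_axis_below by metis
    have "h \<le> F" using h(2) jn_least[OF F(1) pr_C(2)[OF C(1)] pr_C(2)[OF C(3)]] by (rule order_trans)
    have Ft: "F \<^bold>\<bottom> t" using F(2) disj_commute by blast
    have "(pr x \<^bold>\<squnion> t) \<^bold>\<sqinter> (h \<^bold>\<squnion> t) = (pr x \<^bold>\<sqinter> h) \<^bold>\<squnion> t" if "x \<in> C" for x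
      using pr_C[OF that] h(3) \<open>h \<le> F\<close> t(1) F(1) Ft by (intro disj_jn_absorb[of F])
    then have "v \<^bold>\<sqinter> (h \<^bold>\<squnion> t) = t" "u \<^bold>\<sqinter> (h \<^bold>\<squnion> t) = t"
      using h(1) restore[OF C(1,5) M(2)] restore[OF C(3,7) M(4)] C t(1)
      by (metis jn_commute axis_def disj_def jn_z(2))+
    moreover have "v \<^bold>\<squnion> (h \<^bold>\<squnion> t) = (pr v \<^bold>\<squnion> h) \<^bold>\<squnion> (t \<^bold>\<squnion> t)" "u \<^bold>\<squnion> (h \<^bold>\<squnion> t) = (pr u \<^bold>\<squnion> h) \<^bold>\<squnion> (t \<^bold>\<squnion> t)"
      using restore[OF C(1,5) M(2)] restore[OF C(3,7) M(4)] by (metis jn_commute jn_assoc)+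
    then have "v \<^bold>\<squnion> (h \<^bold>\<squnion> t) = u \<^bold>\<squnion> (h \<^bold>\<squnion> t)" using h(1) by (simp add: axis_def)
    ultimately show "up.persp v u"
      using C h(3) t(1) by (intro up.perspI[of _ _ "h \<^bold>\<squnion> t"]) (simp_all add: above_iff up.disj_def)
  qed
qed

end

section \<open>The relation over all common lower bounds\<close>

context relcomp_modular begin

text \<open>Representatives need a bottom, which \<open>C\<close> may lack. Asking for every common
  lower bound lets one bottom below the first terms serve a whole chain, and lets transitivity
  descend to a bound below the middle interval.\<close>

definition glob_rel :: "'b \<Rightarrow> 'b \<Rightarrow> 'b \<Rightarrow> 'b \<Rightarrow> bool"
  where "glob_rel a b c d \<longleftrightarrow> (\<forall>t\<in>C. t \<le> a \<longrightarrow> t \<le> c \<longrightarrow>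
    relcomp_modular_0.absorbs (above C t) jn t UNIV a b c d \<and> relcomp_modular_0.absorbs (above C t) jn t UNIV c d a b)"

lemma glob_relD: "glob_rel a b c d \<Longrightarrow> t \<in> C \<Longrightarrow> t \<le> a \<Longrightarrow> t \<le> c \<Longrightarrow>
    relcomp_modular_0.absorbs (above C t) jn t UNIV a b c d"
  unfolding glob_rel_def by simp

lemma above_above: "t' \<le> t \<Longrightarrow> above (above C t') t = above C t"
  by (auto simp: above_iff)

lemma kernel_dim_glob: "kernel_dim C jn glob_rel"
proof (intro kernel_dim.intro kernel_dim_axioms.intro)
  show "relcomp_modular C jn" by (rule relcomp_modular_axioms)
next
  fix a b assume ab: "a \<in> C" "b \<in> C"
  show "glob_rel a (a \<^bold>\<squnion> b) (a \<^bold>\<sqinter> b) b"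
    unfolding glob_rel_def
  proof (intro ballI impI)
    fix t assume t: "t \<in> C" "t \<le> a" "t \<le> a \<^bold>\<sqinter> b"
    interpret up: relcomp_modular_0 "above C t" jn t by (rule above_relcomp_modular_0[OF t(1)])
    have "a \<in> above C t" "b \<in> above C t" using ab t by (simp_all add: above_iff)
    then show "up.absorbs UNIV a (a \<^bold>\<squnion> b) (a \<^bold>\<sqinter> b) b \<and> up.absorbs UNIV (a \<^bold>\<sqinter> b) b a (a \<^bold>\<squnion> b)"
      using up.absorbs_transp by simp
  qed
next
  fix a b c d assume "glob_rel a b c d" then show "glob_rel c d a b" unfolding glob_rel_def by simp
next
  fix X a b c d e f assume g: "good_rel C glob_rel X" and X: "X a b c d" "X c d e f"
  have *: "relcomp_modular_0.absorbs (above C t) jn t UNIV a b e f"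
    if X: "X a b c d" "X c d e f" and t: "t \<in> C" "t \<le> a" "t \<le> e" for a b c d e f t
  proof -
    note D1 = good_relD[OF g X(1)] and D2 = good_relD[OF g X(2)]
    \<comment> \<open>\<open>t\<close> need not lie below the middle interval. Transitivity is
      obtained over the smaller bound and carried back to \<open>t\<close> by
      \<open>absorbs_above\<close>.\<close>
    let ?t = "t \<^bold>\<sqinter> c"
    have t': "?t \<in> C" "?t \<le> t" using t D1 by simp_all
    have le: "?t \<le> a" "?t \<le> c" "?t \<le> e" using t(2,3) by (auto intro: le_infI1)
    interpret dn: relcomp_modular_0 "above C ?t" jn ?t by (rule above_relcomp_modular_0[OF t'(1)])
    note [simp del, rule del] = dn.z_le
    \<comment> \<open>Restricting \<open>X\<close> to intervals above the new bottom keeps it good,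
      because cuts lie above the lower ends.\<close>
    have "good_rel (above C ?t) (dn.absorbs UNIV) (\<lambda>a b c d. X a b c d \<and> ?t \<le> a \<and> ?t \<le> c)"
      unfolding good_rel_def
    proof (intro allI impI, elim conjE)
      fix a b c' d assume X: "X a b c' d" and le: "?t \<le> a" "?t \<le> c'"
      note D = good_relD[OF g X]
      have "?t \<le> b" "?t \<le> d" using le D(5,6) by (blast intro: order_trans)+
      moreover have "\<exists>f\<in>above C ?t. c' \<le> f \<and> f \<le> d \<and> (X a e c' f \<and> ?t \<le> a \<and> ?t \<le> c') \<and> X e b f d \<and> ?t \<le> e \<and> ?t \<le> f"
        if e: "e \<in> above C ?t" "a \<le> e" "e \<le> b" for e
      proof -
        obtain f where f: "f \<in> C" "c' \<le> f" "f \<le> d" "X a e c' f" "X e b f d"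
          using D(9)[OF _ e(2,3)] e(1) unfolding above_iff by blast
        have "?t \<le> f" using le(2) f(2) by (rule order_trans)
        then show ?thesis using f le e by (intro bexI[of _ f]) (simp_all add: above_iff)
      qed
      moreover have "dn.absorbs UNIV a b c' d" by (rule glob_relD[OF D(7) t'(1) le])
      ultimately show "a \<in> above C ?t \<and> b \<in> above C ?t \<and> c' \<in> above C ?t \<and> d \<in> above C ?t \<and> a \<le> b \<and> c' \<le> d \<and>
        dn.absorbs UNIV a b c' d \<and> (X c' d a b \<and> ?t \<le> c' \<and> ?t \<le> a) \<and> (\<forall>e\<in>above C ?t. a \<le> e \<longrightarrow> e \<le> b \<longrightarrow>
        (\<exists>f\<in>above C ?t. c' \<le> f \<and> f \<le> d \<and> (X a e c' f \<and> ?t \<le> a \<and> ?t \<le> c') \<and> X e b f d \<and> ?t \<le> e \<and> ?t \<le> f))"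
        using D(1-6,8) le by (simp add: above_iff)
    qed
    from dn.absorbs_trans[OF this] have "dn.absorbs UNIV a b e f" using X le by blast
    then have "relcomp_modular_0.absorbs (above (above C ?t) t) jn t UNIV a b e f"
      using t t' D1(1) D2(3) le by (intro dn.absorbs_above) (simp_all add: above_iff)
    then show ?thesis using above_above[OF t'(2)] by simp
  qed
  show "glob_rel a b e f"
    unfolding glob_rel_def
    by (intro ballI impI conjI *[OF X] *[OF good_relD(8)[OF g X(2)] good_relD(8)[OF g X(1)]])
next
  fix X Y y Z y' assume g: "good_rel C glob_rel X" and Y: "chain_in C Y" "seq_lub C Y y"
    and Z: "chain_in C Z" "seq_lub C Z y'" and X: "\<And>n. X (Y n) (Y (Suc n)) (Z n) (Z (Suc n))"
  show "glob_rel (Y 0) y (Z 0) y'"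
    unfolding glob_rel_def
  proof (intro ballI impI)
    fix t assume t: "t \<in> C" "t \<le> Y 0" "t \<le> Z 0"
    interpret up: relcomp_modular_0 "above C t" jn t by (rule above_relcomp_modular_0[OF t(1)])
    note [simp del, rule del] = up.z_le
    have "t \<le> Y n" "t \<le> Z n" for n
      using order_trans[OF t(2) chain_inD(2)[OF Y(1), of 0 n]] order_trans[OF t(3) chain_inD(2)[OF Z(1), of 0 n]] by simp_all
    then have step: "up.absorbs UNIV (Y n) (Y (Suc n)) (Z n) (Z (Suc n))" "up.absorbs UNIV (Z n) (Z (Suc n)) (Y n) (Y (Suc n))" for n
      using glob_relD[OF good_relD(7)[OF g X[of n]] t(1)] glob_relD[OF good_relD(7)[OF g good_relD(8)[OF g X[of n]]] t(1)] by simp_all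
    have Y': "chain_in (above C t) Y" "seq_lub (above C t) Y y" and Z': "chain_in (above C t) Z" "seq_lub (above C t) Z y'"
      using Y Z t chain_in_above[of t Y] chain_in_above[of t Z] seq_lub_above[of t Y] seq_lub_above[of t Z] by simp_all
    show "up.absorbs UNIV (Y 0) y (Z 0) y' \<and> up.absorbs UNIV (Z 0) y' (Y 0) y"
      using up.absorbs_seq_lub[OF UNIV_I Y' Z' step(1)] up.absorbs_seq_lub[OF UNIV_I Z' Y' step(2)] by simp
  qed
qed

end

section \<open>Kernel-related intervals have equal dimension\<close>

context add_dim begin

lemma D_axis:
  assumes "x \<in> C" "y \<in> C" "g \<in> C" "x \<^bold>\<sqinter> g = t" "y \<^bold>\<sqinter> g = t" "x \<^bold>\<squnion> g = y \<^bold>\<squnion> g"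
  shows "D t x = D t y"
  using D_complement[OF assms(1,3,4) HOL.refl] D_complement[OF assms(2,3,5) HOL.refl] assms(6) by simp

text \<open>The sequence below \<open>x\<close> is split into its terms of even and of odd index, with joins \<open>E\<close> and \<open>O\<close>.
  Both \<open>E\<close> and \<open>s \<squnion> E\<close> are perspective to \<open>O\<close>.\<close>

lemma D_absorb_of_persp:
  assumes S: "chain_in C S" "S 0 = t" "seq_lub C S y" and x: "x \<in> C" "y \<le> x" and s: "s \<in> C" "x \<^bold>\<sqinter> s = t"
    and persp: "\<And>i j p q. i < j \<Longrightarrow> relcomp_modular_0.rep (above C t) jn t p (S i) (S (Suc i)) \<Longrightarrow>
      relcomp_modular_0.rep (above C t) jn t q (S j) (S (Suc j)) \<Longrightarrow> relcomp_modular_0.disj t p q \<Longrightarrow>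
      relcomp_modular_0.persp (above C t) jn t p q"
    and persp': "\<And>p. relcomp_modular_0.rep (above C t) jn t p (S (Suc 0)) (S (Suc (Suc 0))) \<Longrightarrow>
      relcomp_modular_0.persp (above C t) jn t s p"
  shows "D t x = D t (x \<^bold>\<squnion> s)"
proof -
  have tC: "t \<in> C" using chain_inD(1)[OF S(1), of 0] S(2) by simp
  interpret up: relcomp_modular_0 "above C t" jn t by (rule above_relcomp_modular_0[OF tC])
  note [simp del, rule del] = up.z_le
  have Sc: "S n \<in> above C t" "S n \<le> S (Suc n)" "y \<in> above C t" for n
    using chain_inD(1)[OF S(1)] chain_in_step[OF S(1)] chain_inD(2)[OF S(1), of 0 n] S(2) seq_lubD[OF S(3)]
      seq_lubD(2)[OF S(3), of 0] by (simp_all add: above_iff)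
  have ts: "t \<le> s" "t \<le> x" using inf_le1[of x s] inf_le2[of x s] s(2) by simp_all
  then have sU: "s \<in> above C t" "x \<in> above C t" using s x by (simp_all add: above_iff)
  have xs: "up.disj x s" using s(2) by (simp add: up.disj_def)
  have S': "chain_in (above C t) S" "seq_lub (above C t) S y"
    using S chain_in_above[of t S] seq_lub_above[of t S] by simp_all
  \<comment> \<open>The terms of even index are kept as a chain; those of odd index become the cut
    points handed to \<open>split_chain_0\<close>.\<close>
  have Y: "chain_in (above C t) (\<lambda>n. S (2 * n))" "S (2 * 0) = t" "seq_lub (above C t) (\<lambda>n. S (2 * n)) y"
  proof -
    show "chain_in (above C t) (\<lambda>n. S (2 * n))"
      using Sc(1) up.chain_inD(2)[OF S'(1)] by (intro up.chain_inI) simp_all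
    show "S (2 * 0) = t" using S(2) by simp
    show "seq_lub (above C t) (\<lambda>n. S (2 * n)) y"
    proof (rule up.seq_lubI)
      fix u assume u: "u \<in> above C t" "\<And>n. S (2 * n) \<le> u"
      have "S n \<le> u" for n using up.chain_inD(2)[OF S'(1), of n "2 * n"] u(2)[of n] by simp
      then show "y \<le> u" by (rule up.seq_lub_least[OF S'(2) u(1)])
    qed (use Sc(3) up.seq_lubD(2)[OF S'(2)] in simp_all)
  qed
  obtain P Q E R where P: "chain_in (above C t) P" "P 0 = t" "seq_lub (above C t) P E"
    and Q: "chain_in (above C t) Q" "Q 0 = t" "seq_lub (above C t) Q R" and ER: "up.disj E R" "E \<^bold>\<squnion> R = y"
    and r: "\<And>n. \<exists>r. up.rep r (P n) (P (Suc n)) \<and> up.rep r (S (2 * n)) (S (Suc (2 * n)))"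
      "\<And>n. \<exists>r. up.rep r (Q n) (Q (Suc n)) \<and> up.rep r (S (Suc (2 * n))) (S (Suc (Suc (2 * n))))"
    using up.split_chain_0[OF Y, of "\<lambda>n. S (Suc (2 * n))"] Sc(1,2) by auto
  obtain p q where p: "\<And>n. up.rep (p n) (P n) (P (Suc n))" "\<And>n. up.rep (p n) (S (2 * n)) (S (Suc (2 * n)))"
    and q: "\<And>n. up.rep (q n) (Q n) (Q (Suc n))" "\<And>n. up.rep (q n) (S (Suc (2 * n))) (S (Suc (Suc (2 * n))))"
    using r by metis
  have c: "E \<in> above C t" "R \<in> above C t" "p n \<in> above C t" "q n \<in> above C t" "P n \<in> above C t" "P n \<le> E" for n
    using up.seq_lubD[OF P(3)] up.seq_lubD(1)[OF Q(3)] up.repD[OF p(1)] up.repD[OF q(1)] up.chain_inD(1)[OF P(1)] by auto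
  have le: "p n \<le> P (Suc n)" "p n \<le> E" "q n \<le> R" for n
    using up.repD[OF p(1)[of n]] up.repD[OF q(1)[of n]] up.seq_lubD(2)[OF P(3), of "Suc n"]
      up.seq_lubD(2)[OF Q(3), of "Suc n"] by (auto intro: order_trans)
  have pq: "up.disj (p i) (q j)" for i j by (rule up.disj_mono[OF ER(1) le(2,3) c(3,4)])
  have Ex: "E \<le> x" "R \<le> x" using x(2) unfolding ER(2)[symmetric] by (meson jn_ge1 jn_ge2 order_trans)+
  have "up.persp E R"
  proof (rule up.persp_seq_lub[OF P Q ER(1)])
    fix n
    have "up.persp (p n) (q n)" using persp[of "2 * n" "Suc (2 * n)"] p(2) q(2) pq by simp
    with p(1) q(1) show "\<exists>p q. up.rep p (P n) (P (Suc n)) \<and> up.rep q (Q n) (Q (Suc n)) \<and> up.persp p q" by blast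
  qed
  moreover have dR: "up.disj (s \<^bold>\<squnion> E) R"
  proof -
    have "up.disj (R \<^bold>\<squnion> E) s" using up.disj_mono[OF xs _ order_refl _ sU(1), of y] x(2) Sc(3) ER(2) by (simp add: jn_commute)
    moreover have "up.disj R E" using ER(1) up.disj_commute by blast
    ultimately have "up.disj R (E \<^bold>\<squnion> s)" using c sU by (intro up.disj_jn)
    then show ?thesis using up.disj_commute by (simp add: jn_commute)
  qed
  \<comment> \<open>\<open>E\<close> and \<open>s \<squnion> E\<close> overlap, so both are compared
    with \<open>R\<close>. The shifted chain is matched with the odd steps: \<open>s\<close> with
    \<open>q 0\<close>, and \<open>p k\<close> with \<open>q (Suc k)\<close>, whose indices
    \<open>2 * k\<close> and \<open>2 * k + 3\<close> are increasing as \<open>persp\<close>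
    requires.\<close>
  have "up.persp (s \<^bold>\<squnion> E) R"
  proof (rule up.persp_seq_lub[OF up.chain_in_case_nat[OF P sU(1) ts(1)] _ up.seq_lub_case_nat[OF P sU(1) ts(1)] Q dR])
    fix n
    show "\<exists>p q. up.rep p (case_nat t (\<lambda>n. s \<^bold>\<squnion> P n) n) (case_nat t (\<lambda>n. s \<^bold>\<squnion> P n) (Suc n)) \<and>
      up.rep q (Q n) (Q (Suc n)) \<and> up.persp p q"
    proof (cases n)
      case 0
      have "up.rep s t (s \<^bold>\<squnion> P 0)" using up.rep_z[OF sU(1)] P(2) sU(1) by simp
      moreover have "up.persp s (q 0)" using persp'[of "q 0"] q(2)[of 0] by simp
      ultimately show ?thesis using q(1)[of 0] 0 by auto
    next
      case (Suc k)
      have "up.disj (p k) (P k)" "P (Suc k) = p k \<^bold>\<squnion> P k" using up.repD[OF p(1)[of k]] by simp_all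
      moreover have "up.disj (P (Suc k)) s"
        using up.disj_mono[OF xs order_trans[OF c(6) Ex(1)] order_refl c(5) sU(1)] .
      ultimately have "up.disj (p k) (P k \<^bold>\<squnion> s)" using c sU by (intro up.disj_jn) simp_all
      then have "up.rep (p k) (s \<^bold>\<squnion> P k) (s \<^bold>\<squnion> P (Suc k))"
        using c(3)[of k] up.repD[OF p(1)[of k]] by (simp add: up.rep_def jn_commute jn_left_commute)
      moreover have "up.persp (p k) (q n)" using persp[of "2 * k" "Suc (2 * n)"] p(2)[of k] q(2)[of n] pq Suc by simp
      ultimately show ?thesis using q(1)[of n] Suc by auto
    qed
  qed simp
  moreover have persp_D: "D t a = D t b" if "up.persp a b" for a b
    using that unfolding up.persp_def up.axis_def up.disj_def above_iff by (elim conjE exE) (rule D_axis)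
  ultimately have "D t E = D t (s \<^bold>\<squnion> E)" by simp
  then have "D t (E \<^bold>\<squnion> R) = D t ((s \<^bold>\<squnion> E) \<^bold>\<squnion> R)"
    using ER(1) dR c(1,2) s(1) by (intro D_add_disj) (simp_all add: up.disj_def above_iff)
  then have "D t y = D t (s \<^bold>\<squnion> y)" using ER(2) by (simp add: jn_assoc)
  then show ?thesis using Sc(3) x s tC by (intro D_absorb_extend[of t x s y]) (simp_all add: above_iff)
qed

text \<open>By cancellation it suffices to treat disjoint intervals, where \<open>glob_rel\<close> is perspectivity, and the
  absorption of a summand that occurs infinitely often.\<close>

theorem kernel_glob_D_eq:
  assumes "kernel C glob_rel a b c d" shows "D a b = D c d"
proof -
  interpret G: kernel_dim C jn glob_rel by (rule kernel_dim_glob)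
  note K = G.KD[OF assms]
  define t where "t = a \<^bold>\<sqinter> c"
  have t: "t \<in> C" "t \<le> a" "t \<le> c" using K by (simp_all add: t_def)
  interpret up: relcomp_modular_0 "above C t" jn t by (rule above_relcomp_modular_0[OF t(1)])
  note [simp del, rule del] = up.z_le
  have U: "a \<in> above C t" "b \<in> above C t" "c \<in> above C t" "d \<in> above C t"
    using K t order_trans[OF t(2) K(5)] order_trans[OF t(3) K(6)] by (simp_all add: above_iff)
  obtain x y where xy: "up.rep x a b" "up.rep y c d" using up.rep_ex[OF U(1,2) K(5)] up.rep_ex[OF U(3,4) K(6)] by blast
  have xyU: "x \<in> above C t" "y \<in> above C t" and xyC: "x \<in> C" "y \<in> C" "t \<le> x" "t \<le> y"
    using up.repD[OF xy(1)] up.repD[OF xy(2)] by (simp_all add: above_iff)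
  have "D a b = D t x" "D c d = D t y" "G.cls a b = G.cls t x" "G.cls c d = G.cls t y"
    using D_complement[of x a t b] D_complement[of y c t d] G.D_complement[of x a t b] G.D_complement[of y c t d]
      xy xyC K by (simp_all add: up.rep_def up.disj_def)
  moreover have "G.cls a b = G.cls c d" using G.cls_eq_iff[OF K(1,2,5)] assms by simp
  ultimately have eq: "G.cls t x = G.cls t y" and goal: "D a b = D c d \<longleftrightarrow> D t x = D t y" by simp_all
  \<comment> \<open>The overlap of \<open>x\<close> and \<open>y\<close>. Cancelling its class
    compares the disjoint parts \<open>p\<close> and \<open>k\<close> up to summands that
    \<open>m\<close> absorbs.\<close>
  define m where "m = x \<^bold>\<sqinter> y"
  have m: "m \<in> above C t" "m \<in> C" "m \<le> x" "m \<le> y" using xyU xyC by (simp_all add: m_def above_iff)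
  obtain p where p: "up.dsum x m p" using up.dsum_ex[OF xyU(1) m(1,3)] .
  obtain k where k: "up.dsum y m k" using up.dsum_ex[OF xyU(2) m(1,4)] .
  have pk: "p \<in> above C t" "k \<in> above C t" "p \<le> x" "k \<le> y" "p \<in> C" "k \<in> C" "up.disj m p" "up.disj m k"
    "x = m \<^bold>\<squnion> p" "y = m \<^bold>\<squnion> k" "t \<le> p" "t \<le> k"
    using p k up.dsumD[OF p] up.dsumD[OF k] by (simp_all add: up.dsum_def above_iff)
  have "G.plus_rel (G.cls t m) (G.cls t p) (G.cls t x)" "G.plus_rel (G.cls t m) (G.cls t k) (G.cls t y)"
    using G.plus_rel_disj[of m p t] G.plus_rel_disj[of m k t] pk m by (simp_all add: up.disj_def)
  then obtain r s s' \<sigma> u \<tau> v where rs: "G.plus_rel r s (G.cls t p)" "G.plus_rel r s' (G.cls t k)"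
    "G.sum_rel (\<lambda>_. s) \<sigma>" "G.plus_rel \<sigma> u (G.cls t m)" "G.sum_rel (\<lambda>_. s') \<tau>" "G.plus_rel \<tau> v (G.cls t m)"
    unfolding eq by (rule G.cancellation) (rule that)
  \<comment> \<open>For disjoint representatives the relation yields perspectivity, since
    \<open>w\<close> may test itself.\<close>
  have persp: "up.persp w w'" if "G.cls a b = G.cls a' b'" "up.rep w a b" "up.rep w' a' b'" "up.disj w w'"
      "a \<in> above C t" "a' \<in> above C t" for w w' a b a' b'
  proof -
    have ab: "a \<in> C" "b \<in> C" "a \<le> b" "t \<le> a" "t \<le> a'" "w \<in> above C t"
      using that(5,6) up.repD[OF that(2)] up.jn_closed[of w a] by (auto simp: above_iff)
    then have "glob_rel a b a' b'" using G.cls_eq_iff[OF ab(1-3), THEN iffD1, OF that(1)] G.KD(7) by blast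
    from up.absorbsD[OF glob_relD[OF this t(1) ab(4,5)] UNIV_I that(2,3) up.persp_refl[OF ab(6)] that(4)]
    show ?thesis .
  qed
  have absorb: "D t m = D t (m \<^bold>\<squnion> w)"
    if w: "w \<in> above C t" "up.disj m w" "G.cls t w = \<alpha>" and sum: "G.sum_rel (\<lambda>_. \<alpha>) \<mu>" "G.plus_rel \<mu> u (G.cls t m)"
    for w \<alpha> \<mu> u
  proof -
    obtain S y where S: "chain_in C S" "S 0 = t" "seq_lub C S y" "y \<le> m" "\<And>n. G.cls (S n) (S (Suc n)) = \<alpha>"
      by (rule G.sum_rel_const_realize[OF sum t(1) m(2)]) (use m(1) in \<open>simp add: above_iff\<close>, rule that)
    have SU: "S n \<in> above C t" "S n \<le> m" for n
      using chain_inD(1)[OF S(1)] chain_inD(2)[OF S(1), of 0 n] S(2) order_trans[OF seq_lubD(2)[OF S(3)] S(4)]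
      by (simp_all add: above_iff)
    show ?thesis
    proof (rule D_absorb_of_persp[OF S(1-3) m(2) S(4)])
      show "w \<in> C" "m \<^bold>\<sqinter> w = t" using w by (simp_all add: above_iff up.disj_def)
      show "up.persp p q" if "up.rep p (S i) (S (Suc i))" "up.rep q (S j) (S (Suc j))" "up.disj p q" for i j p q
        using persp[OF _ that(1-3) SU(1) SU(1)] S(5) by simp
      show "up.persp w p" if p: "up.rep p (S (Suc 0)) (S (Suc (Suc 0)))" for p
      proof (rule persp[OF _ up.rep_z[OF w(1)] p _ up.z_closed SU(1)])
        show "G.cls t w = G.cls (S (Suc 0)) (S (Suc (Suc 0)))" using w(3) S(5) by simp
        have "p \<le> m" using up.repD[OF p] SU(2)[of "Suc (Suc 0)"] by (blast intro: order_trans)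
        then have "up.disj p w" using up.disj_mono[OF w(2) _ order_refl _ w(1)] up.repD[OF p] by blast
        then show "up.disj w p" using up.disj_commute by blast
      qed
    qed
  qed
  obtain r1 s1 where r1: "r1 \<in> C" "s1 \<in> C" "r1 \<^bold>\<sqinter> s1 = t" "r1 \<^bold>\<squnion> s1 = p" "G.cls t r1 = r" "G.cls t s1 = s"
    by (rule G.plus_rel_realize_disj[OF rs(1) t(1) pk(5,11)]) (rule that)
  obtain r2 s2 where r2: "r2 \<in> C" "s2 \<in> C" "r2 \<^bold>\<sqinter> s2 = t" "r2 \<^bold>\<squnion> s2 = k" "G.cls t r2 = r" "G.cls t s2 = s'"
    by (rule G.plus_rel_realize_disj[OF rs(2) t(1) pk(6,12)]) (rule that)
  have c: "r1 \<in> above C t" "s1 \<in> above C t" "r2 \<in> above C t" "s2 \<in> above C t"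
    using r1 r2 inf_le1[of r1 s1] inf_le2[of r1 s1] inf_le1[of r2 s2] inf_le2[of r2 s2] by (simp_all add: above_iff)
  have le: "r1 \<le> p" "s1 \<le> p" "r2 \<le> k" "s2 \<le> k" using r1(4) r2(4) by (metis jn_ge1 jn_ge2)+
  have disj: "up.disj m r1" "up.disj m s1" "up.disj m r2" "up.disj m s2"
    using up.disj_mono[OF pk(7) order_refl _ m(1)] up.disj_mono[OF pk(8) order_refl _ m(1)] le c by auto
  have "up.disj r1 r2"
  proof -
    have "up.disj p m" using pk(7) up.disj_commute by blast
    have "p \<^bold>\<sqinter> k \<le> p \<^bold>\<sqinter> m" unfolding m_def using pk(3,4) by (auto intro: le_infI1 le_infI2)
    also have "\<dots> = t" using \<open>up.disj p m\<close> by (simp add: up.disj_def)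
    finally have "up.disj p k" unfolding up.disj_def using pk by (intro up.eq_zI) (auto simp: above_iff)
    then show ?thesis by (rule up.disj_mono[OF _ le(1,3) c(1,3)])
  qed
  then have "up.persp r1 r2" using r1(5) r2(5) c by (intro persp[of t r1 t r2] up.rep_z) simp_all
  then have r: "D t r1 = D t r2"
    unfolding up.persp_def up.axis_def up.disj_def above_iff by (elim conjE exE) (rule D_axis)
  have 1: "D t m = D t (m \<^bold>\<squnion> s1)" by (rule absorb[OF c(2) disj(2) r1(6) rs(3,4)])
  have 2: "D t m = D t (m \<^bold>\<squnion> s2)" by (rule absorb[OF c(4) disj(4) r2(6) rs(5,6)])
  have "up.disj r1 s1" "up.disj r2 s2" using r1(3) r2(3) by (simp_all only: up.disj_def)
  moreover have "up.disj (r1 \<^bold>\<squnion> s1) m" "up.disj (r2 \<^bold>\<squnion> s2) m"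
    using pk(7,8) unfolding r1(4) r2(4) up.disj_commute[of m] by simp_all
  ultimately have d1: "up.disj r1 (s1 \<^bold>\<squnion> m)" and d2: "up.disj r2 (s2 \<^bold>\<squnion> m)"
    using up.disj_jn[OF c(1,2) m(1)] up.disj_jn[OF c(3,4) m(1)] by simp_all
  have "D t ((m \<^bold>\<squnion> s1) \<^bold>\<squnion> r1) = D t (m \<^bold>\<squnion> r2)"
    using d1 disj 1 r c m by (intro D_add_disj) (simp_all add: up.disj_def above_iff inf.commute jn_commute)
  moreover have "D t ((m \<^bold>\<squnion> s2) \<^bold>\<squnion> r2) = D t (m \<^bold>\<squnion> r2)"
    using d2 disj 2 c m by (intro D_add_disj) (simp_all add: up.disj_def above_iff inf.commute jn_commute)
  moreover have "(m \<^bold>\<squnion> s1) \<^bold>\<squnion> r1 = x" "(m \<^bold>\<squnion> s2) \<^bold>\<squnion> r2 = y"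
    unfolding pk(9,10) r1(4)[symmetric] r2(4)[symmetric] by (simp_all only: jn_ac)
  ultimately have "D t x = D t y" by simp
  then show ?thesis using goal by simp
qed

end

section \<open>Principal ideals\<close>

text \<open>Order and operations are parameters so that one development applies to \<open>L\<close>
  and, with order reversed and operations exchanged, to its dual.\<close>

locale lattice_ops =
  fixes K :: "'a set" and le :: "'a \<Rightarrow> 'a \<Rightarrow> bool" and mt jo :: "'a \<Rightarrow> 'a \<Rightarrow> 'a"
  assumes le_refl: "x \<in> K \<Longrightarrow> le x x"
    and le_antisym: "x \<in> K \<Longrightarrow> y \<in> K \<Longrightarrow> le x y \<Longrightarrow> le y x \<Longrightarrow> x = y"
    and le_trans: "x \<in> K \<Longrightarrow> y \<in> K \<Longrightarrow> w \<in> K \<Longrightarrow> le x y \<Longrightarrow> le y w \<Longrightarrow> le x w"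
    and mt_closed: "x \<in> K \<Longrightarrow> y \<in> K \<Longrightarrow> mt x y \<in> K"
    and jo_closed: "x \<in> K \<Longrightarrow> y \<in> K \<Longrightarrow> jo x y \<in> K"
    and mt_le: "x \<in> K \<Longrightarrow> y \<in> K \<Longrightarrow> le (mt x y) x" "x \<in> K \<Longrightarrow> y \<in> K \<Longrightarrow> le (mt x y) y"
    and mt_greatest: "x \<in> K \<Longrightarrow> y \<in> K \<Longrightarrow> w \<in> K \<Longrightarrow> le w x \<Longrightarrow> le w y \<Longrightarrow> le w (mt x y)"
    and jo_ge: "x \<in> K \<Longrightarrow> y \<in> K \<Longrightarrow> le x (jo x y)" "x \<in> K \<Longrightarrow> y \<in> K \<Longrightarrow> le y (jo x y)"
    and jo_least: "x \<in> K \<Longrightarrow> y \<in> K \<Longrightarrow> w \<in> K \<Longrightarrow> le x w \<Longrightarrow> le y w \<Longrightarrow> le (jo x y) w"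
begin

text \<open>\<open>H\<close> is continuity inside one interval, for an element \<open>a\<close> of
  that interval. An arbitrary \<open>a\<close> is replaced by its meet with \<open>u\<close>, and
  the interval is enlarged downward so as to contain it.\<close>

lemma meet_cont_of_intervals:
  assumes H: "\<And>lo hi B a. lo \<in> K \<Longrightarrow> hi \<in> K \<Longrightarrow> le lo hi \<Longrightarrow> (\<And>n. B n \<in> K) \<Longrightarrow> (\<And>n. le lo (B n)) \<Longrightarrow> (\<And>n. le (B n) hi) \<Longrightarrow>
      (\<And>n. le (B n) (B (Suc n))) \<Longrightarrow> a \<in> K \<Longrightarrow> le lo a \<Longrightarrow> le a hi \<Longrightarrow>
      \<exists>s\<in>K. le s hi \<and> (\<forall>n. le (B n) s) \<and> (\<forall>v\<in>K. le v hi \<longrightarrow> (\<forall>n. le (B n) v) \<longrightarrow> le s v) \<and>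
        (\<forall>v\<in>K. le v hi \<longrightarrow> (\<forall>n. le (mt a (B n)) v) \<longrightarrow> le (mt a s) v)"
    and B: "\<And>n. B n \<in> K" "\<And>n::nat. le (B n) (B (Suc n))" and u: "u \<in> K" "\<And>n. le (B n) u"
  shows "\<exists>s\<in>K. (\<forall>n. le (B n) s) \<and> (\<forall>v\<in>K. (\<forall>n. le (B n) v) \<longrightarrow> le s v) \<and>
        (\<forall>a\<in>K. \<forall>v\<in>K. (\<forall>n. le (mt a (B n)) v) \<longrightarrow> le (mt a s) v)"
proof -
  have B0: "le (B 0) (B n)" for n
    by (induction n) (auto intro: le_refl B le_trans[OF B(1) B(1) B(1)])
  obtain s where s: "s \<in> K" "le s u" "\<And>n. le (B n) s" and least: "\<And>v. v \<in> K \<Longrightarrow> le v u \<Longrightarrow> (\<And>n. le (B n) v) \<Longrightarrow> le s v"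
    using H[of "B 0" u B u, OF B(1)[of 0] u(1) u(2)[of 0] B(1) B0 u(2) B(2) u(1) u(2)[of 0] le_refl[OF u(1)]] by blast
  show ?thesis
  proof (intro bexI[OF _ s(1)] conjI allI ballI impI s(3))
    fix v assume v: "v \<in> K" "\<forall>n. le (B n) v"
    have m: "mt v u \<in> K" using v u mt_closed by simp
    have "le s (mt v u)" using v u B m by (intro least) (simp_all add: mt_le mt_greatest)
    then show "le s v" using le_trans[OF s(1) m v(1)] mt_le(1)[OF v(1) u(1)] by simp
  next
    fix a v assume a: "a \<in> K" and v: "v \<in> K" "\<forall>n. le (mt a (B n)) v"
    \<comment> \<open>\<open>lo\<close> lies below \<open>a'\<close> and below all terms, so
      \<open>[lo, u]\<close> contains everything to which \<open>H\<close> is applied;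
      \<open>w\<close> replaces the bound \<open>v\<close> by one below \<open>u\<close>.\<close>
    define lo a' w where "lo = mt a (B 0)" and "a' = mt a u" and "w = mt v u"
    have c: "lo \<in> K" "a' \<in> K" "w \<in> K" "mt a s \<in> K" "mt a' s \<in> K" "mt a (B n) \<in> K" "mt a' (B n) \<in> K" for n
      unfolding lo_def a'_def w_def using mt_closed a u(1) v(1) B(1) s(1) by simp_all
    have a': "le a' a" "le a' u" and w: "le w v" "le w u"
      unfolding a'_def w_def using mt_le a u(1) v(1) by simp_all
    have lo: "le lo a" "le lo (B 0)" unfolding lo_def using mt_le a B(1) by simp_all
    have lo2: "le lo (B n)" for n using le_trans[OF c(1) B(1) B(1) lo(2) B0] .
    have lo3: "le lo u" using le_trans[OF c(1) B(1) u(1) lo2 u(2)] .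
    have lo4: "le lo a'" unfolding a'_def using mt_greatest[OF a u(1) c(1) lo(1) lo3] .
    obtain t where t: "t \<in> K" "le t u" "\<And>n. le (B n) t" "\<And>v. v \<in> K \<Longrightarrow> le v u \<Longrightarrow> (\<And>n. le (B n) v) \<Longrightarrow> le t v"
      "\<And>v. v \<in> K \<Longrightarrow> le v u \<Longrightarrow> (\<And>n. le (mt a' (B n)) v) \<Longrightarrow> le (mt a' t) v"
      using H[of lo u B a', OF c(1) u(1) lo3 B(1) lo2 u(2) B(2) c(2) lo4 a'(2)] by blast
    \<comment> \<open>The join does not depend on the lower end of the interval in which it is
      formed.\<close>
    have "t = s" using t(1-4) s least by (intro le_antisym) blast+
    have "le (mt a' (B n)) w" for n
      unfolding w_def
    proof (rule mt_greatest[OF v(1) u(1) c(7)])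
      note m = mt_le[OF c(2) B(1)[of n]]
      have "le (mt a' (B n)) (mt a (B n))"
        using le_trans[OF c(7) c(2) a m(1) a'(1)] m(2) by (rule mt_greatest[OF a B(1) c(7)])
      then show "le (mt a' (B n)) v" using v le_trans[OF c(7) c(6) v(1)] by simp
      show "le (mt a' (B n)) u" using le_trans[OF c(7) B(1) u(1) m(2) u(2)] .
    qed
    then have "le (mt a' s) w" using t(5)[OF c(3) w(2)] \<open>t = s\<close> by simp
    then have av: "le (mt a' s) v" using le_trans[OF c(5,3) v(1)] w(1) by simp
    note m = mt_le[OF a s(1)]
    have "le (mt a s) u" using le_trans[OF c(4) s(1) u(1) m(2) s(2)] .
    then have "le (mt a s) a'" unfolding a'_def using mt_greatest[OF a u(1) c(4) m(1)] by simp
    then have "le (mt a s) (mt a' s)" using mt_greatest[OF c(2) s(1) c(4)] m(2) by simp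
    then show "le (mt a s) v" using le_trans[OF c(4,5) v(1)] av by simp
  qed
qed

end

locale interval_lattice_ops = lattice_ops +
  assumes modular_law: "x \<in> K \<Longrightarrow> y \<in> K \<Longrightarrow> w \<in> K \<Longrightarrow> le x w \<Longrightarrow> le (mt (jo x y) w) (jo x (mt y w))"
    and relcompl: "a \<in> K \<Longrightarrow> b \<in> K \<Longrightarrow> x \<in> K \<Longrightarrow> le a x \<Longrightarrow> le x b \<Longrightarrow> \<exists>y\<in>K. mt x y = a \<and> jo x y = b"
    and meet_cont: "(\<And>n. B n \<in> K) \<Longrightarrow> (\<And>n. le (B n) (B (Suc n))) \<Longrightarrow> u \<in> K \<Longrightarrow> (\<And>n. le (B n) u) \<Longrightarrow>
      \<exists>s\<in>K. (\<forall>n. le (B n) s) \<and> (\<forall>v\<in>K. (\<forall>n. le (B n) v) \<longrightarrow> le s v) \<and>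
        (\<forall>a\<in>K. \<forall>v\<in>K. (\<forall>n. le (mt a (B n)) v) \<longrightarrow> le (mt a s) v)"
begin

text \<open>Elements are replaced by the principal ideals they generate, so that order and meet become
  inclusion and intersection, which are total.\<close>

definition down :: "'a \<Rightarrow> 'a set" where "down x = {y \<in> K. le y x}"

definition ideals :: "'a set set" where "ideals = down ` K"

text \<open>The intersection makes sense for arbitrary sets, so that the basic laws of the join hold
  without membership conditions.\<close>

definition ideal_jn :: "'a set \<Rightarrow> 'a set \<Rightarrow> 'a set" where "ideal_jn X Y = \<Inter>{Z \<in> ideals. X \<subseteq> Z \<and> Y \<subseteq> Z}"

lemma down_subset:
  assumes "x \<in> K" "y \<in> K" shows "down x \<subseteq> down y \<longleftrightarrow> le x y"
proof
  assume "down x \<subseteq> down y"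
  moreover have "x \<in> down x" using assms le_refl by (simp add: down_def)
  ultimately show "le x y" by (auto simp: down_def)
next
  assume "le x y"
  then have "le w y" if "w \<in> K" "le w x" for w using le_trans[OF that(1) assms that(2)] by simp
  then show "down x \<subseteq> down y" by (auto simp: down_def)
qed

lemma down_inj: "x \<in> K \<Longrightarrow> y \<in> K \<Longrightarrow> down x = down y \<longleftrightarrow> x = y"
  using down_subset[of x y] down_subset[of y x] le_antisym[of x y] by auto

lemma down_mt:
  assumes "x \<in> K" "y \<in> K" shows "down x \<inter> down y = down (mt x y)"
proof (rule Set.set_eqI)
  fix w
  have "le w x \<and> le w y \<longleftrightarrow> le w (mt x y)" if w: "w \<in> K"
    using mt_greatest[OF assms w] le_trans[OF w mt_closed[OF assms] assms(1) _ mt_le(1)[OF assms]]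
      le_trans[OF w mt_closed[OF assms] assms(2) _ mt_le(2)[OF assms]] by blast
  then show "w \<in> down x \<inter> down y \<longleftrightarrow> w \<in> down (mt x y)" by (auto simp: down_def)
qed

lemma down_ideals: "x \<in> K \<Longrightarrow> down x \<in> ideals"
  by (simp add: ideals_def)

lemma down_jo:
  assumes "x \<in> K" "y \<in> K" shows "ideal_jn (down x) (down y) = down (jo x y)"
proof
  show "ideal_jn (down x) (down y) \<subseteq> down (jo x y)"
    unfolding ideal_jn_def using assms jo_closed jo_ge by (intro Inter_lower) (simp add: down_subset down_ideals)
  show "down (jo x y) \<subseteq> ideal_jn (down x) (down y)"
    unfolding ideal_jn_def
  proof (rule Inter_greatest)
    fix Z assume "Z \<in> {Z \<in> ideals. down x \<subseteq> Z \<and> down y \<subseteq> Z}"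
    then obtain w where "w \<in> K" "Z = down w" "down x \<subseteq> Z" "down y \<subseteq> Z" by (auto simp: ideals_def)
    then show "down (jo x y) \<subseteq> Z" using assms jo_closed jo_least by (simp add: down_subset)
  qed
qed

lemma ideal_jn_le_iff: "Z \<in> ideals \<Longrightarrow> ideal_jn X Y \<subseteq> Z \<longleftrightarrow> X \<subseteq> Z \<and> Y \<subseteq> Z"
proof -
  assume Z: "Z \<in> ideals"
  have "X \<subseteq> ideal_jn X Y" "Y \<subseteq> ideal_jn X Y" by (auto simp: ideal_jn_def)
  moreover have "ideal_jn X Y \<subseteq> Z" if "X \<subseteq> Z" "Y \<subseteq> Z"
    unfolding ideal_jn_def using Z that by (intro Inter_lower) simp
  ultimately show ?thesis by blast
qed

lemma relcomp_modular_ideals: "relcomp_modular ideals ideal_jn"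
proof unfold_locales
  show "X \<inter> Y \<in> ideals" "ideal_jn X Y \<in> ideals" if "X \<in> ideals" "Y \<in> ideals" for X Y
    using that mt_closed jo_closed by (auto simp: ideals_def down_mt down_jo)
  show "ideal_jn X Y = ideal_jn Y X" for X Y unfolding ideal_jn_def by (simp add: conj_commute)
  show "ideal_jn (ideal_jn X Y) W = ideal_jn X (ideal_jn Y W)" for X Y W
  proof -
    have "(Z \<in> ideals \<and> ideal_jn X Y \<subseteq> Z \<and> W \<subseteq> Z) = (Z \<in> ideals \<and> X \<subseteq> Z \<and> ideal_jn Y W \<subseteq> Z)" for Z
      using ideal_jn_le_iff[of Z X Y] ideal_jn_le_iff[of Z Y W] by blast
    then have "\<Inter>{Z \<in> ideals. ideal_jn X Y \<subseteq> Z \<and> W \<subseteq> Z} = \<Inter>{Z \<in> ideals. X \<subseteq> Z \<and> ideal_jn Y W \<subseteq> Z}" by simp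
    then show ?thesis unfolding ideal_jn_def[of "ideal_jn X Y"] ideal_jn_def[of X "ideal_jn Y W"] .
  qed
  show "X \<subseteq> ideal_jn X Y" for X Y unfolding ideal_jn_def by blast
  show "ideal_jn X Y \<subseteq> W" if "W \<in> ideals" "X \<subseteq> W" "Y \<subseteq> W" for X Y W using that ideal_jn_le_iff by simp
  show "ideal_jn X Y \<subseteq> ideal_jn X' Y'" if "X \<subseteq> X'" "Y \<subseteq> Y'" for X Y X' Y' using that unfolding ideal_jn_def by blast
  show "ideal_jn X Y \<inter> W \<subseteq> ideal_jn X (Y \<inter> W)" if XYW: "X \<in> ideals" "Y \<in> ideals" "W \<in> ideals" "X \<subseteq> W" for X Y W
  proof -
    obtain x y w where "x \<in> K" "y \<in> K" "w \<in> K" "X = down x" "Y = down y" "W = down w"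
      using XYW(1-3) by (auto simp: ideals_def)
    then show ?thesis using XYW(4) modular_law mt_closed jo_closed by (simp add: down_jo down_mt down_subset)
  qed
  show "\<exists>Y\<in>ideals. X \<inter> Y = A \<and> ideal_jn X Y = B" if ABX: "A \<in> ideals" "B \<in> ideals" "X \<in> ideals" "A \<subseteq> X" "X \<subseteq> B" for A B X
  proof -
    obtain a b x where *: "a \<in> K" "b \<in> K" "x \<in> K" "A = down a" "B = down b" "X = down x"
      using ABX(1-3) by (auto simp: ideals_def)
    then obtain y where "y \<in> K" "mt x y = a" "jo x y = b" using relcompl[of a b x] ABX(4,5) by (auto simp: down_subset)
    then show ?thesis using * by (intro bexI[of _ "down y"]) (simp_all add: down_mt down_jo down_ideals)
  qed
  show "\<exists>s. seq_lub ideals Y s \<and> (\<forall>a\<in>ideals. seq_lub ideals (\<lambda>n. a \<inter> Y n) (a \<inter> s))"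
    if Y: "chain_in ideals Y" "u \<in> ideals" "\<And>n. Y n \<subseteq> u" for Y u
  proof -
    have "\<exists>x. x \<in> K \<and> Y n = down x" for n using Y(1) by (auto simp: chain_in_def ideals_def)
    then obtain b where b: "\<And>n. b n \<in> K" "\<And>n. Y n = down (b n)" by metis
    obtain v where v: "v \<in> K" "u = down v" using Y(2) by (auto simp: ideals_def)
    have le1: "le (b n) (b (Suc n))" for n
      using Y(1) b monoD[of Y n "Suc n"] by (simp add: chain_in_def down_subset)
    have le2: "le (b n) v" for n using Y(3)[of n] b v by (simp add: down_subset)
    obtain s where s: "s \<in> K" "\<forall>n. le (b n) s" "\<forall>v\<in>K. (\<forall>n. le (b n) v) \<longrightarrow> le s v"
      "\<forall>a\<in>K. \<forall>v\<in>K. (\<forall>n. le (mt a (b n)) v) \<longrightarrow> le (mt a s) v"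
      using meet_cont[of b, OF b(1) le1 v(1) le2] by (elim bexE conjE) (rule that)
    have sl: "seq_lub ideals Y (down s)"
      unfolding seq_lub_def
    proof (intro conjI allI ballI impI)
      show "down s \<in> ideals" using s(1) by (rule down_ideals)
      show "Y n \<subseteq> down s" for n using s(1,2) b by (simp add: down_subset)
      fix U assume U: "U \<in> ideals" "\<forall>n. Y n \<subseteq> U"
      obtain w where w: "w \<in> K" "U = down w" using U(1) by (auto simp: ideals_def)
      then have "le (b n) w" for n using U(2) b down_subset[of "b n" w] by simp
      then show "down s \<subseteq> U" using s(1,3) w by (simp add: down_subset)
    qed
    moreover have "seq_lub ideals (\<lambda>n. A \<inter> Y n) (A \<inter> down s)" if "A \<in> ideals" for A
    proof -
      obtain a where a: "a \<in> K" "A = down a" using \<open>A \<in> ideals\<close> by (auto simp: ideals_def)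
      show ?thesis
        unfolding seq_lub_def
      proof (intro conjI allI ballI impI)
        show "A \<inter> down s \<in> ideals" using a s(1) mt_closed by (simp add: down_mt down_ideals)
        have "Y n \<subseteq> down s" for n using sl by (simp add: seq_lub_def)
        then show "A \<inter> Y n \<subseteq> A \<inter> down s" for n by blast
        fix U assume U: "U \<in> ideals" "\<forall>n. A \<inter> Y n \<subseteq> U"
        obtain w where w: "w \<in> K" "U = down w" using U(1) by (auto simp: ideals_def)
        have "down (mt a (b n)) \<subseteq> down w" for n using U(2) unfolding a(2) w(2) b(2) by (simp add: down_mt a(1) b(1))
        then have "le (mt a (b n)) w" for n using down_subset[OF mt_closed[OF a(1) b(1)] w(1)] by simp
        then have "le (mt a s) w" using s(4) a(1) w(1) by simp
        then show "A \<inter> down s \<subseteq> U" using a s(1) w mt_closed by (simp add: down_mt down_subset)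
      qed
    qed
    ultimately show ?thesis by blast
  qed
qed

end

section \<open>Infinite sums in refinement monoids\<close>

text \<open>\<open>I\<close> stands for the classes of single intervals and \<open>S\<close> for the
  sums read off chains. The remainder condition is known for sequences that start in the generating
  set \<open>I\<close>, which is why \<open>S\<close> is extended to \<open>sums\<close>
  below.\<close>

locale partial_sum_monoid = comm_monoid M for M (structure) +
  fixes I :: "'a set" and S :: "(nat \<Rightarrow> 'a) \<Rightarrow> 'a \<Rightarrow> bool"
  assumes I_subset: "I \<subseteq> carrier M" and one_I: "\<one> \<in> I"
    and refinement: "a \<in> carrier M \<Longrightarrow> b \<in> carrier M \<Longrightarrow> c \<in> carrier M \<Longrightarrow> d \<in> carrier M \<Longrightarrow> a \<otimes> b = c \<otimes> d \<Longrightarrow>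
      \<exists>p\<in>carrier M. \<exists>q\<in>carrier M. \<exists>r\<in>carrier M. \<exists>s\<in>carrier M. a = p \<otimes> q \<and> b = r \<otimes> s \<and> c = p \<otimes> r \<and> d = q \<otimes> s"
    and generated: "x \<in> carrier M \<Longrightarrow> (\<And>x. x \<in> I \<Longrightarrow> R x) \<Longrightarrow>
      (\<And>x y. x \<in> carrier M \<Longrightarrow> y \<in> carrier M \<Longrightarrow> R x \<Longrightarrow> R y \<Longrightarrow> R (x \<otimes> y)) \<Longrightarrow> R x"
    and S_closed: "S f c \<Longrightarrow> c \<in> carrier M \<and> (\<forall>n. f n \<in> carrier M)"
    and S_unique: "S f c \<Longrightarrow> S f d \<Longrightarrow> c = d"
    and S_Suc: "S f c \<Longrightarrow> \<exists>t. S (\<lambda>n. f (Suc n)) t \<and> c = f 0 \<otimes> t"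
    and S_mult: "(\<And>n. f n \<in> carrier M) \<Longrightarrow> (\<And>n. g n \<in> carrier M) \<Longrightarrow> S (\<lambda>n. f n \<otimes> g n) c \<Longrightarrow>
      \<exists>s t. S f s \<and> S g t \<and> c = s \<otimes> t"
    and S_refine: "a \<in> carrier M \<Longrightarrow> b \<in> carrier M \<Longrightarrow> S h (a \<otimes> b) \<Longrightarrow>
      \<exists>f g. S f a \<and> S g b \<and> (\<forall>n. h n = f n \<otimes> g n)"
    and S_remainder: "(\<And>n. f n \<in> carrier M) \<Longrightarrow> (\<And>n. g n \<in> carrier M) \<Longrightarrow> f 0 \<in> I \<Longrightarrow> (\<And>n. f n = g n \<otimes> f (Suc n)) \<Longrightarrow>
      \<exists>a\<in>carrier M. \<forall>n. \<exists>s. S (\<lambda>k. g (n + k)) s \<and> f n = a \<otimes> s"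
begin

lemma refinement_seq:
  assumes c: "\<And>n. a n \<in> carrier M" "\<And>n. b n \<in> carrier M" "\<And>n. c n \<in> carrier M" "\<And>n. d n \<in> carrier M"
    and eq: "\<And>n. a n \<otimes> b n = c n \<otimes> d n"
  obtains p q r s where "\<And>n :: nat. p n \<in> carrier M" "\<And>n. q n \<in> carrier M" "\<And>n. r n \<in> carrier M" "\<And>n. s n \<in> carrier M"
    "\<And>n. a n = p n \<otimes> q n" "\<And>n. b n = r n \<otimes> s n" "\<And>n. c n = p n \<otimes> r n" "\<And>n. d n = q n \<otimes> s n"
proof -
  have "\<forall>n. \<exists>v. fst v \<in> carrier M \<and> fst (snd v) \<in> carrier M \<and> fst (snd (snd v)) \<in> carrier M \<and> snd (snd (snd v)) \<in> carrier M \<and>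
    a n = fst v \<otimes> fst (snd v) \<and> b n = fst (snd (snd v)) \<otimes> snd (snd (snd v)) \<and>
    c n = fst v \<otimes> fst (snd (snd v)) \<and> d n = fst (snd v) \<otimes> snd (snd (snd v))"
  proof
    fix n
    obtain p q r s where "p \<in> carrier M" "q \<in> carrier M" "r \<in> carrier M" "s \<in> carrier M"
      "a n = p \<otimes> q" "b n = r \<otimes> s" "c n = p \<otimes> r" "d n = q \<otimes> s"
      using refinement[OF c eq[of n]] by (elim bexE conjE) (rule that)
    then show "\<exists>v. fst v \<in> carrier M \<and> fst (snd v) \<in> carrier M \<and> fst (snd (snd v)) \<in> carrier M \<and> snd (snd (snd v)) \<in> carrier M \<and>
      a n = fst v \<otimes> fst (snd v) \<and> b n = fst (snd (snd v)) \<otimes> snd (snd (snd v)) \<and>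
      c n = fst v \<otimes> fst (snd (snd v)) \<and> d n = fst (snd v) \<otimes> snd (snd (snd v))"
      by (intro exI[of _ "(p, q, r, s)"]) simp
  qed
  from choice[OF this] show thesis
    by (elim exE) (rule that[of "\<lambda>n. fst (_ n)" "\<lambda>n. fst (snd (_ n))" "\<lambda>n. fst (snd (snd (_ n)))" "\<lambda>n. snd (snd (snd (_ n)))"]; blast)
qed

inductive sums :: "(nat \<Rightarrow> 'a) \<Rightarrow> 'a \<Rightarrow> bool" where
  base: "S f c \<Longrightarrow> sums f c"
| mult: "sums f c \<Longrightarrow> sums g d \<Longrightarrow> sums (\<lambda>n. f n \<otimes> g n) (c \<otimes> d)"

lemma sums_closed: "sums f c \<Longrightarrow> c \<in> carrier M \<and> (\<forall>n. f n \<in> carrier M)"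
  by (induction rule: sums.induct) (auto dest: S_closed)

lemma sums_Suc: "sums f c \<Longrightarrow> \<exists>t. sums (\<lambda>n. f (Suc n)) t \<and> c = f 0 \<otimes> t"
proof (induction rule: sums.induct)
  case (base f c) then show ?case using S_Suc sums.base by blast
next
  case (mult f c g d)
  then obtain s t where "sums (\<lambda>n. f (Suc n)) s" "c = f 0 \<otimes> s" "sums (\<lambda>n. g (Suc n)) t" "d = g 0 \<otimes> t" by blast
  moreover from this have "c \<otimes> d = (f 0 \<otimes> g 0) \<otimes> (s \<otimes> t)"
    using sums_closed[OF mult(1)] sums_closed[OF mult(2)] sums_closed[of _ s] sums_closed[of _ t] by (auto simp: m_ac)
  ultimately show ?case using sums.mult by blast
qed

text \<open>If the series is a termwise product of \<open>h1\<close> and \<open>h2\<close>, termwise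
  refinement against \<open>f n \<otimes> g n\<close> yields four series, two for each of
  \<open>h1\<close> and \<open>h2\<close>, to which the induction hypotheses apply.\<close>

lemma sums_mult:
  "sums h c \<Longrightarrow> (\<And>n. f n \<in> carrier M) \<Longrightarrow> (\<And>n. g n \<in> carrier M) \<Longrightarrow> (\<And>n. h n = f n \<otimes> g n) \<Longrightarrow>
    \<exists>s t. sums f s \<and> sums g t \<and> c = s \<otimes> t"
proof (induction arbitrary: f g rule: sums.induct)
  case (base h c)
  have "h = (\<lambda>n. f n \<otimes> g n)" using base(4) by (rule ext)
  then have "S (\<lambda>n. f n \<otimes> g n) c" using base(1) by simp
  then show ?case using S_mult base(2,3) sums.base by blast
next
  case (mult h1 c1 h2 c2)
  note cl = sums_closed[OF mult(1)] sums_closed[OF mult(2)]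
  obtain p q r s where pq: "\<And>n. p n \<in> carrier M" "\<And>n. q n \<in> carrier M" "\<And>n. r n \<in> carrier M" "\<And>n. s n \<in> carrier M"
    and eq: "\<And>n. f n = p n \<otimes> q n" "\<And>n. g n = r n \<otimes> s n" "\<And>n. h1 n = p n \<otimes> r n" "\<And>n. h2 n = q n \<otimes> s n"
    by (rule refinement_seq[of f g h1 h2]) (use mult(5-7) cl that in auto)
  obtain P R where 1: "sums p P" "sums r R" "c1 = P \<otimes> R" using mult(3)[OF pq(1,3) eq(3)] by blast
  obtain Q T where 2: "sums q Q" "sums s T" "c2 = Q \<otimes> T" using mult(4)[OF pq(2,4) eq(4)] by blast
  have "f = (\<lambda>n. p n \<otimes> q n)" "g = (\<lambda>n. r n \<otimes> s n)" using eq by auto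
  then have "sums f (P \<otimes> Q)" "sums g (R \<otimes> T)" using sums.mult 1 2 by simp_all
  moreover have "c1 \<otimes> c2 = (P \<otimes> Q) \<otimes> (R \<otimes> T)"
    using sums_closed[OF 1(1)] sums_closed[OF 1(2)] sums_closed[OF 2(1)] sums_closed[OF 2(2)]
    by (simp add: 1(3) 2(3) m_ac)
  ultimately show ?case by blast
qed

text \<open>\<open>S_mult\<close> cuts a sum given by \<open>S\<close> along the construction of the
  same series in \<open>sums\<close>, so the totals are compared factor by factor.\<close>

lemma S_sums_unique: "sums f d \<Longrightarrow> S f c \<Longrightarrow> c = d"
proof (induction arbitrary: c rule: sums.induct)
  case (base f d) then show ?case using S_unique by blast
next
  case (mult f c1 g c2)
  obtain s t where "S f s" "S g t" "c = s \<otimes> t"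
    using S_mult[OF _ _ mult(5)] sums_closed[OF mult(1)] sums_closed[OF mult(2)] by blast
  then show ?case using mult(3,4) by simp
qed

lemma sums_unique: "sums f c \<Longrightarrow> sums f d \<Longrightarrow> c = d"
proof (induction arbitrary: d rule: sums.induct)
  case (base f c) then show ?case using S_sums_unique by blast
next
  case (mult f c1 g c2)
  obtain s t where "sums f s" "sums g t" "d = s \<otimes> t"
    using sums_mult[OF mult(5)] sums_closed[OF mult(1)] sums_closed[OF mult(2)] by blast
  then show ?case using mult(3,4) by simp
qed

text \<open>Refining the two factorizations of the total reduces a product of series to its
  factors.\<close>

lemma sums_refine: "sums h c \<Longrightarrow> a \<in> carrier M \<Longrightarrow> b \<in> carrier M \<Longrightarrow> c = a \<otimes> b \<Longrightarrow>
    \<exists>f g. sums f a \<and> sums g b \<and> (\<forall>n. h n = f n \<otimes> g n)"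
proof (induction arbitrary: a b rule: sums.induct)
  case (base h c) then show ?case using S_refine sums.base by metis
next
  case (mult h1 c1 h2 c2)
  note cl = sums_closed[OF mult(1)] sums_closed[OF mult(2)]
  obtain p q r s where pq: "p \<in> carrier M" "q \<in> carrier M" "r \<in> carrier M" "s \<in> carrier M"
    and eq: "a = p \<otimes> q" "b = r \<otimes> s" "c1 = p \<otimes> r" "c2 = q \<otimes> s"
    using refinement[OF mult(5,6) conjunct1[OF cl(1)] conjunct1[OF cl(2)] mult(7)[symmetric]]
    by (elim bexE conjE) (rule that)
  obtain f1 g1 where 1: "sums f1 p" "sums g1 r" "\<And>n. h1 n = f1 n \<otimes> g1 n" using mult(3)[OF pq(1,3) eq(3)] by blast
  obtain f2 g2 where 2: "sums f2 q" "sums g2 s" "\<And>n. h2 n = f2 n \<otimes> g2 n" using mult(4)[OF pq(2,4) eq(4)] by blast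
  have "h1 n \<otimes> h2 n = (f1 n \<otimes> f2 n) \<otimes> (g1 n \<otimes> g2 n)" for n
    using sums_closed[OF 1(1)] sums_closed[OF 1(2)] sums_closed[OF 2(1)] sums_closed[OF 2(2)]
    by (simp add: 1(3) 2(3) m_ac)
  then show ?case unfolding eq(1,2) using sums.mult[OF 1(1) 2(1)] sums.mult[OF 1(2) 2(2)] by blast
qed

text \<open>Induction on the generation of \<open>f 0\<close>. For a product
  \<open>x \<otimes> y\<close>, repeated refinement splits the whole sequence into one starting at
  \<open>x\<close> and one starting at \<open>y\<close>.\<close>

lemma sums_remainder:
  assumes "x \<in> carrier M" "\<And>n. f n \<in> carrier M" "\<And>n. g n \<in> carrier M" "f 0 = x" "\<And>n. f n = g n \<otimes> f (Suc n)"
  shows "\<exists>a\<in>carrier M. \<forall>n. \<exists>s. sums (\<lambda>k. g (n + k)) s \<and> f n = a \<otimes> s"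
proof -
  have "\<forall>f g. (\<forall>n. f n \<in> carrier M) \<longrightarrow> (\<forall>n. g n \<in> carrier M) \<longrightarrow> f 0 = x \<longrightarrow> (\<forall>n. f n = g n \<otimes> f (Suc n)) \<longrightarrow>
    (\<exists>a\<in>carrier M. \<forall>n. \<exists>s. sums (\<lambda>k. g (n + k)) s \<and> f n = a \<otimes> s)"
    using assms(1)
  proof (rule generated)
    fix x assume "x \<in> I"
    then show "\<forall>f g. (\<forall>n. f n \<in> carrier M) \<longrightarrow> (\<forall>n. g n \<in> carrier M) \<longrightarrow> f 0 = x \<longrightarrow> (\<forall>n. f n = g n \<otimes> f (Suc n)) \<longrightarrow>
      (\<exists>a\<in>carrier M. \<forall>n. \<exists>s. sums (\<lambda>k. g (n + k)) s \<and> f n = a \<otimes> s)"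
    proof (intro allI impI)
      fix f g assume "\<forall>n. f n \<in> carrier M" "\<forall>n. g n \<in> carrier M" "f 0 = x" "\<forall>n. f n = g n \<otimes> f (Suc n)"
      then obtain a where "a \<in> carrier M" "\<forall>n. \<exists>s. S (\<lambda>k. g (n + k)) s \<and> f n = a \<otimes> s"
        using S_remainder[of f g] \<open>x \<in> I\<close> by blast
      then show "\<exists>a\<in>carrier M. \<forall>n. \<exists>s. sums (\<lambda>k. g (n + k)) s \<and> f n = a \<otimes> s" using sums.base by blast
    qed
  next
    fix x y assume xy: "x \<in> carrier M" "y \<in> carrier M"
      and IHx: "\<forall>f g. (\<forall>n. f n \<in> carrier M) \<longrightarrow> (\<forall>n. g n \<in> carrier M) \<longrightarrow> f 0 = x \<longrightarrow> (\<forall>n. f n = g n \<otimes> f (Suc n)) \<longrightarrow>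
      (\<exists>a\<in>carrier M. \<forall>n. \<exists>s. sums (\<lambda>k. g (n + k)) s \<and> f n = a \<otimes> s)"
      and IHy: "\<forall>f g. (\<forall>n. f n \<in> carrier M) \<longrightarrow> (\<forall>n. g n \<in> carrier M) \<longrightarrow> f 0 = y \<longrightarrow> (\<forall>n. f n = g n \<otimes> f (Suc n)) \<longrightarrow>
      (\<exists>a\<in>carrier M. \<forall>n. \<exists>s. sums (\<lambda>k. g (n + k)) s \<and> f n = a \<otimes> s)"
    show "\<forall>f g. (\<forall>n. f n \<in> carrier M) \<longrightarrow> (\<forall>n. g n \<in> carrier M) \<longrightarrow> f 0 = x \<otimes> y \<longrightarrow> (\<forall>n. f n = g n \<otimes> f (Suc n)) \<longrightarrow>
      (\<exists>a\<in>carrier M. \<forall>n. \<exists>s. sums (\<lambda>k. g (n + k)) s \<and> f n = a \<otimes> s)"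
    proof (intro allI impI)
      fix f g assume fg: "\<forall>n. f n \<in> carrier M" "\<forall>n. g n \<in> carrier M" "f 0 = x \<otimes> y" "\<forall>n. f n = g n \<otimes> f (Suc n)"
      define ok where "ok n v = (fst v \<in> carrier M \<and> snd v \<in> carrier M \<and> f n = fst v \<otimes> snd v \<and> (n = 0 \<longrightarrow> v = (x, y)))" for n :: nat and v
      define step where "step n v v' = (\<exists>p\<in>carrier M. \<exists>q\<in>carrier M. g n = p \<otimes> q \<and> fst v = p \<otimes> fst v' \<and> snd v = q \<otimes> snd v')" for n :: nat and v v'
      have "\<exists>V. \<forall>n. ok n (V n) \<and> step n (V n) (V (Suc n))"
      proof (rule dependent_nat_choice)
        show "\<exists>v. ok 0 v" using xy fg(3) by (intro exI[of _ "(x, y)"]) (simp add: ok_def)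
        fix v n assume v: "ok n v"
        then have v': "fst v \<in> carrier M" "snd v \<in> carrier M" "f n = fst v \<otimes> snd v" by (simp_all add: ok_def)
        have "g n \<otimes> f (Suc n) = f n" using spec[OF fg(4), of n] by (rule HOL.sym)
        also note v'(3)
        finally have vc: "g n \<otimes> f (Suc n) = fst v \<otimes> snd v" .
        obtain p q r s where pq: "p \<in> carrier M" "q \<in> carrier M" and rs: "r \<in> carrier M" "s \<in> carrier M"
          and eq: "g n = p \<otimes> q" "f (Suc n) = r \<otimes> s" "fst v = p \<otimes> r" "snd v = q \<otimes> s"
          using refinement[OF spec[OF fg(2)] spec[OF fg(1)] v'(1,2) vc] by (elim bexE conjE) (rule that)
        have "ok (Suc n) (r, s)" using rs eq(2) by (simp add: ok_def)
        moreover have "step n v (r, s)"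
          unfolding step_def using eq(1,3,4) by (intro bexI[OF _ pq(1)] bexI[OF _ pq(2)]) simp
        ultimately show "\<exists>v'. ok (Suc n) v' \<and> step n v v'" by blast
      qed
      then obtain V where V: "\<And>n. ok n (V n)" "\<And>n. step n (V n) (V (Suc n))" by blast
      obtain p q where pq: "\<And>n. p n \<in> carrier M" "\<And>n. q n \<in> carrier M" "\<And>n. g n = p n \<otimes> q n"
        "\<And>n. fst (V n) = p n \<otimes> fst (V (Suc n))" "\<And>n. snd (V n) = q n \<otimes> snd (V (Suc n))"
      proof -
        have "\<forall>n. \<exists>v. fst v \<in> carrier M \<and> snd v \<in> carrier M \<and> g n = fst v \<otimes> snd v \<and>
          fst (V n) = fst v \<otimes> fst (V (Suc n)) \<and> snd (V n) = snd v \<otimes> snd (V (Suc n))"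
        proof
          fix n
          obtain p q where "p \<in> carrier M" "q \<in> carrier M" "g n = p \<otimes> q" "fst (V n) = p \<otimes> fst (V (Suc n))"
            "snd (V n) = q \<otimes> snd (V (Suc n))"
            using V(2)[of n] unfolding step_def by (elim bexE conjE) (rule that)
          then show "\<exists>v. fst v \<in> carrier M \<and> snd v \<in> carrier M \<and> g n = fst v \<otimes> snd v \<and>
            fst (V n) = fst v \<otimes> fst (V (Suc n)) \<and> snd (V n) = snd v \<otimes> snd (V (Suc n))"
            by (intro exI[of _ "(p, q)"]) simp
        qed
        from choice[OF this] show thesis by (elim exE) (rule that[of "\<lambda>n. fst (_ n)" "\<lambda>n. snd (_ n)"]; blast)
      qed
      have Vc: "fst (V n) \<in> carrier M" "snd (V n) \<in> carrier M" "f n = fst (V n) \<otimes> snd (V n)" for n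
        using V(1)[of n] by (simp_all add: ok_def)
      have V0: "fst (V 0) = x" "snd (V 0) = y" using V(1)[of 0] by (simp_all add: ok_def)
      obtain a where a: "a \<in> carrier M" "\<And>n. \<exists>s. sums (\<lambda>k. p (n + k)) s \<and> fst (V n) = a \<otimes> s"
        using IHx[rule_format, of "\<lambda>n. fst (V n)" p] Vc(1) pq(1,4) V0(1) by blast
      obtain b where b: "b \<in> carrier M" "\<And>n. \<exists>s. sums (\<lambda>k. q (n + k)) s \<and> snd (V n) = b \<otimes> s"
        using IHy[rule_format, of "\<lambda>n. snd (V n)" q] Vc(2) pq(2,5) V0(2) by blast
      have "\<exists>s. sums (\<lambda>k. g (n + k)) s \<and> f n = (a \<otimes> b) \<otimes> s" for n
      proof -
        obtain s t where st: "sums (\<lambda>k. p (n + k)) s" "fst (V n) = a \<otimes> s" "sums (\<lambda>k. q (n + k)) t" "snd (V n) = b \<otimes> t"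
          using a(2)[of n] b(2)[of n] by blast
        have "s \<in> carrier M" "t \<in> carrier M" using sums_closed[OF st(1)] sums_closed[OF st(3)] by auto
        then have "f n = (a \<otimes> b) \<otimes> (s \<otimes> t)" using a(1) b(1) by (simp add: Vc(3) st(2,4) m_ac)
        moreover have "sums (\<lambda>k. g (n + k)) (s \<otimes> t)" using sums.mult[OF st(1,3)] by (simp add: pq(3))
        ultimately show ?thesis by blast
      qed
      then show "\<exists>a\<in>carrier M. \<forall>n. \<exists>s. sums (\<lambda>k. g (n + k)) s \<and> f n = a \<otimes> s" using a(1) b(1) by blast
    qed
  qed
  then show ?thesis using assms by blast
qed

theorem is_GCA: "is_GCA M"
proof -
  define isum where "isum f = (if \<exists>c. sums f c then Some (THE c. sums f c) else None)" for f
  have isum: "isum f = Some c \<longleftrightarrow> sums f c" for f c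
  proof -
    have "(THE d. sums f d) = c" if "sums f c" for c using that sums_unique by blast
    then show ?thesis unfolding isum_def by auto
  qed
  define plus where "plus x y = (if x \<in> carrier M \<and> y \<in> carrier M then Some (x \<otimes> y) else None)" for x y
  have plus: "plus x y = Some c \<longleftrightarrow> x \<in> carrier M \<and> y \<in> carrier M \<and> c = x \<otimes> y" for x y c by (auto simp: plus_def)
  have "generalized_cardinal_algebra (carrier M) plus \<one> isum"
  proof
    show "\<one> \<in> carrier M" by simp
    show "a \<in> carrier M \<and> b \<in> carrier M \<and> c \<in> carrier M" if "plus a b = Some c" for a b c using that by (auto simp: plus)
    show "range f \<subseteq> carrier M \<and> c \<in> carrier M" if "isum f = Some c" for f c using that sums_closed by (auto simp: isum)
    show "\<exists>t. isum (\<lambda>n. f (Suc n)) = Some t \<and> plus (f 0) t = Some a" if "isum f = Some a" for f a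
      using sums_Suc[of f a] sums_closed that unfolding isum plus by metis
    show "\<exists>s t. isum f = Some s \<and> isum g = Some t \<and> plus s t = Some c"
      if "\<And>n. plus (f n) (g n) = Some (h n)" "isum h = Some c" for f g h c
      using sums_mult[of h c f g] sums_closed that unfolding isum plus by metis
    show "plus a \<one> = Some a \<and> plus \<one> a = Some a" if "a \<in> carrier M" for a using that by (simp add: plus)
    show "\<exists>f g. isum f = Some a \<and> isum g = Some b \<and> (\<forall>n. plus (f n) (g n) = Some (h n))"
      if "plus a b = Some c" "isum h = Some c" for a b c h
      using sums_refine[of h c a b] sums_closed that unfolding isum plus by metis
    show "\<exists>a\<in>carrier M. \<forall>n. \<exists>s. isum (\<lambda>k. g (n + k)) = Some s \<and> plus a s = Some (f n)"
      if "\<And>n. plus (g n) (f (Suc n)) = Some (f n)" for g f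
    proof -
      have fg: "f n \<in> carrier M" "g n \<in> carrier M" "f n = g n \<otimes> f (Suc n)" for n using that[of n] by (auto simp: plus)
      then obtain a where "a \<in> carrier M" "\<forall>n. \<exists>s. sums (\<lambda>k. g (n + k)) s \<and> f n = a \<otimes> s"
        using sums_remainder[of "f 0" f g, OF fg(1) fg(1,2) HOL.refl fg(3)] by blast
      then show ?thesis unfolding isum plus using sums_closed by blast
    qed
  qed
  then show ?thesis unfolding is_GCA_def plus_def[abs_def] using comm_monoid_axioms by blast
qed

end

section \<open>Words and their splittings\<close>

locale relcomp_modular_lattice = modular_lattice L + relatively_complemented_lattice L for L (structure)
begin

lemma carrier_interval: "carrier (interval_lattice L a b) = {x \<in> carrier L. a \<sqsubseteq> x \<and> x \<sqsubseteq> b}"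
  by (simp add: interval_lattice_def at_least_at_most_def)

lemma le_interval: "x \<sqsubseteq>\<^bsub>interval_lattice L a b\<^esub> y \<longleftrightarrow> x \<sqsubseteq> y"
  by (simp add: interval_lattice_def)

text \<open>The meet of the interval lattice is taken with respect to the smaller carrier; convexity
  of the interval identifies it with the meet of \<open>L\<close>.\<close>

lemma meet_interval:
  assumes "lattice (interval_lattice L a b)" "a \<in> carrier L" "b \<in> carrier L"
    and x: "x \<in> carrier L" "a \<sqsubseteq> x" "x \<sqsubseteq> b" and y: "y \<in> carrier L" "a \<sqsubseteq> y" "y \<sqsubseteq> b"
  shows "x \<sqinter>\<^bsub>interval_lattice L a b\<^esub> y = x \<sqinter> y"
proof -
  interpret I: lattice "interval_lattice L a b" by fact
  let ?m = "x \<sqinter>\<^bsub>interval_lattice L a b\<^esub> y"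
  have xy: "x \<in> carrier (interval_lattice L a b)" "y \<in> carrier (interval_lattice L a b)"
    using x y by (simp_all add: carrier_interval)
  note m = I.meet_closed[OF xy] I.meet_left[OF xy] I.meet_right[OF xy]
  then have "?m \<in> carrier L" "a \<sqsubseteq> ?m" by (simp_all add: carrier_interval)
  moreover have "x \<sqinter> y \<in> carrier (interval_lattice L a b)"
    using x y assms(2,3) by (auto simp: carrier_interval meet_le intro: le_trans[OF meet_left])
  ultimately show ?thesis
    using m I.meet_le[of "x \<sqinter> y" x y] xy x y
    by (intro le_antisym) (auto simp: le_interval meet_le meet_left meet_right)
qed

lemma join_interval:
  assumes "lattice (interval_lattice L a b)" "a \<in> carrier L" "b \<in> carrier L"
    and x: "x \<in> carrier L" "a \<sqsubseteq> x" "x \<sqsubseteq> b" and y: "y \<in> carrier L" "a \<sqsubseteq> y" "y \<sqsubseteq> b"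
  shows "x \<squnion>\<^bsub>interval_lattice L a b\<^esub> y = x \<squnion> y"
proof -
  interpret I: lattice "interval_lattice L a b" by fact
  let ?m = "x \<squnion>\<^bsub>interval_lattice L a b\<^esub> y"
  have xy: "x \<in> carrier (interval_lattice L a b)" "y \<in> carrier (interval_lattice L a b)"
    using x y by (simp_all add: carrier_interval)
  note m = I.join_closed[OF xy] I.join_left[OF xy] I.join_right[OF xy]
  then have "?m \<in> carrier L" "?m \<sqsubseteq> b" by (simp_all add: carrier_interval)
  moreover have "x \<squnion> y \<in> carrier (interval_lattice L a b)"
    using x y assms(2,3) by (auto simp: carrier_interval join_le intro: le_trans[OF _ join_left])
  ultimately show ?thesis
    using m I.join_le[of x "x \<squnion> y" y] xy x y
    by (intro le_antisym) (auto simp: le_interval join_le join_left join_right)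
qed

lemma relative_complement:
  assumes "a \<in> carrier L" "b \<in> carrier L" "x \<in> carrier L" "a \<sqsubseteq> x" "x \<sqsubseteq> b"
  obtains y where "y \<in> carrier L" "a \<sqsubseteq> y" "y \<sqsubseteq> b" "x \<sqinter> y = a" "x \<squnion> y = b"
proof -
  have ab: "a \<sqsubseteq> b" using assms by (blast intro: le_trans)
  let ?I = "interval_lattice L a b"
  interpret I: complemented_lattice ?I
    using interval_complemented assms(1,2) ab by simp
  have x: "x \<in> carrier ?I" and c: "a \<in> carrier ?I" "b \<in> carrier ?I"
    using assms ab by (simp_all add: carrier_interval)
  have bot: "\<bottom>\<^bsub>?I\<^esub> = a" using I.bottom_lower[OF c(1)] I.bottom_closed assms(1)
    by (auto simp: le_interval carrier_interval intro: le_antisym)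
  have top: "\<top>\<^bsub>?I\<^esub> = b" using I.top_higher[OF c(2)] I.top_closed assms(2)
    by (auto simp: le_interval carrier_interval intro: le_antisym)
  obtain y where "y \<in> carrier ?I" "x \<sqinter>\<^bsub>?I\<^esub> y = \<bottom>\<^bsub>?I\<^esub>" "x \<squnion>\<^bsub>?I\<^esub> y = \<top>\<^bsub>?I\<^esub>"
    using I.complement_exists[OF x] by blast
  then show thesis
    using that[of y] meet_interval[OF I.lattice_axioms assms(1-5)] join_interval[OF I.lattice_axioms assms(1-5)] bot top
    by (simp add: carrier_interval)
qed

end

context lattice begin

lemma join_absorb: "x \<in> carrier L \<Longrightarrow> y \<in> carrier L \<Longrightarrow> x \<sqsubseteq> y \<Longrightarrow> x \<squnion> y = y"
  by (intro le_antisym join_le) (auto intro: join_right join_closed)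

lemma meet_absorb: "x \<in> carrier L \<Longrightarrow> y \<in> carrier L \<Longrightarrow> x \<sqsubseteq> y \<Longrightarrow> x \<sqinter> y = x"
  by (intro le_antisym meet_le) (auto intro: meet_left meet_closed)

lemma dim_cong_D2':
  assumes "x \<in> carrier L" "y \<in> carrier L" "x \<sqinter> y = u" "x \<squnion> y = v"
  shows "({#(x, v)#}, {#(u, y)#}) \<in> dim_cong L" "({#(u, y)#}, {#(x, v)#}) \<in> dim_cong L"
  using dim_cong.D2[OF assms(1,2)] assms(3,4) by (auto intro: dim_cong.sym)

lemma dim_cong_D1':
  assumes "a \<in> carrier L" "b \<in> carrier L" "c \<in> carrier L" "a \<sqsubseteq> b" "b \<sqsubseteq> c"
    and "({#(a, b)#}, X) \<in> dim_cong L" "({#(b, c)#}, Y) \<in> dim_cong L"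
  shows "({#(a, c)#}, X + Y) \<in> dim_cong L"
proof -
  have "({#(a, b)#} + {#(b, c)#}, X + Y) \<in> dim_cong L" using assms(6,7) by (rule dim_cong.add)
  then show ?thesis using dim_cong.trans[OF dim_cong.D1[OF assms(1-5)]] by (simp add: add_mset_commute)
qed

lemma dim_cong_single: "a \<in> carrier L \<Longrightarrow> b \<in> carrier L \<Longrightarrow> a \<sqsubseteq> b \<Longrightarrow> ({#(a, b)#}, {#(a, b)#}) \<in> dim_cong L"
  by (rule dim_cong.refl) (simp add: dim_words_def dim_generators_def)

text \<open>The triples in \<open>T\<close> record which lower part and which upper part belong to
  one letter, also when letters are repeated.\<close>

definition "splits X X1 X2 \<longleftrightarrow> (\<exists>T. (\<forall>(a, c, b) \<in># T. a \<in> carrier L \<and> c \<in> carrier L \<and> b \<in> carrier L \<and> a \<sqsubseteq> c \<and> c \<sqsubseteq> b) \<and>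
  X = image_mset (\<lambda>(a, c, b). (a, b)) T \<and> X1 = image_mset (\<lambda>(a, c, b). (a, c)) T \<and>
  X2 = image_mset (\<lambda>(a, c, b). (c, b)) T)"

lemma splits_empty: "splits {#} X1 X2 \<longleftrightarrow> X1 = {#} \<and> X2 = {#}"
  unfolding splits_def by auto

lemma splits_singleI:
  "a \<in> carrier L \<Longrightarrow> c \<in> carrier L \<Longrightarrow> b \<in> carrier L \<Longrightarrow> a \<sqsubseteq> c \<Longrightarrow> c \<sqsubseteq> b \<Longrightarrow> splits {#(a, b)#} {#(a, c)#} {#(c, b)#}"
  unfolding splits_def by (intro exI[of _ "{#(a, c, b)#}"]) simp

lemma splits_singleE:
  assumes "splits {#(a, b)#} X1 X2"
  obtains c where "a \<in> carrier L" "c \<in> carrier L" "b \<in> carrier L" "a \<sqsubseteq> c" "c \<sqsubseteq> b" "X1 = {#(a, c)#}" "X2 = {#(c, b)#}"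
proof -
  obtain T where T: "\<forall>(a, c, b) \<in># T. a \<in> carrier L \<and> c \<in> carrier L \<and> b \<in> carrier L \<and> a \<sqsubseteq> c \<and> c \<sqsubseteq> b"
    "{#(a, b)#} = image_mset (\<lambda>(a, c, b). (a, b)) T" "X1 = image_mset (\<lambda>(a, c, b). (a, c)) T"
    "X2 = image_mset (\<lambda>(a, c, b). (c, b)) T" using assms unfolding splits_def by blast
  have "image_mset (\<lambda>(a, c, b). (a, b)) T = add_mset (a, b) {#}" using T(2) by simp
  from msed_map_invR[OF this] obtain t where "T = {#t#}" "(\<lambda>(a, c, b). (a, b)) t = (a, b)" by auto
  then show thesis using that[of "fst (snd t)"] T by (auto split: prod.splits)
qed

lemma splits_plusI:
  assumes "splits X X1 X2" "splits Y Y1 Y2" shows "splits (X + Y) (X1 + Y1) (X2 + Y2)"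
proof -
  from assms obtain S T where
    "(\<forall>(a, c, b) \<in># S. a \<in> carrier L \<and> c \<in> carrier L \<and> b \<in> carrier L \<and> a \<sqsubseteq> c \<and> c \<sqsubseteq> b) \<and>
      X = image_mset (\<lambda>(a, c, b). (a, b)) S \<and> X1 = image_mset (\<lambda>(a, c, b). (a, c)) S \<and> X2 = image_mset (\<lambda>(a, c, b). (c, b)) S"
    "(\<forall>(a, c, b) \<in># T. a \<in> carrier L \<and> c \<in> carrier L \<and> b \<in> carrier L \<and> a \<sqsubseteq> c \<and> c \<sqsubseteq> b) \<and>
      Y = image_mset (\<lambda>(a, c, b). (a, b)) T \<and> Y1 = image_mset (\<lambda>(a, c, b). (a, c)) T \<and> Y2 = image_mset (\<lambda>(a, c, b). (c, b)) T"
    unfolding splits_def by blast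
  then show ?thesis unfolding splits_def by (intro exI[of _ "S + T"]) auto
qed

lemma splits_plusE:
  assumes "splits (X + Y) Z1 Z2"
  obtains X1 X2 Y1 Y2 where "splits X X1 X2" "splits Y Y1 Y2" "Z1 = X1 + Y1" "Z2 = X2 + Y2"
proof -
  obtain T where T: "\<forall>(a, c, b) \<in># T. a \<in> carrier L \<and> c \<in> carrier L \<and> b \<in> carrier L \<and> a \<sqsubseteq> c \<and> c \<sqsubseteq> b"
    "X + Y = image_mset (\<lambda>(a, c, b). (a, b)) T" "Z1 = image_mset (\<lambda>(a, c, b). (a, c)) T"
    "Z2 = image_mset (\<lambda>(a, c, b). (c, b)) T" using assms unfolding splits_def by blast
  from image_mset_eq_plusD[OF T(2)[symmetric]] obtain T1 T2 where *: "T = T1 + T2"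
    "X = image_mset (\<lambda>(a, c, b). (a, b)) T1" "Y = image_mset (\<lambda>(a, c, b). (a, b)) T2" by auto
  show thesis
  proof (rule that)
    show "splits X (image_mset (\<lambda>(a, c, b). (a, c)) T1) (image_mset (\<lambda>(a, c, b). (c, b)) T1)"
      unfolding splits_def using T(1) * by (intro exI[of _ T1]) simp
    show "splits Y (image_mset (\<lambda>(a, c, b). (a, c)) T2) (image_mset (\<lambda>(a, c, b). (c, b)) T2)"
      unfolding splits_def using T(1) * by (intro exI[of _ T2]) simp
  qed (simp_all add: T *)
qed

lemma dim_words_plus: "X + Y \<in> dim_words L \<longleftrightarrow> X \<in> dim_words L \<and> Y \<in> dim_words L"
  by (auto simp: dim_words_def)

lemma dim_words_empty: "{#} \<in> dim_words L" by (simp add: dim_words_def)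

lemma dim_words_single: "{#(a, b)#} \<in> dim_words L \<longleftrightarrow> a \<in> carrier L \<and> b \<in> carrier L \<and> a \<sqsubseteq> b"
  by (simp add: dim_words_def dim_generators_def)

lemma dim_words_induct [consumes 1, case_names empty single plus]:
  assumes "X \<in> dim_words L" "P {#}"
    "\<And>a b. a \<in> carrier L \<Longrightarrow> b \<in> carrier L \<Longrightarrow> a \<sqsubseteq> b \<Longrightarrow> P {#(a, b)#}"
    "\<And>X Y. X \<in> dim_words L \<Longrightarrow> Y \<in> dim_words L \<Longrightarrow> P X \<Longrightarrow> P Y \<Longrightarrow> P (X + Y)"
  shows "P X"
  using assms(1)
proof (induction X)
  case (add p X)
  obtain a b where p: "p = (a, b)" by (cases p)
  have "{#p#} + X \<in> dim_words L" using add.prems by simp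
  then have *: "{#p#} \<in> dim_words L" "X \<in> dim_words L" using dim_words_plus by blast+
  then have "P {#p#}" using assms(3) dim_words_single p by simp
  then have "P ({#p#} + X)" by (rule assms(4)[OF * _ add.IH[OF *(2)]])
  then show ?case by simp
qed (rule assms(2))

lemma splits_sum:
  assumes "X \<in> dim_words L" "splits X X1 X2" shows "(X, X1 + X2) \<in> dim_cong L"
  using assms
proof (induction X arbitrary: X1 X2 rule: dim_words_induct)
  case empty
  then show ?case by (simp add: splits_empty dim_cong.refl dim_words_empty)
next
  case (single a b)
  from single(4) obtain c where c: "c \<in> carrier L" "a \<sqsubseteq> c" "c \<sqsubseteq> b" "X1 = {#(a, c)#}" "X2 = {#(c, b)#}"
    by (rule splits_singleE)
  show ?case
    unfolding c(4,5) using single c dim_cong_single by (intro dim_cong_D1'[of a c b]) simp_all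
next
  case (plus X Y)
  obtain U1 U2 V1 V2 where "splits X U1 U2" "splits Y V1 V2" and *: "X1 = U1 + V1" "X2 = U2 + V2"
    using plus.prems by (rule splits_plusE)
  then have "(X + Y, (U1 + U2) + (V1 + V2)) \<in> dim_cong L" by (intro dim_cong.add plus.IH)
  then show ?case using * by (simp add: ac_simps)
qed

text \<open>Every letter is cut at its upper end, which leaves a word of trivial intervals.\<close>

lemma splits_top:
  assumes "X \<in> dim_words L" obtains Z where "splits X X Z" "(Z, {#}) \<in> dim_cong L"
proof -
  from assms have "\<exists>Z. splits X X Z \<and> (Z, {#}) \<in> dim_cong L"
  proof (induction X rule: dim_words_induct)
    case empty
    then show ?case by (simp add: splits_empty dim_cong.refl dim_words_empty)
  next
    case (single a b)
    then show ?case by (intro exI[of _ "{#(b, b)#}"] conjI splits_singleI dim_cong.D0) auto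
  next
    case (plus X Y)
    then obtain Z W where "splits X X Z" "splits Y Y W" "(Z, {#}) \<in> dim_cong L" "(W, {#}) \<in> dim_cong L" by blast
    then show ?case using dim_cong.add[of Z "{#}" L W "{#}"] splits_plusI by (intro exI[of _ "Z + W"]) simp
  qed
  then show thesis using that by blast
qed

lemma splits_bottom:
  assumes "X \<in> dim_words L" obtains Z where "splits X Z X" "(Z, {#}) \<in> dim_cong L"
proof -
  from assms have "\<exists>Z. splits X Z X \<and> (Z, {#}) \<in> dim_cong L"
  proof (induction X rule: dim_words_induct)
    case empty
    then show ?case by (simp add: splits_empty dim_cong.refl dim_words_empty)
  next
    case (single a b)
    then show ?case by (intro exI[of _ "{#(a, a)#}"] conjI splits_singleI dim_cong.D0) auto
  next
    case (plus X Y)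
    then obtain Z W where "splits X Z X" "splits Y W Y" "(Z, {#}) \<in> dim_cong L" "(W, {#}) \<in> dim_cong L" by blast
    then show ?case using dim_cong.add[of Z "{#}" L W "{#}"] splits_plusI by (intro exI[of _ "Z + W"]) simp
  qed
  then show thesis using that by blast
qed

text \<open>A simulation property, through which congruence of words yields refinement.\<close>

definition "splits_transfer X Y \<longleftrightarrow> (\<forall>X1 X2. splits X X1 X2 \<longrightarrow>
  (\<exists>Y1 Y2. splits Y Y1 Y2 \<and> (X1, Y1) \<in> dim_cong L \<and> (X2, Y2) \<in> dim_cong L))"

end

context relcomp_modular_lattice begin

text \<open>A cut \<open>e\<close> of \<open>[a, c]\<close> induces the cuts
  \<open>b \<sqinter> e\<close> and \<open>b \<squnion> e\<close>, the middle pieces being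
  transposes. Conversely, cuts \<open>d\<close> and \<open>e\<close> of the two parts are merged by
  a relative complement of \<open>b\<close> in \<open>[d, e]\<close>.\<close>

lemma splits_transfer_D1:
  assumes c: "a \<in> carrier L" "b \<in> carrier L" "c \<in> carrier L" and le: "a \<sqsubseteq> b" "b \<sqsubseteq> c"
  shows "splits_transfer {#(a, c)#} ({#(a, b)#} + {#(b, c)#})" "splits_transfer ({#(a, b)#} + {#(b, c)#}) {#(a, c)#}"
proof -
  show "splits_transfer {#(a, c)#} ({#(a, b)#} + {#(b, c)#})"
    unfolding splits_transfer_def
  proof (intro allI impI)
    fix X1 X2 assume "splits {#(a, c)#} X1 X2"
    then obtain e where e: "e \<in> carrier L" "a \<sqsubseteq> e" "e \<sqsubseteq> c" "X1 = {#(a, e)#}" "X2 = {#(e, c)#}" by (rule splits_singleE)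
    have m: "b \<sqinter> e \<in> carrier L" "b \<squnion> e \<in> carrier L" "a \<sqsubseteq> b \<sqinter> e" "b \<sqinter> e \<sqsubseteq> b" "b \<sqinter> e \<sqsubseteq> e" "b \<sqsubseteq> b \<squnion> e"
      "e \<sqsubseteq> b \<squnion> e" "b \<squnion> e \<sqsubseteq> c"
      using c le e by (simp_all add: meet_le join_le meet_left meet_right join_left join_right)
    have "({#(a, e)#}, {#(a, b \<sqinter> e)#} + {#(b, b \<squnion> e)#}) \<in> dim_cong L"
      using c e m by (intro dim_cong_D1'[of _ "b \<sqinter> e"] dim_cong_D2' dim_cong_single) simp_all
    moreover have "({#(e, c)#}, {#(b \<sqinter> e, b)#} + {#(b \<squnion> e, c)#}) \<in> dim_cong L"
      using c e m by (intro dim_cong_D1'[of _ "b \<squnion> e"] dim_cong_D2' dim_cong_single) (simp_all add: join_comm meet_comm)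
    moreover have "splits ({#(a, b)#} + {#(b, c)#}) ({#(a, b \<sqinter> e)#} + {#(b, b \<squnion> e)#}) ({#(b \<sqinter> e, b)#} + {#(b \<squnion> e, c)#})"
      using c m by (intro splits_plusI splits_singleI)
    ultimately show "\<exists>Y1 Y2. splits ({#(a, b)#} + {#(b, c)#}) Y1 Y2 \<and> (X1, Y1) \<in> dim_cong L \<and> (X2, Y2) \<in> dim_cong L"
      unfolding e(4,5) by blast
  qed
  show "splits_transfer ({#(a, b)#} + {#(b, c)#}) {#(a, c)#}"
    unfolding splits_transfer_def
  proof (intro allI impI)
    fix Z1 Z2 assume "splits ({#(a, b)#} + {#(b, c)#}) Z1 Z2"
    then obtain X1 X2 Y1 Y2 where "splits {#(a, b)#} X1 X2" "splits {#(b, c)#} Y1 Y2" and Z: "Z1 = X1 + Y1" "Z2 = X2 + Y2"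
      by (rule splits_plusE)
    then obtain d e where d: "d \<in> carrier L" "a \<sqsubseteq> d" "d \<sqsubseteq> b" "X1 = {#(a, d)#}" "X2 = {#(d, b)#}"
      and e: "e \<in> carrier L" "b \<sqsubseteq> e" "e \<sqsubseteq> c" "Y1 = {#(b, e)#}" "Y2 = {#(e, c)#}" by (elim splits_singleE)
    obtain f where f: "f \<in> carrier L" "d \<sqsubseteq> f" "f \<sqsubseteq> e" "b \<sqinter> f = d" "b \<squnion> f = e"
      using d(1) e(1) c(2) d(3) e(2) by (rule relative_complement)
    have m: "a \<sqsubseteq> f" "f \<sqsubseteq> c" using le_trans[OF d(2) f(2)] le_trans[OF f(3) e(3)] c d(1) e(1) f(1) by simp_all
    have f': "f \<sqinter> b = d" "f \<squnion> b = e" using f(4,5) by (simp_all add: join_comm meet_comm)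
    have "({#(a, f)#}, {#(a, d)#} + {#(b, e)#}) \<in> dim_cong L"
      using dim_cong_D2'(2)[OF c(2) f(1,4,5)] dim_cong_single[OF c(1) d(1,2)]
      by (intro dim_cong_D1'[OF c(1) d(1) f(1) d(2) f(2)])
    moreover have "({#(f, c)#}, {#(d, b)#} + {#(e, c)#}) \<in> dim_cong L"
      using dim_cong_D2'(1)[OF f(1) c(2) f'] dim_cong_single[OF e(1) c(3) e(3)]
      by (intro dim_cong_D1'[OF f(1) e(1) c(3) f(3) e(3)])
    ultimately show "\<exists>Y1 Y2. splits {#(a, c)#} Y1 Y2 \<and> (Z1, Y1) \<in> dim_cong L \<and> (Z2, Y2) \<in> dim_cong L"
      unfolding Z d(4,5) e(4,5) using splits_singleI[OF c(1) f(1) c(3) m] by (blast intro: dim_cong.sym)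
  qed
qed

text \<open>By modularity the maps \<open>e \<sqinter> b\<close> and \<open>a \<squnion> e\<close>
  between the transposed intervals are inverse to each other, and corresponding parts are again
  transposes.\<close>

lemma splits_transfer_D2:
  assumes c: "a \<in> carrier L" "b \<in> carrier L"
  shows "splits_transfer {#(a, a \<squnion> b)#} {#(a \<sqinter> b, b)#}" "splits_transfer {#(a \<sqinter> b, b)#} {#(a, a \<squnion> b)#}"
proof -
  have ab: "a \<sqinter> b \<in> carrier L" "a \<squnion> b \<in> carrier L" "a \<sqinter> b \<sqsubseteq> a" "a \<sqinter> b \<sqsubseteq> b" "a \<sqsubseteq> a \<squnion> b" "b \<sqsubseteq> a \<squnion> b"
    using c by (simp_all add: meet_left meet_right join_left join_right)
  show "splits_transfer {#(a, a \<squnion> b)#} {#(a \<sqinter> b, b)#}"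
    unfolding splits_transfer_def
  proof (intro allI impI)
    fix X1 X2 assume "splits {#(a, a \<squnion> b)#} X1 X2"
    then obtain e where e: "e \<in> carrier L" "a \<sqsubseteq> e" "e \<sqsubseteq> a \<squnion> b" "X1 = {#(a, e)#}" "X2 = {#(e, a \<squnion> b)#}" by (rule splits_singleE)
    have m: "e \<sqinter> b \<in> carrier L" "a \<sqinter> b \<sqsubseteq> e \<sqinter> b" "e \<sqinter> b \<sqsubseteq> b" "e \<sqinter> b \<sqsubseteq> e"
      using c e ab le_trans[OF ab(3) e(2)] by (simp_all add: meet_le meet_left meet_right)
    have 1: "a \<squnion> (e \<sqinter> b) = e" using modular[OF c e(1,2)] meet_absorb[OF e(1) ab(2) e(3)] by (simp add: meet_comm)
    have 2: "a \<sqinter> (e \<sqinter> b) = a \<sqinter> b"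
      using meet_absorb[OF c(1) e(1,2)] meet_assoc[OF c(1) e(1) c(2)] by simp
    have "e \<squnion> b \<sqsubseteq> a \<squnion> b" using e ab c by (simp add: join_le)
    moreover have "a \<squnion> b \<sqsubseteq> e \<squnion> b"
      using e c le_trans[OF e(2) join_left[OF e(1) c(2)]] by (intro join_le) (simp_all add: join_right)
    ultimately have 3: "e \<squnion> b = a \<squnion> b" using c e by (intro le_antisym) simp_all
    have "({#(a, e)#}, {#(a \<sqinter> b, e \<sqinter> b)#}) \<in> dim_cong L" using c(1) m(1) 2 1 by (rule dim_cong_D2')
    moreover have "({#(e, a \<squnion> b)#}, {#(e \<sqinter> b, b)#}) \<in> dim_cong L" using e(1) c(2) HOL.refl 3 by (rule dim_cong_D2')
    moreover have "splits {#(a \<sqinter> b, b)#} {#(a \<sqinter> b, e \<sqinter> b)#} {#(e \<sqinter> b, b)#}" using ab m c by (intro splits_singleI)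
    ultimately show "\<exists>Y1 Y2. splits {#(a \<sqinter> b, b)#} Y1 Y2 \<and> (X1, Y1) \<in> dim_cong L \<and> (X2, Y2) \<in> dim_cong L"
      unfolding e(4,5) by blast
  qed
  show "splits_transfer {#(a \<sqinter> b, b)#} {#(a, a \<squnion> b)#}"
    unfolding splits_transfer_def
  proof (intro allI impI)
    fix X1 X2 assume "splits {#(a \<sqinter> b, b)#} X1 X2"
    then obtain e where e: "e \<in> carrier L" "a \<sqinter> b \<sqsubseteq> e" "e \<sqsubseteq> b" "X1 = {#(a \<sqinter> b, e)#}" "X2 = {#(e, b)#}" by (rule splits_singleE)
    have m: "a \<squnion> e \<in> carrier L" "a \<sqsubseteq> a \<squnion> e" "a \<squnion> e \<sqsubseteq> a \<squnion> b" "e \<sqsubseteq> a \<squnion> e"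
      using c e ab le_trans[OF e(3) ab(6)] by (simp_all add: join_le join_left join_right)
    have "a \<sqinter> e \<sqsubseteq> a \<sqinter> b"
      using c e le_trans[OF meet_right[OF c(1) e(1)] e(3)] by (intro meet_le) (simp_all add: meet_left)
    moreover have "a \<sqinter> b \<sqsubseteq> a \<sqinter> e" using c e ab by (intro meet_le) simp_all
    ultimately have 1: "a \<sqinter> e = a \<sqinter> b" using c e by (intro le_antisym) simp_all
    have 2: "(a \<squnion> e) \<sqinter> b = e"
      using modular[OF e(1) c e(3)] join_absorb[OF ab(1) e(1,2)] by (simp add: join_comm)
    have 3: "(a \<squnion> e) \<squnion> b = a \<squnion> b" using join_absorb[OF e(1) c(2) e(3)] join_assoc[OF c(1) e(1) c(2)] by simp
    have "({#(a \<sqinter> b, e)#}, {#(a, a \<squnion> e)#}) \<in> dim_cong L" using c(1) e(1) 1 HOL.refl by (rule dim_cong_D2')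
    moreover have "({#(e, b)#}, {#(a \<squnion> e, a \<squnion> b)#}) \<in> dim_cong L" using m(1) c(2) 2 3 by (rule dim_cong_D2')
    moreover have "splits {#(a, a \<squnion> b)#} {#(a, a \<squnion> e)#} {#(a \<squnion> e, a \<squnion> b)#}" using ab m c by (intro splits_singleI)
    ultimately show "\<exists>Y1 Y2. splits {#(a, a \<squnion> b)#} Y1 Y2 \<and> (X1, Y1) \<in> dim_cong L \<and> (X2, Y2) \<in> dim_cong L"
      unfolding e(4,5) by blast
  qed
qed

lemma splits_words:
  assumes "X \<in> dim_words L" "splits X X1 X2" shows "X1 \<in> dim_words L" "X2 \<in> dim_words L"
  using dim_cong_words[OF splits_sum[OF assms]] by (simp_all add: dim_words_plus)

text \<open>Both directions are proved together, which makes the symmetry rule trivial in the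
  induction.\<close>

lemma splits_transfer:
  assumes "(X, Y) \<in> dim_cong L" shows "splits_transfer X Y \<and> splits_transfer Y X"
  using assms
proof induction
  case (D0 a)
  have "splits_transfer {#(a, a)#} {#}"
    unfolding splits_transfer_def
  proof (intro allI impI)
    fix X1 X2 assume "splits {#(a, a)#} X1 X2"
    then obtain e where e: "e \<in> carrier L" "a \<sqsubseteq> e" "e \<sqsubseteq> a" "X1 = {#(a, e)#}" "X2 = {#(e, a)#}" by (rule splits_singleE)
    then have "X1 = {#(a, a)#}" "X2 = {#(a, a)#}" using D0 le_antisym[of a e] by auto
    then show "\<exists>Y1 Y2. splits {#} Y1 Y2 \<and> (X1, Y1) \<in> dim_cong L \<and> (X2, Y2) \<in> dim_cong L"
      using dim_cong.D0[OF D0] by (simp add: splits_empty)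
  qed
  moreover have "splits_transfer {#} {#(a, a)#}"
    unfolding splits_transfer_def
    using splits_singleI[of a a a] dim_cong.sym[OF dim_cong.D0[OF D0]] D0
    by (auto simp: splits_empty)
  ultimately show ?case ..
next
  case (D1 a b c)
  then show ?case using splits_transfer_D1[of a b c] by (simp add: add_mset_commute)
next
  case (D2 a b)
  then show ?case using splits_transfer_D2 by simp
next
  case (refl X)
  then show ?case unfolding splits_transfer_def using splits_words by (blast intro: dim_cong.refl)
next
  case (sym X Y)
  then show ?case by simp
next
  case (trans X Y Z)
  have "splits_transfer X Z" if "splits_transfer X Y" "splits_transfer Y Z" for X Y Z
    using that unfolding splits_transfer_def by (meson dim_cong.trans)
  then show ?case using trans.IH by blast
next
  case (add X Y U V)
  have "splits_transfer (X + U) (Y + V)" if *: "splits_transfer X Y" "splits_transfer U V" for X Y U V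
    unfolding splits_transfer_def
  proof (intro allI impI)
    fix Z1 Z2 assume "splits (X + U) Z1 Z2"
    then obtain X1 X2 U1 U2 where s: "splits X X1 X2" "splits U U1 U2" and Z: "Z1 = X1 + U1" "Z2 = X2 + U2" by (rule splits_plusE)
    obtain Y1 Y2 where Y: "splits Y Y1 Y2" "(X1, Y1) \<in> dim_cong L" "(X2, Y2) \<in> dim_cong L"
      using *(1) s(1) unfolding splits_transfer_def by blast
    obtain V1 V2 where V: "splits V V1 V2" "(U1, V1) \<in> dim_cong L" "(U2, V2) \<in> dim_cong L"
      using *(2) s(2) unfolding splits_transfer_def by blast
    show "\<exists>Y1 Y2. splits (Y + V) Y1 Y2 \<and> (Z1, Y1) \<in> dim_cong L \<and> (Z2, Y2) \<in> dim_cong L"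
      unfolding Z using splits_plusI[OF Y(1) V(1)] dim_cong.add[OF Y(2) V(2)] dim_cong.add[OF Y(3) V(3)] by blast
  qed
  then show ?case using add.IH by blast
qed

text \<open>Cutting \<open>P\<close> at the top and \<open>Q\<close> at the bottom splits
  \<open>P + Q\<close> into \<open>P\<close> and \<open>Q\<close> up to trivial letters. This
  splitting is transferred to \<open>X\<close>.\<close>

lemma dim_cong_plusE:
  assumes "(X, P + Q) \<in> dim_cong L"
  obtains X1 X2 where "splits X X1 X2" "(X1, P) \<in> dim_cong L" "(X2, Q) \<in> dim_cong L"
proof -
  have PQ: "P \<in> dim_words L" "Q \<in> dim_words L" using dim_cong_words[OF assms] by (simp_all add: dim_words_plus)
  obtain Z W where Z: "splits P P Z" "(Z, {#}) \<in> dim_cong L" and W: "splits Q W Q" "(W, {#}) \<in> dim_cong L"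
    by (rule splits_top[OF PQ(1)], rule splits_bottom[OF PQ(2)]) (rule that)
  have "(P + W, P + {#}) \<in> dim_cong L" "(Z + Q, {#} + Q) \<in> dim_cong L"
    using dim_cong.refl[OF PQ(1)] dim_cong.refl[OF PQ(2)] Z(2) W(2) by (auto intro: dim_cong.add simp del: add_0_right add_0_left)
  moreover obtain X1 X2 where "splits X X1 X2" "(P + W, X1) \<in> dim_cong L" "(Z + Q, X2) \<in> dim_cong L"
    using splits_plusI[OF Z(1) W(1)] splits_transfer[OF assms] unfolding splits_transfer_def by blast
  ultimately show thesis using that[of X1 X2] by (auto intro: dim_cong.sym dim_cong.trans)
qed

end

section \<open>Dimension classes\<close>

definition dim_class :: "('a, 'm) gorder_scheme \<Rightarrow> 'a \<Rightarrow> 'a \<Rightarrow> ('a \<times> 'a) multiset set"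
  where "dim_class L a b = dim_cong L `` {{#(a, b)#}}"

context lattice begin

lemma dim_classI: "X \<in> dim_words L \<Longrightarrow> dim_cong L `` {X} \<in> carrier (Dim L)"
  by (simp add: Dim_def quotientI)

lemma dim_classE:
  assumes "x \<in> carrier (Dim L)" obtains X where "X \<in> dim_words L" "x = dim_cong L `` {X}"
  using assms unfolding Dim_def by (auto elim: quotientE)

lemma dim_class_eq_iff:
  "X \<in> dim_words L \<Longrightarrow> Y \<in> dim_words L \<Longrightarrow> dim_cong L `` {X} = dim_cong L `` {Y} \<longleftrightarrow> (X, Y) \<in> dim_cong L"
  using eq_equiv_class_iff[OF equiv_dim_cong] by blast

lemma dim_class_closed: "a \<in> carrier L \<Longrightarrow> b \<in> carrier L \<Longrightarrow> a \<sqsubseteq> b \<Longrightarrow> dim_class L a b \<in> carrier (Dim L)"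
  unfolding dim_class_def by (rule dim_classI) (simp add: dim_words_single)

lemma dim_class_refl: "a \<in> carrier L \<Longrightarrow> dim_class L a a = \<one>\<^bsub>Dim L\<^esub>"
  using dim_class_eq_iff[of "{#(a, a)#}" "{#}"] dim_cong.D0[of a L]
  by (simp add: dim_class_def Dim_def dim_words_single dim_words_empty)

lemma dim_class_trans:
  assumes "a \<in> carrier L" "b \<in> carrier L" "c \<in> carrier L" "a \<sqsubseteq> b" "b \<sqsubseteq> c"
  shows "dim_class L a b \<otimes>\<^bsub>Dim L\<^esub> dim_class L b c = dim_class L a c"
proof -
  have ac: "a \<sqsubseteq> c" using assms by (blast intro: le_trans)
  have "dim_cong L `` {{#(a, c)#}} = dim_cong L `` {{#(a, b)#} + {#(b, c)#}}"
    using dim_class_eq_iff dim_cong_words dim_cong.D1[OF assms] by (simp add: add_mset_commute)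
  then show ?thesis
    unfolding dim_class_def using assms by (subst dim_mult_class) (simp_all add: dim_words_single)
qed

lemma dim_class_transp: "a \<in> carrier L \<Longrightarrow> b \<in> carrier L \<Longrightarrow> dim_class L a (a \<squnion> b) = dim_class L (a \<sqinter> b) b"
  unfolding dim_class_def
  by (subst dim_class_eq_iff) (auto simp: dim_words_single join_left meet_right dim_cong.D2)

lemma dim_induct [consumes 1, case_names one dim_class mult]:
  assumes "x \<in> carrier (Dim L)" "R \<one>\<^bsub>Dim L\<^esub>"
    "\<And>a b. a \<in> carrier L \<Longrightarrow> b \<in> carrier L \<Longrightarrow> a \<sqsubseteq> b \<Longrightarrow> R (dim_class L a b)"
    "\<And>x y. x \<in> carrier (Dim L) \<Longrightarrow> y \<in> carrier (Dim L) \<Longrightarrow> R x \<Longrightarrow> R y \<Longrightarrow> R (x \<otimes>\<^bsub>Dim L\<^esub> y)"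
  shows "R x"
proof -
  obtain X where X: "X \<in> dim_words L" "x = dim_cong L `` {X}" using assms(1) by (rule dim_classE)
  from X(1) have "R (dim_cong L `` {X})"
  proof (induction rule: dim_words_induct)
    case empty
    then show ?case using assms(2) by (simp add: Dim_def)
  next
    case (single a b)
    then show ?case using assms(3) by (simp add: dim_class_def)
  next
    case (plus X Y)
    have "R ((dim_cong L `` {X}) \<otimes>\<^bsub>Dim L\<^esub> (dim_cong L `` {Y}))"
      using plus by (intro assms(4) dim_classI)
    then show ?case using dim_mult_class plus by simp
  qed
  then show ?thesis using X by simp
qed

lemma Dim_trivial: "carrier L = {} \<Longrightarrow> carrier (Dim L) = {\<one>\<^bsub>Dim L\<^esub>}"
proof -
  assume e: "carrier L = {}"
  interpret comm_monoid "Dim L" by (rule comm_monoid_Dim)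
  have "x = \<one>\<^bsub>Dim L\<^esub>" if "x \<in> carrier (Dim L)" for x
    using that by (induction rule: dim_induct) (simp_all add: e)
  then show ?thesis by auto
qed

end

context relcomp_modular_lattice begin

text \<open>The splitting of \<open>A + B\<close> that matches \<open>C\<close> and \<open>D\<close>
  cuts single letters, hence restricts to \<open>A\<close> and to \<open>B\<close>; the four
  resulting words form the refinement matrix.\<close>

lemma Dim_refinement:
  assumes "a \<in> carrier (Dim L)" "b \<in> carrier (Dim L)" "c \<in> carrier (Dim L)" "d \<in> carrier (Dim L)"
    "a \<otimes>\<^bsub>Dim L\<^esub> b = c \<otimes>\<^bsub>Dim L\<^esub> d"
  shows "\<exists>p\<in>carrier (Dim L). \<exists>q\<in>carrier (Dim L). \<exists>r\<in>carrier (Dim L). \<exists>s\<in>carrier (Dim L).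
    a = p \<otimes>\<^bsub>Dim L\<^esub> q \<and> b = r \<otimes>\<^bsub>Dim L\<^esub> s \<and> c = p \<otimes>\<^bsub>Dim L\<^esub> r \<and> d = q \<otimes>\<^bsub>Dim L\<^esub> s"
proof -
  let ?c = "\<lambda>X. dim_cong L `` {X}"
  obtain A B C D where w: "A \<in> dim_words L" "B \<in> dim_words L" "C \<in> dim_words L" "D \<in> dim_words L"
    and eq: "a = ?c A" "b = ?c B" "c = ?c C" "d = ?c D" using assms(1-4) by (elim dim_classE)
  have "?c (A + B) = ?c (C + D)" using assms(5) unfolding eq by (simp add: w dim_mult_class)
  then have "(A + B, C + D) \<in> dim_cong L" using dim_class_eq_iff[of "A + B" "C + D"] w by (simp add: dim_words_plus)
  then obtain X1 X2 where X: "splits (A + B) X1 X2" "(X1, C) \<in> dim_cong L" "(X2, D) \<in> dim_cong L" by (rule dim_cong_plusE)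
  from X(1) obtain P Q R S where s: "splits A P Q" "splits B R S" "X1 = P + R" "X2 = Q + S" by (rule splits_plusE)
  have w': "P \<in> dim_words L" "Q \<in> dim_words L" "R \<in> dim_words L" "S \<in> dim_words L"
    using splits_words w s by blast+
  have "?c A = ?c (P + Q)" "?c B = ?c (R + S)" "?c (P + R) = ?c C" "?c (Q + S) = ?c D"
    using splits_sum[OF w(1) s(1)] splits_sum[OF w(2) s(2)] X(2,3) w w'
    by (simp_all add: dim_class_eq_iff dim_words_plus s)
  then show ?thesis unfolding eq using w'
    by (intro bexI[of _ "?c P"] bexI[of _ "?c Q"] bexI[of _ "?c R"] bexI[of _ "?c S"]) (simp_all add: dim_mult_class dim_classI)
qed

text \<open>A splitting of a one-letter word is a cut of its interval, so a decomposition of an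
  interval class can be realized inside that interval.\<close>

lemma dim_class_mult_split:
  assumes ab: "a \<in> carrier L" "b \<in> carrier L" "a \<sqsubseteq> b" and x: "x \<in> carrier (Dim L)" "y \<in> carrier (Dim L)"
    and eq: "dim_class L a b = x \<otimes>\<^bsub>Dim L\<^esub> y"
  obtains c where "c \<in> carrier L" "a \<sqsubseteq> c" "c \<sqsubseteq> b" "x = dim_class L a c" "y = dim_class L c b"
proof -
  let ?c = "\<lambda>X. dim_cong L `` {X}"
  obtain X Y where w: "X \<in> dim_words L" "Y \<in> dim_words L" and e: "x = ?c X" "y = ?c Y" using x by (elim dim_classE)
  have "?c {#(a, b)#} = ?c (X + Y)" using eq unfolding dim_class_def e by (simp add: w dim_mult_class)
  then have "({#(a, b)#}, X + Y) \<in> dim_cong L"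
    using dim_class_eq_iff[of "{#(a, b)#}" "X + Y"] w ab by (simp add: dim_words_plus dim_words_single)
  then obtain X1 X2 where X: "splits {#(a, b)#} X1 X2" "(X1, X) \<in> dim_cong L" "(X2, Y) \<in> dim_cong L" by (rule dim_cong_plusE)
  from X(1) obtain c where c: "c \<in> carrier L" "a \<sqsubseteq> c" "c \<sqsubseteq> b" "X1 = {#(a, c)#}" "X2 = {#(c, b)#}" by (rule splits_singleE)
  have "?c X1 = x" "?c X2 = y"
    unfolding e using X(2,3) dim_cong_words[OF X(2)] dim_cong_words[OF X(3)] by (simp_all add: dim_class_eq_iff)
  then show thesis using that[OF c(1-3)] by (simp add: dim_class_def c(4,5))
qed

end

text \<open>Words are interpreted in intervals through a map \<open>E\<close> that respects the relations; this makes
  the dimension classes the finest such invariant of intervals.\<close>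

locale interval_invariant = relcomp_modular_lattice L for L (structure) +
  fixes E :: "'a \<Rightarrow> 'a \<Rightarrow> 'e"
  assumes E_transp: "a \<in> carrier L \<Longrightarrow> b \<in> carrier L \<Longrightarrow> E a (a \<squnion> b) = E (a \<sqinter> b) b"
    and E_add: "a \<in> carrier L \<Longrightarrow> b \<in> carrier L \<Longrightarrow> c \<in> carrier L \<Longrightarrow> a' \<in> carrier L \<Longrightarrow> b' \<in> carrier L \<Longrightarrow> c' \<in> carrier L \<Longrightarrow>
      a \<sqsubseteq> b \<Longrightarrow> b \<sqsubseteq> c \<Longrightarrow> a' \<sqsubseteq> b' \<Longrightarrow> b' \<sqsubseteq> c' \<Longrightarrow> E a b = E a' b' \<Longrightarrow> E b c = E b' c' \<Longrightarrow> E a c = E a' c'"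
    and E_split: "a \<in> carrier L \<Longrightarrow> b \<in> carrier L \<Longrightarrow> c \<in> carrier L \<Longrightarrow> a' \<in> carrier L \<Longrightarrow> b' \<in> carrier L \<Longrightarrow>
      a \<sqsubseteq> c \<Longrightarrow> c \<sqsubseteq> b \<Longrightarrow> a' \<sqsubseteq> b' \<Longrightarrow>
      E a b = E a' b' \<Longrightarrow> \<exists>c'\<in>carrier L. a' \<sqsubseteq> c' \<and> c' \<sqsubseteq> b' \<and> E a c = E a' c' \<and> E c b = E c' b'"
begin

lemma E_refl: "a \<in> carrier L \<Longrightarrow> b \<in> carrier L \<Longrightarrow> E a a = E b b"
  using E_transp[of a "a \<sqinter> b"] E_transp[of b "a \<sqinter> b"] join_absorb[of "a \<sqinter> b" a] join_absorb[of "a \<sqinter> b" b]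
    meet_absorb[of "a \<sqinter> b" a] meet_absorb[of "a \<sqinter> b" b]
  by (simp add: meet_left meet_right join_comm meet_comm[of _ "a \<sqinter> b"])

lemma E_D2:
  assumes "x \<in> carrier L" "y \<in> carrier L" "x \<sqinter> y = u" "x \<squnion> y = v" shows "E x v = E u y" "E y v = E u x"
  using E_transp[of x y] E_transp[of y x] assms by (auto simp: join_comm meet_comm)

text \<open>\<open>sub a b X\<close> says that \<open>[a, b]\<close> has a chain whose successive intervals have, in some order, the
  \<open>E\<close>-values of the intervals in the word \<open>X\<close>.\<close>

inductive sub :: "'a \<Rightarrow> 'a \<Rightarrow> ('a \<times> 'a) multiset \<Rightarrow> bool" where
  sub_empty: "a \<in> carrier L \<Longrightarrow> b \<in> carrier L \<Longrightarrow> a \<sqsubseteq> b \<Longrightarrow> E a b = E a a \<Longrightarrow> sub a b {#}"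
| sub_add: "a \<in> carrier L \<Longrightarrow> c \<in> carrier L \<Longrightarrow> a \<sqsubseteq> c \<Longrightarrow> E a c = E x y \<Longrightarrow> sub c b X \<Longrightarrow> sub a b (add_mset (x, y) X)"

lemma sub_carrier: "sub a b X \<Longrightarrow> a \<in> carrier L \<and> b \<in> carrier L \<and> a \<sqsubseteq> b"
  by (induction rule: sub.induct) (auto intro: le_trans)

lemma sub_cong:
  "sub a b X \<Longrightarrow> a' \<in> carrier L \<Longrightarrow> b' \<in> carrier L \<Longrightarrow> a' \<sqsubseteq> b' \<Longrightarrow> E a b = E a' b' \<Longrightarrow> sub a' b' X"
proof (induction arbitrary: a' b' rule: sub.induct)
  case (sub_empty a b)
  then show ?case using E_refl[of a a'] by (intro sub.sub_empty) auto
next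
  case (sub_add a c x y b X)
  have cb: "b \<in> carrier L" "c \<sqsubseteq> b" using sub_carrier sub_add(5) by auto
  obtain c' where c': "c' \<in> carrier L" "a' \<sqsubseteq> c'" "c' \<sqsubseteq> b'" "E a c = E a' c'" "E c b = E c' b'"
    using E_split[OF sub_add(1) cb(1) sub_add(2) sub_add.prems(1,2) sub_add(3) cb(2) sub_add.prems(3,4)] by blast
  have "sub c' b' X" using c' sub_add.prems sub_add.IH by blast
  then show ?case using c' sub_add by (intro sub.sub_add[of a' c']) auto
qed

text \<open>The letters of a multiset have no order. A letter is moved to the front by exchanging
  adjacent steps of the chain through a relative complement.\<close>

lemma sub_add_msetD:
  "sub a b (add_mset p X) \<Longrightarrow> \<exists>c\<in>carrier L. a \<sqsubseteq> c \<and> E a c = E (fst p) (snd p) \<and> sub c b X"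
proof (induction a b "add_mset p X" arbitrary: X rule: sub.induct)
  case (sub_add a c x y b Z)
  show ?case
  proof (cases "p = (x, y)")
    case True
    then have "Z = X" using sub_add.hyps(7) by simp
    then show ?thesis using sub_add True by auto
  next
    case False
    then obtain W where W: "Z = add_mset p W" "X = add_mset (x, y) W"
      using sub_add.hyps(7) by (auto simp: add_eq_conv_ex)
    obtain d where d: "d \<in> carrier L" "c \<sqsubseteq> d" "E c d = E (fst p) (snd p)" "sub d b W" using sub_add.hyps(6)[OF W(1)] by blast
    have ad: "a \<sqsubseteq> d" using sub_add d le_trans by blast
    obtain f where f: "f \<in> carrier L" "a \<sqsubseteq> f" "f \<sqsubseteq> d" "c \<sqinter> f = a" "c \<squnion> f = d"
      using sub_add(1) d(1) sub_add(2,3) d(2) by (rule relative_complement)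
    have "E a f = E c d" "E f d = E a c" using E_D2[OF sub_add(2) f(1) f(4,5)] by simp_all
    then have "sub f b (add_mset (x, y) W)" using f d sub_add by (intro sub.sub_add[of f d]) auto
    then show ?thesis using f W \<open>E a f = E c d\<close> d by auto
  qed
qed auto

lemma sub_emptyD: "sub a b {#} \<Longrightarrow> a \<in> carrier L \<and> b \<in> carrier L \<and> a \<sqsubseteq> b \<and> E a b = E a a"
  by (auto elim: sub.cases)

lemma sub_plusI: "sub a c X \<Longrightarrow> sub c b Y \<Longrightarrow> sub a b (X + Y)"
proof (induction rule: sub.induct)
  case (sub_empty a c)
  have cb: "b \<in> carrier L" "c \<sqsubseteq> b" using sub_carrier sub_empty by auto
  have "E c b = E a b"
    using sub_empty cb E_refl[of a c] join_closed
    by (intro E_add[of c c b a c b]) auto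
  then show ?case using sub_cong[OF sub_empty(5)] sub_empty cb le_trans[of a c b] by simp
next
  case (sub_add a c' x y c X)
  then show ?case by (auto intro: sub.sub_add)
qed

lemma sub_plusD: "sub a b (X + Y) \<Longrightarrow> \<exists>c. sub a c X \<and> sub c b Y"
proof (induction X arbitrary: a)
  case empty
  then show ?case using sub_carrier[OF empty] by (auto intro!: sub.sub_empty exI[of _ a])
next
  case (add p X)
  then obtain c where c: "c \<in> carrier L" "a \<sqsubseteq> c" "E a c = E (fst p) (snd p)" "sub c b (X + Y)"
    using sub_add_msetD[of a b p "X + Y"] by auto
  then obtain d where "sub c d X" "sub d b Y" using add.IH by blast
  then show ?case using c sub_carrier[OF add.prems] sub.sub_add[of a c "fst p" "snd p" d X] by auto
qed

lemma sub_single: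
  assumes "a \<in> carrier L" "b \<in> carrier L" "a \<sqsubseteq> b" shows "sub a b {#(x, y)#} \<longleftrightarrow> E a b = E x y"
proof
  assume "sub a b {#(x, y)#}"
  then obtain c where c: "c \<in> carrier L" "a \<sqsubseteq> c" "E a c = E x y" "sub c b {#}" using sub_add_msetD[of a b "(x, y)" "{#}"] by auto
  have "E a b = E a c" using assms c sub_emptyD[OF c(4)] by (intro E_add[of a c b a c c]) auto
  then show "E a b = E x y" using c by simp
next
  assume "E a b = E x y"
  then show "sub a b {#(x, y)#}" using assms by (intro sub.sub_add[of a b] sub.sub_empty) auto
qed

text \<open>\<open>E_split\<close> and \<open>E_add\<close> account for subdivision,
  \<open>E_transp\<close> for transposition, and \<open>sub_plusI\<close> with
  \<open>sub_plusD\<close> for addition. For one-letter words the result says that equal classes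
  force equal \<open>E\<close>-values.\<close>

lemma sub_dim_cong:
  assumes "(X, Y) \<in> dim_cong L" shows "sub a b X \<longleftrightarrow> sub a b Y"
  using assms
proof (induction arbitrary: a b)
  case (D0 x)
  show ?case
  proof (cases "a \<in> carrier L \<and> b \<in> carrier L \<and> a \<sqsubseteq> b")
    case True
    then have "sub a b {#} \<longleftrightarrow> E a b = E a a" using sub_emptyD sub.sub_empty by blast
    then show ?thesis using True sub_single E_refl[of a x] D0 by simp
  next
    case False
    then show ?thesis using sub_carrier by blast
  qed
next
  case (D1 x y z)
  show ?case
  proof
    assume s: "sub a b {#(x, z)#}"
    note ab = sub_carrier[OF s]
    have "E x z = E a b" using s sub_single ab by simp
    with D1 ab obtain c where "c \<in> carrier L" "a \<sqsubseteq> c" "c \<sqsubseteq> b" "E x y = E a c" "E y z = E c b"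
      using E_split[of x z y a b] by blast
    then show "sub a b {#(x, y), (y, z)#}" using ab sub_single[of c b y z] by (intro sub.sub_add[of a c]) auto
  next
    assume s: "sub a b {#(x, y), (y, z)#}"
    note ab = sub_carrier[OF s]
    obtain c where c: "c \<in> carrier L" "a \<sqsubseteq> c" "E a c = E x y" "sub c b {#(y, z)#}"
      using sub_add_msetD[OF s] by auto
    have "E c b = E y z" "c \<sqsubseteq> b" using c(1,4) sub_carrier[OF c(4)] sub_single by auto
    then have "E a b = E x z" using D1 ab c by (intro E_add[of a c b x y z]) auto
    then show "sub a b {#(x, z)#}" using ab sub_single by simp
  qed
next
  case (D2 x y)
  then show ?case using sub_single[of a b] sub_carrier[of a b] E_transp[of x y] by metis
next
  case (add X Y U V)
  then show ?case using sub_plusI sub_plusD by meson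
qed auto

lemma E_eq_of_dim_class_eq:
  assumes "a \<in> carrier L" "b \<in> carrier L" "a \<sqsubseteq> b" "c \<in> carrier L" "d \<in> carrier L" "c \<sqsubseteq> d"
    "dim_class L a b = dim_class L c d"
  shows "E a b = E c d"
proof -
  have "({#(a, b)#}, {#(c, d)#}) \<in> dim_cong L"
    using assms dim_class_eq_iff by (simp add: dim_class_def dim_words_single)
  from sub_dim_cong[OF this, of a b] show ?thesis using sub_single[OF assms(1-3)] by simp
qed

end

section \<open>Continuous lattices\<close>

text \<open>The order-neutral properties of the dimension classes. \<open>F_finest\<close> is stated
  for one fixed value type, that of the kernel classes of pairs of ideals, where it is
  applied.\<close>

locale dimension_monoid = interval_lattice_ops K le mt jo + comm_monoid M
  for K :: "'a set" and le mt jo and M (structure) +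
  fixes F :: "'a \<Rightarrow> 'a \<Rightarrow> 'm"
  assumes K_nonempty: "K \<noteq> {}"
    and F_closed: "a \<in> K \<Longrightarrow> b \<in> K \<Longrightarrow> le a b \<Longrightarrow> F a b \<in> carrier M"
    and F_refl: "a \<in> K \<Longrightarrow> F a a = \<one>"
    and F_transp: "a \<in> K \<Longrightarrow> b \<in> K \<Longrightarrow> F a (jo a b) = F (mt a b) b"
    and F_mult: "a \<in> K \<Longrightarrow> b \<in> K \<Longrightarrow> c \<in> K \<Longrightarrow> le a b \<Longrightarrow> le b c \<Longrightarrow> F a b \<otimes> F b c = F a c"
    and F_mult_split: "a \<in> K \<Longrightarrow> b \<in> K \<Longrightarrow> le a b \<Longrightarrow> x \<in> carrier M \<Longrightarrow> y \<in> carrier M \<Longrightarrow> F a b = x \<otimes> y \<Longrightarrow>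
      \<exists>c\<in>K. le a c \<and> le c b \<and> x = F a c \<and> y = F c b"
    and F_finest: "\<And>E :: 'a \<Rightarrow> 'a \<Rightarrow> ('a set \<times> 'a set) set.
      (\<And>a b. a \<in> K \<Longrightarrow> b \<in> K \<Longrightarrow> E a (jo a b) = E (mt a b) b) \<Longrightarrow>
      (\<And>a b c a' b' c'. a \<in> K \<Longrightarrow> b \<in> K \<Longrightarrow> c \<in> K \<Longrightarrow> a' \<in> K \<Longrightarrow> b' \<in> K \<Longrightarrow> c' \<in> K \<Longrightarrow>
        le a b \<Longrightarrow> le b c \<Longrightarrow> le a' b' \<Longrightarrow> le b' c' \<Longrightarrow> E a b = E a' b' \<Longrightarrow> E b c = E b' c' \<Longrightarrow> E a c = E a' c') \<Longrightarrow>
      (\<And>a b c a' b'. a \<in> K \<Longrightarrow> b \<in> K \<Longrightarrow> c \<in> K \<Longrightarrow> a' \<in> K \<Longrightarrow> b' \<in> K \<Longrightarrow> le a c \<Longrightarrow> le c b \<Longrightarrow> le a' b' \<Longrightarrow>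
        E a b = E a' b' \<Longrightarrow> \<exists>c'\<in>K. le a' c' \<and> le c' b' \<and> E a c = E a' c' \<and> E c b = E c' b') \<Longrightarrow>
      a \<in> K \<Longrightarrow> b \<in> K \<Longrightarrow> c \<in> K \<Longrightarrow> d \<in> K \<Longrightarrow> le a b \<Longrightarrow> le c d \<Longrightarrow> F a b = F c d \<Longrightarrow> E a b = E c d"
    and M_refinement: "x \<in> carrier M \<Longrightarrow> y \<in> carrier M \<Longrightarrow> v \<in> carrier M \<Longrightarrow> w \<in> carrier M \<Longrightarrow> x \<otimes> y = v \<otimes> w \<Longrightarrow>
      \<exists>p\<in>carrier M. \<exists>q\<in>carrier M. \<exists>r\<in>carrier M. \<exists>s\<in>carrier M. x = p \<otimes> q \<and> y = r \<otimes> s \<and> v = p \<otimes> r \<and> w = q \<otimes> s"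
    and M_generated: "x \<in> carrier M \<Longrightarrow> R \<one> \<Longrightarrow> (\<And>a b. a \<in> K \<Longrightarrow> b \<in> K \<Longrightarrow> le a b \<Longrightarrow> R (F a b)) \<Longrightarrow>
      (\<And>x y. x \<in> carrier M \<Longrightarrow> y \<in> carrier M \<Longrightarrow> R x \<Longrightarrow> R y \<Longrightarrow> R (x \<otimes> y)) \<Longrightarrow> R x"
begin

lemma F_add: "a \<in> K \<Longrightarrow> b \<in> K \<Longrightarrow> c \<in> K \<Longrightarrow> a' \<in> K \<Longrightarrow> b' \<in> K \<Longrightarrow> c' \<in> K \<Longrightarrow>
    le a b \<Longrightarrow> le b c \<Longrightarrow> le a' b' \<Longrightarrow> le b' c' \<Longrightarrow> F a b = F a' b' \<Longrightarrow> F b c = F b' c' \<Longrightarrow> F a c = F a' c'"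
  using F_mult[of a b c] F_mult[of a' b' c'] by metis

lemma F_split:
  assumes *: "a \<in> K" "b \<in> K" "c \<in> K" "a' \<in> K" "b' \<in> K" "le a c" "le c b" "le a' b'" "F a b = F a' b'"
  shows "\<exists>c'\<in>K. le a' c' \<and> le c' b' \<and> F a c = F a' c' \<and> F c b = F c' b'"
  by (rule F_mult_split) (use * F_closed F_mult[of a c b] in auto)

definition gen :: "'a set \<Rightarrow> 'a" where "gen X = (SOME x. x \<in> K \<and> X = down x)"

lemma gen_down [simp]:
  assumes "x \<in> K" shows "gen (down x) = x"
proof -
  have "gen (down x) \<in> K \<and> down x = down (gen (down x))"
    unfolding gen_def using assms by (intro someI[of "\<lambda>y. y \<in> K \<and> down x = down y"]) simp
  then show ?thesis using down_inj assms by blast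
qed

definition ideal_dim :: "'a set \<Rightarrow> 'a set \<Rightarrow> 'm" where "ideal_dim X Y = F (gen X) (gen Y)"

lemma ideal_dim_down: "x \<in> K \<Longrightarrow> y \<in> K \<Longrightarrow> ideal_dim (down x) (down y) = F x y"
  by (simp add: ideal_dim_def)

lemma idealE: assumes "X \<in> ideals" obtains x where "x \<in> K" "X = down x"
  using assms by (auto simp: ideals_def)

lemma transp_dim_ideals: "transp_dim ideals ideal_jn ideal_dim"
proof (intro transp_dim.intro transp_dim_axioms.intro relcomp_modular_ideals)
  fix X Y assume "X \<in> ideals" "Y \<in> ideals"
  then obtain x y where "x \<in> K" "y \<in> K" "X = down x" "Y = down y" by (metis idealE)
  then show "ideal_dim X (ideal_jn X Y) = ideal_dim (X \<inter> Y) Y"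
    using F_transp mt_closed jo_closed by (simp add: down_jo down_mt ideal_dim_down)
qed

lemma add_dim_ideals: "add_dim ideals ideal_jn ideal_dim"
proof (intro add_dim.intro add_dim_axioms.intro transp_dim_ideals)
  fix A B G A' B' G' assume "A \<in> ideals" "B \<in> ideals" "G \<in> ideals" "A' \<in> ideals" "B' \<in> ideals" "G' \<in> ideals"
    and *: "A \<subseteq> B" "B \<subseteq> G" "A' \<subseteq> B'" "B' \<subseteq> G'" "ideal_dim A B = ideal_dim A' B'" "ideal_dim B G = ideal_dim B' G'"
  then obtain a b g a' b' g' where "a \<in> K" "b \<in> K" "g \<in> K" "a' \<in> K" "b' \<in> K" "g' \<in> K"
    "A = down a" "B = down b" "G = down g" "A' = down a'" "B' = down b'" "G' = down g'"
    by (elim idealE)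
  then show "ideal_dim A G = ideal_dim A' G'"
    using * F_add[of a b g a' b' g'] by (simp add: down_subset ideal_dim_down)
qed

lemma split_dim_ideals: "split_dim ideals ideal_jn ideal_dim"
proof (intro split_dim.intro split_dim_axioms.intro transp_dim_ideals)
  fix A B G A' B' assume "A \<in> ideals" "B \<in> ideals" "G \<in> ideals" "A' \<in> ideals" "B' \<in> ideals"
    and *: "A \<subseteq> G" "G \<subseteq> B" "A' \<subseteq> B'" "ideal_dim A B = ideal_dim A' B'"
  then obtain a b g a' b' where c: "a \<in> K" "b \<in> K" "g \<in> K" "a' \<in> K" "b' \<in> K"
    "A = down a" "B = down b" "G = down g" "A' = down a'" "B' = down b'"
    by (elim idealE)
  then obtain g' where "g' \<in> K" "le a' g'" "le g' b'" "F a g = F a' g'" "F g b = F g' b'"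
    using * F_split[of a b g a' b'] by (auto simp: down_subset ideal_dim_down)
  then show "\<exists>G'\<in>ideals. A' \<subseteq> G' \<and> G' \<subseteq> B' \<and> ideal_dim A G = ideal_dim A' G' \<and> ideal_dim G B = ideal_dim G' B'"
    using c by (intro bexI[of _ "down g'"]) (simp_all add: down_subset ideal_dim_down down_ideals)
qed

text \<open>Countable additivity is borrowed from the kernel classes, which are reached through
  \<open>F_finest\<close> and left through \<open>kernel_glob_D_eq\<close>.\<close>

lemma countable_dim_ideals: "countable_dim ideals ideal_jn ideal_dim"
proof (intro countable_dim.intro split_dim_ideals cont_dim.intro cont_dim_axioms.intro transp_dim_ideals)
  interpret A: add_dim ideals ideal_jn ideal_dim by (rule add_dim_ideals)
  interpret G: kernel_dim ideals ideal_jn A.glob_rel by (rule A.kernel_dim_glob)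
  have finest: "G.cls (down a) (down b) = G.cls (down c) (down d)"
    if "a \<in> K" "b \<in> K" "c \<in> K" "d \<in> K" "le a b" "le c d" "F a b = F c d" for a b c d
  proof (rule F_finest[OF _ _ _ that])
    show "G.cls (down a) (down (jo a b)) = G.cls (down (mt a b)) (down b)" if "a \<in> K" "b \<in> K" for a b
      using that G.D_transp[of "down a" "down b"] by (simp add: down_jo down_mt down_ideals)
  next
    fix a b c a' b' c' assume "a \<in> K" "b \<in> K" "c \<in> K" "a' \<in> K" "b' \<in> K" "c' \<in> K" "le a b" "le b c" "le a' b'" "le b' c'"
      "G.cls (down a) (down b) = G.cls (down a') (down b')" "G.cls (down b) (down c) = G.cls (down b') (down c')"
    then show "G.cls (down a) (down c) = G.cls (down a') (down c')"
      by (intro G.D_add[of "down a" "down b" "down c" "down a'" "down b'" "down c'"]) (simp_all add: down_ideals down_subset)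
  next
    fix a b c a' b' assume *: "a \<in> K" "b \<in> K" "c \<in> K" "a' \<in> K" "b' \<in> K" "le a c" "le c b" "le a' b'"
      "G.cls (down a) (down b) = G.cls (down a') (down b')"
    then have "\<exists>C'\<in>ideals. down a' \<subseteq> C' \<and> C' \<subseteq> down b' \<and> G.cls (down a) (down c) = G.cls (down a') C' \<and>
      G.cls (down c) (down b) = G.cls C' (down b')"
      by (intro G.D_split) (simp_all add: down_ideals down_subset)
    then show "\<exists>c'\<in>K. le a' c' \<and> le c' b' \<and> G.cls (down a) (down c) = G.cls (down a') (down c') \<and>
      G.cls (down c) (down b) = G.cls (down c') (down b')"
      using * by (auto simp: ideals_def down_subset)
  qed
  fix Y y Z y' assume Y: "chain_in ideals Y" "seq_lub ideals Y y" and Z: "chain_in ideals Z" "seq_lub ideals Z y'"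
    and step: "\<And>n. ideal_dim (Y n) (Y (Suc n)) = ideal_dim (Z n) (Z (Suc n))"
  have "G.cls (Y n) (Y (Suc n)) = G.cls (Z n) (Z (Suc n))" for n
  proof -
    have "Y n \<in> ideals" "Y (Suc n) \<in> ideals" "Z n \<in> ideals" "Z (Suc n) \<in> ideals" "Y n \<subseteq> Y (Suc n)" "Z n \<subseteq> Z (Suc n)"
      using A.chain_inD(1)[OF Y(1)] A.chain_inD(1)[OF Z(1)] A.chain_in_step[OF Y(1)] A.chain_in_step[OF Z(1)] by simp_all
    moreover from this(1-4) obtain a b c d where "a \<in> K" "b \<in> K" "c \<in> K" "d \<in> K" "Y n = down a" "Y (Suc n) = down b"
      "Z n = down c" "Z (Suc n) = down d" by (elim idealE)
    ultimately show ?thesis using finest[of a b c d] step[of n] by (simp add: down_subset ideal_dim_down)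
  qed
  then have "G.cls (Y 0) y = G.cls (Z 0) y'" by (rule G.D_seq_lub[OF Y Z])
  then have "kernel ideals A.glob_rel (Y 0) y (Z 0) y'"
    using G.cls_eq_iff[OF A.chain_inD(1)[OF Y(1)] A.seq_lubD[OF Y(2)]] by simp
  then show "ideal_dim (Y 0) y = ideal_dim (Z 0) y'" by (rule A.kernel_glob_D_eq)
qed

definition intervals where "intervals = {F a b | a b. a \<in> K \<and> b \<in> K \<and> le a b}"

interpretation ideals: countable_dim ideals ideal_jn ideal_dim
  by (rule countable_dim_ideals)

lemma intervals_subset: "intervals \<subseteq> carrier M"
  by (auto simp: intervals_def F_closed)

text \<open>One cut of the interval realizes both summands, so the partial addition of interval
  values agrees with the addition of \<open>M\<close> wherever the total is an interval
  class.\<close>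

lemma intervals_factor:
  assumes "x \<in> carrier M" "y \<in> carrier M" "x \<otimes> y \<in> intervals"
  shows "x \<in> intervals" "y \<in> intervals" "ideals.plus_rel x y (x \<otimes> y)"
proof -
  obtain a b where ab: "a \<in> K" "b \<in> K" "le a b" "x \<otimes> y = F a b" using assms(3) by (auto simp: intervals_def)
  obtain c where c: "c \<in> K" "le a c" "le c b" "x = F a c" "y = F c b"
    using F_mult_split[OF ab(1-3) assms(1,2) ab(4)[symmetric]] by blast
  then show "x \<in> intervals" "y \<in> intervals" using ab unfolding intervals_def by blast+
  show "ideals.plus_rel x y (x \<otimes> y)"
    unfolding ab(4) unfolding c(4,5) using ideals.plus_relI[of "down a" "down c" "down b"] c(1-3) ab(1-3)
    by (simp add: ideal_dim_down down_ideals down_subset)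
qed

lemma plus_rel_mult:
  assumes "ideals.plus_rel x y v" shows "x \<in> intervals" "y \<in> intervals" "v \<in> intervals" "v = x \<otimes> y"
proof -
  obtain A B G where "A \<in> ideals" "B \<in> ideals" "G \<in> ideals" "A \<subseteq> B" "B \<subseteq> G"
    and xy: "x = ideal_dim A B" "y = ideal_dim B G" "v = ideal_dim A G"
    using assms by (rule ideals.plus_relE)
  then obtain a b g where "a \<in> K" "b \<in> K" "g \<in> K" and *: "A = down a" "B = down b" "G = down g" and "le a b" "le b g"
    by (elim idealE) (auto simp: down_subset)
  moreover have "le a g" using calculation le_trans by blast
  moreover have "x = F a b" "y = F b g" "v = F a g" using calculation xy by (simp_all add: ideal_dim_down)
  ultimately show "x \<in> intervals" "y \<in> intervals" "v \<in> intervals" "v = x \<otimes> y"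
    using F_mult[of a b g] by (auto simp: intervals_def)
qed

lemma ideal_dim_intervals: "X \<in> ideals \<Longrightarrow> Y \<in> ideals \<Longrightarrow> X \<subseteq> Y \<Longrightarrow> ideal_dim X Y \<in> intervals"
  by (elim idealE) (auto simp: intervals_def ideal_dim_down down_subset)

lemma sum_rel_intervals:
  assumes "ideals.sum_rel f v" shows "v \<in> intervals" "f n \<in> intervals"
proof -
  obtain Y y where Y: "chain_in ideals Y" "seq_lub ideals Y y" and f: "\<And>n. f n = ideal_dim (Y n) (Y (Suc n))"
    and v: "v = ideal_dim (Y 0) y" using assms unfolding ideals.sum_rel_def by blast
  have "Y n \<in> ideals" "Y n \<subseteq> Y (Suc n)" "Y n \<subseteq> y" "y \<in> ideals" for n
    using ideals.chain_inD(1)[OF Y(1)] ideals.chain_in_step[OF Y(1)] ideals.seq_lubD[OF Y(2)] by simp_all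
  then show "v \<in> intervals" "f n \<in> intervals" unfolding v f by (simp_all add: ideal_dim_intervals)
qed

theorem is_GCA: "is_GCA M"
proof -
  have "partial_sum_monoid M intervals ideals.sum_rel"
  proof (intro partial_sum_monoid.intro partial_sum_monoid_axioms.intro comm_monoid_axioms intervals_subset)
    obtain a where "a \<in> K" using K_nonempty by blast
    then have one: "\<one> \<in> intervals" using F_refl[of a] le_refl[of a] unfolding intervals_def by force
    show "\<one> \<in> intervals" by (rule one)
    show "R x" if "x \<in> carrier M" "\<And>x. x \<in> intervals \<Longrightarrow> R x"
      "\<And>x y. x \<in> carrier M \<Longrightarrow> y \<in> carrier M \<Longrightarrow> R x \<Longrightarrow> R y \<Longrightarrow> R (x \<otimes> y)" for x R
      using that(1)
    proof (rule M_generated)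
      show "R \<one>" by (rule that(2)) (rule one)
      show "R (F a b)" if "a \<in> K" "b \<in> K" "le a b" for a b
        by (rule \<open>\<And>x. x \<in> intervals \<Longrightarrow> R x\<close>) (use that in \<open>auto simp: intervals_def\<close>)
    qed (rule that(3))
    show "c \<in> carrier M \<and> (\<forall>n. f n \<in> carrier M)" if "ideals.sum_rel f c" for f c
      using sum_rel_intervals[OF that] intervals_subset by blast
    show "\<exists>t. ideals.sum_rel (\<lambda>n. f (Suc n)) t \<and> c = f 0 \<otimes> t" if "ideals.sum_rel f c" for f c
      using ideals.sum_rel_Suc[OF that] plus_rel_mult(4) by blast
    show "\<exists>s t. ideals.sum_rel f s \<and> ideals.sum_rel g t \<and> c = s \<otimes> t"
      if fg: "\<And>n. f n \<in> carrier M" "\<And>n. g n \<in> carrier M" "ideals.sum_rel (\<lambda>n. f n \<otimes> g n) c" for f g c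
    proof -
      have "ideals.plus_rel (f n) (g n) (f n \<otimes> g n)" for n
        using fg(1,2) sum_rel_intervals(2)[OF fg(3)] by (rule intervals_factor(3))
      from ideals.sum_rel_plus_rel[OF this fg(3)] show ?thesis using plus_rel_mult(4) by blast
    qed
    show "\<exists>f g. ideals.sum_rel f a \<and> ideals.sum_rel g b \<and> (\<forall>n. h n = f n \<otimes> g n)"
      if ab: "a \<in> carrier M" "b \<in> carrier M" "ideals.sum_rel h (a \<otimes> b)" for a b h
      using ideals.sum_rel_refine[OF intervals_factor(3)[OF ab(1,2) sum_rel_intervals(1)[OF ab(3)]] ab(3)]
        plus_rel_mult(4) by metis
    show "\<exists>a\<in>carrier M. \<forall>n. \<exists>s. ideals.sum_rel (\<lambda>k. g (n + k)) s \<and> f n = a \<otimes> s"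
      if f: "\<And>n. f n \<in> carrier M" "\<And>n. g n \<in> carrier M" "f 0 \<in> intervals" "\<And>n. f n = g n \<otimes> f (Suc n)" for f g
    proof -
      \<comment> \<open>All remainders are summands of \<open>f 0\<close>, hence interval classes
        themselves.\<close>
      have fi: "f n \<in> intervals" for n
      proof (induction n)
        case (Suc n)
        then have "g n \<otimes> f (Suc n) \<in> intervals" by (subst f(4)[symmetric])
        then show ?case by (rule intervals_factor(2)[OF f(2,1)])
      qed (rule f(3))
      have "ideals.plus_rel (g n) (f (Suc n)) (f n)" for n
        using intervals_factor(3)[OF f(2,1), of n "Suc n"] fi[of n] unfolding f(4)[of n, symmetric] by blast
      from ideals.sum_rel_remainder[of g f, OF this] obtain a
        where a: "\<And>n. \<exists>s. ideals.sum_rel (\<lambda>k. g (n + k)) s \<and> ideals.plus_rel a s (f n)" by blast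
      then have "a \<in> carrier M" using plus_rel_mult(1) intervals_subset by blast
      moreover have "\<exists>s. ideals.sum_rel (\<lambda>k. g (n + k)) s \<and> f n = a \<otimes> s" for n
        using a[of n] plus_rel_mult(4) by blast
      ultimately show ?thesis by blast
    qed
    show "c = d" if "ideals.sum_rel f c" "ideals.sum_rel f d" for f c d
      using that by (rule ideals.sum_rel_unique)
    show "\<exists>p\<in>carrier M. \<exists>q\<in>carrier M. \<exists>r\<in>carrier M. \<exists>s\<in>carrier M. a = p \<otimes> q \<and> b = r \<otimes> s \<and> c = p \<otimes> r \<and> d = q \<otimes> s"
      if "a \<in> carrier M" "b \<in> carrier M" "c \<in> carrier M" "d \<in> carrier M" "a \<otimes> b = c \<otimes> d" for a b c d
      using that by (rule M_refinement)
  qed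
  then show ?thesis by (rule partial_sum_monoid.is_GCA)
qed

end

section \<open>The two continuity conditions and the dual lattice\<close>

context aleph0_meet_continuous_lattice begin

lemma sup_seq:
  assumes "\<And>n::nat. b n \<in> carrier L" "\<And>n. b n \<sqsubseteq> b (Suc n)"
  shows "\<Squnion>(range b) \<in> carrier L" "b n \<sqsubseteq> \<Squnion>(range b)" "v \<in> carrier L \<Longrightarrow> (\<And>n. b n \<sqsubseteq> v) \<Longrightarrow> \<Squnion>(range b) \<sqsubseteq> v"
proof -
  have l: "least L (\<Squnion>(range b)) (Upper L (range b))"
    unfolding Lattice.sup_def by (rule someI_ex[OF sup_seq_exists]) (fact assms)+
  then show "\<Squnion>(range b) \<in> carrier L" by (rule least_closed)
  show "b n \<sqsubseteq> \<Squnion>(range b)" using assms(1) by (intro least_Upper_above[OF l]) auto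
  show "\<Squnion>(range b) \<sqsubseteq> v" if "v \<in> carrier L" "\<And>n. b n \<sqsubseteq> v"
    using that by (intro least_le[OF l]) (auto simp: Upper_def)
qed

end

context aleph0_join_continuous_lattice begin

lemma inf_seq:
  assumes "\<And>n::nat. b n \<in> carrier L" "\<And>n. b (Suc n) \<sqsubseteq> b n"
  shows "\<Sqinter>(range b) \<in> carrier L" "\<Sqinter>(range b) \<sqsubseteq> b n" "v \<in> carrier L \<Longrightarrow> (\<And>n. v \<sqsubseteq> b n) \<Longrightarrow> v \<sqsubseteq> \<Sqinter>(range b)"
proof -
  have l: "greatest L (\<Sqinter>(range b)) (Lower L (range b))"
    unfolding Lattice.inf_def by (rule someI_ex[OF inf_seq_exists]) (fact assms)+
  then show "\<Sqinter>(range b) \<in> carrier L" by (rule greatest_closed)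
  show "\<Sqinter>(range b) \<sqsubseteq> b n" using assms(1) by (intro greatest_Lower_below[OF l]) auto
  show "v \<sqsubseteq> \<Sqinter>(range b)" if "v \<in> carrier L" "\<And>n. v \<sqsubseteq> b n"
    using that by (intro greatest_le[OF l]) (auto simp: Lower_def)
qed

end

context relcomp_modular_lattice begin

lemma lattice_ops: "lattice_ops (carrier L) (\<sqsubseteq>) (\<sqinter>) (\<squnion>)"
  by unfold_locales
    (auto intro: le_antisym le_trans meet_left meet_right meet_le join_left join_right join_le)

lemma lattice_ops_dual: "lattice_ops (carrier L) (\<lambda>x y. y \<sqsubseteq> x) (\<squnion>) (\<sqinter>)"
  by unfold_locales
    (auto intro: le_antisym le_trans meet_left meet_right meet_le join_left join_right join_le)

lemma interval_lattice_opsI: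
  assumes "conditionally_aleph0_meet_continuous_lattice L"
  shows "interval_lattice_ops (carrier L) (\<sqsubseteq>) (\<sqinter>) (\<squnion>)"
proof (intro interval_lattice_ops.intro interval_lattice_ops_axioms.intro lattice_ops)
  interpret ops: lattice_ops "carrier L" "(\<sqsubseteq>)" "(\<sqinter>)" "(\<squnion>)" by (rule lattice_ops)
  interpret C: conditionally_aleph0_meet_continuous_lattice L by fact
  show "(x \<squnion> y) \<sqinter> w \<sqsubseteq> x \<squnion> (y \<sqinter> w)"
    if "x \<in> carrier L" "y \<in> carrier L" "w \<in> carrier L" "x \<sqsubseteq> w" for x y w
    using that modular[of x y w] by simp
  show "\<exists>y\<in>carrier L. x \<sqinter> y = a \<and> x \<squnion> y = b"
    if "a \<in> carrier L" "b \<in> carrier L" "x \<in> carrier L" "a \<sqsubseteq> x" "x \<sqsubseteq> b" for a b x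
    using relative_complement[OF that] by metis
  show "\<exists>s\<in>carrier L. (\<forall>n. B n \<sqsubseteq> s) \<and> (\<forall>v\<in>carrier L. (\<forall>n. B n \<sqsubseteq> v) \<longrightarrow> s \<sqsubseteq> v) \<and>
      (\<forall>a\<in>carrier L. \<forall>v\<in>carrier L. (\<forall>n. a \<sqinter> B n \<sqsubseteq> v) \<longrightarrow> a \<sqinter> s \<sqsubseteq> v)"
    if B: "\<And>n. B n \<in> carrier L" "\<And>n::nat. B n \<sqsubseteq> B (Suc n)" "u \<in> carrier L" "\<And>n. B n \<sqsubseteq> u" for B u
  proof (rule ops.meet_cont_of_intervals[where B = B and u = u, OF _ B])
    fix lo hi a and B :: "nat \<Rightarrow> 'a"
    assume lo: "lo \<in> carrier L" "hi \<in> carrier L" "lo \<sqsubseteq> hi" and Bc: "\<And>n. B n \<in> carrier L" and Blo: "\<And>n. lo \<sqsubseteq> B n"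
      and Bhi: "\<And>n. B n \<sqsubseteq> hi" and inc: "\<And>n. B n \<sqsubseteq> B (Suc n)" and a: "a \<in> carrier L" "lo \<sqsubseteq> a" "a \<sqsubseteq> hi"
    let ?I = "interval_lattice L lo hi"
    interpret I: aleph0_meet_continuous_lattice ?I by (rule C.interval_meet_continuous[OF lo])
    have aI: "a \<in> carrier ?I" and B: "B n \<in> carrier ?I" "B n \<sqsubseteq>\<^bsub>?I\<^esub> B (Suc n)" for n
      using a Bc Blo Bhi inc by (simp_all add: carrier_interval le_interval)
    let ?s = "\<Squnion>\<^bsub>?I\<^esub>(range B)"
    note s = I.sup_seq[of B, OF B]
    have s': "?s \<in> carrier L" "lo \<sqsubseteq> ?s" "?s \<sqsubseteq> hi" using s(1) by (simp_all add: carrier_interval)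
    have mt: "a \<sqinter>\<^bsub>?I\<^esub> x = a \<sqinter> x" if "x \<in> carrier ?I" for x
      using that by (intro meet_interval[OF I.lattice_axioms lo(1,2) a]) (simp_all add: carrier_interval)
    have mB: "a \<sqinter> B n \<in> carrier ?I" for n using I.meet_closed[OF aI B(1)] mt[OF B(1)] by simp
    have minc: "a \<sqinter> B n \<sqsubseteq>\<^bsub>?I\<^esub> a \<sqinter> B (Suc n)" for n
      unfolding le_interval using le_trans[OF meet_right[OF a(1) Bc] inc] a Bc
      by (intro meet_le) (simp_all add: meet_left)
    have eq: "a \<sqinter> ?s = \<Squnion>\<^bsub>?I\<^esub>(range (\<lambda>n. a \<sqinter> B n))"
      using I.meet_sup_seq[of a B, OF aI B] by (simp add: mt s(1) B(1))
    show "\<exists>s\<in>carrier L. s \<sqsubseteq> hi \<and> (\<forall>n. B n \<sqsubseteq> s) \<and> (\<forall>v\<in>carrier L. v \<sqsubseteq> hi \<longrightarrow> (\<forall>n. B n \<sqsubseteq> v) \<longrightarrow> s \<sqsubseteq> v) \<and>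
        (\<forall>v\<in>carrier L. v \<sqsubseteq> hi \<longrightarrow> (\<forall>n. a \<sqinter> B n \<sqsubseteq> v) \<longrightarrow> a \<sqinter> s \<sqsubseteq> v)"
    proof (intro bexI[OF _ s'(1)] conjI allI ballI impI s'(3))
      show "B n \<sqsubseteq> ?s" for n using s(2) by (simp add: le_interval)
    next
      fix v assume v: "v \<in> carrier L" "v \<sqsubseteq> hi" "\<forall>n. B n \<sqsubseteq> v"
      then have "lo \<sqsubseteq> v" using le_trans[OF Blo[of 0] _ lo(1) Bc] by simp
      then show "?s \<sqsubseteq> v" using s(3)[of v] v by (simp add: carrier_interval le_interval)
    next
      fix v assume v: "v \<in> carrier L" "v \<sqsubseteq> hi" "\<forall>n. a \<sqinter> B n \<sqsubseteq> v"
      then have "lo \<sqsubseteq> v" using le_trans[of lo "a \<sqinter> B 0" v] mB[of 0] lo by (simp add: carrier_interval)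
      then show "a \<sqinter> ?s \<sqsubseteq> v"
        unfolding eq using I.sup_seq(3)[of "\<lambda>n. a \<sqinter> B n" v, OF mB minc] v by (simp add: carrier_interval le_interval)
    qed
  qed
qed

lemma interval_lattice_opsI_dual:
  assumes "conditionally_aleph0_join_continuous_lattice L"
  shows "interval_lattice_ops (carrier L) (\<lambda>x y. y \<sqsubseteq> x) (\<squnion>) (\<sqinter>)"
proof (intro interval_lattice_ops.intro interval_lattice_ops_axioms.intro lattice_ops_dual)
  interpret dual: lattice_ops "carrier L" "\<lambda>x y. y \<sqsubseteq> x" "(\<squnion>)" "(\<sqinter>)" by (rule lattice_ops_dual)
  interpret C: conditionally_aleph0_join_continuous_lattice L by fact
  show "x \<sqinter> (y \<squnion> w) \<sqsubseteq> (x \<sqinter> y) \<squnion> w"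
    if "x \<in> carrier L" "y \<in> carrier L" "w \<in> carrier L" "w \<sqsubseteq> x" for x y w
    using that modular[of w y x] by (simp add: join_comm meet_comm)
  show "\<exists>y\<in>carrier L. x \<squnion> y = a \<and> x \<sqinter> y = b"
    if "a \<in> carrier L" "b \<in> carrier L" "x \<in> carrier L" "x \<sqsubseteq> a" "b \<sqsubseteq> x" for a b x
    using relative_complement[OF that(2,1,3,5,4)] by metis
  show "\<exists>s\<in>carrier L. (\<forall>n. s \<sqsubseteq> B n) \<and> (\<forall>v\<in>carrier L. (\<forall>n. v \<sqsubseteq> B n) \<longrightarrow> v \<sqsubseteq> s) \<and>
      (\<forall>a\<in>carrier L. \<forall>v\<in>carrier L. (\<forall>n. v \<sqsubseteq> a \<squnion> B n) \<longrightarrow> v \<sqsubseteq> a \<squnion> s)"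
    if B: "\<And>n. B n \<in> carrier L" "\<And>n::nat. B (Suc n) \<sqsubseteq> B n" "u \<in> carrier L" "\<And>n. u \<sqsubseteq> B n" for B u
  proof (rule dual.meet_cont_of_intervals[where B = B and u = u, OF _ B])
    fix lo hi a and B :: "nat \<Rightarrow> 'a"
    assume lo: "lo \<in> carrier L" "hi \<in> carrier L" "hi \<sqsubseteq> lo" and Bc: "\<And>n. B n \<in> carrier L" and Blo: "\<And>n. B n \<sqsubseteq> lo"
      and Bhi: "\<And>n. hi \<sqsubseteq> B n" and dec: "\<And>n. B (Suc n) \<sqsubseteq> B n" and a: "a \<in> carrier L" "a \<sqsubseteq> lo" "hi \<sqsubseteq> a"
    let ?I = "interval_lattice L hi lo"
    interpret I: aleph0_join_continuous_lattice ?I by (rule C.interval_join_continuous[OF lo(2,1,3)])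
    have aI: "a \<in> carrier ?I" and B: "B n \<in> carrier ?I" "B (Suc n) \<sqsubseteq>\<^bsub>?I\<^esub> B n" for n
      using a Bc Blo Bhi dec by (simp_all add: carrier_interval le_interval)
    let ?s = "\<Sqinter>\<^bsub>?I\<^esub>(range B)"
    note s = I.inf_seq[of B, OF B]
    have s': "?s \<in> carrier L" "?s \<sqsubseteq> lo" "hi \<sqsubseteq> ?s" using s(1) by (simp_all add: carrier_interval)
    have jn: "a \<squnion>\<^bsub>?I\<^esub> x = a \<squnion> x" if "x \<in> carrier ?I" for x
      using that by (intro join_interval[OF I.lattice_axioms lo(2,1) a(1,3,2)]) (simp_all add: carrier_interval)
    have jB: "a \<squnion> B n \<in> carrier ?I" for n using I.join_closed[OF aI B(1)] jn[OF B(1)] by simp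
    have jdec: "a \<squnion> B (Suc n) \<sqsubseteq>\<^bsub>?I\<^esub> a \<squnion> B n" for n
      unfolding le_interval using le_trans[OF dec join_right[OF a(1) Bc]] a Bc
      by (intro join_le) (simp_all add: join_left)
    have eq: "a \<squnion> ?s = \<Sqinter>\<^bsub>?I\<^esub>(range (\<lambda>n. a \<squnion> B n))"
      using I.join_inf_seq[of a B, OF aI B] by (simp add: jn s(1) B(1))
    show "\<exists>s\<in>carrier L. hi \<sqsubseteq> s \<and> (\<forall>n. s \<sqsubseteq> B n) \<and> (\<forall>v\<in>carrier L. hi \<sqsubseteq> v \<longrightarrow> (\<forall>n. v \<sqsubseteq> B n) \<longrightarrow> v \<sqsubseteq> s) \<and>
        (\<forall>v\<in>carrier L. hi \<sqsubseteq> v \<longrightarrow> (\<forall>n. v \<sqsubseteq> a \<squnion> B n) \<longrightarrow> v \<sqsubseteq> a \<squnion> s)"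
    proof (intro bexI[OF _ s'(1)] conjI allI ballI impI s'(3))
      show "?s \<sqsubseteq> B n" for n using s(2) by (simp add: le_interval)
    next
      fix v assume v: "v \<in> carrier L" "hi \<sqsubseteq> v" "\<forall>n. v \<sqsubseteq> B n"
      then have "v \<sqsubseteq> lo" using le_trans[OF _ Blo[of 0] _ Bc lo(1)] by simp
      then show "v \<sqsubseteq> ?s" using s(3)[of v] v by (simp add: carrier_interval le_interval)
    next
      fix v assume v: "v \<in> carrier L" "hi \<sqsubseteq> v" "\<forall>n. v \<sqsubseteq> a \<squnion> B n"
      then have "v \<sqsubseteq> lo" using le_trans[of v "a \<squnion> B 0" lo] jB[of 0] lo by (simp add: carrier_interval)
      then show "v \<sqsubseteq> a \<squnion> ?s"
        unfolding eq using I.inf_seq(3)[of "\<lambda>n. a \<squnion> B n" v, OF jB jdec] v by (simp add: carrier_interval le_interval)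
    qed
  qed
qed

lemma is_GCA_Dim_meet:
  assumes "conditionally_aleph0_meet_continuous_lattice L" "carrier L \<noteq> {}"
  shows "is_GCA (Dim L)"
proof -
  interpret M: comm_monoid "Dim L" by (rule comm_monoid_Dim)
  have "dimension_monoid (carrier L) (\<sqsubseteq>) (\<sqinter>) (\<squnion>) (Dim L) (dim_class L)"
  proof (intro dimension_monoid.intro dimension_monoid_axioms.intro interval_lattice_opsI assms comm_monoid_Dim)
    fix E :: "'a \<Rightarrow> 'a \<Rightarrow> ('a set \<times> 'a set) set" and a b c d
    assume E: "\<And>a b. a \<in> carrier L \<Longrightarrow> b \<in> carrier L \<Longrightarrow> E a (a \<squnion> b) = E (a \<sqinter> b) b"
      "\<And>a b c a' b' c'. a \<in> carrier L \<Longrightarrow> b \<in> carrier L \<Longrightarrow> c \<in> carrier L \<Longrightarrow> a' \<in> carrier L \<Longrightarrow> b' \<in> carrier L \<Longrightarrow> c' \<in> carrier L \<Longrightarrow>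
        a \<sqsubseteq> b \<Longrightarrow> b \<sqsubseteq> c \<Longrightarrow> a' \<sqsubseteq> b' \<Longrightarrow> b' \<sqsubseteq> c' \<Longrightarrow> E a b = E a' b' \<Longrightarrow> E b c = E b' c' \<Longrightarrow> E a c = E a' c'"
      "\<And>a b c a' b'. a \<in> carrier L \<Longrightarrow> b \<in> carrier L \<Longrightarrow> c \<in> carrier L \<Longrightarrow> a' \<in> carrier L \<Longrightarrow> b' \<in> carrier L \<Longrightarrow>
        a \<sqsubseteq> c \<Longrightarrow> c \<sqsubseteq> b \<Longrightarrow> a' \<sqsubseteq> b' \<Longrightarrow>
        E a b = E a' b' \<Longrightarrow> \<exists>c'\<in>carrier L. a' \<sqsubseteq> c' \<and> c' \<sqsubseteq> b' \<and> E a c = E a' c' \<and> E c b = E c' b'"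
    interpret interval_invariant L E by unfold_locales (fact E)+
    assume "a \<in> carrier L" "b \<in> carrier L" "c \<in> carrier L" "d \<in> carrier L" "a \<sqsubseteq> b" "c \<sqsubseteq> d" "dim_class L a b = dim_class L c d"
    then show "E a b = E c d" using E_eq_of_dim_class_eq by blast
  next
    fix a b x y
    assume "a \<in> carrier L" "b \<in> carrier L" "a \<sqsubseteq> b" "x \<in> carrier (Dim L)" "y \<in> carrier (Dim L)" "dim_class L a b = x \<otimes>\<^bsub>Dim L\<^esub> y"
    then show "\<exists>c\<in>carrier L. a \<sqsubseteq> c \<and> c \<sqsubseteq> b \<and> x = dim_class L a c \<and> y = dim_class L c b"
      by (rule dim_class_mult_split) blast
  qed (fact dim_class_closed dim_class_refl dim_class_transp dim_class_trans Dim_refinement dim_induct)+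
  then show ?thesis by (rule dimension_monoid.is_GCA)
qed

text \<open>The dual lattice appears through reversed order, exchanged operations and reversed
  arguments of \<open>dim_class\<close>. Concatenation of intervals then reverses its summands,
  which commutativity of \<open>Dim L\<close> repairs.\<close>

lemma is_GCA_Dim_join:
  assumes "conditionally_aleph0_join_continuous_lattice L" "carrier L \<noteq> {}"
  shows "is_GCA (Dim L)"
proof -
  interpret M: comm_monoid "Dim L" by (rule comm_monoid_Dim)
  have "dimension_monoid (carrier L) (\<lambda>x y. y \<sqsubseteq> x) (\<squnion>) (\<sqinter>) (Dim L) (\<lambda>a b. dim_class L b a)"
  proof (intro dimension_monoid.intro dimension_monoid_axioms.intro interval_lattice_opsI_dual assms comm_monoid_Dim)
    fix E :: "'a \<Rightarrow> 'a \<Rightarrow> ('a set \<times> 'a set) set" and a b c d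
    assume E: "\<And>a b. a \<in> carrier L \<Longrightarrow> b \<in> carrier L \<Longrightarrow> E a (a \<sqinter> b) = E (a \<squnion> b) b"
      "\<And>a b c a' b' c'. a \<in> carrier L \<Longrightarrow> b \<in> carrier L \<Longrightarrow> c \<in> carrier L \<Longrightarrow> a' \<in> carrier L \<Longrightarrow> b' \<in> carrier L \<Longrightarrow> c' \<in> carrier L \<Longrightarrow>
        b \<sqsubseteq> a \<Longrightarrow> c \<sqsubseteq> b \<Longrightarrow> b' \<sqsubseteq> a' \<Longrightarrow> c' \<sqsubseteq> b' \<Longrightarrow> E a b = E a' b' \<Longrightarrow> E b c = E b' c' \<Longrightarrow> E a c = E a' c'"
      "\<And>a b c a' b'. a \<in> carrier L \<Longrightarrow> b \<in> carrier L \<Longrightarrow> c \<in> carrier L \<Longrightarrow> a' \<in> carrier L \<Longrightarrow> b' \<in> carrier L \<Longrightarrow>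
        c \<sqsubseteq> a \<Longrightarrow> b \<sqsubseteq> c \<Longrightarrow> b' \<sqsubseteq> a' \<Longrightarrow>
        E a b = E a' b' \<Longrightarrow> \<exists>c'\<in>carrier L. c' \<sqsubseteq> a' \<and> b' \<sqsubseteq> c' \<and> E a c = E a' c' \<and> E c b = E c' b'"
    interpret interval_invariant L "\<lambda>x y. E y x"
    proof
      show "E (a \<squnion> b) a = E b (a \<sqinter> b)" if "a \<in> carrier L" "b \<in> carrier L" for a b
        using E(1)[OF that(2,1)] by (simp add: join_comm meet_comm)
    next
      fix a b c a' b' c' assume "a \<in> carrier L" "b \<in> carrier L" "c \<in> carrier L" "a' \<in> carrier L" "b' \<in> carrier L" "c' \<in> carrier L"
        "a \<sqsubseteq> b" "b \<sqsubseteq> c" "a' \<sqsubseteq> b'" "b' \<sqsubseteq> c'" "E b a = E b' a'" "E c b = E c' b'"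
      then show "E c a = E c' a'" using E(2)[of c b a c' b' a'] by blast
    next
      fix a b c a' b' assume "a \<in> carrier L" "b \<in> carrier L" "c \<in> carrier L" "a' \<in> carrier L" "b' \<in> carrier L"
        "a \<sqsubseteq> c" "c \<sqsubseteq> b" "a' \<sqsubseteq> b'" "E b a = E b' a'"
      then show "\<exists>c'\<in>carrier L. a' \<sqsubseteq> c' \<and> c' \<sqsubseteq> b' \<and> E c a = E c' a' \<and> E b c = E b' c'" using E(3)[of b a c b' a'] by blast
    qed
    assume "a \<in> carrier L" "b \<in> carrier L" "c \<in> carrier L" "d \<in> carrier L" "b \<sqsubseteq> a" "d \<sqsubseteq> c" "dim_class L b a = dim_class L d c"
    then show "E a b = E c d" using E_eq_of_dim_class_eq[of b a d c] by blast
  next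
    fix a b x y
    assume *: "a \<in> carrier L" "b \<in> carrier L" "b \<sqsubseteq> a" and x: "x \<in> carrier (Dim L)" "y \<in> carrier (Dim L)" "dim_class L b a = x \<otimes>\<^bsub>Dim L\<^esub> y"
    have "dim_class L b a = y \<otimes>\<^bsub>Dim L\<^esub> x" using x M.m_comm by simp
    then show "\<exists>c\<in>carrier L. c \<sqsubseteq> a \<and> b \<sqsubseteq> c \<and> x = dim_class L c a \<and> y = dim_class L b c"
      by (rule dim_class_mult_split[OF *(2,1,3) x(2,1)]) blast
  next
    show "dim_class L (a \<sqinter> b) a = dim_class L b (a \<squnion> b)" if "a \<in> carrier L" "b \<in> carrier L" for a b
      using dim_class_transp[OF that(2,1)] by (simp add: join_comm meet_comm)
    show "dim_class L b a \<otimes>\<^bsub>Dim L\<^esub> dim_class L c b = dim_class L c a"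
      if "a \<in> carrier L" "b \<in> carrier L" "c \<in> carrier L" "b \<sqsubseteq> a" "c \<sqsubseteq> b" for a b c
      using dim_class_trans[of c b a] dim_class_closed M.m_comm[of "dim_class L b a" "dim_class L c b"] that by simp
    show "R x" if "x \<in> carrier (Dim L)" "R \<one>\<^bsub>Dim L\<^esub>" "\<And>a b. a \<in> carrier L \<Longrightarrow> b \<in> carrier L \<Longrightarrow> b \<sqsubseteq> a \<Longrightarrow> R (dim_class L b a)"
      "\<And>x y. x \<in> carrier (Dim L) \<Longrightarrow> y \<in> carrier (Dim L) \<Longrightarrow> R x \<Longrightarrow> R y \<Longrightarrow> R (x \<otimes>\<^bsub>Dim L\<^esub> y)" for x R
      using that by (rule dim_induct)
    show "dim_class L b a \<in> carrier (Dim L)" if "a \<in> carrier L" "b \<in> carrier L" "b \<sqsubseteq> a" for a b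
      using that(2,1,3) by (rule dim_class_closed)
  qed (fact dim_class_refl Dim_refinement)+
  then show ?thesis by (rule dimension_monoid.is_GCA)
qed

end

lemma (in comm_monoid) is_GCA_trivial:
  assumes "carrier G = {\<one>}" shows "is_GCA G"
proof -
  let ?plus = "\<lambda>x y. if x \<in> carrier G \<and> y \<in> carrier G then Some (x \<otimes> y) else None"
  let ?isum = "\<lambda>f. if range f \<subseteq> carrier G then Some \<one> else None"
  have p: "?plus x y = Some c \<longleftrightarrow> x = \<one> \<and> y = \<one> \<and> c = \<one>" for x y c by (auto simp: assms)
  have s: "?isum f = Some c \<longleftrightarrow> f = (\<lambda>_. \<one>) \<and> c = \<one>" for f :: "nat \<Rightarrow> 'a" and c by (auto simp: assms)
  have "generalized_cardinal_algebra (carrier G) ?plus \<one> ?isum"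
  proof (rule generalized_cardinal_algebra.intro, unfold p s)
    show "\<exists>a\<in>carrier G. \<forall>n. \<exists>s. ((\<lambda>k. g (n + k)) = (\<lambda>_. \<one>) \<and> s = \<one>) \<and> a = \<one> \<and> s = \<one> \<and> f n = \<one>"
      if "\<And>n. g n = \<one> \<and> f (Suc n) = \<one> \<and> f n = \<one>" for g f :: "nat \<Rightarrow> 'a"
      using that by (simp add: assms)
    show "\<exists>f g. (f = (\<lambda>_. \<one>) \<and> a = \<one>) \<and> (g = (\<lambda>_. \<one>) \<and> b = \<one>) \<and> (\<forall>n. f n = \<one> \<and> g n = \<one> \<and> h n = \<one>)"
      if "a = \<one> \<and> b = \<one> \<and> c = \<one>" "h = (\<lambda>_. \<one>) \<and> c = \<one>" for a b c and h :: "nat \<Rightarrow> 'a"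
      using that by simp
  qed (auto simp: assms)
  then show ?thesis unfolding is_GCA_def using comm_monoid_axioms by blast
qed

theorem theorem13p11:
  fixes L :: "('a, 'm) gorder_scheme"
  assumes "modular_lattice L"
    and "relatively_complemented_lattice L"
    and "conditionally_aleph0_meet_continuous_lattice L
      \<or> conditionally_aleph0_join_continuous_lattice L"
  shows "is_GCA (Dim L)"
proof -
  interpret relcomp_modular_lattice L
    using assms(1,2) by (rule relcomp_modular_lattice.intro)
  show ?thesis
  proof (cases "carrier L = {}")
    \<comment> \<open>An empty lattice has no interval to carry the zero class, so the one-element
      monoid \<open>Dim L\<close> is treated separately.\<close>
    case True
    then show ?thesis using comm_monoid.is_GCA_trivial[OF comm_monoid_Dim] Dim_trivial by blast
  next
    case False
    then show ?thesis using assms(3) is_GCA_Dim_meet is_GCA_Dim_join by blast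
  qed
qed

end
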